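(* Let $1\le p\le\infty$. Assume that the equation $x'(t)=L(t)x_t=\sum_{j=0}^N A_j(t)x(t-r_j)$ is asymptotically hyperbolic, and that (1) $\operatorname{Ind}(\Lambda_L)=0$; (2) $\Lambda_L:W^{1,p}_\mu\to L^p_\mu$ has trivial kernel $\mathcal{K}_L$. Then the equation $x'(t)=L(t)x_t$ has an exponential dichotomy on $\mathbb{R}$.
   Context: Fix delays $0=r_0<r_1<\cdots<r_N=r$. Let $C=C([-r,0],\mathbb{R}^n)$ with the supremum norm, and for a function $x$ put $x_t(\theta)=x(t+\theta)$, $\theta\in[-r,0]$. Let $L(t):C\to\mathbb{R}^n$, $L(t)\phi=\sum_{j=0}^N A_j(t)\phi(-r_j)$, where the $n\times n$ matrix functions $A_j$ are measurable and uniformly bounded on $\mathbb{R}$, with limits $A_{\pm,j}=\lim_{t\to\pm\infty}A_j(t)\in M_n(\mathbb{R})$. An autonomous system $x'(t)=L_0x_t=\sum_{j=0}^N A_{j,0}x(t-r_j)$ is hyperbolic if $\det\Delta_{L_0}(iz)\neq0$ for all $z\in\mathbb{R}$, where $\Delta_{L_0}(s)=sI-\sum_{j=0}^N A_{j,0}e^{-sr_j}$. The equation $x'(t)=L(t)x_t$ is asymptotically hyperbolic at $+\infty$ (resp. $-\infty$) if $L(t)=L_0+M(t)$ with $x'(t)=L_0x_t$ autonomous and hyperbolic, and $M(t)\phi=\sum_j C_j(t)\phi(-r_j)$ with $C_j$ measurable, uniformly bounded and $C_j(t)\to0$ as $t\to+\infty$ (resp. $-\infty$). It is asymptotically hyperbolic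 if it is so at both $+\infty$ and $-\infty$ (the two limit systems need not coincide). Let $\omega(t)=(1+t^2)^{-1}$ and $d\mu=\omega(t)\,dt$. For $1\le p<\infty$, $L^p_\mu$ is the space of measurable $f:\mathbb{R}\to\mathbb{R}^n$ with $\int_{\mathbb{R}}|f|^p\,d\mu<\infty$. $L^\infty_\mu$ is the space of measurable $f$ for which there is a constant $C$ with $|f(t)|\omega(t)\le C$ a.e. (norm: the essential supremum of $|f|\omega$). $W^{1,p}_\mu$ is the space of absolutely continuous $f\in L^p_\mu$ with $f'\in L^p_\mu$. The operator $\Lambda_L:W^{1,p}_\mu\to L^p_\mu$ is $(\Lambda_Lx)(t)=x'(t)-\sum_{j=0}^N A_j(t)x(t-r_j)$. The index of a Fredholm operator $A$ with Banach space adjoint $A'$ is $\operatorname{Ind}(A)=\dim\ker A-\dim\ker A'$. A solution on an interval $J$ is a continuous function on $\{t+\theta:t\in J,\theta\in[-r,0]\}$, absolutely continuous on $J$, satisfying the equation for a.e. $t\in J$. The solution operator is $T(t,s):C\to C$, $T(t,s)\phi=x_t$ for $t\ge s$, where $x$ is the unique solution with $x_s=\phi$. The equation has an exponential dichotomy on an interval $J$ if there are positive constants $D,\lambda$ and strongly continuous projections $P(s)$, $Q(s)=I-P(s)$, $s\in J$, on $C$ such that: (i) $T(t,s)P(s)=P(t)T(t,s)$ for $t\ge s$ in $J$; (ii) $\overline{T}(t,s)=T(t,s)|_{\mathcal{R}Q(s)}$ is an isomorphism of the range $\mathcal{R}Q(s)$ onto $\mathcal{R}Q(t)$ for $t\ge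 s$, and $\overline{T}(s,t):\mathcal{R}Q(t)\to\mathcal{R}Q(s)$ denotes its inverse; (iii) $\|T(t,s)P(s)\|\le De^{-\lambda(t-s)}$ for $t\ge s$ in $J$; (iv) $\|\overline{T}(s,t)Q(t)\|\le De^{-\lambda(t-s)}$ for $t\ge s$ in $J$. *)

theory Defs
  imports
    "HOL-Analysis.Analysis"
    "HOL-Library.Function_Algebras"
    "HOL-Probability.Essential_Supremum"
begin

text \<open>Pointwise real vector space structure on functions, so that the library's
  \<open>span\<close> and \<open>dim\<close> apply to function spaces and to spaces of functionals.\<close>

instantiation "fun" :: (type, real_vector) real_vector
begin

definition scaleR_fun :: "real \<Rightarrow> ('a \<Rightarrow> 'b) \<Rightarrow> 'a \<Rightarrow> 'b"
  where "scaleR_fun c f = (\<lambda>x. c *\<^sub>R f x)"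

instance
  by standard (simp_all add: scaleR_fun_def fun_eq_iff scaleR_add_right scaleR_add_left)

end


section \<open>Operators between seminormed spaces of functions\<close>

text \<open>A pair \<open>(S, \<nu>)\<close> of a linear subspace \<open>S\<close> and a seminorm \<open>\<nu>\<close> on it stands for the
  normed space obtained by identifying \<open>x\<close> and \<open>y\<close> when \<open>\<nu> (x - y) = 0\<close>. Operators are given
  on representatives, so they need to be linear only up to this identification.\<close>

type_synonym 'a seminormed = "'a set \<times> ('a \<Rightarrow> real)"

definition bounded_operator ::
    "'a::real_vector seminormed \<Rightarrow> 'b::real_vector seminormed \<Rightarrow> ('a \<Rightarrow> 'b) \<Rightarrow> bool" where
  "bounded_operator X Y A \<longleftrightarrow>
     (\<forall>x\<in>fst X. A x \<in> fst Y) \<and>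
     (\<forall>x\<in>fst X. \<forall>y\<in>fst X. snd Y (A (x + y) - (A x + A y)) = 0) \<and>
     (\<forall>c. \<forall>x\<in>fst X. snd Y (A (c *\<^sub>R x) - c *\<^sub>R A x) = 0) \<and>
     (\<exists>K. \<forall>x\<in>fst X. snd Y (A x) \<le> K * snd X x)"

text \<open>In the following, the domain \<open>X\<close> is meant to be genuinely normed (\<open>snd X x = 0\<close> only for
  \<open>x = 0\<close>), so that its elements need no identification; only \<open>Y\<close> may carry a mere seminorm.\<close>

definition op_kernel :: "'a seminormed \<Rightarrow> 'b seminormed \<Rightarrow> ('a \<Rightarrow> 'b) \<Rightarrow> 'a set" where
  "op_kernel X Y A = {x \<in> fst X. snd Y (A x) = 0}"

text \<open>Continuous linear functionals, normalised to vanish outside the carrier. The bound by the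
  seminorm makes them well defined on the quotient.\<close>

definition dual_space :: "'a::real_vector seminormed \<Rightarrow> ('a \<Rightarrow> real) set" where
  "dual_space Y = {l. (\<forall>y. y \<notin> fst Y \<longrightarrow> l y = 0) \<and>
     (\<forall>y\<in>fst Y. \<forall>z\<in>fst Y. l (y + z) = l y + l z) \<and>
     (\<forall>c. \<forall>y\<in>fst Y. l (c *\<^sub>R y) = c * l y) \<and>
     (\<exists>K. \<forall>y\<in>fst Y. \<bar>l y\<bar> \<le> K * snd Y y)}"

definition op_adjoint :: "'a seminormed \<Rightarrow> ('a \<Rightarrow> 'b) \<Rightarrow> ('b \<Rightarrow> real) \<Rightarrow> ('a \<Rightarrow> real)" where
  "op_adjoint X A l = (\<lambda>x. if x \<in> fst X then l (A x) else 0)"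

definition adjoint_kernel ::
    "'a seminormed \<Rightarrow> 'b::real_vector seminormed \<Rightarrow> ('a \<Rightarrow> 'b) \<Rightarrow> ('b \<Rightarrow> real) set" where
  "adjoint_kernel X Y A = {l \<in> dual_space Y. op_adjoint X A l = (\<lambda>_. 0)}"

definition fredholm ::
    "'a::real_vector seminormed \<Rightarrow> 'b::real_vector seminormed \<Rightarrow> ('a \<Rightarrow> 'b) \<Rightarrow> bool" where
  "fredholm X Y A \<longleftrightarrow>
     bounded_operator X Y A \<and>
     (\<exists>B. finite B \<and> op_kernel X Y A \<subseteq> span B) \<and>
     (\<forall>y\<in>fst Y. (\<forall>e>0. \<exists>x\<in>fst X. snd Y (y - A x) < e) \<longrightarrow> (\<exists>x\<in>fst X. snd Y (y - A x) = 0)) \<and>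
     (\<exists>B. finite B \<and> B \<subseteq> fst Y \<and> (\<forall>y\<in>fst Y. \<exists>x\<in>fst X. \<exists>b\<in>span B. snd Y (y - A x - b) = 0))"

text \<open>Meaningful for Fredholm operators only: \<open>dim\<close> is \<open>0\<close> on infinite-dimensional spaces.\<close>

definition fredholm_index ::
    "'a::real_vector seminormed \<Rightarrow> 'b::real_vector seminormed \<Rightarrow> ('a \<Rightarrow> 'b) \<Rightarrow> int" where
  "fredholm_index X Y A = int (dim (op_kernel X Y A)) - int (dim (adjoint_kernel X Y A))"


section \<open>Weighted Lebesgue and Sobolev spaces\<close>

definition weight :: "real \<Rightarrow> real" where
  "weight t = 1 / (1 + t\<^sup>2)"

definition weighted_lebesgue :: "real measure" where
  "weighted_lebesgue = density lebesgue (\<lambda>t. ennreal (weight t))"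

definition Lp_set :: "ennreal \<Rightarrow> (real \<Rightarrow> real^'n) set" where
  "Lp_set p = {f \<in> borel_measurable lebesgue.
     if p = \<infinity> then \<exists>C. AE t in lebesgue. norm (f t) * weight t \<le> C
     else integrable weighted_lebesgue (\<lambda>t. norm (f t) powr enn2real p)}"

definition Lp_norm :: "ennreal \<Rightarrow> (real \<Rightarrow> real^'n) \<Rightarrow> real" where
  "Lp_norm p f =
     (if p = \<infinity> then enn2real (esssup lebesgue (\<lambda>t. ennreal (norm (f t) * weight t)))
      else (\<integral>t. norm (f t) powr enn2real p \<partial>weighted_lebesgue) powr (1 / enn2real p))"

definition Lp_mu :: "ennreal \<Rightarrow> (real \<Rightarrow> real^'n) seminormed" where
  "Lp_mu p = (Lp_set p, Lp_norm p)"

definition abs_continuous_on :: "real \<Rightarrow> real \<Rightarrow> (real \<Rightarrow> real^'n) \<Rightarrow> bool" where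
  "abs_continuous_on a b f \<longleftrightarrow>
     (\<forall>e>0. \<exists>d>0. \<forall>(k::nat) u v.
        (\<forall>i<k. a \<le> u i \<and> u i \<le> v i \<and> v i \<le> b) \<and>
        (\<forall>i<k. \<forall>j<k. i \<noteq> j \<longrightarrow> {u i<..<v i} \<inter> {u j<..<v j} = {}) \<and>
        (\<Sum>i<k. v i - u i) < d
        \<longrightarrow> (\<Sum>i<k. norm (f (v i) - f (u i))) < e)"

text \<open>On unbounded intervals absolute continuity is understood locally, i.e. on every compact
  subinterval.\<close>

definition loc_abs_continuous_on :: "real set \<Rightarrow> (real \<Rightarrow> real^'n) \<Rightarrow> bool" where
  "loc_abs_continuous_on J f \<longleftrightarrow> (\<forall>a b. a \<le> b \<and> {a..b} \<subseteq> J \<longrightarrow> abs_continuous_on a b f)"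

text \<open>The pointwise derivative, which exists almost everywhere for (locally) absolutely
  continuous functions; its value elsewhere is irrelevant.\<close>

definition ae_deriv :: "(real \<Rightarrow> real^'n) \<Rightarrow> real \<Rightarrow> real^'n" where
  "ae_deriv x t = vector_derivative x (at t)"

definition W1p_mu :: "ennreal \<Rightarrow> (real \<Rightarrow> real^'n) seminormed" where
  "W1p_mu p =
     ({x. loc_abs_continuous_on UNIV x \<and> x \<in> Lp_set p \<and> ae_deriv x \<in> Lp_set p},
      \<lambda>x. Lp_norm p x + Lp_norm p (ae_deriv x))"


section \<open>Delay equations\<close>

definition delays :: "nat \<Rightarrow> (nat \<Rightarrow> real) \<Rightarrow> bool" where
  "delays N r \<longleftrightarrow> r 0 = 0 \<and> (\<forall>j<N. r j < r (Suc j))"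

text \<open>\<open>C([-R,0], \<real>\<^sup>n)\<close>, its elements extended by \<open>0\<close> outside \<open>[-R,0]\<close>.\<close>

definition C_set :: "real \<Rightarrow> (real \<Rightarrow> real^'n) set" where
  "C_set R = {\<phi>. continuous_on {-R..0} \<phi> \<and> (\<forall>\<theta>. \<theta> \<notin> {-R..0} \<longrightarrow> \<phi> \<theta> = 0)}"

definition sup_norm :: "real \<Rightarrow> (real \<Rightarrow> real^'n) \<Rightarrow> real" where
  "sup_norm R \<phi> = (SUP \<theta>\<in>{-R..0}. norm (\<phi> \<theta>))"

definition history :: "real \<Rightarrow> (real \<Rightarrow> real^'n) \<Rightarrow> real \<Rightarrow> (real \<Rightarrow> real^'n)" where
  "history R x t = (\<lambda>\<theta>. if \<theta> \<in> {-R..0} then x (t + \<theta>) else 0)"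

text \<open>\<open>L(t)\<phi>\<close> for the coefficients \<open>A\<close>.\<close>

definition delay_op ::
    "nat \<Rightarrow> (nat \<Rightarrow> real) \<Rightarrow> (nat \<Rightarrow> real \<Rightarrow> real^'n^'n) \<Rightarrow> real \<Rightarrow> (real \<Rightarrow> real^'n) \<Rightarrow> real^'n" where
  "delay_op N r A t \<phi> = (\<Sum>j\<le>N. A j t *v \<phi> (- r j))"

definition char_matrix ::
    "nat \<Rightarrow> (nat \<Rightarrow> real) \<Rightarrow> (nat \<Rightarrow> real^'n^'n) \<Rightarrow> complex \<Rightarrow> complex^'n^'n" where
  "char_matrix N r A0 s =
     (\<chi> i k. (if i = k then s else 0)
        - (\<Sum>j\<le>N. complex_of_real (A0 j $ i $ k) * exp (- s * complex_of_real (r j))))"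

definition hyperbolic :: "nat \<Rightarrow> (nat \<Rightarrow> real) \<Rightarrow> (nat \<Rightarrow> real^'n^'n) \<Rightarrow> bool" where
  "hyperbolic N r A0 \<longleftrightarrow> (\<forall>z::real. det (char_matrix N r A0 (\<i> * complex_of_real z)) \<noteq> 0)"

definition asymp_hyperbolic_at ::
    "real filter \<Rightarrow> nat \<Rightarrow> (nat \<Rightarrow> real) \<Rightarrow> (nat \<Rightarrow> real \<Rightarrow> real^'n^'n) \<Rightarrow> bool" where
  "asymp_hyperbolic_at F N r A \<longleftrightarrow>
     (\<exists>A0 C. hyperbolic N r A0 \<and>
        (\<forall>t. \<forall>\<phi>\<in>C_set (r N).
           delay_op N r A t \<phi> = delay_op N r (\<lambda>j _. A0 j) t \<phi> + delay_op N r C t \<phi>) \<and>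
        (\<forall>j\<le>N. C j \<in> borel_measurable lebesgue \<and> bounded (range (C j)) \<and> (C j \<longlongrightarrow> 0) F))"

definition asymp_hyperbolic ::
    "nat \<Rightarrow> (nat \<Rightarrow> real) \<Rightarrow> (nat \<Rightarrow> real \<Rightarrow> real^'n^'n) \<Rightarrow> bool" where
  "asymp_hyperbolic N r A \<longleftrightarrow>
     asymp_hyperbolic_at at_top N r A \<and> asymp_hyperbolic_at at_bot N r A"

definition Lambda ::
    "nat \<Rightarrow> (nat \<Rightarrow> real) \<Rightarrow> (nat \<Rightarrow> real \<Rightarrow> real^'n^'n) \<Rightarrow> (real \<Rightarrow> real^'n) \<Rightarrow> (real \<Rightarrow> real^'n)" where
  "Lambda N r A x = (\<lambda>t. ae_deriv x t - (\<Sum>j\<le>N. A j t *v x (t - r j)))"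

definition is_solution ::
    "nat \<Rightarrow> (nat \<Rightarrow> real) \<Rightarrow> (nat \<Rightarrow> real \<Rightarrow> real^'n^'n) \<Rightarrow> real set \<Rightarrow> (real \<Rightarrow> real^'n) \<Rightarrow> bool" where
  "is_solution N r A J x \<longleftrightarrow>
     continuous_on {t + \<theta> | t \<theta>. t \<in> J \<and> \<theta> \<in> {- r N..0}} x \<and>
     loc_abs_continuous_on J x \<and>
     (AE t in lebesgue. t \<in> J \<longrightarrow>
        (x has_vector_derivative delay_op N r A t (history (r N) x t)) (at t within J))"

text \<open>\<open>T(t,s)\<phi>\<close> for \<open>t \<ge> s\<close>. Only the segment \<open>x\<^sub>t\<close> is described uniquely, since the values of a
  solution \<open>x\<close> before time \<open>s - r N\<close> are arbitrary.\<close>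

definition sol_op ::
    "nat \<Rightarrow> (nat \<Rightarrow> real) \<Rightarrow> (nat \<Rightarrow> real \<Rightarrow> real^'n^'n) \<Rightarrow> real \<Rightarrow> real
      \<Rightarrow> (real \<Rightarrow> real^'n) \<Rightarrow> (real \<Rightarrow> real^'n)" where
  "sol_op N r A t s \<phi> =
     (THE \<psi>. \<exists>x. is_solution N r A {s..} x \<and> history (r N) x s = \<phi> \<and> history (r N) x t = \<psi>)"

text \<open>The operator norm estimates are written out pointwise on \<open>C([-r,0], \<real>\<^sup>n)\<close>.\<close>

definition exponential_dichotomy ::
    "nat \<Rightarrow> (nat \<Rightarrow> real) \<Rightarrow> (nat \<Rightarrow> real \<Rightarrow> real^'n^'n) \<Rightarrow> real set \<Rightarrow> bool" where
  "exponential_dichotomy N r A J \<longleftrightarrow>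
     (\<exists>D \<kappa>. \<exists>P Q :: real \<Rightarrow> (real \<Rightarrow> real^'n) \<Rightarrow> (real \<Rightarrow> real^'n).
        let C = C_set (r N); \<nu> = sup_norm (r N); T = sol_op N r A; RQ = (\<lambda>s. Q s ` C) in
        D > 0 \<and> \<kappa> > 0 \<and>
        (\<forall>s\<in>J. bounded_operator (C, \<nu>) (C, \<nu>) (P s) \<and> (\<forall>\<phi>\<in>C. P s (P s \<phi>) = P s \<phi>)) \<and>
        (\<forall>s\<in>J. \<forall>\<phi>\<in>C. Q s \<phi> = \<phi> - P s \<phi>) \<and>
        (\<forall>\<phi>\<in>C. \<forall>s\<in>J. ((\<lambda>u. \<nu> (P u \<phi> - P s \<phi>)) \<longlongrightarrow> 0) (at s within J)) \<and>
        (\<forall>s\<in>J. \<forall>t\<in>J. s \<le> t \<longrightarrow>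
           (\<forall>\<phi>\<in>C. T t s (P s \<phi>) = P t (T t s \<phi>)) \<and>
           (bij_betw (T t s) (RQ s) (RQ t) \<and>
            bounded_operator (RQ s, \<nu>) (RQ t, \<nu>) (T t s) \<and>
            bounded_operator (RQ t, \<nu>) (RQ s, \<nu>) (inv_into (RQ s) (T t s))) \<and>
           (\<forall>\<phi>\<in>C. \<nu> (T t s (P s \<phi>)) \<le> D * exp (- \<kappa> * (t - s)) * \<nu> \<phi>) \<and>
           (\<forall>\<phi>\<in>C. \<nu> (inv_into (RQ s) (T t s) (Q t \<phi>)) \<le> D * exp (- \<kappa> * (t - s)) * \<nu> \<phi>)))"

end

theory Submission
  imports Defs
begin

text \<open>
  A Fredholm operator of index \<open>0\<close> with trivial kernel is bijective. So each forcing \<open>f\<close> in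
  \<open>L\<^sup>p\<^sub>\<mu>\<close> has exactly one response \<open>z\<close> in \<open>L\<^sup>p\<^sub>\<mu>\<close>, that is, a solution of \<open>z' = L(t) z\<^sub>t + f\<close>.
  As in the theorems of Perron and of Massera and Schaeffer, the dichotomy is read off from the
  responses.

  \<^item> The Green operator \<open>f \<mapsto> z\<close> is bounded (\<open>green_bounded\<close>).
  \<^item> If \<open>f\<close> is bounded and supported in \<open>[s, s + h]\<close>, then \<open>z\<close> decays exponentially on both sides of
    \<open>s\<close>, with constants that do not depend on \<open>s\<close> (\<open>green_decay\<close>). Let \<open>\<rho>\<close> be a bounded smooth weight
    that grows like \<open>e\<^sup>\<delta>\<^sup>|\<^sup>t\<^sup>-\<^sup>s\<^sup>|\<close> up to an arbitrarily large height. Then \<open>\<rho> z\<close> is the response to a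
    forcing that differs from \<open>\<rho> f\<close> by a term of size \<open>O(\<delta>)\<close> relative to \<open>\<rho> z\<close>, so the bound on the Green operator controls it once \<open>\<delta>\<close> is small.
    The weight of \<open>L\<^sup>p\<^sub>\<mu>\<close> varies only polynomially and is dominated by the exponential.
  \<^item> A segment \<open>\<phi>\<close> at time \<open>s\<close> is split by means of one such response (\<open>decomposition\<close>). The solution
    \<open>x\<close> with \<open>x\<^sub>s = \<phi>\<close> is switched on by a ramp during \<open>[s, s + 1]\<close>; the resulting function \<open>y\<close>
    vanishes before \<open>s\<close>, agrees with \<open>x\<close> after \<open>s + 1\<close> and solves the equation with a forcing \<open>f\<close>
    supported in \<open>[s, s + 1 + r\<^sub>N]\<close>. With \<open>z\<close> the response to \<open>f\<close>, the function \<open>w = y - z\<close> solves the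
    homogeneous equation on the whole line and is \<open>-z\<close> before \<open>s\<close>, and \<open>x - w\<close> is \<open>z\<close> after
    \<open>s + 1\<close>. So \<open>\<phi>\<close> is the sum of a segment \<open>(x - w)\<^sub>s\<close> whose solution decays to the right and a
    segment \<open>w\<^sub>s\<close> whose solution decays to the left.
  \<^item> The splitting is unique, since a solution on the whole line that lies in \<open>L\<^sup>p\<^sub>\<mu>\<close> is \<open>0\<close>
    (\<open>stable_inter_unstable\<close>). Uniqueness makes the two parts linear in \<open>\<phi>\<close> and compatible with the
    solution operator, and the decay of \<open>z\<close> gives the dichotomy estimates.

  The derivative in the Sobolev space is the pointwise one, and the almost everywhere
  differentiability of the functions in that space is obtained from the linearity of the operator
  (\<open>Sobolev_differentiable\<close>). Otherwise solutions are treated through the integral equation.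
\<close>

section \<open>Functional analysis on seminormed spaces\<close>

locale seminormed_space =
  fixes Y :: "'b::real_vector set" and \<nu> :: "'b \<Rightarrow> real"
  assumes carrier: "subspace Y"
    and triangle: "\<And>x y. x \<in> Y \<Longrightarrow> y \<in> Y \<Longrightarrow> \<nu> (x + y) \<le> \<nu> x + \<nu> y"
    and scale: "\<And>c x. x \<in> Y \<Longrightarrow> \<nu> (c *\<^sub>R x) = \<bar>c\<bar> * \<nu> x"
begin

lemma zero: "\<nu> 0 = 0"
  using scale[of 0 0] subspace_0[OF carrier] by simp

lemma minus: "x \<in> Y \<Longrightarrow> \<nu> (- x) = \<nu> x"
  using scale[of x "-1"] by simp

lemma nonneg: "x \<in> Y \<Longrightarrow> 0 \<le> \<nu> x"
  using triangle[of x "- x"] subspace_neg[OF carrier, of x] by (simp add: minus zero)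

lemma diff_closed: "x \<in> Y \<Longrightarrow> y \<in> Y \<Longrightarrow> x - y \<in> Y"
  by (rule subspace_diff[OF carrier])

lemma diff_commute: "x \<in> Y \<Longrightarrow> y \<in> Y \<Longrightarrow> \<nu> (x - y) = \<nu> (y - x)"
  using minus[of "x - y"] diff_closed[of x y] by simp

lemma triangle_diff: "x \<in> Y \<Longrightarrow> y \<in> Y \<Longrightarrow> \<nu> (x - y) \<le> \<nu> x + \<nu> y"
  using triangle[of x "- y"] minus[of y] subspace_neg[OF carrier, of y] by simp

lemma triangle_mid: "x \<in> Y \<Longrightarrow> y \<in> Y \<Longrightarrow> z \<in> Y \<Longrightarrow> \<nu> (x - z) \<le> \<nu> (x - y) + \<nu> (y - z)"
  using triangle[of "x - y" "y - z"] diff_closed by simp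

lemma sum_closed: "(\<And>k. f k \<in> Y) \<Longrightarrow> (\<Sum>k<m::nat. f k) \<in> Y"
  by (rule subspace_sum[OF carrier]) auto

end

text \<open>Zabreiko's lemma. By Baire's theorem some sublevel set of \<open>q\<close> is dense in a ball, by
  symmetry and convexity in a ball around \<open>0\<close>; successive approximation then writes every \<open>y\<close> as a
  series whose terms have geometrically decaying \<open>q\<close>, and countable subadditivity sums the bounds up.
  The category argument is carried out directly with nested balls, because \<open>Y\<close> carries only a
  seminorm and is not a metric space.\<close>

lemma (in seminormed_space) countably_subadditive_seminorm_bounded:
  fixes q :: "'b \<Rightarrow> real"
  assumes complete: "\<And>f. (\<And>k. f k \<in> Y) \<Longrightarrow> summable (\<lambda>k. \<nu> (f k)) \<Longrightarrow>
      \<exists>g\<in>Y. (\<lambda>m. \<nu> (g - (\<Sum>k<m. f k))) \<longlonglongrightarrow> 0"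
    and q_nonneg: "\<And>y. y \<in> Y \<Longrightarrow> 0 \<le> q y"
    and q_scale: "\<And>c y. y \<in> Y \<Longrightarrow> q (c *\<^sub>R y) = \<bar>c\<bar> * q y"
    and q_subadd: "\<And>f g. (\<And>k. f k \<in> Y) \<Longrightarrow> g \<in> Y \<Longrightarrow> summable (\<lambda>k. \<nu> (f k)) \<Longrightarrow>
      summable (\<lambda>k. q (f k)) \<Longrightarrow> (\<lambda>m. \<nu> (g - (\<Sum>k<m. f k))) \<longlonglongrightarrow> 0 \<Longrightarrow> q g \<le> (\<Sum>k. q (f k))"
  obtains K where "K > 0" "\<And>y. y \<in> Y \<Longrightarrow> q y \<le> K * \<nu> y"
proof -
  have Y0: "0 \<in> Y" and Yadd: "\<And>x y. x \<in> Y \<Longrightarrow> y \<in> Y \<Longrightarrow> x + y \<in> Y"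
    and Ysc: "\<And>c x. x \<in> Y \<Longrightarrow> c *\<^sub>R x \<in> Y"
    using carrier by (auto simp: subspace_def)
  have q0: "q 0 = 0" using q_scale[of 0 0] Y0 by simp
  have q_add: "q (x + y) \<le> q x + q y" if "x \<in> Y" "y \<in> Y" for x y
  proof -
    define f where "f k = (if k = 0 then x else if k = 1 then y else 0)" for k :: nat
    have f: "f k = 0" if "k \<ge> 2" for k using that by (auto simp: f_def)
    have S: "(\<Sum>k<m. f k) = x + y" if "m \<ge> 2" for m
    proof -
      have "(\<Sum>k<m. f k) = (\<Sum>k<2. f k)"
        by (rule sum.mono_neutral_right) (use that f in auto)
      then show ?thesis by (simp add: f_def numeral_2_eq_2)
    qed
    have fin: "finite {0,1::nat}" by simp
    have "q (x + y) \<le> (\<Sum>k. q (f k))"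
    proof (rule q_subadd)
      show "summable (\<lambda>k. \<nu> (f k))" "summable (\<lambda>k. q (f k))"
        by (rule summable_finite[OF fin]; simp add: f_def zero q0)+
      have "\<forall>\<^sub>F m in sequentially. \<nu> (x + y - (\<Sum>k<m. f k)) = 0"
        using eventually_ge_at_top[of 2] by eventually_elim (simp add: S zero)
      then show "(\<lambda>m. \<nu> (x + y - (\<Sum>k<m. f k))) \<longlonglongrightarrow> 0" by (rule tendsto_eventually)
    qed (use that Y0 Yadd in \<open>auto simp: f_def\<close>)
    also have "(\<Sum>k. q (f k)) = (\<Sum>k\<in>{0,1}. q (f k))"
      by (rule suminf_finite[OF fin]) (simp add: f_def q0)
    also have "\<dots> = q x + q y" by (simp add: f_def)
    finally show ?thesis .
  qed
  define near where "near N y \<longleftrightarrow> (\<forall>\<eta>>0. \<exists>u\<in>Y. q u \<le> real N \<and> \<nu> (y - u) < \<eta>)" for N y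

  have "\<exists>N. \<exists>y0\<in>Y. \<exists>\<epsilon>>0. \<forall>y\<in>Y. \<nu> (y - y0) < \<epsilon> \<longrightarrow> near N y"
  proof (rule ccontr)
    assume "\<not> ?thesis"
    then have neg: "\<exists>y\<in>Y. \<nu> (y - y0) < \<epsilon> \<and> (\<exists>\<eta>>0. \<forall>u\<in>Y. q u \<le> real N \<longrightarrow> \<eta> \<le> \<nu> (y - u))"
      if "y0 \<in> Y" "\<epsilon> > 0" for N y0 \<epsilon>
      using that unfolding near_def by (metis not_less)
    \<comment> \<open>A pair consists of the centre and the radius of a ball. The factor \<open>2\<close> keeps the whole ball,
      and so the limit of the centres, away from the sublevel set.\<close>
    define good where "good N w \<longleftrightarrow> fst w \<in> Y \<and> 0 < snd w \<and> snd w \<le> (1/2)^N \<and>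
        (\<forall>u\<in>Y. q u \<le> real N \<longrightarrow> 2 * snd w \<le> \<nu> (fst w - u))" for N :: nat and w :: "'b \<times> real"
    define nxt where "nxt w w' \<longleftrightarrow> \<nu> (fst w' - fst w) < snd w / 2 \<and> snd w' \<le> snd w / 2"
      for w w' :: "'b \<times> real"
    have step: "\<exists>w'. good N w' \<and> nxt w w'" if w: "fst w \<in> Y" "0 < snd w" for N w
    proof -
      obtain y \<eta> where y: "y \<in> Y" "\<nu> (y - fst w) < snd w / 2" "\<eta> > 0"
        "\<forall>u\<in>Y. q u \<le> real N \<longrightarrow> \<eta> \<le> \<nu> (y - u)"
        using neg[OF w(1) half_gt_zero[OF w(2)], of N] by blast
      define e where "e = min (\<eta>/2) (min (snd w / 2) ((1/2)^N))"
      have "e > 0" "2 * e \<le> \<eta>" "e \<le> snd w / 2" "e \<le> (1/2)^N"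
        using y w by (auto simp: e_def)
      then have "good N (y, e) \<and> nxt w (y, e)"
        unfolding good_def nxt_def using y by force
      then show ?thesis by blast
    qed
    have "\<exists>w. \<forall>n. good n (w n) \<and> nxt (w n) (w (Suc n))"
    proof (rule dependent_nat_choice)
      show "\<exists>w. good 0 w" using step[of "(0, 1)" 0] Y0 by auto
      show "\<exists>w'. good (Suc n) w' \<and> nxt w w'" if "good n w" for w n
        using step[of w "Suc n"] that by (auto simp: good_def)
    qed
    then obtain w where w: "\<And>n. good n (w n)" "\<And>n. nxt (w n) (w (Suc n))" by blast
    define y e where "y n = fst (w n)" and "e n = snd (w n)" for n
    have y: "y n \<in> Y" "0 < e n" "e n \<le> (1/2)^n"
      "\<And>u. u \<in> Y \<Longrightarrow> q u \<le> real n \<Longrightarrow> 2 * e n \<le> \<nu> (y n - u)"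
      "\<nu> (y (Suc n) - y n) < e n / 2" "e (Suc n) \<le> e n / 2" for n
      using w[of n] by (auto simp: good_def nxt_def y_def e_def)
    define d where "d n = y (Suc n) - y n" for n
    have dY: "d n \<in> Y" for n using y by (simp add: d_def diff_closed)
    have "summable (\<lambda>n. \<nu> (d n))"
    proof (rule summable_comparison_test'[of "\<lambda>n. (1/2::real)^n" 0])
      fix n show "norm (\<nu> (d n)) \<le> (1/2)^n"
        using y(2,3,5)[of n] nonneg[OF dY[of n]] by (simp add: d_def)
    qed (rule summable_geometric, simp)
    then obtain g where g: "g \<in> Y" "(\<lambda>m. \<nu> (g - (\<Sum>k<m. d k))) \<longlonglongrightarrow> 0"
      using complete[of d] dY by blast
    have sum_d: "(\<Sum>k<m. d k) = y m - y 0" for m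
      unfolding d_def by (rule sum_lessThan_telescope)
    define h where "h = g + y 0"
    have h: "h \<in> Y" "(\<lambda>m. \<nu> (h - y m)) \<longlonglongrightarrow> 0"
      using g y Yadd by (auto simp: h_def sum_d algebra_simps)
    obtain N where N: "q h \<le> real N" using real_arch_simple by blast
    have tail: "\<nu> (y m - y N) \<le> e N - e m" if "m \<ge> N" for m
      using that
    proof (induction m rule: dec_induct)
      case base then show ?case by (simp add: zero)
    next
      case (step m)
      have "\<nu> (y (Suc m) - y N) \<le> \<nu> (y (Suc m) - y m) + \<nu> (y m - y N)"
        using triangle_mid y by blast
      then show ?case using step.IH y(5,6)[of m] y(2)[of m] by linarith
    qed
    have "\<nu> (h - y N) \<le> e N"
    proof (rule tendsto_lowerbound)
      show "(\<lambda>m. \<nu> (h - y m) + e N) \<longlonglongrightarrow> e N"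
        using tendsto_add[OF h(2) tendsto_const[of "e N"]] by simp
      show "\<forall>\<^sub>F m in sequentially. \<nu> (h - y N) \<le> \<nu> (h - y m) + e N"
        using eventually_ge_at_top[of N]
      proof eventually_elim
        case (elim m)
        have "\<nu> (h - y N) \<le> \<nu> (h - y m) + \<nu> (y m - y N)" using triangle_mid h y by blast
        then show ?case using tail[OF elim] y(2)[of m] by linarith
      qed
    qed simp
    moreover have "2 * e N \<le> \<nu> (y N - h)" using y(4)[OF h(1) N] .
    ultimately show False using y(2)[of N] diff_commute[OF h(1) y(1)[of N]] by linarith
  qed
  then obtain N y0 \<epsilon> where y0: "y0 \<in> Y" and \<epsilon>: "\<epsilon> > 0"
    and ball: "\<And>y. y \<in> Y \<Longrightarrow> \<nu> (y - y0) < \<epsilon> \<Longrightarrow> near N y" by blast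
  have near0: "near N y" if "y \<in> Y" "\<nu> y < \<epsilon>" for y
    unfolding near_def
  proof (intro allI impI)
    fix \<eta> :: real assume "\<eta> > 0"
    have "near N (y0 + y)" "near N (y0 - y)"
      using that y0 by (auto intro!: ball simp: minus Yadd diff_closed)
    then obtain u v where u: "u \<in> Y" "q u \<le> real N" "\<nu> (y0 + y - u) < \<eta>"
      and v: "v \<in> Y" "q v \<le> real N" "\<nu> (y0 - y - v) < \<eta>"
      using \<open>\<eta> > 0\<close> unfolding near_def by meson
    have "q ((1/2) *\<^sub>R (u + (-1) *\<^sub>R v)) \<le> real N"
      using q_add[OF u(1) Ysc[OF v(1), of "-1"]] q_scale[OF v(1), of "-1"]
        q_scale[OF Yadd[OF u(1) Ysc[OF v(1), of "-1"]], of "1/2"] u v by simp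
    moreover have "y - (1/2) *\<^sub>R (u + (-1) *\<^sub>R v) = (1/2) *\<^sub>R ((y0 + y - u) - (y0 - y - v))"
      by (simp add: algebra_simps flip: scaleR_2)
    moreover have "\<nu> ((1/2) *\<^sub>R ((y0 + y - u) - (y0 - y - v))) < \<eta>"
    proof -
      have "(y0 + y - u) - (y0 - y - v) \<in> Y" using that y0 u v by (intro diff_closed Yadd)
      then have "\<nu> ((1/2) *\<^sub>R ((y0 + y - u) - (y0 - y - v))) = 1/2 * \<nu> ((y0 + y - u) - (y0 - y - v))"
        using scale[of _ "1/2"] by simp
      moreover have "\<nu> ((y0 + y - u) - (y0 - y - v)) \<le> \<nu> (y0 + y - u) + \<nu> (y0 - y - v)"
        using that y0 u v by (intro triangle_diff) (auto simp: Yadd diff_closed)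
      ultimately show ?thesis using u v by linarith
    qed
    ultimately show "\<exists>u\<in>Y. q u \<le> real N \<and> \<nu> (y - u) < \<eta>"
      using u v by (metis Yadd Ysc)
  qed
  define c where "c = (2 * real N + 1) / \<epsilon>"
  have c: "c > 0" using \<epsilon> by (simp add: c_def add_pos_nonneg)
  have approx: "\<exists>u\<in>Y. q u \<le> c * \<delta> \<and> \<nu> (y - u) < \<eta>"
    if y: "y \<in> Y" "\<nu> y \<le> \<delta>" and pos: "\<delta> > 0" "\<eta> > 0" for y \<delta> \<eta>
  proof -
    define \<kappa> where "\<kappa> = \<epsilon> / (2 * \<delta>)"
    have \<kappa>: "\<kappa> > 0" using pos \<epsilon> by (simp add: \<kappa>_def)
    have "\<nu> (\<kappa> *\<^sub>R y) < \<epsilon>"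
    proof -
      have "\<kappa> * \<nu> y \<le> \<kappa> * \<delta>" using \<kappa> y by (simp add: mult_left_mono)
      also have "\<dots> < \<epsilon>" using pos \<epsilon> by (simp add: \<kappa>_def)
      finally show ?thesis using scale[OF y(1), of \<kappa>] \<kappa> by simp
    qed
    then have "near N (\<kappa> *\<^sub>R y)" using near0 y Ysc by blast
    then obtain u where u: "u \<in> Y" "q u \<le> real N" "\<nu> (\<kappa> *\<^sub>R y - u) < \<kappa> * \<eta>"
      using \<kappa> pos unfolding near_def by (meson mult_pos_pos)
    have "q ((1/\<kappa>) *\<^sub>R u) \<le> real N / \<kappa>"
      using q_scale[OF u(1), of "1/\<kappa>"] u(2) \<kappa> by (simp add: divide_right_mono)
    also have "\<dots> = 2 * real N / \<epsilon> * \<delta>" using pos \<epsilon> by (simp add: \<kappa>_def)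
    also have "\<dots> \<le> c * \<delta>"
      unfolding c_def using pos \<epsilon> by (intro mult_right_mono divide_right_mono) auto
    finally have 1: "q ((1/\<kappa>) *\<^sub>R u) \<le> c * \<delta>" .
    have "y - (1/\<kappa>) *\<^sub>R u = (1/\<kappa>) *\<^sub>R (\<kappa> *\<^sub>R y - u)" using \<kappa> by (simp add: scaleR_diff_right)
    then have "\<nu> (y - (1/\<kappa>) *\<^sub>R u) = (1/\<kappa>) * \<nu> (\<kappa> *\<^sub>R y - u)"
      using scale[of "\<kappa> *\<^sub>R y - u" "1/\<kappa>"] \<kappa> y u by (simp add: diff_closed Ysc)
    also have "\<dots> < \<eta>" using u(3) \<kappa> by (simp add: field_simps)
    finally show ?thesis using 1 u Ysc by blast
  qed
  have bound: "q y \<le> 2 * c * \<delta>" if y: "y \<in> Y" "\<nu> y \<le> \<delta>" and \<delta>: "\<delta> > 0" for y \<delta>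
  proof -
    define P where "P n z \<longleftrightarrow> z \<in> Y \<and> \<nu> z \<le> \<delta> * (1/2)^n" for n :: nat and z
    have "\<exists>z. \<forall>n. P n (z n) \<and> (q (z n - z (Suc n)) \<le> c * (\<delta> * (1/2)^n)) \<and> (n = 0 \<longrightarrow> z n = y)"
    proof -
      have "\<exists>z. z 0 = y \<and> (\<forall>n. (P n (z n)) \<and> (q (z n - z (Suc n)) \<le> c * (\<delta> * (1/2)^n)))"
      proof -
        have "\<exists>z. \<forall>n. (P n (z n) \<and> (n = 0 \<longrightarrow> z n = y)) \<and> q (z n - z (Suc n)) \<le> c * (\<delta> * (1/2)^n)"
        proof (rule dependent_nat_choice)
          show "\<exists>x. P 0 x \<and> (0 = 0 \<longrightarrow> x = y)" using y by (auto simp: P_def)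
          fix z :: 'b and n :: nat assume "P n z \<and> (n = 0 \<longrightarrow> z = y)"
          then have z: "z \<in> Y" "\<nu> z \<le> \<delta> * (1/2)^n" by (auto simp: P_def)
          obtain u where u: "u \<in> Y" "q u \<le> c * (\<delta> * (1/2)^n)" "\<nu> (z - u) < \<delta> * (1/2)^Suc n"
            using approx[OF z, of "\<delta> * (1/2)^Suc n"] \<delta> by auto
          then show "\<exists>z'. (P (Suc n) z' \<and> (Suc n = 0 \<longrightarrow> z' = y)) \<and>
              q (z - z') \<le> c * (\<delta> * (1/2)^n)"
            by (intro exI[of _ "z - u"]) (auto simp: P_def z diff_closed)
        qed
        then show ?thesis by blast
      qed
      then show ?thesis by metis
    qed
    then obtain z where z: "\<And>n. z n \<in> Y" "\<And>n. \<nu> (z n) \<le> \<delta> * (1/2)^n"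
      "\<And>n. q (z n - z (Suc n)) \<le> c * (\<delta> * (1/2)^n)" "z 0 = y"
      by (auto simp: P_def)
    define f where "f n = z n - z (Suc n)" for n
    have fY: "f n \<in> Y" for n using z by (simp add: f_def diff_closed)
    have rest: "y - (\<Sum>k<m. f k) = z m" for m
      using sum_lessThan_telescope'[of z m] z(4) by (simp add: f_def)
    have geo: "summable (\<lambda>n. C * (1/2::real)^n)" for C
      by (intro summable_mult summable_geometric) simp
    have "q y \<le> (\<Sum>k. q (f k))"
    proof (rule q_subadd)
      show "summable (\<lambda>k. \<nu> (f k))"
      proof (rule summable_comparison_test'[OF geo[of "2 * \<delta>"], of 0])
        fix n
        have "\<nu> (f n) \<le> \<nu> (z n) + \<nu> (z (Suc n))" unfolding f_def by (intro triangle_diff z)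
        also have "\<dots> \<le> \<delta> * (1/2)^n + \<delta> * (1/2)^Suc n" by (intro add_mono z)
        also have "\<dots> \<le> 2 * \<delta> * (1/2)^n" using \<delta> by simp
        finally show "norm (\<nu> (f n)) \<le> 2 * \<delta> * (1/2)^n" using nonneg[OF fY[of n]] by simp
      qed
      show "summable (\<lambda>k. q (f k))"
        by (rule summable_comparison_test'[OF geo[of "c * \<delta>"], of 0])
          (use z(3) q_nonneg fY in \<open>auto simp: f_def mult.assoc\<close>)
      show "(\<lambda>m. \<nu> (y - (\<Sum>k<m. f k))) \<longlonglongrightarrow> 0"
        unfolding rest
        by (rule tendsto_sandwich[of "\<lambda>_. 0" _ _ "\<lambda>n. \<delta> * (1/2)^n"])
          (use z nonneg in \<open>auto intro!: tendsto_eq_intros LIMSEQ_realpow_zero\<close>)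
    qed (use fY y in auto)
    also have "\<dots> \<le> (\<Sum>k. c * \<delta> * (1/2)^k)"
      by (intro suminf_le geo summable_comparison_test'[OF geo[of "c * \<delta>"], of 0])
        (use z(3) q_nonneg fY in \<open>auto simp: f_def mult.assoc\<close>)
    also have "\<dots> = c * \<delta> * (\<Sum>k. (1/2)^k)" by (rule suminf_mult) simp
    also have "\<dots> = 2 * c * \<delta>" by (simp add: suminf_geometric)
    finally show ?thesis .
  qed
  have "q y \<le> 2 * c * \<nu> y" if y: "y \<in> Y" for y
  proof (rule field_le_epsilon)
    fix e :: real assume "e > 0"
    have "q y \<le> 2 * c * (\<nu> y + e / (2 * c))"
      using c \<open>e > 0\<close> nonneg[OF y] by (intro bound) (auto intro!: add_nonneg_pos y)
    then show "q y \<le> 2 * c * \<nu> y + e" using c by (simp add: distrib_left)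
  qed
  then show ?thesis using that[of "2 * c"] c by simp
qed

text \<open>Hahn-Banach for closed subspaces of finite codimension: a spanning set is adjoined one vector at
  a time, and the last one outside the subspace defines a functional that is bounded by the
  reciprocal of its distance.\<close>

lemma (in seminormed_space) annihilating_functional:
  assumes fin: "finite B" and R: "subspace R" "R \<subseteq> Y"
    and closed: "\<And>y. y \<in> Y \<Longrightarrow> (\<And>e. e > 0 \<Longrightarrow> \<exists>x\<in>R. \<nu> (y - x) < e) \<Longrightarrow> y \<in> R"
    and B: "B \<subseteq> Y" and span: "\<And>y. y \<in> Y \<Longrightarrow> \<exists>x\<in>R. y - x \<in> span B"
    and ne: "R \<noteq> Y"
  shows "\<exists>l. (\<forall>y\<in>Y. \<forall>z\<in>Y. l (y + z) = l y + l z) \<and> (\<forall>c. \<forall>y\<in>Y. l (c *\<^sub>R y) = c * l y) \<and>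
     (\<exists>K. \<forall>y\<in>Y. \<bar>l y\<bar> \<le> K * \<nu> y) \<and> (\<forall>x\<in>R. l x = 0) \<and> (\<exists>y\<in>Y. l y \<noteq> 0)"
  using fin R closed B span ne
proof (induction B arbitrary: R rule: finite_induct)
  case empty
  have "y \<in> R" if "y \<in> Y" for y using empty.prems(5)[OF that] by auto
  then show ?case using empty.prems by blast
next
  case (insert b B)
  note R = \<open>subspace R\<close> and RY = \<open>R \<subseteq> Y\<close> and closed = insert.prems(3)
  have b: "b \<in> Y" and B: "B \<subseteq> Y" using insert.prems(4) by auto
  have decomp: "\<exists>x\<in>R. \<exists>k. y - x - k *\<^sub>R b \<in> span B" if y: "y \<in> Y" for y
  proof -
    obtain x where x: "x \<in> R" "y - x \<in> span (insert b B)" using insert.prems(5)[OF y] by blast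
    then obtain k where "y - x - k *\<^sub>R b \<in> span B" by (auto simp: span_insert)
    then show ?thesis using x by blast
  qed
  show ?case
  proof (cases "b \<in> R")
    case True
    have "\<exists>x\<in>R. y - x \<in> span B" if y: "y \<in> Y" for y
    proof -
      obtain x k where "x \<in> R" "y - x - k *\<^sub>R b \<in> span B" using decomp[OF y] by blast
      then show ?thesis using True R
        by (intro bexI[of _ "x + k *\<^sub>R b"]) (auto simp: subspace_def diff_diff_eq)
    qed
    then show ?thesis using insert.IH[OF R RY closed B] insert.prems(6) by blast
  next
    case False
    then obtain d where d: "d > 0" "\<And>x. x \<in> R \<Longrightarrow> d \<le> \<nu> (b - x)"
      using closed[OF b] by (meson not_less)
    have dist: "\<bar>k\<bar> * d \<le> \<nu> (x + k *\<^sub>R b)" if x: "x \<in> R" for x k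
    proof (cases "k = 0")
      case True then show ?thesis using nonneg RY x by auto
    next
      case False
      have "(- 1 / k) *\<^sub>R x \<in> R" using R x by (rule subspace_scale)
      then have "d \<le> \<nu> (b - (- 1 / k) *\<^sub>R x)" by (rule d)
      moreover have "x + k *\<^sub>R b = k *\<^sub>R (b - (- 1 / k) *\<^sub>R x)"
        using False by (simp add: scaleR_add_right)
      moreover have "b - (- 1 / k) *\<^sub>R x \<in> Y"
        using \<open>(- 1 / k) *\<^sub>R x \<in> R\<close> RY b by (intro diff_closed) auto
      ultimately show ?thesis using scale[of "b - (- 1 / k) *\<^sub>R x" k] by (simp add: mult_left_mono)
    qed
    define R' where "R' = {x + k *\<^sub>R b | x k. x \<in> R}"
    have R'_I: "x + k *\<^sub>R b \<in> R'" if "x \<in> R" for x k using that R'_def by blast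
    have RR': "R \<subseteq> R'" using R'_I[of _ 0] by auto
    have R'Y: "R' \<subseteq> Y" unfolding R'_def using RY b carrier by (auto simp: subspace_def)
    have "subspace R'"
      unfolding subspace_def
    proof (intro conjI ballI allI)
      show "0 \<in> R'" using RR' R by (auto simp: subspace_def)
      fix u assume "u \<in> R'"
      then obtain x k where u: "x \<in> R" "u = x + k *\<^sub>R b" by (auto simp: R'_def)
      show "c *\<^sub>R u \<in> R'" for c
        using R'_I[of "c *\<^sub>R x" "c * k"] u R by (simp add: scaleR_add_right subspace_scale)
      fix v assume "v \<in> R'"
      then obtain x' k' where v: "x' \<in> R" "v = x' + k' *\<^sub>R b" by (auto simp: R'_def)
      show "u + v \<in> R'"
        using R'_I[of "x + x'" "k + k'"] u v R by (simp add: subspace_add algebra_simps)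
    qed
    show ?thesis
    proof (cases "R' = Y")
      case False
      have "\<exists>x\<in>R'. y - x \<in> span B" if "y \<in> Y" for y
        using decomp[OF that] R'_I by (metis diff_diff_eq)
      moreover have "y \<in> R'" if y: "y \<in> Y" and ap: "\<And>e. e > 0 \<Longrightarrow> \<exists>x\<in>R'. \<nu> (y - x) < e" for y
      proof -
        have "\<exists>x k. x \<in> R \<and> \<nu> (y - (x + k *\<^sub>R b)) < 1 / real (Suc n)" for n
          using ap[of "1 / real (Suc n)"] unfolding R'_def by auto
        then obtain x k where xk: "\<And>n. x n \<in> R" "\<And>n. \<nu> (y - (x n + k n *\<^sub>R b)) < 1 / real (Suc n)"
          by metis
        have inY: "y - (x n + k n *\<^sub>R b) \<in> Y" for n
          using xk R'_I R'Y y by (meson diff_closed subsetD)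
        have kk: "\<bar>k n - k m\<bar> * d \<le> 1 / real (Suc n) + 1 / real (Suc m)" for n m
        proof -
          have "\<bar>k n - k m\<bar> * d \<le> \<nu> ((x n - x m) + (k n - k m) *\<^sub>R b)"
            using xk R by (intro dist subspace_diff)
          also have "(x n - x m) + (k n - k m) *\<^sub>R b
              = (y - (x m + k m *\<^sub>R b)) - (y - (x n + k n *\<^sub>R b))"
            by (simp add: algebra_simps)
          also have "\<nu> \<dots> \<le> \<nu> (y - (x m + k m *\<^sub>R b)) + \<nu> (y - (x n + k n *\<^sub>R b))"
            by (rule triangle_diff[OF inY inY])
          finally show ?thesis using xk(2)[of n] xk(2)[of m] by linarith
        qed
        have "Cauchy k"
        proof (rule metric_CauchyI)
          fix e :: real assume "e > 0"
          then obtain M where M: "1 / real (Suc M) < e * d / 2"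
            using d reals_Archimedean[of "e * d / 2"] by (auto simp: inverse_eq_divide)
          have "dist (k m) (k n) < e" if "m \<ge> M" "n \<ge> M" for m n
          proof -
            have "1 / real (Suc m) \<le> 1 / real (Suc M)" "1 / real (Suc n) \<le> 1 / real (Suc M)"
              using that by (auto intro!: divide_left_mono)
            then have "\<bar>k m - k n\<bar> * d < e * d" using kk[of m n] M by linarith
            then show ?thesis using d by (simp add: dist_real_def)
          qed
          then show "\<exists>M. \<forall>m\<ge>M. \<forall>n\<ge>M. dist (k m) (k n) < e" by blast
        qed
        then obtain k0 where k0: "k \<longlonglongrightarrow> k0" using Cauchy_convergent_iff convergent_def by blast
        have "y - k0 *\<^sub>R b \<in> R"
        proof (rule closed)
          show "y - k0 *\<^sub>R b \<in> Y" using y b carrier by (simp add: subspace_def diff_closed)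
          fix e :: real assume e: "e > 0"
          have "(\<lambda>n. 1 / real (Suc n) + \<bar>k n - k0\<bar> * \<nu> b) \<longlonglongrightarrow> 0 + \<bar>k0 - k0\<bar> * \<nu> b"
            by (intro tendsto_intros k0 LIMSEQ_Suc[OF lim_const_over_n])
          then have "\<forall>\<^sub>F n in sequentially. 1 / real (Suc n) + \<bar>k n - k0\<bar> * \<nu> b < e"
            using e by (intro order_tendstoD(2)) auto
          then obtain n where n: "1 / real (Suc n) + \<bar>k n - k0\<bar> * \<nu> b < e"
            by (auto simp: eventually_sequentially)
          have kb: "(k n - k0) *\<^sub>R b \<in> Y" using b carrier by (simp add: subspace_scale)
          have "\<nu> (y - k0 *\<^sub>R b - x n) = \<nu> ((y - (x n + k n *\<^sub>R b)) + (k n - k0) *\<^sub>R b)"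
            by (simp add: algebra_simps)
          also have "\<dots> \<le> \<nu> (y - (x n + k n *\<^sub>R b)) + \<nu> ((k n - k0) *\<^sub>R b)"
            by (rule triangle[OF inY kb])
          also have "\<dots> < e" using xk(2)[of n] n scale[OF b, of "k n - k0"] by linarith
          finally show "\<exists>x\<in>R. \<nu> (y - k0 *\<^sub>R b - x) < e" using xk by blast
        qed
        then show ?thesis using R'_I[of "y - k0 *\<^sub>R b" k0] by simp
      qed
      ultimately show ?thesis
        using insert.IH[OF \<open>subspace R'\<close> R'Y _ B _ False] RR' by blast
    next
      case True
      have uniq: "k = k'" if "x \<in> R" "x' \<in> R" "x + k *\<^sub>R b = x' + k' *\<^sub>R b" for x x' k k'
      proof -
        have "\<bar>k - k'\<bar> * d \<le> \<nu> ((x - x') + (k - k') *\<^sub>R b)"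
          using that R by (intro dist subspace_diff)
        also have "(x - x') + (k - k') *\<^sub>R b = 0" using that(3) by (simp add: algebra_simps)
        finally show ?thesis using d zero by (simp add: mult_le_0_iff)
      qed
      define l where "l y = (THE k. \<exists>x\<in>R. y = x + k *\<^sub>R b)" for y
      have l: "l (x + k *\<^sub>R b) = k" if "x \<in> R" for x k
        unfolding l_def by (rule the_equality) (use that uniq in blast)+
      have l0: "l x = 0" if "x \<in> R" for x using l[OF that, of 0] by simp
      have lb: "l b = 1" using l[of 0 1] R by (simp add: subspace_0)
      have dec: "\<exists>x\<in>R. \<exists>k. y = x + k *\<^sub>R b" if "y \<in> Y" for y using that True R'_def by auto
      show ?thesis
      proof (intro exI[of _ l] conjI ballI allI)
        fix y assume "y \<in> Y"
        then obtain x k where y: "x \<in> R" "y = x + k *\<^sub>R b" using dec by blast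
        show "l (c *\<^sub>R y) = c * l y" for c
          using l[of "c *\<^sub>R x" "c * k"] l[of x k] y R
          by (simp add: scaleR_add_right subspace_scale)
        fix z assume "z \<in> Y"
        then obtain x' k' where z: "x' \<in> R" "z = x' + k' *\<^sub>R b" using dec by blast
        show "l (y + z) = l y + l z"
          using l[of "x + x'" "k + k'"] l[of x k] l[of x' k'] y z R
          by (simp add: subspace_add algebra_simps)
      next
        show "\<exists>K. \<forall>y\<in>Y. \<bar>l y\<bar> \<le> K * \<nu> y"
        proof (intro exI[of _ "1/d"] ballI)
          fix y assume "y \<in> Y"
          then obtain x k where y: "x \<in> R" "y = x + k *\<^sub>R b" using dec by blast
          show "\<bar>l y\<bar> \<le> 1 / d * \<nu> y" using dist[OF y(1), of k] l[OF y(1)] y(2) d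
            by (simp add: field_simps)
        qed
        show "\<exists>y\<in>Y. l y \<noteq> 0" using b lb by force
      qed (rule l0)
    qed
  qed
qed

text \<open>A functional in the adjoint kernel of a Fredholm operator is determined by its values on a
  finite set spanning a complement of the range. So the adjoint kernel is finite-dimensional, and
  dimension \<open>0\<close> means that it is trivial.\<close>

lemma adjoint_kernel_trivial:
  fixes X :: "'a::real_vector seminormed" and Y :: "'b::real_vector seminormed"
  assumes Y: "seminormed_space (fst Y) (snd Y)"
    and A: "\<And>x. x \<in> fst X \<Longrightarrow> A x \<in> fst Y"
    and B: "finite B" "B \<subseteq> fst Y"
      "\<And>y. y \<in> fst Y \<Longrightarrow> \<exists>x\<in>fst X. \<exists>b\<in>span B. snd Y (y - A x - b) = 0"
    and dim: "dim (adjoint_kernel X Y A) = 0"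
    and l: "l \<in> adjoint_kernel X Y A"
  shows "l = (\<lambda>_. 0)"
proof -
  interpret Y: seminormed_space "fst Y" "snd Y" by (rule Y)
  let ?K = "adjoint_kernel X Y A"
  have K_iff: "k \<in> ?K \<longleftrightarrow> (\<forall>y. y \<notin> fst Y \<longrightarrow> k y = 0) \<and>
      (\<forall>y\<in>fst Y. \<forall>z\<in>fst Y. k (y + z) = k y + k z) \<and> (\<forall>c. \<forall>y\<in>fst Y. k (c *\<^sub>R y) = c * k y) \<and>
      (\<exists>C. \<forall>y\<in>fst Y. \<bar>k y\<bar> \<le> C * snd Y y) \<and> (\<forall>x\<in>fst X. k (A x) = 0)" for k
    by (auto simp: adjoint_kernel_def dual_space_def op_adjoint_def fun_eq_iff)
  have Kout: "k y = 0" if "k \<in> ?K" "y \<notin> fst Y" for k y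
    using that by (simp add: K_iff)
  have Kadd: "k (y + z) = k y + k z" if "k \<in> ?K" "y \<in> fst Y" "z \<in> fst Y" for k y z
    using that by (simp add: K_iff)
  have Ksc: "k (c *\<^sub>R y) = c * k y" if "k \<in> ?K" "y \<in> fst Y" for k y c
    using that by (simp add: K_iff)
  have Kbd: "\<exists>C. \<forall>y\<in>fst Y. \<bar>k y\<bar> \<le> C * snd Y y" if "k \<in> ?K" for k
    using that by (simp add: K_iff)
  have KA: "k (A x) = 0" if "k \<in> ?K" "x \<in> fst X" for k x
    using that by (simp add: K_iff)
  have sub: "subspace ?K"
    unfolding subspace_def
  proof (intro conjI ballI allI)
    show "0 \<in> ?K"
      by (auto simp: K_iff intro!: exI[of _ 0])
    fix k assume k: "k \<in> ?K"
    obtain C where C: "\<forall>y\<in>fst Y. \<bar>k y\<bar> \<le> C * snd Y y" using Kbd[OF k] by blast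
    show "c *\<^sub>R k \<in> ?K" for c
    proof -
      have "\<forall>y\<in>fst Y. \<bar>(c *\<^sub>R k) y\<bar> \<le> (\<bar>c\<bar> * C) * snd Y y"
        using C by (auto simp: scaleR_fun_def abs_mult mult.assoc intro!: mult_left_mono)
      then have "\<exists>C. \<forall>y\<in>fst Y. \<bar>(c *\<^sub>R k) y\<bar> \<le> C * snd Y y" by blast
      then show ?thesis
        using Kout[OF k] Kadd[OF k] Ksc[OF k] KA[OF k]
        unfolding K_iff by (simp add: scaleR_fun_def algebra_simps)
    qed
    fix k' assume k': "k' \<in> ?K"
    obtain C' where C': "\<forall>y\<in>fst Y. \<bar>k' y\<bar> \<le> C' * snd Y y" using Kbd[OF k'] by blast
    have "\<forall>y\<in>fst Y. \<bar>(k + k') y\<bar> \<le> (C + C') * snd Y y"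
    proof
      fix y assume "y \<in> fst Y"
      then have "\<bar>k y\<bar> \<le> C * snd Y y" "\<bar>k' y\<bar> \<le> C' * snd Y y" using C C' by auto
      then show "\<bar>(k + k') y\<bar> \<le> (C + C') * snd Y y" by (simp add: distrib_right)
    qed
    then have "\<exists>C. \<forall>y\<in>fst Y. \<bar>(k + k') y\<bar> \<le> C * snd Y y" by blast
    then show "k + k' \<in> ?K"
      using Kout[OF k] Kadd[OF k] Ksc[OF k] KA[OF k] Kout[OF k'] Kadd[OF k'] Ksc[OF k'] KA[OF k']
      unfolding K_iff by (simp add: algebra_simps)
  qed
  have det: "k = 0" if k: "k \<in> ?K" and kB: "\<And>b. b \<in> B \<Longrightarrow> k b = 0" for k
  proof -
    have spB: "b \<in> fst Y \<and> k b = 0" if "b \<in> span B" for b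
      using that
    proof (induction rule: span_induct_alt)
      case base
      then show ?case using Ksc[OF k, of 0 0] subspace_0[OF Y.carrier] by simp
    next
      case (step c x y)
      then have "x \<in> fst Y" using B by blast
      then show ?case using step kB Kadd[OF k] Ksc[OF k] Y.carrier by (simp add: subspace_def)
    qed
    have "k y = 0" if y: "y \<in> fst Y" for y
    proof -
      obtain x b where xb: "x \<in> fst X" "b \<in> span B" "snd Y (y - A x - b) = 0" using B(3)[OF y] by blast
      have in1: "y - A x \<in> fst Y" "y - A x - b \<in> fst Y"
        using y A[OF xb(1)] spB[OF xb(2)] by (simp_all add: Y.diff_closed)
      obtain C where "\<forall>y\<in>fst Y. \<bar>k y\<bar> \<le> C * snd Y y" using Kbd[OF k] by blast
      then have "k (y - A x - b) = 0" using in1 xb by force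
      moreover have "k y = k (y - A x - b) + (k (A x) + k b)"
        using Kadd[OF k, of "y - A x - b" "A x + b"] Kadd[OF k, of "A x" b] in1 A[OF xb(1)] spB[OF xb(2)]
        by (simp add: subspace_add[OF Y.carrier])
      ultimately show ?thesis using KA[OF k xb(1)] spB[OF xb(2)] by simp
    qed
    then show ?thesis using Kout[OF k] by (auto simp: fun_eq_iff)
  qed
  define \<Phi> where "\<Phi> k = (\<lambda>y. if y \<in> B then k y else 0)" for k :: "'b \<Rightarrow> real"
  have lin: "linear \<Phi>"
    by (rule linearI) (auto simp: \<Phi>_def fun_eq_iff scaleR_fun_def)
  obtain b where b: "b \<subseteq> ?K" "independent b" "?K \<subseteq> span b" "card b = dim ?K"
    using basis_exists by blast
  have spb: "span b = ?K" using b sub by (metis span_minimal subset_antisym)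
  have inj: "inj_on \<Phi> (span b)"
  proof (rule inj_onI)
    fix k k' assume kk: "k \<in> span b" "k' \<in> span b" "\<Phi> k = \<Phi> k'"
    have "(k - k') x = 0" if "x \<in> B" for x
      using fun_cong[OF kk(3), of x] that by (simp add: \<Phi>_def)
    moreover have "k - k' \<in> ?K" using kk spb sub by (simp add: subspace_diff)
    ultimately have "k - k' = 0" using det by blast
    then show "k = k'" by simp
  qed
  define E where "E = (\<lambda>x. (\<lambda>y. if y = x then 1 else 0 :: real)) ` B"
  have "\<Phi> k \<in> span E" for k
  proof -
    have "\<Phi> k = (\<Sum>x\<in>B. k x *\<^sub>R (\<lambda>y. if y = x then 1 else 0))"
    proof
      fix y
      have "(\<Sum>x\<in>B. k x *\<^sub>R (\<lambda>y. if y = x then 1 else 0 :: real)) y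
          = (\<Sum>x\<in>B. if y = x then k x else 0)"
        using B(1) by (induction rule: finite_induct) (auto simp: scaleR_fun_def)
      then show "\<Phi> k y = (\<Sum>x\<in>B. k x *\<^sub>R (\<lambda>y. if y = x then 1 else 0)) y"
        using B(1) by (simp add: \<Phi>_def sum.delta)
    qed
    also have "\<dots> \<in> span E" by (intro span_sum span_scale span_base) (auto simp: E_def)
    finally show ?thesis .
  qed
  moreover have "independent (\<Phi> ` b)"
    using lin b(2) inj by (rule linear_independent_injective_image)
  ultimately have "finite (\<Phi> ` b)"
    using independent_span_bound[of E "\<Phi> ` b"] B(1) by (auto simp: E_def)
  then have "finite b" using inj span_superset by (metis finite_imageD inj_on_subset)
  then have "b = {}" using b(4) dim by simp
  then have "?K = {0}" using spb by simp
  then show ?thesis using l by (auto simp: zero_fun_def)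
qed

text \<open>A surjectivity criterion: a proper closed range would have an annihilating functional, and
  this would lie in the adjoint kernel.\<close>

lemma fredholm_index_zero_imp_surjective:
  fixes X :: "'a::real_vector seminormed" and Y :: "'b::real_vector seminormed"
  assumes Y: "seminormed_space (fst Y) (snd Y)" and X: "subspace (fst X)"
    and F: "fredholm X Y A" and ind: "fredholm_index X Y A = 0" and ker: "op_kernel X Y A = {0}"
    and y: "y \<in> fst Y"
  shows "\<exists>x\<in>fst X. snd Y (y - A x) = 0"
proof -
  interpret Y: seminormed_space "fst Y" "snd Y" by (rule Y)
  have A: "A x \<in> fst Y" if "x \<in> fst X" for x
    using F that by (auto simp: fredholm_def bounded_operator_def)
  have Aadd: "snd Y (A (x + x') - (A x + A x')) = 0" if "x \<in> fst X" "x' \<in> fst X" for x x'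
    using F that by (auto simp: fredholm_def bounded_operator_def)
  have Asc: "snd Y (A (c *\<^sub>R x) - c *\<^sub>R A x) = 0" if "x \<in> fst X" for x c
    using F that by (auto simp: fredholm_def bounded_operator_def)
  obtain B where B: "finite B" "B \<subseteq> fst Y"
    "\<And>y. y \<in> fst Y \<Longrightarrow> \<exists>x\<in>fst X. \<exists>b\<in>span B. snd Y (y - A x - b) = 0"
    using F by (auto simp: fredholm_def)
  have "dim (op_kernel X Y A) = 0" unfolding ker using dim_le_card'[of "{}::'a set"] dim_span[of "{}::'a set"] by (simp del: dim_span)
  then have dim: "dim (adjoint_kernel X Y A) = 0"
    using ind by (simp add: fredholm_index_def)
  define R where "R = {y \<in> fst Y. \<exists>x\<in>fst X. snd Y (y - A x) = 0}"
  have "R = fst Y"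
  proof (rule ccontr)
    assume "R \<noteq> fst Y"
    moreover have "subspace R"
      unfolding subspace_def
    proof (intro conjI ballI allI)
      have "snd Y (A 0) = 0" using Asc[of 0 0] subspace_0[OF X] by simp
      then show "0 \<in> R" using subspace_0[OF X] subspace_0[OF Y.carrier] A[of 0] Y.minus[of "A 0"]
        by (auto simp: R_def intro!: bexI[of _ 0])
      fix u assume "u \<in> R"
      then obtain x where u: "u \<in> fst Y" "x \<in> fst X" "snd Y (u - A x) = 0" by (auto simp: R_def)
      show "c *\<^sub>R u \<in> R" for c
      proof -
        have cx: "c *\<^sub>R x \<in> fst X" using u X by (simp add: subspace_scale)
        have m: "u - A x \<in> fst Y" "c *\<^sub>R (u - A x) \<in> fst Y" "A (c *\<^sub>R x) - c *\<^sub>R A x \<in> fst Y"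
            "c *\<^sub>R u \<in> fst Y"
          using u A[OF u(2)] A[OF cx] Y.carrier by (simp_all add: subspace_scale Y.diff_closed)
        have "snd Y (c *\<^sub>R u - A (c *\<^sub>R x)) = snd Y (c *\<^sub>R (u - A x) - (A (c *\<^sub>R x) - c *\<^sub>R A x))"
          by (simp add: algebra_simps)
        also have "\<dots> \<le> snd Y (c *\<^sub>R (u - A x)) + snd Y (A (c *\<^sub>R x) - c *\<^sub>R A x)"
          by (rule Y.triangle_diff[OF m(2,3)])
        also have "\<dots> = 0" using Y.scale[OF m(1)] u Asc[OF u(2)] by simp
        finally show ?thesis using cx m(4) Y.nonneg[of "c *\<^sub>R u - A (c *\<^sub>R x)"] A[OF cx]
          by (auto simp: R_def Y.diff_closed intro!: bexI[of _ "c *\<^sub>R x"])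
      qed
      fix v assume "v \<in> R"
      then obtain z where v: "v \<in> fst Y" "z \<in> fst X" "snd Y (v - A z) = 0" by (auto simp: R_def)
      have xz: "x + z \<in> fst X" using u v X by (simp add: subspace_add)
      have m: "u - A x \<in> fst Y" "v - A z \<in> fst Y" "A (x + z) - (A x + A z) \<in> fst Y"
          "(u - A x) + (v - A z) \<in> fst Y"
        using u v A Y.carrier xz by (simp_all add: subspace_add Y.diff_closed)
      have "snd Y (u + v - A (x + z)) = snd Y ((u - A x) + (v - A z) - (A (x + z) - (A x + A z)))"
        by (simp add: algebra_simps)
      also have "\<dots> \<le> snd Y ((u - A x) + (v - A z)) + snd Y (A (x + z) - (A x + A z))"
        by (rule Y.triangle_diff[OF m(4,3)])
      also have "\<dots> \<le> 0" using Y.triangle[OF m(1,2)] u v Aadd[OF u(2) v(2)] by simp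
      finally show "u + v \<in> R"
        using xz u v Y.nonneg[of "u + v - A (x + z)"] A[OF xz]
        by (auto simp: R_def Y.diff_closed subspace_add[OF Y.carrier] intro!: bexI[of _ "x + z"])
    qed
    moreover have "R \<subseteq> fst Y" by (auto simp: R_def)
    moreover have "z \<in> R" if z: "z \<in> fst Y" and ap: "\<And>e. e > 0 \<Longrightarrow> \<exists>u\<in>R. snd Y (z - u) < e" for z
    proof -
      have "\<exists>x\<in>fst X. snd Y (z - A x) < e" if "e > 0" for e
      proof -
        obtain u x where u: "u \<in> fst Y" "snd Y (z - u) < e" "x \<in> fst X" "snd Y (u - A x) = 0"
          using ap[OF \<open>e > 0\<close>] by (auto simp: R_def)
        then show ?thesis using Y.triangle_mid[of z u "A x"] z A by force
      qed
      then show ?thesis using F z by (auto simp: fredholm_def R_def)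
    qed
    moreover have "\<exists>u\<in>R. z - u \<in> span B" if z: "z \<in> fst Y" for z
    proof -
      obtain x b where xb: "x \<in> fst X" "b \<in> span B" "snd Y (z - A x - b) = 0" using B(3)[OF z] by blast
      have "b \<in> fst Y" using xb(2) B(2) Y.carrier span_minimal by blast
      then show ?thesis using xb z
        by (intro bexI[of _ "z - b"]) (auto simp: R_def Y.diff_closed diff_diff_eq add.commute)
    qed
    ultimately obtain l where l: "\<forall>y\<in>fst Y. \<forall>z\<in>fst Y. l (y + z) = l y + l z"
      "\<forall>c. \<forall>y\<in>fst Y. l (c *\<^sub>R y) = c * l y" "\<exists>K. \<forall>y\<in>fst Y. \<bar>l y\<bar> \<le> K * snd Y y"
      "\<forall>u\<in>R. l u = 0" "\<exists>y\<in>fst Y. l y \<noteq> 0"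
      using Y.annihilating_functional[OF B(1) _ _ _ B(2), of R] by blast
    define l' where "l' y = (if y \<in> fst Y then l y else 0)" for y
    have "A x \<in> R" if "x \<in> fst X" for x
      using that A Y.zero by (auto simp: R_def intro!: bexI[of _ x])
    then have "l' \<in> adjoint_kernel X Y A"
      using l A Y.carrier
      by (auto simp: adjoint_kernel_def dual_space_def op_adjoint_def l'_def fun_eq_iff subspace_def)
    then have "l' = (\<lambda>_. 0)" using adjoint_kernel_trivial[OF Y A B dim] by blast
    then show False using l(5) by (auto simp: l'_def fun_eq_iff split: if_splits)
  qed
  then show ?thesis using y by (auto simp: R_def)
qed

section \<open>Absolutely continuous functions and the fundamental theorem of calculus\<close>

text \<open>Intervals tagged outside the null set \<open>N\<close> of bad points contribute little by
  differentiability. Those tagged in \<open>N\<close> lie in a small open set, so that absolute continuity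
  bounds the increments over them.\<close>

lemma abs_continuous_on_has_integral_deriv:
  fixes x :: "real \<Rightarrow> real^'n"
  assumes ac: "abs_continuous_on a b x" and ab: "a \<le> b"
    and deriv: "AE t in lebesgue. t \<in> {a<..<b} \<longrightarrow> (x has_vector_derivative x' t) (at t)"
  shows "(x' has_integral x b - x a) {a..b}"
proof -
  define N where "N = {t. \<not> (t \<in> {a<..<b} \<longrightarrow> (x has_vector_derivative x' t) (at t))} \<union> {a, b}"
  have "{t. \<not> (t \<in> {a<..<b} \<longrightarrow> (x has_vector_derivative x' t) (at t))} \<in> null_sets lebesgue"
    using deriv by (simp add: AE_iff_null_sets completion.AE_iff_null_sets)
  then have neg: "negligible N"
    unfolding N_def by (simp add: negligible_iff_null_sets)
  have good: "(x has_vector_derivative x' t) (at t)" if "t \<in> {a..b} - N" for t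
    using that by (auto simp: N_def)
  define g where "g t = (if t \<in> N then 0 else x' t)" for t
  have "(g has_integral x b - x a) {a..b}"
    unfolding has_integral_real
  proof (intro allI impI)
    fix e :: real assume e: "e > 0"
    define e1 where "e1 = e / (2 * (b - a + 1))"
    have e1: "e1 > 0" using e ab by (simp add: e1_def)
    have e1': "e1 * (b - a) < e / 2"
    proof -
      have "e1 * (b - a) < e1 * (b - a + 1)" using e1 by simp
      also have "\<dots> = e / 2" using ab by (simp add: e1_def field_simps)
      finally show ?thesis .
    qed
    have "e / 2 > 0" using e by simp
    then obtain \<delta> where \<delta>: "\<delta> > 0" and H: "\<forall>(k::nat) u v.
        (\<forall>i<k. a \<le> u i \<and> u i \<le> v i \<and> v i \<le> b) \<and>
        (\<forall>i<k. \<forall>j<k. i \<noteq> j \<longrightarrow> {u i<..<v i} \<inter> {u j<..<v j} = {}) \<and> (\<Sum>i<k. v i - u i) < \<delta>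
        \<longrightarrow> (\<Sum>i<k. norm (x (v i) - x (u i))) < e / 2"
      using ac unfolding abs_continuous_on_def by blast
    note small = H[THEN spec, THEN spec, THEN spec, THEN mp, OF conjI[OF _ conjI]]
    obtain U where U: "open U" "N \<subseteq> U" "U - N \<in> lmeasurable" "emeasure lebesgue (U - N) < ennreal \<delta>"
      using sets_lebesgue_outer_open[OF _ \<delta>, of N] neg negligible_imp_sets by blast
    have Nnull: "N \<in> null_sets lebesgue" using neg by (simp add: negligible_iff_null_sets)
    have Um: "U \<in> lmeasurable"
    proof -
      have "U = (U - N) \<union> N" using U by blast
      then show ?thesis using U(3) Nnull by (metis fmeasurable.Un neg negligible_imp_measurable)
    qed
    have Umeas: "measure lebesgue U < \<delta>"
    proof -
      have "emeasure lebesgue U = emeasure lebesgue (U - N)"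
        using Nnull Um by (simp add: emeasure_Diff_null_set fmeasurableD)
      then have "emeasure lebesgue U < ennreal \<delta>" using U by simp
      then show ?thesis using \<delta> Um
        by (metis emeasure_eq_measure2 ennreal_less_iff measure_nonneg)
    qed
    have "\<exists>d>0. (t \<in> N \<longrightarrow> ball t d \<subseteq> U) \<and>
        (t \<in> {a..b} - N \<longrightarrow> (\<forall>s. \<bar>s - t\<bar> < d \<longrightarrow> norm (x s - x t - (s - t) *\<^sub>R x' t) \<le> e1 * \<bar>s - t\<bar>))" for t
    proof (cases "t \<in> N")
      case True
      then show ?thesis using U by (meson Diff_iff open_contains_ball subsetD)
    next
      case False
      show ?thesis
      proof (cases "t \<in> {a..b} - N")
        case True
        from good[OF this] have "\<exists>d>0. \<forall>s. norm (s - t) < d \<longrightarrow>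
            norm (x s - x t - (s - t) *\<^sub>R x' t) \<le> e1 * norm (s - t)"
          using e1 unfolding has_vector_derivative_def has_derivative_at_alt by blast
        then show ?thesis using True by auto
      qed (use False in \<open>auto intro: exI[of _ 1]\<close>)
    qed
    then obtain d where d: "\<And>t. d t > 0" "\<And>t. t \<in> N \<Longrightarrow> ball t (d t) \<subseteq> U"
      "\<And>t s. t \<in> {a..b} - N \<Longrightarrow> \<bar>s - t\<bar> < d t \<Longrightarrow> norm (x s - x t - (s - t) *\<^sub>R x' t) \<le> e1 * \<bar>s - t\<bar>"
      by metis
    define \<gamma> where "\<gamma> t = ball t (d t)" for t
    have "gauge \<gamma>" using d(1) unfolding \<gamma>_def by (auto intro: gauge_ball_dependent)
    moreover have "norm ((\<Sum>(t, k)\<in>p. measure lborel k *\<^sub>R g t) - (x b - x a)) < e"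
      if p: "p tagged_division_of {a..b}" and fine: "\<gamma> fine p" for p
    proof -
      have finp: "finite p" using p by blast
      have iv: "\<exists>u v. k = {u..v} \<and> u \<le> t \<and> t \<le> v \<and> a \<le> u \<and> v \<le> b" if tk: "(t, k) \<in> p" for t k
      proof -
        obtain u v where k: "k = cbox u v" using tagged_division_ofD(4)[OF p tk] by blast
        have "t \<in> k" "k \<subseteq> {a..b}" using tagged_division_ofD(2,3)[OF p tk] by auto
        then have "k = {u..v} \<and> u \<le> t \<and> t \<le> v \<and> a \<le> u \<and> v \<le> b" using k by auto
        then show ?thesis by blast
      qed
      define \<Delta> where "\<Delta> k = x (Sup k) - x (Inf k)" for k
      define p1 where "p1 = {z\<in>p. fst z \<notin> N}"
      define p2 where "p2 = {z\<in>p. fst z \<in> N}"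
      have split: "p = p1 \<union> p2" "p1 \<inter> p2 = {}" "finite p1" "finite p2"
        using finp by (auto simp: p1_def p2_def)
      have "(\<Sum>(t, k)\<in>p. measure lborel k *\<^sub>R g t) - (x b - x a) = (\<Sum>(t, k)\<in>p. measure lborel k *\<^sub>R g t - \<Delta> k)"
        using additive_tagged_division_1[OF ab p, of x] by (simp add: \<Delta>_def sum_subtractf split_def)
      also have "\<dots> = (\<Sum>(t, k)\<in>p1. measure lborel k *\<^sub>R g t - \<Delta> k) + (\<Sum>(t, k)\<in>p2. measure lborel k *\<^sub>R g t - \<Delta> k)"
        by (subst split(1), rule sum.union_disjoint) (use split in auto)
      also have "norm \<dots> \<le> (\<Sum>(t, k)\<in>p1. norm (measure lborel k *\<^sub>R g t - \<Delta> k)) + (\<Sum>(t, k)\<in>p2. norm (measure lborel k *\<^sub>R g t - \<Delta> k))"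
        unfolding split_def by (intro order.trans[OF norm_triangle_ineq] add_mono norm_sum)
      also have "(\<Sum>(t, k)\<in>p1. norm (measure lborel k *\<^sub>R g t - \<Delta> k)) \<le> (\<Sum>(t, k)\<in>p1. e1 * measure lborel k)"
      proof (rule sum_mono, clarify)
        fix t k assume tk: "(t, k) \<in> p1"
        then have tkp: "(t, k) \<in> p" and tN: "t \<notin> N" by (auto simp: p1_def)
        obtain u v where k: "k = {u..v}" "u \<le> t" "t \<le> v" "a \<le> u" "v \<le> b" using iv[OF tkp] by blast
        have "k \<subseteq> ball t (d t)" using fine tkp by (auto simp: fine_def \<gamma>_def)
        moreover have "u \<in> k" "v \<in> k" using k by auto
        ultimately have "u \<in> ball t (d t)" "v \<in> ball t (d t)" by blast+
        then have dv: "norm (x u - x t - (u - t) *\<^sub>R x' t) \<le> e1 * \<bar>u - t\<bar>"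
          "norm (x v - x t - (v - t) *\<^sub>R x' t) \<le> e1 * \<bar>v - t\<bar>"
          using k tN d(3)[of t u] d(3)[of t v] by (simp_all add: dist_real_def)
        have "measure lborel k *\<^sub>R g t - \<Delta> k = (x u - x t - (u - t) *\<^sub>R x' t) - (x v - x t - (v - t) *\<^sub>R x' t)"
          using k tN by (simp add: \<Delta>_def g_def algebra_simps)
        also have "norm \<dots> \<le> e1 * \<bar>u - t\<bar> + e1 * \<bar>v - t\<bar>"
          using dv norm_triangle_ineq4 add_mono order.trans by blast
        also have "\<dots> = e1 * measure lborel k" using k by (simp add: algebra_simps)
        finally show "norm (measure lborel k *\<^sub>R g t - \<Delta> k) \<le> e1 * measure lborel k" .
      qed
      also have "\<dots> \<le> (\<Sum>(t, k)\<in>p. e1 * measure lborel k)"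
        using finp e1 by (intro sum_mono2) (auto simp: p1_def)
      also have "\<dots> = e1 * (b - a)"
        using additive_content_tagged_division[of p a b] p ab
        by (simp add: split_def flip: sum_distrib_left)
      also have "(\<Sum>(t, k)\<in>p2. norm (measure lborel k *\<^sub>R g t - \<Delta> k)) < e / 2"
      proof -
        obtain h where h: "bij_betw h {..<card p2} p2"
          using ex_bij_betw_nat_finite[OF split(4)] by (auto simp: atLeast0LessThan)
        define u v where "u i = Inf (snd (h i))" and "v i = Sup (snd (h i))" for i
        have hp: "h i \<in> p2" if "i < card p2" for i using h that by (auto simp: bij_betw_def)
        have uv: "snd (h i) = {u i..v i} \<and> u i \<le> fst (h i) \<and> fst (h i) \<le> v i \<and> a \<le> u i \<and> v i \<le> b"
          if "i < card p2" for i
        proof -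
          have "(fst (h i), snd (h i)) \<in> p" using hp[OF that] by (simp add: p2_def)
          from iv[OF this] obtain c d where cd: "snd (h i) = {c..d}" "c \<le> fst (h i)" "fst (h i) \<le> d"
            "a \<le> c" "d \<le> b" by blast
          then have "u i = c" "v i = d" by (simp_all add: u_def v_def)
          then show ?thesis using cd by simp
        qed
        have ordering: "a \<le> u i" "u i \<le> v i" "v i \<le> b" if "i < card p2" for i
          using uv[OF that] by linarith+
        have disj: "{u i<..<v i} \<inter> {u j<..<v j} = {}" if "i < card p2" "j < card p2" "i \<noteq> j" for i j
        proof -
          have "h i \<noteq> h j" using h that by (auto simp: bij_betw_def inj_on_def)
          moreover have "(fst (h i), snd (h i)) \<in> p" "(fst (h j), snd (h j)) \<in> p"
            using hp that by (auto simp: p2_def)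
          ultimately have "interior (snd (h i)) \<inter> interior (snd (h j)) = {}"
            using tagged_division_ofD(5)[OF p] by (metis prod.collapse)
          then show ?thesis using uv that by simp
        qed
        have inU: "{u i<..<v i} \<subseteq> U" if "i < card p2" for i
        proof -
          have *: "(fst (h i), snd (h i)) \<in> p" "fst (h i) \<in> N" using hp[OF that] by (auto simp: p2_def)
          have "snd (h i) \<subseteq> ball (fst (h i)) (d (fst (h i)))" "ball (fst (h i)) (d (fst (h i))) \<subseteq> U"
            using fineD[OF fine *(1)] d(2)[OF *(2)] unfolding \<gamma>_def .
          moreover have "{u i<..<v i} \<subseteq> snd (h i)" unfolding conjunct1[OF uv[OF that]] by auto
          ultimately show ?thesis by blast
        qed
        have "(\<Sum>i<card p2. v i - u i) = (\<Sum>i<card p2. measure lebesgue {u i<..<v i})"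
          using ordering by (intro sum.cong) auto
        also have "\<dots> = measure lebesgue (\<Union>i<card p2. {u i<..<v i})"
          using disj ordering by (intro measure_finite_Union[symmetric]) (auto simp: disjoint_family_on_def)
        also have "\<dots> \<le> measure lebesgue U"
          using inU Um by (intro measure_mono_fmeasurable) auto
        finally have "(\<Sum>i<card p2. v i - u i) < \<delta>" using Umeas by linarith
        then have *: "(\<Sum>i<card p2. norm (x (v i) - x (u i))) < e / 2"
          using ordering disj by (intro small) auto
        have "(\<Sum>(t, k)\<in>p2. norm (measure lborel k *\<^sub>R g t - \<Delta> k)) = (\<Sum>(t, k)\<in>p2. norm (\<Delta> k))"
          by (intro sum.cong) (auto simp: p2_def g_def)
        also have "\<dots> = (\<Sum>i<card p2. norm (x (v i) - x (u i)))"
          unfolding split_def by (subst sum.reindex_bij_betw[OF h, symmetric]) (simp add: \<Delta>_def u_def v_def)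
        finally show ?thesis using * by simp
      qed
      finally show ?thesis using e1' by linarith
    qed
    ultimately show "\<exists>\<gamma>. gauge \<gamma> \<and> (\<forall>\<D>. \<D> tagged_division_of {a..b} \<and> \<gamma> fine \<D> \<longrightarrow>
        norm ((\<Sum>(t, k)\<in>\<D>. measure lborel k *\<^sub>R g t) - (x b - x a)) < e)"
      by (intro exI[of _ \<gamma>] conjI allI impI) (assumption | elim conjE)+
  qed
  then show ?thesis by (rule has_integral_spike[OF neg, rotated]) (simp add: g_def)
qed

lemma lipschitz_imp_abs_continuous_on:
  fixes x :: "real \<Rightarrow> real^'n"
  assumes "\<And>u v. a \<le> u \<Longrightarrow> u \<le> v \<Longrightarrow> v \<le> b \<Longrightarrow> norm (x v - x u) \<le> K * (v - u)"
  shows "abs_continuous_on a b x"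
  unfolding abs_continuous_on_def
proof (intro allI impI)
  fix e :: real assume e: "e > 0"
  define d where "d = e / (\<bar>K\<bar> + 1)"
  have d: "d > 0" using e by (simp add: d_def add_nonneg_pos)
  have "(\<Sum>i<k. norm (x (v i) - x (u i))) < e"
    if uv: "\<forall>i<k. a \<le> u i \<and> u i \<le> v i \<and> v i \<le> b" and s: "(\<Sum>i<k. v i - u i) < d" for k :: nat and u v
  proof -
    have "(\<Sum>i<k. norm (x (v i) - x (u i))) \<le> (\<Sum>i<k. (\<bar>K\<bar> + 1) * (v i - u i))"
    proof (rule sum_mono)
      fix i assume "i \<in> {..<k}"
      then have i: "a \<le> u i" "u i \<le> v i" "v i \<le> b" using uv by auto
      have "norm (x (v i) - x (u i)) \<le> K * (v i - u i)" by (rule assms[OF i])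
      also have "\<dots> \<le> (\<bar>K\<bar> + 1) * (v i - u i)" using i by (intro mult_right_mono) auto
      finally show "norm (x (v i) - x (u i)) \<le> (\<bar>K\<bar> + 1) * (v i - u i)" .
    qed
    also have "\<dots> = (\<bar>K\<bar> + 1) * (\<Sum>i<k. v i - u i)" by (simp add: sum_distrib_left)
    also have "\<dots> < (\<bar>K\<bar> + 1) * d" using s by (intro mult_strict_left_mono) auto
    also have "\<dots> = e" by (simp add: d_def)
    finally show ?thesis .
  qed
  note bound = this
  show "\<exists>d>0. \<forall>(k::nat) u v. (\<forall>i<k. a \<le> u i \<and> u i \<le> v i \<and> v i \<le> b) \<and>
      (\<forall>i<k. \<forall>j<k. i \<noteq> j \<longrightarrow> {u i<..<v i} \<inter> {u j<..<v j} = {}) \<and> (\<Sum>i<k. v i - u i) < d \<longrightarrow>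
      (\<Sum>i<k. norm (x (v i) - x (u i))) < e"
  proof (rule exI[of _ d], intro conjI allI impI d)
    fix k :: nat and u v
    assume "(\<forall>i<k. a \<le> u i \<and> u i \<le> v i \<and> v i \<le> b) \<and>
      (\<forall>i<k. \<forall>j<k. i \<noteq> j \<longrightarrow> {u i<..<v i} \<inter> {u j<..<v j} = {}) \<and> (\<Sum>i<k. v i - u i) < d"
    then show "(\<Sum>i<k. norm (x (v i) - x (u i))) < e" by (elim conjE) (rule bound)
  qed
qed

text \<open>The Vitali covering step of Lebesgue's differentiation theorem. A disjoint family \<open>T\<close> of
  intervals on which the mean of \<open>f\<close> exceeds \<open>\<beta>\<close>, inside an open set barely larger than
  \<open>{f < \<alpha>}\<close>, satisfies \<open>\<beta> |T| \<le> \<alpha> |T| + \<epsilon>\<close> and so is small.\<close>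

lemma negligible_steep_points:
  fixes f F :: "real \<Rightarrow> real"
  assumes meas: "f \<in> borel_measurable lebesgue" and bnd: "\<And>t. 0 \<le> f t" "\<And>t. f t \<le> C"
    and F: "\<And>u v. u \<le> v \<Longrightarrow> (f has_integral F v - F u) {u..v}"
    and ab: "\<alpha> < \<beta>"
  shows "negligible {t. f t < \<alpha> \<and> (\<forall>d>0. \<exists>u v. u \<le> t \<and> t \<le> v \<and> u < v \<and> v - u < d \<and> \<beta> * (v - u) < F v - F u)}"
    (is "negligible ?E")
proof (cases "\<alpha> > 0")
  case False
  then have "\<not> f t < \<alpha>" for t using bnd(1)[of t] by linarith
  then show ?thesis by simp
next
  case \<alpha>: True
  have C: "0 \<le> C" using bnd[of 0] by linarith
  show ?thesis
    unfolding negligible_on_intervals[of ?E]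
  proof (intro allI)
    fix a b :: real
    show "negligible (?E \<inter> cbox a b)"
      unfolding negligible_outer_le
    proof (intro allI impI)
      fix e :: real assume e: "e > 0"
      define \<epsilon> where "\<epsilon> = e * (\<beta> - \<alpha>) / (C + 1)"
      have \<epsilon>: "\<epsilon> > 0" using e ab C by (simp add: \<epsilon>_def)
      define E0 where "E0 = {t \<in> cbox a b. f t < \<alpha>}"
      have E0: "E0 \<in> sets lebesgue"
      proof -
        have "{t. f t < \<alpha>} \<in> sets lebesgue" using meas by (simp add: borel_measurable_iff_less)
        moreover have "E0 = cbox a b \<inter> {t. f t < \<alpha>}" by (auto simp: E0_def)
        moreover have "cbox a b \<in> sets lebesgue" by (simp del: box_real add: sets_completionI_sets)
        ultimately show ?thesis by (simp only: sets.Int)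
      qed
      obtain U where U: "open U" "E0 \<subseteq> U" "U - E0 \<in> lmeasurable" "emeasure lebesgue (U - E0) < ennreal \<epsilon>"
        using sets_lebesgue_outer_open[OF E0 \<epsilon>] by blast
      have E0m: "E0 \<in> lmeasurable"
        using E0 by (intro bounded_set_imp_lmeasurable bounded_subset[OF bounded_cbox]) (auto simp: E0_def)
      then have Um: "U \<in> lmeasurable" using U by (metis fmeasurable.Un Diff_partition)
      define K where "K = {i :: real \<times> real. 0 < snd i \<and> cball (fst i) (snd i) \<subseteq> U \<and>
          \<beta> * (2 * snd i) < F (fst i + snd i) - F (fst i - snd i)}"
      have cover: "\<exists>i. i \<in> K \<and> t \<in> cball (fst i) (snd i) \<and> snd i < d" if t: "t \<in> ?E \<inter> cbox a b" and d: "0 < d" for t d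
      proof -
        have "t \<in> U" using t U by (auto simp: E0_def)
        then obtain d0 where d0: "d0 > 0" "ball t d0 \<subseteq> U" using U(1) open_contains_ball by blast
        have "min d d0 > 0" using d d0 by simp
        then obtain u v where uv: "u \<le> t" "t \<le> v" "u < v" "v - u < min d d0" "\<beta> * (v - u) < F v - F u"
          using t by blast
        have 1: "cball ((u + v) / 2) ((v - u) / 2) = {u..v}"
          by (auto simp: cball_eq_atLeastAtMost field_simps)
        have 2: "(u + v) / 2 + (v - u) / 2 = v" "(u + v) / 2 - (v - u) / 2 = u"
          "2 * ((v - u) / 2) = v - u" by (auto simp: field_simps)
        have "{u..v} \<subseteq> ball t d0" using uv by (auto simp: dist_real_def)
        then have "((u + v) / 2, (v - u) / 2) \<in> K"
          unfolding K_def mem_Collect_eq fst_conv snd_conv 1 2 using uv d0 by auto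
        then show ?thesis using uv 1 by (intro exI[of _ "((u + v) / 2, (v - u) / 2)"]) auto
      qed
      obtain I where I: "countable I" "I \<subseteq> K"
        and disj: "pairwise (\<lambda>i j. disjnt (cball (fst i) (snd i)) (cball (fst j) (snd j))) I"
        and rest: "negligible ((?E \<inter> cbox a b) - (\<Union>i\<in>I. cball (fst i) (snd i)))"
        using Vitali_covering_theorem_cballs[of K snd "?E \<inter> cbox a b" fst] cover
        by (auto simp: K_def)
      define T where "T = (\<Union>i\<in>I. cball (fst i) (snd i))"
      have T: "T \<in> sets lebesgue" unfolding T_def using I(1) by (intro sets.countable_UN'') auto
      have TU: "T \<subseteq> U" using I(2) by (auto simp: T_def K_def)
      have Tm: "T \<in> lmeasurable" using Um T TU by (meson fmeasurableI2)
      define \<nu> where "\<nu> = density lebesgue (\<lambda>t. ennreal (f t))"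
      have sets\<nu>[simp]: "sets \<nu> = sets lebesgue" by (simp add: \<nu>_def)
      have fm[measurable]: "(\<lambda>t. ennreal (f t)) \<in> borel_measurable lebesgue" using meas by measurable
      have \<nu>: "emeasure \<nu> S = (\<integral>\<^sup>+t. ennreal (f t) * indicator S t \<partial>lebesgue)" if "S \<in> sets lebesgue" for S
        unfolding \<nu>_def using that by (simp add: emeasure_density)
      have dfam: "disjoint_family_on (\<lambda>i. cball (fst i) (snd i)) I"
        using disj by (auto simp: disjoint_family_on_def pairwise_def disjnt_def)
      have "ennreal \<beta> * emeasure lebesgue T = (\<integral>\<^sup>+i. ennreal \<beta> * emeasure lebesgue (cball (fst i) (snd i)) \<partial>count_space I)"
        unfolding T_def using I(1) dfam
        by (subst emeasure_UN_countable) (auto simp: nn_integral_cmult)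
      also have "\<dots> \<le> (\<integral>\<^sup>+i. emeasure \<nu> (cball (fst i) (snd i)) \<partial>count_space I)"
      proof (rule nn_integral_mono)
        fix i assume "i \<in> space (count_space I)"
        then have i: "0 < snd i" "\<beta> * (2 * snd i) < F (fst i + snd i) - F (fst i - snd i)"
          using I(2) by (auto simp: K_def)
        have ib: "cball (fst i) (snd i) = {fst i - snd i..fst i + snd i}"
          by (simp add: cball_eq_atLeastAtMost)
        have "emeasure \<nu> (cball (fst i) (snd i)) = ennreal (F (fst i + snd i) - F (fst i - snd i))"
          using i bnd F[of "fst i - snd i" "fst i + snd i"] unfolding ib
          by (subst \<nu>) (auto simp: nn_integral_completion nn_integral_has_integral_lebesgue')
        moreover have "ennreal \<beta> * emeasure lebesgue (cball (fst i) (snd i)) = ennreal (\<beta> * (2 * snd i))"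
          using i ab \<alpha> unfolding ib by (simp add: ennreal_mult)
        ultimately show "ennreal \<beta> * emeasure lebesgue (cball (fst i) (snd i)) \<le> emeasure \<nu> (cball (fst i) (snd i))"
          using i by (simp add: ennreal_leI)
      qed
      also have "\<dots> = emeasure \<nu> T"
        unfolding T_def using I(1) dfam by (subst emeasure_UN_countable) auto
      also have "\<dots> = (\<integral>\<^sup>+t. ennreal (f t) * indicator T t \<partial>lebesgue)" by (rule \<nu>[OF T])
      also have "\<dots> \<le> (\<integral>\<^sup>+t. ennreal \<alpha> * indicator T t + ennreal C * indicator (U - E0) t \<partial>lebesgue)"
      proof (rule nn_integral_mono)
        fix t
        show "ennreal (f t) * indicator T t \<le> ennreal \<alpha> * indicator T t + ennreal C * indicator (U - E0) t"
        proof (cases "t \<in> T")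
          case True
          show ?thesis
          proof (cases "t \<in> E0")
            case True
            then have "ennreal (f t) \<le> ennreal \<alpha>" by (auto simp: E0_def intro: ennreal_leI)
            then show ?thesis using True \<open>t \<in> T\<close> by simp
          next
            case False
            then have "t \<in> U - E0" using \<open>t \<in> T\<close> TU by auto
            then show ?thesis using \<open>t \<in> T\<close> bnd(2)[of t] by (simp add: ennreal_leI add_increasing)
          qed
        qed simp
      qed
      also have "\<dots> = ennreal \<alpha> * emeasure lebesgue T + ennreal C * emeasure lebesgue (U - E0)"
        using T U(3) by (subst nn_integral_add) (auto simp: nn_integral_cmult_indicator fmeasurableD)
      finally have "ennreal \<beta> * emeasure lebesgue T \<le> ennreal \<alpha> * emeasure lebesgue T + ennreal C * emeasure lebesgue (U - E0)" .
      moreover have "emeasure lebesgue (U - E0) = ennreal (measure lebesgue (U - E0))"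
        using U(3) by (rule emeasure_eq_measure2)
      moreover have "emeasure lebesgue T = ennreal (measure lebesgue T)"
        using Tm by (rule emeasure_eq_measure2)
      ultimately have "ennreal (\<beta> * measure lebesgue T) \<le> ennreal (\<alpha> * measure lebesgue T + C * measure lebesgue (U - E0))"
        using ab \<alpha> C by (simp add: ennreal_mult ennreal_plus)
      then have "\<beta> * measure lebesgue T \<le> \<alpha> * measure lebesgue T + C * measure lebesgue (U - E0)"
        using \<alpha> C by (subst (asm) ennreal_le_iff) auto
      moreover have "measure lebesgue (U - E0) \<le> \<epsilon>"
        using U(4) \<epsilon> unfolding emeasure_eq_measure2[OF U(3)] by (simp add: ennreal_less_iff)
      then have "C * measure lebesgue (U - E0) \<le> C * \<epsilon>" using C by (rule mult_left_mono)
      moreover have "C * \<epsilon> \<le> (C + 1) * \<epsilon>" using \<epsilon> by (simp add: mult_right_mono)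
      moreover have "(C + 1) * \<epsilon> = e * (\<beta> - \<alpha>)" using C by (simp add: \<epsilon>_def)
      ultimately have "measure lebesgue T * (\<beta> - \<alpha>) \<le> e * (\<beta> - \<alpha>)" by (simp add: algebra_simps)
      then have Te: "measure lebesgue T \<le> e" using ab by simp
      define R where "R = (?E \<inter> cbox a b) - T"
      have R: "negligible R" using rest by (simp add: R_def T_def)
      show "\<exists>T. ?E \<inter> cbox a b \<subseteq> T \<and> T \<in> lmeasurable \<and> measure lebesgue T \<le> e"
      proof (intro exI[of _ "T \<union> R"] conjI)
        show "T \<union> R \<in> lmeasurable" using Tm negligible_imp_measurable[OF R] by (rule fmeasurable.Un)
        have "measure lebesgue (T \<union> R) \<le> measure lebesgue T + measure lebesgue R"
          using Tm R by (intro measure_Un_le) (auto simp: fmeasurableD negligible_imp_sets)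
        then show "measure lebesgue (T \<union> R) \<le> e" using Te negligible_imp_measure0[OF R] by simp
      qed (auto simp: R_def)
    qed
  qed
qed

text \<open>Lebesgue's differentiation theorem for bounded functions: the preceding lemma, applied to the
  nonnegative functions \<open>C + f\<close> and \<open>C - f\<close> and all pairs of rational bounds.\<close>

lemma AE_has_real_derivative_indefinite_integral:
  fixes f F :: "real \<Rightarrow> real"
  assumes meas: "f \<in> borel_measurable lebesgue" and bnd: "\<And>t. \<bar>f t\<bar> \<le> C"
    and F: "\<And>u v. u \<le> v \<Longrightarrow> (f has_integral F v - F u) {u..v}"
  shows "AE t in lebesgue. (F has_vector_derivative f t) (at t)"
proof -
  define steep where "steep f F \<alpha> \<beta> = {t. f t < \<alpha> \<and> (\<forall>d>0. \<exists>u v. u \<le> t \<and> t \<le> v \<and> u < v \<and> v - u < d \<and>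
      \<beta> * (v - u) < F v - F u)}" for f F :: "real \<Rightarrow> real" and \<alpha> \<beta> :: real
  define f1 F1 f2 F2 where "f1 t = C + f t" and "F1 t = C * t + F t"
    and "f2 t = C - f t" and "F2 t = C * t - F t" for t
  have i1: "(f1 has_integral F1 v - F1 u) {u..v}" if "u \<le> v" for u v
  proof -
    have "((\<lambda>t. C + f t) has_integral (v - u) *\<^sub>R C + (F v - F u)) {u..v}"
      using that F[OF that] has_integral_const_real[of C u v] by (intro has_integral_add) auto
    then show ?thesis by (simp add: f1_def[abs_def] F1_def algebra_simps)
  qed
  have i2: "(f2 has_integral F2 v - F2 u) {u..v}" if "u \<le> v" for u v
  proof -
    have "((\<lambda>t. C - f t) has_integral (v - u) *\<^sub>R C - (F v - F u)) {u..v}"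
      using that F[OF that] has_integral_const_real[of C u v] by (intro has_integral_diff) auto
    then show ?thesis by (simp add: f2_def[abs_def] F2_def algebra_simps)
  qed
  have b: "0 \<le> f1 t" "f1 t \<le> 2 * C" "0 \<le> f2 t" "f2 t \<le> 2 * C" for t
    using bnd[of t] by (auto simp: f1_def f2_def abs_le_iff)
  have m: "f1 \<in> borel_measurable lebesgue" "f2 \<in> borel_measurable lebesgue"
    unfolding f1_def[abs_def] f2_def[abs_def] using meas by measurable
  have n1: "negligible (steep f1 F1 \<alpha> \<beta>)" if "\<alpha> < \<beta>" for \<alpha> \<beta>
    unfolding steep_def by (rule negligible_steep_points[OF m(1) b(1,2) i1 that])
  have n2: "negligible (steep f2 F2 \<alpha> \<beta>)" if "\<alpha> < \<beta>" for \<alpha> \<beta>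
    unfolding steep_def by (rule negligible_steep_points[OF m(2) b(3,4) i2 that])
  define Q where "Q = {z \<in> (\<rat>::real set) \<times> \<rat>. fst z < snd z}"
  define N where "N = (\<Union>z\<in>Q. steep f1 F1 (fst z) (snd z) \<union> steep f2 F2 (fst z) (snd z))"
  have "countable Q" unfolding Q_def by (intro countable_Collect countable_SIGMA countable_rat)
  then have "negligible N"
    unfolding N_def by (intro negligible_countable_Union countable_image)
      (auto simp: Q_def intro!: negligible_Un n1 n2)
  then have "AE t in lebesgue. t \<notin> N"
    using AE_not_in negligible_iff_null_sets by blast
  moreover have "(F has_vector_derivative f t) (at t)" if t: "t \<notin> N" for t
  proof -
    have one_sided: "\<exists>d>0. \<forall>u v. u \<le> t \<longrightarrow> t \<le> v \<longrightarrow> u < v \<longrightarrow> v - u < d \<longrightarrow> G v - G u \<le> (g t + e) * (v - u)"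
      if "e > 0" and nb: "\<And>\<alpha> \<beta>. (\<alpha>, \<beta>) \<in> Q \<Longrightarrow> t \<notin> steep g G \<alpha> \<beta>" for g G :: "real \<Rightarrow> real" and e
    proof -
      obtain \<alpha> where \<alpha>: "\<alpha> \<in> \<rat>" "g t < \<alpha>" "\<alpha> < g t + e" using Rats_dense_in_real[of "g t" "g t + e"] \<open>e > 0\<close> by auto
      obtain \<beta> where \<beta>: "\<beta> \<in> \<rat>" "\<alpha> < \<beta>" "\<beta> < g t + e" using Rats_dense_in_real[OF \<alpha>(3)] by auto
      have "t \<notin> steep g G \<alpha> \<beta>" by (rule nb) (use \<alpha> \<beta> in \<open>simp add: Q_def\<close>)
      then obtain d where d: "d > 0" "\<And>u v. u \<le> t \<Longrightarrow> t \<le> v \<Longrightarrow> u < v \<Longrightarrow> v - u < d \<Longrightarrow> G v - G u \<le> \<beta> * (v - u)"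
        using \<alpha>(2) unfolding steep_def mem_Collect_eq by (meson not_less)
      show ?thesis
      proof (intro exI[of _ d] conjI allI impI d(1))
        fix u v assume uv: "u \<le> t" "t \<le> v" "u < v" "v - u < d"
        have "G v - G u \<le> \<beta> * (v - u)" by (rule d(2)[OF uv])
        also have "\<dots> \<le> (g t + e) * (v - u)" using uv \<beta> by (intro mult_right_mono) auto
        finally show "G v - G u \<le> (g t + e) * (v - u)" .
      qed
    qed
    show ?thesis
      unfolding has_vector_derivative_def has_derivative_at_alt
    proof (intro conjI allI impI)
      show "bounded_linear (\<lambda>x. x *\<^sub>R f t)" by (rule bounded_linear_scaleR_left)
      fix e :: real assume e: "e > 0"
      have "\<And>\<alpha> \<beta>. (\<alpha>, \<beta>) \<in> Q \<Longrightarrow> t \<notin> steep f1 F1 \<alpha> \<beta>" "\<And>\<alpha> \<beta>. (\<alpha>, \<beta>) \<in> Q \<Longrightarrow> t \<notin> steep f2 F2 \<alpha> \<beta>"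
        using t by (force simp: N_def)+
      from one_sided[OF e, OF this(1)] one_sided[OF e, OF this(2)]
      obtain d1 d2 where d1: "d1 > 0" "\<And>u v. u \<le> t \<Longrightarrow> t \<le> v \<Longrightarrow> u < v \<Longrightarrow> v - u < d1 \<Longrightarrow> F1 v - F1 u \<le> (f1 t + e) * (v - u)"
        and d2: "d2 > 0" "\<And>u v. u \<le> t \<Longrightarrow> t \<le> v \<Longrightarrow> u < v \<Longrightarrow> v - u < d2 \<Longrightarrow> F2 v - F2 u \<le> (f2 t + e) * (v - u)"
        by blast
      have key: "\<bar>F v - F u - (v - u) * f t\<bar> \<le> e * (v - u)"
        if "u \<le> t" "t \<le> v" "u < v" "v - u < min d1 d2" for u v
        using d1(2)[of u v] d2(2)[of u v] that
        by (auto simp: F1_def F2_def f1_def f2_def abs_le_iff algebra_simps)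
      show "\<exists>d>0. \<forall>y. norm (y - t) < d \<longrightarrow> norm (F y - F t - (y - t) *\<^sub>R f t) \<le> e * norm (y - t)"
      proof (intro exI[of _ "min d1 d2"] conjI allI impI)
        fix y assume y: "norm (y - t) < min d1 d2"
        consider "y = t" | "t < y" | "y < t" by linarith
        then show "norm (F y - F t - (y - t) *\<^sub>R f t) \<le> e * norm (y - t)"
        proof cases
          case 2 then show ?thesis using key[of t y] y by simp
        next
          case 3 then show ?thesis using key[of y t] y by (simp add: abs_le_iff algebra_simps)
        qed simp
      qed (use d1 d2 in auto)
    qed
  qed
  ultimately show ?thesis by (rule eventually_mono)
qed

lemma AE_has_vector_derivative_indefinite_integral:
  fixes f F :: "real \<Rightarrow> 'a::euclidean_space"
  assumes meas: "f \<in> borel_measurable lebesgue" and bnd: "\<And>t. t \<in> {a..b} \<Longrightarrow> norm (f t) \<le> C"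
    and F: "\<And>u v. a \<le> u \<Longrightarrow> u \<le> v \<Longrightarrow> v \<le> b \<Longrightarrow> (f has_integral F v - F u) {u..v}"
  shows "AE t in lebesgue. t \<in> {a<..<b} \<longrightarrow> (F has_vector_derivative f t) (at t)"
proof (cases "a < b")
  case ab: True
  define c where "c t = max a (min b t)" for t :: real
  have c: "a \<le> c t" "c t \<le> b" "u \<le> v \<Longrightarrow> c u \<le> c v" "t \<in> {a..b} \<Longrightarrow> c t = t" for t u v
    using ab by (auto simp: c_def max_def min_def)
  define G where "G t = F (c t)" for t
  define g where "g t = (if t \<in> {a..b} then f t else 0)" for t
  have gG: "(g has_integral G v - G u) {u..v}" if uv: "u \<le> v" for u v
  proof -
    have int: "{a..b} \<inter> {u..v} = (if v < a \<or> b < u then {} else {c u..c v})"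
      using ab uv by (auto simp: c_def)
    have "(f has_integral G v - G u) ({a..b} \<inter> {u..v})"
    proof (cases "v < a \<or> b < u")
      case True
      then have "c u = c v" using uv ab by (auto simp: c_def)
      then show ?thesis using True int by (simp add: G_def)
    qed (use F[of "c u" "c v"] c uv int in \<open>simp add: G_def\<close>)
    then show ?thesis unfolding g_def by (subst has_integral_restrict_Int)
  qed
  have gm: "g \<in> borel_measurable lebesgue"
    unfolding g_def[abs_def] using meas by (intro measurable_If_set) auto
  have C: "norm (g t) \<le> \<bar>C\<bar>" for t using bnd[of t] by (auto simp: g_def)
  have "\<forall>i\<in>Basis. AE t in lebesgue. ((\<lambda>t. G t \<bullet> i) has_vector_derivative g t \<bullet> i) (at t)"
  proof
    fix i :: 'a assume i: "i \<in> Basis"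
    show "AE t in lebesgue. ((\<lambda>t. G t \<bullet> i) has_vector_derivative g t \<bullet> i) (at t)"
    proof (rule AE_has_real_derivative_indefinite_integral)
      show "(\<lambda>t. g t \<bullet> i) \<in> borel_measurable lebesgue" using gm by measurable
      show "\<bar>g t \<bullet> i\<bar> \<le> \<bar>C\<bar>" for t using C[of t] Basis_le_norm[OF i, of "g t"] by linarith
      show "((\<lambda>t. g t \<bullet> i) has_integral G v \<bullet> i - G u \<bullet> i) {u..v}" if "u \<le> v" for u v
        using gG[OF that] i unfolding has_integral_componentwise_iff[of g] by (auto simp: inner_diff_left)
    qed
  qed
  then have "AE t in lebesgue. \<forall>i\<in>Basis. ((\<lambda>t. G t \<bullet> i) has_vector_derivative g t \<bullet> i) (at t)"
    by (subst AE_ball_countable) (auto intro: countable_finite)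
  then show ?thesis
  proof (rule eventually_mono, intro impI)
    fix t assume G: "\<forall>i\<in>Basis. ((\<lambda>t. G t \<bullet> i) has_vector_derivative g t \<bullet> i) (at t)"
      and t: "t \<in> {a<..<b}"
    have "(G has_vector_derivative g t) (at t)"
      unfolding has_vector_derivative_def has_derivative_componentwise_within[of G]
      using G by (simp add: has_vector_derivative_def)
    then have "(F has_vector_derivative g t) (at t)"
      by (rule has_vector_derivative_transform_within_open[of _ _ _ "{a<..<b}"])
        (use t c in \<open>auto simp: G_def\<close>)
    then show "(F has_vector_derivative f t) (at t)" using t by (simp add: g_def)
  qed
qed auto

text \<open>Differentiability at \<open>t\<close> is the Cauchy condition for difference quotients, and by continuity it
  suffices to test it with rational increments; so it is a countable condition.\<close>

lemma differentiability_set_measurable: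
  fixes x :: "real \<Rightarrow> 'a::euclidean_space"
  assumes cont: "continuous_on UNIV x"
  shows "{t. \<exists>D. (x has_vector_derivative D) (at t)} \<in> sets lebesgue"
proof -
  define q where "q t h = (1 / h) *\<^sub>R (x (t + h) - x t)" for t h
  define Q where "Q m = {h \<in> \<rat>. h \<noteq> 0 \<and> \<bar>h\<bar> < 1 / real (Suc m)}" for m
  have Q: "countable (Q m)" for m unfolding Q_def by (intro countable_Collect countable_rat)
  have "{t. \<exists>D. (x has_vector_derivative D) (at t)} =
      (\<Inter>n::nat. \<Union>m::nat. \<Inter>h\<in>Q m. \<Inter>k\<in>Q m. {t. norm (q t h - q t k) \<le> 1 / real (Suc n)})"
    (is "?D = ?R")
  proof (intro equalityI subsetI)
    fix t assume "t \<in> ?D"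
    then obtain D where D: "(x has_vector_derivative D) (at t)" by blast
    show "t \<in> ?R"
    proof
      fix n :: nat
      have "\<exists>d>0. \<forall>y. norm (y - t) < d \<longrightarrow> norm (x y - x t - (y - t) *\<^sub>R D) \<le> (1 / (2 * real (Suc n))) * norm (y - t)"
        by (rule D[unfolded has_vector_derivative_def has_derivative_at_alt, THEN conjunct2, rule_format]) simp
      then obtain d where d: "d > 0"
        "\<And>y. norm (y - t) < d \<Longrightarrow> norm (x y - x t - (y - t) *\<^sub>R D) \<le> (1 / (2 * real (Suc n))) * norm (y - t)"
        by blast
      obtain m where m: "1 / real (Suc m) < d" using d(1) reals_Archimedean[of d] by (auto simp: inverse_eq_divide)
      have qD: "norm (q t h - D) \<le> 1 / (2 * real (Suc n))" if "h \<in> Q m" for h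
      proof -
        have h: "h \<noteq> 0" "\<bar>h\<bar> < d" using that m by (auto simp: Q_def)
        have "q t h - D = (1 / h) *\<^sub>R (x (t + h) - x t - h *\<^sub>R D)" using h by (simp add: q_def algebra_simps)
        then have "norm (q t h - D) = (1 / \<bar>h\<bar>) * norm (x (t + h) - x t - h *\<^sub>R D)" by simp
        also have "\<dots> \<le> (1 / \<bar>h\<bar>) * ((1 / (2 * real (Suc n))) * \<bar>h\<bar>)"
          using d(2)[of "t + h"] h by (intro mult_left_mono) auto
        finally show ?thesis using h by simp
      qed
      have "norm (q t h - q t k) \<le> 1 / real (Suc n)" if "h \<in> Q m" "k \<in> Q m" for h k
      proof -
        have "norm (q t h - q t k) \<le> norm (q t h - D) + norm (q t k - D)"
          using norm_triangle_ineq4[of "q t h - D" "q t k - D"] by simp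
        also have "\<dots> \<le> 1 / (2 * real (Suc n)) + 1 / (2 * real (Suc n))" by (intro add_mono qD that)
        also have "\<dots> = 1 / real (Suc n)" by (simp add: field_simps)
        finally show ?thesis .
      qed
      then show "t \<in> (\<Union>m. \<Inter>h\<in>Q m. \<Inter>k\<in>Q m. {t. norm (q t h - q t k) \<le> 1 / real (Suc n)})" by blast
    qed
  next
    fix t assume "t \<in> ?R"
    then have "\<forall>n. \<exists>m. \<forall>h\<in>Q m. \<forall>k\<in>Q m. norm (q t h - q t k) \<le> 1 / real (Suc n)" by simp
    then obtain M where M: "\<And>n h k. h \<in> Q (M n) \<Longrightarrow> k \<in> Q (M n) \<Longrightarrow> norm (q t h - q t k) \<le> 1 / real (Suc n)"
      by metis
    define s where "s i = 1 / real (Suc (Suc i))" for i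
    have sQ: "s i \<in> Q m" if "i \<ge> m" for i m
      using that by (auto simp: s_def Q_def intro!: divide_strict_left_mono)
    have "Cauchy (\<lambda>i. q t (s i))"
    proof (rule metric_CauchyI)
      fix e :: real assume "e > 0"
      then obtain n where n: "1 / real (Suc n) < e" using reals_Archimedean[of e] by (auto simp: inverse_eq_divide)
      have "dist (q t (s i)) (q t (s j)) < e" if "i \<ge> M n" "j \<ge> M n" for i j
        using M[OF sQ[OF that(1)] sQ[OF that(2)]] n by (simp add: dist_norm)
      then show "\<exists>M. \<forall>i\<ge>M. \<forall>j\<ge>M. dist (q t (s i)) (q t (s j)) < e" by blast
    qed
    then obtain D where D: "(\<lambda>i. q t (s i)) \<longlonglongrightarrow> D" using Cauchy_convergent_iff convergent_def by blast
    have QD: "norm (q t h - D) \<le> 1 / real (Suc n)" if h: "h \<in> Q (M n)" for h n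
    proof (rule tendsto_upperbound)
      show "(\<lambda>i. norm (q t h - q t (s i))) \<longlonglongrightarrow> norm (q t h - D)" by (intro tendsto_intros D)
      show "\<forall>\<^sub>F i in sequentially. norm (q t h - q t (s i)) \<le> 1 / real (Suc n)"
        using eventually_ge_at_top[of "M n"] by eventually_elim (rule M[OF h sQ])
    qed simp
    have all: "norm (x (t + h) - x t - h *\<^sub>R D) \<le> 1 / real (Suc n) * \<bar>h\<bar>" if h: "\<bar>h\<bar> < 1 / real (Suc (M n))" for h n
    proof (rule ccontr)
      assume neg: "\<not> ?thesis"
      define W where "W = {h. 1 / real (Suc n) * \<bar>h\<bar> < norm (x (t + h) - x t - h *\<^sub>R D)} \<inter> {h. \<bar>h\<bar> < 1 / real (Suc (M n))}"
      have cx: "continuous_on UNIV (\<lambda>h. x (t + h))"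
        by (rule continuous_on_compose2[OF cont]) (auto intro!: continuous_intros)
      have "open W"
        unfolding W_def by (intro open_Int open_Collect_less continuous_intros cx)
      moreover have "h \<in> W" using neg h by (simp add: W_def not_le)
      ultimately obtain \<epsilon> where \<epsilon>: "\<epsilon> > 0" "ball h \<epsilon> \<subseteq> W" using open_contains_ball by blast
      then obtain k where k: "k \<in> \<rat>" "h < k" "k < h + \<epsilon>" using Rats_dense_in_real[of h "h + \<epsilon>"] by auto
      then have kW: "k \<in> W" using \<epsilon> by (auto simp: dist_real_def)
      then have "k \<noteq> 0" by (auto simp: W_def)
      then have "k \<in> Q (M n)" using kW k by (auto simp: W_def Q_def)
      then have "norm (q t k - D) \<le> 1 / real (Suc n)" by (rule QD)
      moreover have "x (t + k) - x t - k *\<^sub>R D = k *\<^sub>R (q t k - D)" using \<open>k \<noteq> 0\<close> by (simp add: q_def algebra_simps)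
      ultimately have "norm (x (t + k) - x t - k *\<^sub>R D) \<le> 1 / real (Suc n) * \<bar>k\<bar>"
        using mult_left_mono[of "norm (q t k - D)" "1 / real (Suc n)" "\<bar>k\<bar>"] by (simp add: mult.commute)
      then show False using kW by (simp add: W_def)
    qed
    have "(x has_vector_derivative D) (at t)"
      unfolding has_vector_derivative_def has_derivative_at_alt
    proof (intro conjI allI impI)
      show "bounded_linear (\<lambda>x. x *\<^sub>R D)" by (rule bounded_linear_scaleR_left)
      fix e :: real assume "e > 0"
      then obtain n where n: "1 / real (Suc n) < e" using reals_Archimedean[of e] by (auto simp: inverse_eq_divide)
      show "\<exists>d>0. \<forall>y. norm (y - t) < d \<longrightarrow> norm (x y - x t - (y - t) *\<^sub>R D) \<le> e * norm (y - t)"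
      proof (intro exI[of _ "1 / real (Suc (M n))"] conjI allI impI)
        fix y assume "norm (y - t) < 1 / real (Suc (M n))"
        then have "norm (x y - x t - (y - t) *\<^sub>R D) \<le> 1 / real (Suc n) * \<bar>y - t\<bar>" using all[of "y - t" n] by simp
        also have "\<dots> \<le> e * \<bar>y - t\<bar>" using n by (intro mult_right_mono) auto
        finally show "norm (x y - x t - (y - t) *\<^sub>R D) \<le> e * norm (y - t)" by simp
      qed simp
    qed
    then show "t \<in> ?D" by blast
  qed
  also have "?R \<in> sets borel"
  proof -
    have "{t. norm (q t h - q t k) \<le> 1 / real (Suc n)} \<in> sets borel" for h k n
    proof -
      have cx: "continuous_on UNIV (\<lambda>t. x (t + h))" for h
        by (rule continuous_on_compose2[OF cont]) (auto intro!: continuous_intros)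
      have "closed {t. norm (q t h - q t k) \<le> 1 / real (Suc n)}"
        unfolding q_def by (intro closed_Collect_le continuous_intros cx cont)
      then show ?thesis by simp
    qed
    then have "(\<Inter>h\<in>Q m. \<Inter>k\<in>Q m. {t. norm (q t h - q t k) \<le> 1 / real (Suc n)}) \<in> sets borel" for n m
      using Q[of m] by (intro sets.countable_INT'' ) auto
    then show ?thesis by (intro sets.countable_INT sets.countable_UN) auto
  qed
  finally show ?thesis by (simp add: sets_completionI_sets)
qed

section \<open>The weighted Lebesgue spaces\<close>

lemma weight_pos: "0 < weight t" and weight_le_1: "weight t \<le> 1"
  by (auto simp: weight_def add_pos_nonneg divide_le_eq add_nonneg_pos)

lemma weight_measurable [measurable]: "weight \<in> borel_measurable lebesgue"
proof -
  have "continuous_on UNIV weight"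
    unfolding weight_def by (intro continuous_intros) (auto simp: add_nonneg_eq_0_iff)
  then have "weight \<in> borel_measurable borel" by (rule borel_measurable_continuous_onI)
  then show ?thesis by (simp add: measurable_completion)
qed

lemma weight_shift: "weight s \<le> 2 * (1 + (s - t)\<^sup>2) * weight t"
proof -
  have "1 + t\<^sup>2 \<le> 2 * (1 + (s - t)\<^sup>2) * (1 + s\<^sup>2)"
  proof -
    have "0 \<le> (2 * s - t)\<^sup>2" by simp
    moreover have "0 \<le> (s - t)\<^sup>2 * s\<^sup>2" by simp
    ultimately show ?thesis by (simp add: power2_eq_square algebra_simps)
  qed
  moreover have "0 < 1 + s\<^sup>2" "0 < 1 + t\<^sup>2" by (simp_all add: add_pos_nonneg)
  ultimately show ?thesis by (simp add: weight_def field_simps)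
qed

definition weight_exponent :: "ennreal \<Rightarrow> real" where
  "weight_exponent p = (if p = \<infinity> then 1 else 1 / enn2real p)"

text \<open>The size of the unit bump at \<open>t\<close> in \<open>L\<^sup>p\<^sub>\<mu>\<close>, up to a constant.\<close>

definition point_weight :: "ennreal \<Rightarrow> real \<Rightarrow> real" where
  "point_weight p t = weight t powr weight_exponent p"

lemma finite_exponent:
  assumes "1 \<le> p" "p \<noteq> \<infinity>"
  shows "1 \<le> enn2real p"
  using assms by (cases p) (auto simp: ennreal_1[symmetric] simp del: ennreal_1)

lemma weight_exponent_finite: "p \<noteq> \<infinity> \<Longrightarrow> weight_exponent p = 1 / enn2real p"
  by (simp only: weight_exponent_def if_False)

lemma weight_exponent_bounds:
  assumes "1 \<le> p"
  shows "0 < weight_exponent p" "weight_exponent p \<le> 1"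
  using finite_exponent[OF assms] by (auto simp: weight_exponent_def)

lemma point_weight_pos: "0 < point_weight p t"
  using weight_pos[of t] by (simp add: point_weight_def)

lemma point_weight_shift:
  assumes "1 \<le> p"
  shows "point_weight p s \<le> 2 * (1 + (s - t)\<^sup>2) * point_weight p t"
proof -
  let ?e = "weight_exponent p" and ?K = "2 * (1 + (s - t)\<^sup>2)"
  have K: "1 \<le> ?K" by simp
  have "point_weight p s \<le> (?K * weight t) powr ?e"
    unfolding point_weight_def using weight_exponent_bounds[OF assms] weight_pos[of s]
    by (intro powr_mono2 weight_shift) auto
  also have "\<dots> = ?K powr ?e * point_weight p t"
    using K weight_pos[of t] by (simp add: point_weight_def powr_mult)
  also have "\<dots> \<le> ?K * point_weight p t"
  proof (rule mult_right_mono)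
    have "?K powr ?e \<le> ?K powr 1" using K weight_exponent_bounds[OF assms] by (intro powr_mono) auto
    then show "?K powr ?e \<le> ?K" using K by simp
  qed (use point_weight_pos[of p t] in simp)
  finally show ?thesis .
qed

text \<open>\<open>lp_bound p f c\<close> says that \<open>f\<close> lies in the ball of radius \<open>c\<close>. The form is free of
  roots and essential suprema and includes integrability.\<close>

definition lp_bound :: "ennreal \<Rightarrow> (real \<Rightarrow> real^'n) \<Rightarrow> real \<Rightarrow> bool" where
  "lp_bound p f c \<longleftrightarrow> (if p = \<infinity> then AE t in lebesgue. norm (f t) * weight t \<le> c
     else (\<integral>\<^sup>+t. ennreal (weight t * norm (f t) powr enn2real p) \<partial>lebesgue) \<le> ennreal (c powr enn2real p))"

lemma lp_bound_finite:
  "p \<noteq> \<infinity> \<Longrightarrow> lp_bound p f c \<longleftrightarrow>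
    (\<integral>\<^sup>+t. ennreal (weight t * norm (f t) powr enn2real p) \<partial>lebesgue) \<le> ennreal (c powr enn2real p)"
  by (simp only: lp_bound_def if_False)

lemma Lp_ball_iff:
  fixes f :: "real \<Rightarrow> real^'n"
  assumes p: "1 \<le> p" and c: "0 \<le> c" and f[measurable]: "f \<in> borel_measurable lebesgue"
  shows "f \<in> Lp_set p \<and> Lp_norm p f \<le> c \<longleftrightarrow> lp_bound p f c"
proof (cases "p = \<infinity>")
  case True
  define g where "g t = ennreal (norm (f t) * weight t)" for t
  have g[measurable]: "g \<in> borel_measurable lebesgue" unfolding g_def[abs_def] by measurable
  have n: "0 \<le> norm (f t) * weight t" for t using weight_pos[of t] by simp
  have AEg: "(AE t in lebesgue. g t \<le> ennreal d) \<longleftrightarrow> (AE t in lebesgue. norm (f t) * weight t \<le> d)" if "0 \<le> d" for d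
    unfolding g_def using that by (simp add: ennreal_le_iff)
  have nrm: "Lp_norm p f = enn2real (esssup lebesgue g)" by (simp add: Lp_norm_def True g_def[abs_def])
  show ?thesis
  proof
    assume L: "f \<in> Lp_set p \<and> Lp_norm p f \<le> c"
    then obtain C where "AE t in lebesgue. norm (f t) * weight t \<le> C" by (auto simp: Lp_set_def True)
    then have "AE t in lebesgue. norm (f t) * weight t \<le> \<bar>C\<bar>" by (rule eventually_mono) auto
    then have "AE t in lebesgue. g t \<le> ennreal \<bar>C\<bar>" by (subst AEg) auto
    then have "esssup lebesgue g \<le> ennreal \<bar>C\<bar>" using g by (rule esssup_I[rotated])
    then have "esssup lebesgue g < \<infinity>" by (metis ennreal_less_top infinity_ennreal_def le_less_trans)
    then have "esssup lebesgue g = ennreal (Lp_norm p f)" by (simp add: nrm)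
    then have "esssup lebesgue g \<le> ennreal c" using L by (simp add: ennreal_leI)
    then have "AE t in lebesgue. g t \<le> ennreal c"
      using esssup_AE[where M = lebesgue and f = g] by (auto elim!: eventually_mono intro: order.trans)
    then show "lp_bound p f c" using c by (simp add: lp_bound_def True AEg)
  next
    assume b: "lp_bound p f c"
    then have "AE t in lebesgue. g t \<le> ennreal c" using c by (simp add: lp_bound_def True AEg)
    then have "esssup lebesgue g \<le> ennreal c" using g by (rule esssup_I[rotated])
    then have "Lp_norm p f \<le> c" unfolding nrm using c by (simp add: enn2real_leI)
    then show "f \<in> Lp_set p \<and> Lp_norm p f \<le> c"
      using b f by (auto simp: Lp_set_def True lp_bound_def)
  qed
next
  case False
  define q where "q = enn2real p"
  have q: "1 \<le> q" using finite_exponent[OF p False] by (simp add: q_def)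
  define J where "J = (\<integral>\<^sup>+t. ennreal (weight t * norm (f t) powr q) \<partial>lebesgue)"
  have m: "(\<lambda>t. norm (f t) powr q) \<in> borel_measurable lebesgue" by measurable
  have sets: "sets weighted_lebesgue = sets lebesgue" by (simp add: weighted_lebesgue_def)
  have m': "(\<lambda>t. norm (f t) powr q) \<in> borel_measurable weighted_lebesgue"
    using m by (simp add: measurable_cong_sets[OF sets refl])
  have J: "(\<integral>\<^sup>+t. ennreal (norm (f t) powr q) \<partial>weighted_lebesgue) = J"
    unfolding weighted_lebesgue_def J_def using m weight_pos
    by (subst nn_integral_density) (auto intro!: nn_integral_cong simp: ennreal_mult less_imp_le)
  have set: "f \<in> Lp_set p \<longleftrightarrow> J < \<infinity>"
    using m' J f unfolding Lp_set_def if_not_P[OF False] by (simp add: integrable_iff_bounded q_def)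
  have nrm: "Lp_norm p f = enn2real J powr (1 / q)"
    using m' J unfolding Lp_norm_def if_not_P[OF False] by (simp add: q_def integral_eq_nn_integral)
  have root: "x powr (1 / q) \<le> c \<longleftrightarrow> x \<le> c powr q" if "0 \<le> x" for x
  proof
    assume "x powr (1 / q) \<le> c"
    then have "(x powr (1 / q)) powr q \<le> c powr q" using q by (intro powr_mono2) auto
    then show "x \<le> c powr q" using q that by (simp add: powr_powr)
  next
    assume "x \<le> c powr q"
    then have "x powr (1 / q) \<le> (c powr q) powr (1 / q)" using q that by (intro powr_mono2) auto
    then show "x powr (1 / q) \<le> c" using q c by (simp add: powr_powr)
  qed
  have "J < \<infinity> \<and> enn2real J \<le> c powr q \<longleftrightarrow> J \<le> ennreal (c powr q)"
    by (cases J) (auto simp: top_unique)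
  then show ?thesis unfolding set nrm lp_bound_finite[OF False] by (simp add: root J_def q_def[symmetric])
qed

lemma Lp_set_measurable: "f \<in> Lp_set p \<Longrightarrow> f \<in> borel_measurable lebesgue"
  by (simp add: Lp_set_def)

lemma Lp_norm_nonneg: "0 \<le> Lp_norm p f"
  by (simp add: Lp_norm_def)

lemma Lp_ballI:
  fixes f :: "real \<Rightarrow> real^'n"
  assumes "1 \<le> p" "0 \<le> c" "f \<in> borel_measurable lebesgue" "lp_bound p f c"
  shows "f \<in> Lp_set p" "Lp_norm p f \<le> c"
  using Lp_ball_iff[OF assms(1-3)] assms(4) by auto

lemma Lp_ballD:
  fixes f :: "real \<Rightarrow> real^'n"
  assumes "1 \<le> p" "f \<in> Lp_set p" "Lp_norm p f \<le> c"
  shows "lp_bound p f c"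
  using Lp_ball_iff[OF assms(1) order.trans[OF Lp_norm_nonneg assms(3)] Lp_set_measurable[OF assms(2)]] assms(2,3)
  by blast

lemma lp_bound_dominated:
  fixes f g :: "real \<Rightarrow> real^'n"
  assumes b: "lp_bound p g c" and le: "AE t in lebesgue. norm (f t) \<le> norm (g t)"
  shows "lp_bound p f c"
proof (cases "p = \<infinity>")
  case True
  then have "AE t in lebesgue. norm (g t) * weight t \<le> c" using b by (simp add: lp_bound_def)
  with le have "AE t in lebesgue. norm (f t) * weight t \<le> c"
  proof eventually_elim
    case (elim t)
    have "norm (f t) * weight t \<le> norm (g t) * weight t"
      using elim weight_pos[of t] by (intro mult_right_mono) auto
    then show ?case using elim by simp
  qed
  then show ?thesis by (simp add: lp_bound_def True)
next
  case False
  have "(\<integral>\<^sup>+t. ennreal (weight t * norm (f t) powr enn2real p) \<partial>lebesgue)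
      \<le> (\<integral>\<^sup>+t. ennreal (weight t * norm (g t) powr enn2real p) \<partial>lebesgue)"
    by (rule nn_integral_mono_AE, rule eventually_mono[OF le])
      (auto intro!: ennreal_leI mult_left_mono powr_mono2 simp: weight_pos[THEN less_imp_le])
  then show ?thesis using b by (auto simp: lp_bound_finite[OF False])
qed

lemma lp_bound_scale:
  fixes f :: "real \<Rightarrow> real^'n"
  assumes "0 \<le> c" "lp_bound p f c" and f[measurable]: "f \<in> borel_measurable lebesgue"
  shows "lp_bound p (\<lambda>t. a *\<^sub>R f t) (\<bar>a\<bar> * c)"
proof (cases "p = \<infinity>")
  case True
  then have "AE t in lebesgue. norm (f t) * weight t \<le> c" using assms by (simp add: lp_bound_def)
  then have "AE t in lebesgue. norm (a *\<^sub>R f t) * weight t \<le> \<bar>a\<bar> * c"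
    by (rule eventually_mono) (simp add: mult.assoc mult_left_mono)
  then show ?thesis by (simp add: lp_bound_def True)
next
  case False
  let ?q = "enn2real p"
  have "(\<integral>\<^sup>+t. ennreal (weight t * norm (a *\<^sub>R f t) powr ?q) \<partial>lebesgue)
      = (\<integral>\<^sup>+t. ennreal (\<bar>a\<bar> powr ?q) * ennreal (weight t * norm (f t) powr ?q) \<partial>lebesgue)"
    by (intro nn_integral_cong)
      (simp add: powr_mult ennreal_mult weight_pos less_imp_le mult.left_commute)
  also have "\<dots> = ennreal (\<bar>a\<bar> powr ?q) * (\<integral>\<^sup>+t. ennreal (weight t * norm (f t) powr ?q) \<partial>lebesgue)"
  proof (rule nn_integral_cmult)
    have "(\<lambda>t. norm (f t) powr ?q) \<in> borel_measurable lebesgue" using f by measurable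
    then show "(\<lambda>t. ennreal (weight t * norm (f t) powr ?q)) \<in> borel_measurable lebesgue" by measurable
  qed
  also have "\<dots> \<le> ennreal (\<bar>a\<bar> powr ?q) * ennreal (c powr ?q)"
    using assms False by (intro mult_left_mono) (auto simp: lp_bound_def)
  also have "\<dots> = ennreal ((\<bar>a\<bar> * c) powr ?q)"
    using assms by (simp add: powr_mult flip: ennreal_mult)
  finally show ?thesis by (simp add: lp_bound_finite[OF False])
qed

text \<open>Minkowski's inequality. The ratio \<open>(u + v) / (c + d)\<close> is a convex combination of \<open>u / c\<close> and
  \<open>v / d\<close>, so for functions in the balls of radius \<open>c\<close> and \<open>d\<close> convexity of the power integrates to
  the bound \<open>1\<close>.\<close>

lemma lp_bound_add:
  fixes f g :: "real \<Rightarrow> real^'n"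
  assumes p: "1 \<le> p" and c: "0 < c" and d: "0 < d"
    and f: "f \<in> borel_measurable lebesgue" "lp_bound p f c"
    and g: "g \<in> borel_measurable lebesgue" "lp_bound p g d"
  shows "lp_bound p (\<lambda>t. f t + g t) (c + d)"
proof (cases "p = \<infinity>")
  case True
  then have "AE t in lebesgue. norm (f t) * weight t \<le> c" "AE t in lebesgue. norm (g t) * weight t \<le> d"
    using f g by (simp_all add: lp_bound_def)
  then have "AE t in lebesgue. norm (f t + g t) * weight t \<le> c + d"
  proof eventually_elim
    case (elim t)
    have "norm (f t + g t) * weight t \<le> (norm (f t) + norm (g t)) * weight t"
      using weight_pos[of t] by (intro mult_right_mono norm_triangle_ineq) auto
    then show ?case using elim by (simp add: distrib_right)
  qed
  then show ?thesis by (simp add: lp_bound_def True)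
next
  case False
  define q where "q = enn2real p"
  have q: "1 \<le> q" using finite_exponent[OF p False] by (simp add: q_def)
  define F G where "F t = weight t * norm (f t) powr q" and "G t = weight t * norm (g t) powr q" for t
  have F: "(\<integral>\<^sup>+t. ennreal (F t) \<partial>lebesgue) \<le> ennreal (c powr q)" "F \<in> borel_measurable lebesgue"
    and G: "(\<integral>\<^sup>+t. ennreal (G t) \<partial>lebesgue) \<le> ennreal (d powr q)" "G \<in> borel_measurable lebesgue"
    using f g False by (simp_all add: lp_bound_def q_def F_def[abs_def] G_def[abs_def])
  have FG0: "0 \<le> F t" "0 \<le> G t" for t using weight_pos[of t] by (auto simp: F_def G_def)
  define \<alpha> \<beta> where "\<alpha> = (c + d) powr q * (c / (c + d)) * (1 / c powr q)"
    and "\<beta> = (c + d) powr q * (d / (c + d)) * (1 / d powr q)"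
  have \<alpha>\<beta>: "0 \<le> \<alpha>" "0 \<le> \<beta>" using c d by (auto simp: \<alpha>_def \<beta>_def)
  have conv: "(u + v) powr q \<le> \<alpha> * u powr q + \<beta> * v powr q" if "0 \<le> u" "0 \<le> v" for u v
  proof -
    have pos: "(u + v) powr q \<le> \<alpha> * u powr q + \<beta> * v powr q" if "0 < u" "0 < v" for u v
    proof -
      have "((d / (c + d)) * (v / d) + (c / (c + d)) * (u / c)) powr q
          \<le> (d / (c + d)) * (v / d) powr q + (c / (c + d)) * (u / c) powr q"
        using convex_onD[OF powr_convex[OF q], of "c / (c + d)" "v / d" "u / c"] c d that
        by (simp add: field_simps)
      also have "(d / (c + d)) * (v / d) + (c / (c + d)) * (u / c) = (u + v) / (c + d)"
        using c d by (simp add: add_divide_distrib)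
      finally have "(u + v) powr q / (c + d) powr q \<le> (d / (c + d)) * (v / d) powr q + (c / (c + d)) * (u / c) powr q"
        using c d that by (simp add: powr_divide)
      then have "(u + v) powr q \<le> (c + d) powr q * ((d / (c + d)) * (v / d) powr q + (c / (c + d)) * (u / c) powr q)"
        using c d by (simp add: field_simps)
      also have "\<dots> = \<alpha> * u powr q + \<beta> * v powr q"
        using c d that by (simp add: \<alpha>_def \<beta>_def powr_divide algebra_simps)
      finally show ?thesis .
    qed
    have 1: "((\<lambda>e. \<alpha> * (u + e) powr q + \<beta> * (v + e) powr q) \<longlongrightarrow> \<alpha> * (u + 0) powr q + \<beta> * (v + 0) powr q) (at_right 0)"
      using q that by (intro tendsto_intros) (auto simp: eventually_at_right_field intro!: exI[of _ 1])
    have 2: "((\<lambda>e. (u + e + (v + e)) powr q) \<longlongrightarrow> (u + 0 + (v + 0)) powr q) (at_right 0)"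
      using q that by (intro tendsto_intros) (auto simp: eventually_at_right_field intro!: exI[of _ 1])
    have 3: "\<forall>\<^sub>F e in at_right 0. (u + e + (v + e)) powr q \<le> \<alpha> * (u + e) powr q + \<beta> * (v + e) powr q"
      unfolding eventually_at_right_field using that by (intro exI[of _ 1] conjI allI impI pos) auto
    show ?thesis using tendsto_le[OF trivial_limit_at_right_real 1 2 3] by simp
  qed
  have "(\<integral>\<^sup>+t. ennreal (weight t * norm (f t + g t) powr q) \<partial>lebesgue)
      \<le> (\<integral>\<^sup>+t. ennreal \<alpha> * ennreal (F t) + ennreal \<beta> * ennreal (G t) \<partial>lebesgue)"
  proof (rule nn_integral_mono)
    fix t
    have "norm (f t + g t) powr q \<le> (norm (f t) + norm (g t)) powr q"
      using q by (intro powr_mono2 norm_triangle_ineq) auto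
    also have "\<dots> \<le> \<alpha> * norm (f t) powr q + \<beta> * norm (g t) powr q" by (rule conv) auto
    finally have "weight t * norm (f t + g t) powr q \<le> weight t * (\<alpha> * norm (f t) powr q + \<beta> * norm (g t) powr q)"
      using weight_pos[of t] by (intro mult_left_mono) auto
    also have "\<dots> = \<alpha> * F t + \<beta> * G t" by (simp add: F_def G_def algebra_simps)
    finally show "ennreal (weight t * norm (f t + g t) powr q) \<le> ennreal \<alpha> * ennreal (F t) + ennreal \<beta> * ennreal (G t)"
      using \<alpha>\<beta> FG0[of t] by (simp flip: ennreal_mult ennreal_plus add: ennreal_leI)
  qed
  also have "\<dots> = ennreal \<alpha> * (\<integral>\<^sup>+t. ennreal (F t) \<partial>lebesgue) + ennreal \<beta> * (\<integral>\<^sup>+t. ennreal (G t) \<partial>lebesgue)"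
    using F(2) G(2) by (subst nn_integral_add) (auto simp: nn_integral_cmult)
  also have "\<dots> \<le> ennreal \<alpha> * ennreal (c powr q) + ennreal \<beta> * ennreal (d powr q)"
    using F(1) G(1) by (intro add_mono mult_left_mono) auto
  also have "\<dots> = ennreal (\<alpha> * c powr q + \<beta> * d powr q)"
    using \<alpha>\<beta> by (simp flip: ennreal_mult ennreal_plus)
  also have "\<alpha> * c powr q + \<beta> * d powr q = (c + d) powr q"
  proof -
    have "\<alpha> * c powr q = (c + d) powr q * (c / (c + d))" "\<beta> * d powr q = (c + d) powr q * (d / (c + d))"
      using c d by (simp_all add: \<alpha>_def \<beta>_def)
    then have "\<alpha> * c powr q + \<beta> * d powr q = (c + d) powr q * (c / (c + d) + d / (c + d))"
      by (simp only: distrib_left)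
    also have "c / (c + d) + d / (c + d) = 1" using c d by (simp flip: add_divide_distrib)
    finally show ?thesis by simp
  qed
  finally show ?thesis by (simp add: lp_bound_finite[OF False] q_def)
qed

context
  fixes p :: ennreal
  assumes p: "1 \<le> p"
begin

lemma Lp_zero: "(\<lambda>_. 0 :: real^'n) \<in> Lp_set p" "Lp_norm p (\<lambda>_. 0 :: real^'n) = 0"
proof -
  have "lp_bound p (\<lambda>_. 0 :: real^'n) 0" using finite_exponent[OF p] by (auto simp: lp_bound_def)
  from Lp_ballI[OF p _ _ this] show "(\<lambda>_. 0 :: real^'n) \<in> Lp_set p" "Lp_norm p (\<lambda>_. 0 :: real^'n) = 0"
    using Lp_norm_nonneg[of p "\<lambda>_. 0 :: real^'n"] by auto
qed

lemma Lp_dominated: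
  fixes f g :: "real \<Rightarrow> real^'n"
  assumes "f \<in> borel_measurable lebesgue" "g \<in> Lp_set p" "AE t in lebesgue. norm (f t) \<le> norm (g t)"
  shows "f \<in> Lp_set p" "Lp_norm p f \<le> Lp_norm p g"
  using Lp_ballI[OF p Lp_norm_nonneg assms(1) lp_bound_dominated[OF Lp_ballD[OF p assms(2) order_refl] assms(3)]]
  by auto

lemma Lp_scale_le:
  fixes f :: "real \<Rightarrow> real^'n"
  assumes f: "f \<in> Lp_set p"
  shows "(\<lambda>t. a *\<^sub>R f t) \<in> Lp_set p" "Lp_norm p (\<lambda>t. a *\<^sub>R f t) \<le> \<bar>a\<bar> * Lp_norm p f"
proof -
  have "(\<lambda>t. a *\<^sub>R f t) \<in> borel_measurable lebesgue" using Lp_set_measurable[OF f] by measurable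
  moreover have "0 \<le> \<bar>a\<bar> * Lp_norm p f" by (simp add: Lp_norm_nonneg)
  moreover have "lp_bound p (\<lambda>t. a *\<^sub>R f t) (\<bar>a\<bar> * Lp_norm p f)"
    by (rule lp_bound_scale[OF Lp_norm_nonneg Lp_ballD[OF p f order_refl] Lp_set_measurable[OF f]])
  ultimately show "(\<lambda>t. a *\<^sub>R f t) \<in> Lp_set p" "Lp_norm p (\<lambda>t. a *\<^sub>R f t) \<le> \<bar>a\<bar> * Lp_norm p f"
    using Lp_ballI[OF p] by auto
qed

lemma Lp_add:
  fixes f g :: "real \<Rightarrow> real^'n"
  assumes f: "f \<in> Lp_set p" and g: "g \<in> Lp_set p"
  shows "(\<lambda>t. f t + g t) \<in> Lp_set p" "Lp_norm p (\<lambda>t. f t + g t) \<le> Lp_norm p f + Lp_norm p g"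
proof -
  have m: "(\<lambda>t. f t + g t) \<in> borel_measurable lebesgue"
    using Lp_set_measurable[OF f] Lp_set_measurable[OF g] by measurable
  have e: "(\<lambda>t. f t + g t) \<in> Lp_set p \<and> Lp_norm p (\<lambda>t. f t + g t) \<le> Lp_norm p f + Lp_norm p g + 2 * e" if "e > 0" for e
  proof -
    have "lp_bound p (\<lambda>t. f t + g t) ((Lp_norm p f + e) + (Lp_norm p g + e))"
      using f g that Lp_norm_nonneg[of p f] Lp_norm_nonneg[of p g]
      by (intro lp_bound_add p Lp_ballD Lp_set_measurable) auto
    then show ?thesis
      using Lp_ballI[OF p _ m, of "(Lp_norm p f + e) + (Lp_norm p g + e)"] that
        Lp_norm_nonneg[of p f] Lp_norm_nonneg[of p g] by (simp add: algebra_simps)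
  qed
  from e[of 1] show "(\<lambda>t. f t + g t) \<in> Lp_set p" by simp
  show "Lp_norm p (\<lambda>t. f t + g t) \<le> Lp_norm p f + Lp_norm p g"
  proof (rule field_le_epsilon)
    fix e :: real assume "e > 0"
    with e[of "e/2"] show "Lp_norm p (\<lambda>t. f t + g t) \<le> Lp_norm p f + Lp_norm p g + e" by simp
  qed
qed

lemma Lp_seminormed: "seminormed_space (Lp_set p :: (real \<Rightarrow> real^'n) set) (Lp_norm p)"
proof
  show "subspace (Lp_set p :: (real \<Rightarrow> real^'n) set)"
    using Lp_zero(1) Lp_add(1) Lp_scale_le(1)
    by (auto simp: subspace_def zero_fun_def plus_fun_def scaleR_fun_def)
  fix f g :: "real \<Rightarrow> real^'n" assume f: "f \<in> Lp_set p" and g: "g \<in> Lp_set p"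
  show "Lp_norm p (f + g) \<le> Lp_norm p f + Lp_norm p g" using Lp_add(2)[OF f g] by (simp add: plus_fun_def)
next
  fix f :: "real \<Rightarrow> real^'n" and c assume f: "f \<in> Lp_set p"
  have le: "Lp_norm p (\<lambda>t. c *\<^sub>R f t) \<le> \<bar>c\<bar> * Lp_norm p f" by (rule Lp_scale_le(2)[OF f])
  show "Lp_norm p (c *\<^sub>R f) = \<bar>c\<bar> * Lp_norm p f"
  proof (cases "c = 0")
    case True then show ?thesis using Lp_zero(2) by (simp add: scaleR_fun_def)
  next
    case False
    have "Lp_norm p (\<lambda>t. (1/c) *\<^sub>R (c *\<^sub>R f t)) \<le> \<bar>1/c\<bar> * Lp_norm p (\<lambda>t. c *\<^sub>R f t)"
      by (rule Lp_scale_le(2)[OF Lp_scale_le(1)[OF f]])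
    then have "\<bar>c\<bar> * Lp_norm p f \<le> Lp_norm p (\<lambda>t. c *\<^sub>R f t)"
      using False by (simp add: field_simps)
    then show ?thesis using le by (simp add: scaleR_fun_def)
  qed
qed

lemma Lp_diff:
  fixes f g :: "real \<Rightarrow> real^'n"
  assumes f: "f \<in> Lp_set p" and g: "g \<in> Lp_set p"
  shows "(\<lambda>t. f t - g t) \<in> Lp_set p" "Lp_norm p (\<lambda>t. f t - g t) \<le> Lp_norm p f + Lp_norm p g"
  using seminormed_space.diff_closed[OF Lp_seminormed f g] seminormed_space.triangle_diff[OF Lp_seminormed f g]
  by (simp_all add: fun_diff_def)

lemma Lp_sum:
  fixes f :: "'i \<Rightarrow> real \<Rightarrow> real^'n"
  assumes "finite I" "\<And>i. i \<in> I \<Longrightarrow> f i \<in> Lp_set p"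
  shows "(\<lambda>t. \<Sum>i\<in>I. f i t) \<in> Lp_set p \<and> Lp_norm p (\<lambda>t. \<Sum>i\<in>I. f i t) \<le> (\<Sum>i\<in>I. Lp_norm p (f i))"
  using assms
proof (induction I rule: finite_induct)
  case (insert i I)
  then have "(\<lambda>t. f i t + (\<Sum>i\<in>I. f i t)) \<in> Lp_set p"
    "Lp_norm p (\<lambda>t. f i t + (\<Sum>i\<in>I. f i t)) \<le> Lp_norm p (f i) + Lp_norm p (\<lambda>t. \<Sum>i\<in>I. f i t)"
    using Lp_add[of "f i" "\<lambda>t. \<Sum>i\<in>I. f i t"] by auto
  then show ?case using insert by auto
qed (simp add: Lp_zero)

lemma Lp_scaled_dominated:
  fixes f g :: "real \<Rightarrow> real^'n"
  assumes "f \<in> borel_measurable lebesgue" "g \<in> Lp_set p" "0 \<le> c" "AE t in lebesgue. norm (f t) \<le> c * norm (g t)"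
  shows "f \<in> Lp_set p" "Lp_norm p f \<le> c * Lp_norm p g"
proof -
  have *: "AE t in lebesgue. norm (f t) \<le> norm (c *\<^sub>R g t)" using assms(3,4) by simp
  show "f \<in> Lp_set p" by (rule Lp_dominated(1)[OF assms(1) Lp_scale_le(1)[OF assms(2)] *])
  show "Lp_norm p f \<le> c * Lp_norm p g"
    using Lp_dominated(2)[OF assms(1) Lp_scale_le(1)[OF assms(2)] *] Lp_scale_le(2)[OF assms(2), of c] assms(3) by simp
qed

lemma Lp_norm_eq_0_iff:
  fixes f :: "real \<Rightarrow> real^'n"
  assumes f: "f \<in> Lp_set p"
  shows "Lp_norm p f = 0 \<longleftrightarrow> (AE t in lebesgue. f t = 0)"
proof
  assume "AE t in lebesgue. f t = 0"
  then have "AE t in lebesgue. norm (f t) \<le> norm (0 :: real^'n)" by simp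
  then show "Lp_norm p f = 0"
    using Lp_dominated(2)[OF Lp_set_measurable[OF f] Lp_zero(1)] Lp_zero(2)[where 'n='n] Lp_norm_nonneg[of p f] by simp
next
  assume "Lp_norm p f = 0"
  then have b: "lp_bound p f 0" using Lp_ballD[OF p f] by simp
  show "AE t in lebesgue. f t = 0"
  proof (cases "p = \<infinity>")
    case True
    then have "AE t in lebesgue. norm (f t) * weight t \<le> 0" using b by (simp add: lp_bound_def)
    then show ?thesis
    proof eventually_elim
      case (elim t)
      then show ?case using weight_pos[of t] by (simp add: mult_le_0_iff)
    qed
  next
    case False
    have m: "(\<lambda>t. ennreal (weight t * norm (f t) powr enn2real p)) \<in> borel_measurable lebesgue"
      using Lp_set_measurable[OF f] by measurable
    have "(\<integral>\<^sup>+t. ennreal (weight t * norm (f t) powr enn2real p) \<partial>lebesgue) = 0"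
      using b finite_exponent[OF p False] by (simp add: lp_bound_finite[OF False])
    then have "AE t in lebesgue. ennreal (weight t * norm (f t) powr enn2real p) = 0"
      using nn_integral_0_iff_AE[OF m] by simp
    then show ?thesis
    proof eventually_elim
      case (elim t)
      have "weight t * norm (f t) powr enn2real p \<le> 0" using elim by (simp add: ennreal_eq_0_iff)
      then show ?case using weight_pos[of t] by (simp add: mult_le_0_iff)
    qed
  qed
qed

end

lemma translation_measurable: "(\<lambda>t. t + c) \<in> measurable lebesgue (lebesgue :: real measure)"
proof (rule measurableI)
  fix S :: "real set" assume S: "S \<in> sets lebesgue"
  have "(\<lambda>t. t + c) -` S = (\<lambda>x. - c + x) ` S" by (auto simp: image_iff intro!: bexI[of _ "_ + c"])
  then show "(\<lambda>t. t + c) -` S \<inter> space lebesgue \<in> sets lebesgue"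
    using lebesgue_sets_translation[OF S, of "- c"] by simp
qed simp

lemma AE_translation:
  fixes P :: "real \<Rightarrow> bool"
  assumes "AE t in lebesgue. P t"
  shows "AE t in lebesgue. P (t + c)"
proof -
  have "negligible {t. \<not> P t}"
    using assms by (simp add: negligible_iff_null_sets AE_iff_null_sets completion.AE_iff_null_sets)
  then have "negligible ((+) (- c) ` {t. \<not> P t})" by (rule negligible_translation)
  also have "(+) (- c) ` {t. \<not> P t} = {t. \<not> P (t + c)}"
    by (auto simp: image_iff intro!: exI[of _ "_ + c"])
  finally show ?thesis
    by (simp add: negligible_iff_null_sets AE_iff_null_sets completion.AE_iff_null_sets)
qed

lemma Lp_translation:
  fixes f :: "real \<Rightarrow> real^'n"
  assumes p: "1 \<le> p" and f: "f \<in> Lp_set p"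
  shows "(\<lambda>t. f (t - c)) \<in> Lp_set p" "Lp_norm p (\<lambda>t. f (t - c)) \<le> 2 * (1 + c\<^sup>2) * Lp_norm p f"
proof -
  let ?K = "2 * (1 + c\<^sup>2)"
  have K: "1 \<le> ?K" by simp
  have fm: "f \<in> borel_measurable lebesgue" using f by (rule Lp_set_measurable)
  have m: "(\<lambda>t. f (t - c)) \<in> borel_measurable lebesgue"
    using measurable_compose[OF translation_measurable[of "- c"] fm] by simp
  have b: "lp_bound p f (Lp_norm p f)" using Lp_ballD[OF p f] by simp
  have w: "weight (t + c) \<le> ?K * weight t" for t using weight_shift[of "t + c" t] by simp
  have "lp_bound p (\<lambda>t. f (t - c)) (?K * Lp_norm p f)"
  proof (cases "p = \<infinity>")
    case True
    then have "AE t in lebesgue. norm (f t) * weight t \<le> Lp_norm p f" using b by (simp add: lp_bound_def)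
    then have "AE t in lebesgue. norm (f t) * weight (t + c) \<le> ?K * Lp_norm p f"
    proof eventually_elim
      case (elim t)
      have "norm (f t) * weight (t + c) \<le> norm (f t) * (?K * weight t)" using w by (intro mult_left_mono) auto
      also have "\<dots> = ?K * (norm (f t) * weight t)" by simp
      also have "\<dots> \<le> ?K * Lp_norm p f" using elim K by (intro mult_left_mono) auto
      finally show ?case .
    qed
    from AE_translation[OF this, of "- c"] show ?thesis by (simp add: lp_bound_def True)
  next
    case False
    define q where "q = enn2real p"
    have q: "1 \<le> q" using finite_exponent[OF p False] by (simp add: q_def)
    have "(\<integral>\<^sup>+t. ennreal (weight t * norm (f (t - c)) powr q) \<partial>lebesgue)
        = (\<integral>\<^sup>+t. ennreal (weight (t + c) * norm (f t) powr q) \<partial>lebesgue)"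
    proof -
      have "(\<lambda>t. ennreal (weight t * norm (f (t - c)) powr q)) \<in> borel_measurable lebesgue"
        using m by measurable
      from nn_integral_real_affine_lebesgue[OF this, of 1 c] show ?thesis by (simp add: add.commute)
    qed
    also have "\<dots> \<le> (\<integral>\<^sup>+t. ennreal ?K * ennreal (weight t * norm (f t) powr q) \<partial>lebesgue)"
    proof (rule nn_integral_mono)
      fix t
      have "weight (t + c) * norm (f t) powr q \<le> ?K * (weight t * norm (f t) powr q)"
        using mult_right_mono[OF w[of t], of "norm (f t) powr q"] by (simp add: mult.assoc)
      then show "ennreal (weight (t + c) * norm (f t) powr q) \<le> ennreal ?K * ennreal (weight t * norm (f t) powr q)"
        using K weight_pos[of t] by (subst ennreal_mult[symmetric]) (auto intro: ennreal_leI)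
    qed
    also have "\<dots> = ennreal ?K * (\<integral>\<^sup>+t. ennreal (weight t * norm (f t) powr q) \<partial>lebesgue)"
      by (intro nn_integral_cmult, use fm in measurable)
    also have "\<dots> \<le> ennreal ?K * ennreal (Lp_norm p f powr q)"
      using b by (intro mult_left_mono) (auto simp: lp_bound_finite[OF False] q_def)
    also have "\<dots> = ennreal (?K * Lp_norm p f powr q)" using K by (intro ennreal_mult[symmetric]) auto
    also have "\<dots> \<le> ennreal ((?K * Lp_norm p f) powr q)"
    proof (rule ennreal_leI)
      have "?K powr 1 \<le> ?K powr q" using K q by (intro powr_mono) auto
      then have "?K \<le> ?K powr q" using K by simp
      then show "?K * Lp_norm p f powr q \<le> (?K * Lp_norm p f) powr q"
        using K Lp_norm_nonneg[of p f] by (subst powr_mult) (auto intro: mult_right_mono)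
    qed
    finally show ?thesis by (simp add: lp_bound_finite[OF False] q_def)
  qed
  moreover have "0 \<le> ?K * Lp_norm p f" by (intro mult_nonneg_nonneg Lp_norm_nonneg) auto
  ultimately show "(\<lambda>t. f (t - c)) \<in> Lp_set p" "Lp_norm p (\<lambda>t. f (t - c)) \<le> ?K * Lp_norm p f"
    using Lp_ballI[OF p _ m] by auto
qed

lemma Lp_fatou:
  fixes f :: "nat \<Rightarrow> real \<Rightarrow> real^'n"
  assumes p: "1 \<le> p" and f: "\<And>n. f n \<in> Lp_set p" "\<And>n. Lp_norm p (f n) \<le> c"
    and g: "g \<in> borel_measurable lebesgue" and lim: "AE t in lebesgue. (\<lambda>n. f n t) \<longlonglongrightarrow> g t"
  shows "g \<in> Lp_set p" "Lp_norm p g \<le> c"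
proof -
  have c: "0 \<le> c" using f(2)[of 0] Lp_norm_nonneg[of p "f 0"] by linarith
  have fm: "f n \<in> borel_measurable lebesgue" for n using f(1) by (rule Lp_set_measurable)
  have b: "lp_bound p (f n) c" for n using Lp_ballD[OF p f] .
  have "lp_bound p g c"
  proof (cases "p = \<infinity>")
    case True
    have "AE t in lebesgue. \<forall>n. norm (f n t) * weight t \<le> c"
      using b by (simp add: lp_bound_def True AE_all_countable)
    with lim have "AE t in lebesgue. norm (g t) * weight t \<le> c"
    proof eventually_elim
      case (elim t)
      have "(\<lambda>n. norm (f n t) * weight t) \<longlonglongrightarrow> norm (g t) * weight t"
        using elim by (intro tendsto_intros)
      then show ?case by (rule LIMSEQ_le_const2) (use elim in auto)
    qed
    then show ?thesis by (simp add: lp_bound_def True)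
  next
    case False
    define q where "q = enn2real p"
    have q: "1 \<le> q" using finite_exponent[OF p False] by (simp add: q_def)
    define F where "F n t = ennreal (weight t * norm (f n t) powr q)" for n t
    have "(\<integral>\<^sup>+t. ennreal (weight t * norm (g t) powr q) \<partial>lebesgue) = (\<integral>\<^sup>+t. liminf (\<lambda>n. F n t) \<partial>lebesgue)"
    proof (rule nn_integral_cong_AE)
      show "AE t in lebesgue. ennreal (weight t * norm (g t) powr q) = liminf (\<lambda>n. F n t)"
        using lim
      proof eventually_elim
        case (elim t)
        have "((\<lambda>n. weight t * norm (f n t) powr q) \<longlongrightarrow> weight t * norm (g t) powr q) sequentially"
          using q elim by (intro tendsto_intros) auto
        then have "(\<lambda>n. F n t) \<longlonglongrightarrow> ennreal (weight t * norm (g t) powr q)"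
          unfolding F_def by (rule tendsto_ennrealI)
        then show ?case by (metis lim_imp_Liminf trivial_limit_sequentially)
      qed
    qed
    also have "\<dots> \<le> liminf (\<lambda>n. \<integral>\<^sup>+t. F n t \<partial>lebesgue)"
      by (rule nn_integral_liminf) (use fm in \<open>simp add: F_def[abs_def]\<close>)
    also have "\<dots> \<le> ennreal (c powr q)"
      using b by (intro Liminf_le) (auto simp: lp_bound_finite[OF False] q_def F_def)
    finally show ?thesis by (simp add: lp_bound_finite[OF False] q_def)
  qed
  then show "g \<in> Lp_set p" "Lp_norm p g \<le> c" using Lp_ballI[OF p c g] by auto
qed

lemma Lp_bounded_on_interval:
  fixes f :: "real \<Rightarrow> real^'n"
  assumes p: "1 \<le> p" and f: "f \<in> borel_measurable lebesgue" and ab: "a \<le> b" and B: "0 \<le> B"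
    and bnd: "\<And>t. t \<in> {a..b} \<Longrightarrow> norm (f t) \<le> B" and out: "\<And>t. t \<notin> {a..b} \<Longrightarrow> f t = 0"
  shows "f \<in> Lp_set p"
    "Lp_norm p f \<le> (1 + (b - a)) * (2 * (1 + (b - a)\<^sup>2)) * (B * point_weight p a)"
proof -
  let ?h = "b - a" and ?K = "2 * (1 + (b - a)\<^sup>2)"
  have K: "1 \<le> ?K" by simp
  let ?M = "(1 + ?h) * ?K"
  have M: "?K \<le> ?M" "1 \<le> ?M" using ab K mult_mono[of 1 "1 + ?h" 1 ?K] mult_right_mono[of 1 "1 + ?h" ?K] by auto
  have w: "weight t \<le> ?K * weight a" if "t \<in> {a..b}" for t
  proof -
    have "(t - a)\<^sup>2 \<le> ?h\<^sup>2" using that by (intro power_mono) auto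
    then have "2 * (1 + (t - a)\<^sup>2) * weight a \<le> ?K * weight a" using weight_pos[of a] by (intro mult_right_mono) auto
    then show ?thesis using weight_shift[of t a] by linarith
  qed
  have "lp_bound p f (?M * (B * point_weight p a))"
  proof (cases "p = \<infinity>")
    case True
    have pw: "point_weight p a = weight a" using weight_pos[of a] by (simp add: True point_weight_def weight_exponent_def)
    have "norm (f t) * weight t \<le> ?M * (B * weight a)" for t
    proof (cases "t \<in> {a..b}")
      case True
      then have "norm (f t) * weight t \<le> B * (?K * weight a)"
        using bnd w B weight_pos[of t] by (intro mult_mono) (auto intro: less_imp_le)
      also have "\<dots> = ?K * (B * weight a)" by simp
      also have "\<dots> \<le> ?M * (B * weight a)" using M B weight_pos[of a] by (intro mult_right_mono) auto
      finally show ?thesis .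
    next
      case False
      then have "norm (f t) * weight t = 0" using out by simp
      moreover have "0 \<le> ?M * (B * weight a)" using ab B weight_pos[of a] by (intro mult_nonneg_nonneg) auto
      ultimately show ?thesis by linarith
    qed
    then show ?thesis unfolding lp_bound_def pw using True by simp
  next
    case False
    define q where "q = enn2real p"
    have q: "1 \<le> q" using finite_exponent[OF p False] by (simp add: q_def)
    have "(\<integral>\<^sup>+t. ennreal (weight t * norm (f t) powr q) \<partial>lebesgue)
        \<le> (\<integral>\<^sup>+t. ennreal (?K * weight a * B powr q) * indicator {a..b} t \<partial>lebesgue)"
    proof (rule nn_integral_mono)
      fix t
      show "ennreal (weight t * norm (f t) powr q) \<le> ennreal (?K * weight a * B powr q) * indicator {a..b} t"
      proof (cases "t \<in> {a..b}")
        case True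
        then have "weight t * norm (f t) powr q \<le> ?K * weight a * B powr q"
          using w bnd q weight_pos[of t] weight_pos[of a] by (intro mult_mono powr_mono2) auto
        then show ?thesis using True by (simp add: ennreal_leI)
      qed (use out q in simp)
    qed
    also have "\<dots> = ennreal (?K * weight a * B powr q) * ennreal ?h"
      using ab by (subst nn_integral_cmult_indicator) auto
    also have "\<dots> = ennreal (?K * weight a * B powr q * ?h)"
      using K weight_pos[of a] ab by (intro ennreal_mult[symmetric]) auto
    also have "\<dots> \<le> ennreal ((?M * (B * point_weight p a)) powr q)"
    proof (rule ennreal_leI)
      have pw: "point_weight p a powr q = weight a"
        using q weight_pos[of a] by (simp add: point_weight_def weight_exponent_finite[OF False] powr_powr flip: q_def)
      have "?K * ?h \<le> ?M" using K ab by (simp add: algebra_simps)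
      also have "?M = ?M powr 1" using M by simp
      also have "\<dots> \<le> ?M powr q" using M q by (intro powr_mono) auto
      finally have "?K * ?h * (weight a * B powr q) \<le> ?M powr q * (weight a * B powr q)"
        using weight_pos[of a] by (intro mult_right_mono) auto
      also have "\<dots> = (?M * (B * point_weight p a)) powr q"
        using M B point_weight_pos[of p a] by (simp add: powr_mult pw)
      finally show "?K * weight a * B powr q * ?h \<le> (?M * (B * point_weight p a)) powr q"
        by (simp only: ac_simps)
    qed
    finally show ?thesis by (simp add: lp_bound_finite[OF False] q_def)
  qed
  moreover have "0 \<le> ?M * (B * point_weight p a)"
    using ab B point_weight_pos[of p a] by (intro mult_nonneg_nonneg) auto
  ultimately show "f \<in> Lp_set p" "Lp_norm p f \<le> ?M * (B * point_weight p a)"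
    using Lp_ballI[OF p _ f] by auto
qed

text \<open>The local \<open>L\<^sup>1\<close> estimate. It integrates the elementary inequality
  \<open>x \<le> m + m\<^sup>1\<^sup>-\<^sup>q x\<^sup>q\<close>, with \<open>m\<close> the value that the norm would give to a bump of norm \<open>c\<close>.\<close>

lemma Lp_local_nn_integral:
  fixes f :: "real \<Rightarrow> real^'n"
  assumes p: "1 \<le> p" and f: "f \<in> Lp_set p" and ab: "a \<le> b"
  shows "(\<integral>\<^sup>+t. ennreal (norm (f t)) * indicator {a..b} t \<partial>lebesgue)
    \<le> ennreal (((b - a) + 1) * (2 * (1 + (b - a)\<^sup>2)) * Lp_norm p f / point_weight p a)"
proof (rule ennreal_le_epsilon)
  let ?h = "b - a" and ?K = "2 * (1 + (b - a)\<^sup>2)"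
  fix e :: real assume e: "e > 0"
  have K: "1 \<le> ?K" by simp
  define C where "C = (?h + 1) * ?K / point_weight p a"
  have "0 < ?h + 1" "0 < ?K" using ab K by linarith+
  then have C: "C > 0" unfolding C_def by (simp only: divide_pos_pos mult_pos_pos point_weight_pos)
  define c where "c = Lp_norm p f + e / C"
  have c: "0 < c" using e C Lp_norm_nonneg[of p f] by (auto simp: c_def intro!: add_nonneg_pos)
  define m where "m = c / point_weight p a"
  have m: "0 < m" using c point_weight_pos[of p a] by (simp add: m_def)
  have fm[measurable]: "f \<in> borel_measurable lebesgue" using f by (rule Lp_set_measurable)
  have b: "lp_bound p f c" using e C by (intro Lp_ballD[OF p f]) (simp add: c_def)
  have w: "1 \<le> ?K * weight t / weight a" if "t \<in> {a..b}" for t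
  proof -
    have "(a - t)\<^sup>2 \<le> ?h\<^sup>2" using that by (subst power2_commute, intro power_mono) auto
    then have "2 * (1 + (a - t)\<^sup>2) * weight t \<le> ?K * weight t" using weight_pos[of t] by (intro mult_right_mono) auto
    then have "weight a \<le> ?K * weight t" using weight_shift[of a t] by linarith
    then show ?thesis using weight_pos[of a] by (simp add: field_simps)
  qed
  have "(\<integral>\<^sup>+t. ennreal (norm (f t)) * indicator {a..b} t \<partial>lebesgue) \<le> ennreal ((?h + 1) * ?K * m)"
  proof (cases "p = \<infinity>")
    case True
    have pw: "point_weight p a = weight a" using weight_pos[of a] by (simp add: True point_weight_def weight_exponent_def)
    have "AE t in lebesgue. norm (f t) * weight t \<le> c" using b by (simp add: lp_bound_def True)
    then have "(\<integral>\<^sup>+t. ennreal (norm (f t)) * indicator {a..b} t \<partial>lebesgue) \<le> (\<integral>\<^sup>+t. ennreal (?K * m) * indicator {a..b} t \<partial>lebesgue)"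
    proof (intro nn_integral_mono_AE, eventually_elim)
      case (elim t)
      show ?case
      proof (cases "t \<in> {a..b}")
        case True
        have "norm (f t) * 1 \<le> norm (f t) * (?K * weight t / weight a)"
          by (rule mult_left_mono[OF w[OF True] norm_ge_zero])
        also have "\<dots> = ?K * (norm (f t) * weight t) / weight a" by simp
        also have "\<dots> \<le> ?K * c / weight a"
          using elim K weight_pos[of a] by (intro divide_right_mono mult_left_mono) auto
        also have "\<dots> = ?K * m" by (simp add: m_def pw)
        finally show ?thesis using True by (simp add: ennreal_leI)
      qed simp
    qed
    also have "\<dots> = ennreal (?K * m) * ennreal ?h" using ab by (subst nn_integral_cmult_indicator) auto
    also have "\<dots> = ennreal (?K * m * ?h)" using K m ab by (intro ennreal_mult[symmetric]) auto
    also have "\<dots> \<le> ennreal ((?h + 1) * ?K * m)" using K m by (intro ennreal_leI) (simp add: algebra_simps)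
    finally show ?thesis .
  next
    case False
    define q where "q = enn2real p"
    have q: "1 \<le> q" using finite_exponent[OF p False] by (simp add: q_def)
    define L where "L = m powr (1 - q) * (?K / weight a)"
    have L: "0 \<le> L" using K weight_pos[of a] by (simp add: L_def)
    have pt: "norm (f t) \<le> m + L * (weight t * norm (f t) powr q)" if t: "t \<in> {a..b}" for t
    proof -
      have "norm (f t) \<le> m + m powr (1 - q) * norm (f t) powr q"
      proof (cases "norm (f t) \<le> m")
        case True
        then show ?thesis by (simp add: add_increasing2)
      next
        case False
        then have "norm (f t) powr (1 - q) \<le> m powr (1 - q)"
          using m q by (intro powr_mono2') auto
        then have "norm (f t) powr (1 - q) * norm (f t) powr q \<le> m powr (1 - q) * norm (f t) powr q"
          by (intro mult_right_mono) auto
        moreover have "norm (f t) powr (1 - q) * norm (f t) powr q = norm (f t)"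
          using False m by (simp flip: powr_add)
        ultimately show ?thesis using m by simp
      qed
      also have "m powr (1 - q) * norm (f t) powr q * 1 \<le> m powr (1 - q) * norm (f t) powr q * (?K * weight t / weight a)"
        by (intro mult_left_mono w t) auto
      then have "m + m powr (1 - q) * norm (f t) powr q \<le> m + L * (weight t * norm (f t) powr q)"
        by (simp add: L_def ac_simps)
      finally show ?thesis .
    qed
    have "(\<integral>\<^sup>+t. ennreal (norm (f t)) * indicator {a..b} t \<partial>lebesgue)
        \<le> (\<integral>\<^sup>+t. ennreal m * indicator {a..b} t + ennreal L * ennreal (weight t * norm (f t) powr q) \<partial>lebesgue)"
    proof (rule nn_integral_mono)
      fix t
      show "ennreal (norm (f t)) * indicator {a..b} t \<le> ennreal m * indicator {a..b} t + ennreal L * ennreal (weight t * norm (f t) powr q)"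
      proof (cases "t \<in> {a..b}")
        case True
        then have "ennreal (norm (f t)) \<le> ennreal (m + L * (weight t * norm (f t) powr q))" by (intro ennreal_leI pt)
        also have "\<dots> = ennreal m + ennreal L * ennreal (weight t * norm (f t) powr q)"
          using L m weight_pos[of t] by (simp add: ennreal_plus ennreal_mult)
        finally show ?thesis using True by simp
      qed simp
    qed
    also have "\<dots> = ennreal m * ennreal ?h + ennreal L * (\<integral>\<^sup>+t. ennreal (weight t * norm (f t) powr q) \<partial>lebesgue)"
    proof -
      have F: "(\<lambda>t. ennreal (weight t * norm (f t) powr q)) \<in> borel_measurable lebesgue" by measurable
      have "(\<integral>\<^sup>+t. ennreal m * indicator {a..b} t + ennreal L * ennreal (weight t * norm (f t) powr q) \<partial>lebesgue)
          = (\<integral>\<^sup>+t. ennreal m * indicator {a..b} t \<partial>lebesgue)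
            + (\<integral>\<^sup>+t. ennreal L * ennreal (weight t * norm (f t) powr q) \<partial>lebesgue)"
        by (intro nn_integral_add borel_measurable_times_ennreal borel_measurable_indicator F) simp_all
      also have "(\<integral>\<^sup>+t. ennreal m * indicator {a..b} t \<partial>lebesgue) = ennreal m * ennreal ?h"
        using ab by (subst nn_integral_cmult_indicator) simp_all
      also have "(\<integral>\<^sup>+t. ennreal L * ennreal (weight t * norm (f t) powr q) \<partial>lebesgue)
          = ennreal L * (\<integral>\<^sup>+t. ennreal (weight t * norm (f t) powr q) \<partial>lebesgue)"
        by (rule nn_integral_cmult[OF F])
      finally show ?thesis .
    qed
    also have "\<dots> \<le> ennreal m * ennreal ?h + ennreal L * ennreal (c powr q)"
      using b by (intro add_mono mult_left_mono) (auto simp: lp_bound_finite[OF False] q_def)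
    also have "\<dots> = ennreal (m * ?h + L * c powr q)"
      using m ab L by (simp add: ennreal_plus ennreal_mult)
    also have "\<dots> \<le> ennreal ((?h + 1) * ?K * m)"
    proof (rule ennreal_leI)
      have pw: "point_weight p a powr q = weight a"
        using q weight_pos[of a] by (simp add: point_weight_def weight_exponent_finite[OF False] powr_powr flip: q_def)
      have "c = m * point_weight p a" using point_weight_pos[of p a] by (simp add: m_def)
      then have "c powr q = m powr q * weight a"
        using m point_weight_pos[of p a] by (simp add: powr_mult pw)
      then have "L * c powr q = ?K * (m powr (1 - q) * m powr q)" using weight_pos[of a] by (simp add: L_def)
      also have "m powr (1 - q) * m powr q = m" using m by (simp flip: powr_add)
      finally have "L * c powr q = ?K * m" .
      moreover have "m * ?h \<le> ?K * m * ?h" using K m ab mult_right_mono[of 1 ?K "m * ?h"] by (simp add: ac_simps)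
      ultimately show "m * ?h + L * c powr q \<le> (?h + 1) * ?K * m" by (simp add: algebra_simps)
    qed
    finally show ?thesis .
  qed
  also have "(?h + 1) * ?K * m = C * Lp_norm p f + e"
  proof -
    have "(?h + 1) * ?K * m = C * c" by (simp add: C_def m_def)
    also have "\<dots> = C * Lp_norm p f + e" using C by (simp add: c_def distrib_left)
    finally show ?thesis .
  qed
  also have "ennreal (C * Lp_norm p f + e) = ennreal ((?h + 1) * ?K * Lp_norm p f / point_weight p a) + ennreal e"
  proof -
    have "0 \<le> C * Lp_norm p f" using C by (intro mult_nonneg_nonneg Lp_norm_nonneg) simp
    then have "ennreal (C * Lp_norm p f + e) = ennreal (C * Lp_norm p f) + ennreal e"
      using e by (simp add: ennreal_plus)
    then show ?thesis by (simp add: C_def)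
  qed
  finally show "(\<integral>\<^sup>+t. ennreal (norm (f t)) * indicator {a..b} t \<partial>lebesgue)
    \<le> ennreal ((?h + 1) * ?K * Lp_norm p f / point_weight p a) + ennreal e" .
qed

lemma Lp_local_integral:
  fixes f :: "real \<Rightarrow> real^'n"
  assumes p: "1 \<le> p" and f: "f \<in> Lp_set p" and ab: "a \<le> b"
  shows "f absolutely_integrable_on {a..b}"
    "integral {a..b} (\<lambda>t. norm (f t)) \<le> ((b - a) + 1) * (2 * (1 + (b - a)\<^sup>2)) * Lp_norm p f / point_weight p a"
proof -
  let ?C = "((b - a) + 1) * (2 * (1 + (b - a)\<^sup>2)) * Lp_norm p f / point_weight p a"
  have C: "0 \<le> ?C" using ab Lp_norm_nonneg[of p f] point_weight_pos[of p a]
    by (intro divide_nonneg_pos mult_nonneg_nonneg) auto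
  have fm[measurable]: "f \<in> borel_measurable lebesgue" using f by (rule Lp_set_measurable)
  have eq: "(\<integral>\<^sup>+t. ennreal (norm (indicator {a..b} t *\<^sub>R f t)) \<partial>lebesgue)
      = (\<integral>\<^sup>+t. ennreal (norm (f t)) * indicator {a..b} t \<partial>lebesgue)"
    by (intro nn_integral_cong) (auto split: split_indicator)
  note le = Lp_local_nn_integral[OF p f ab]
  have "integrable lebesgue (\<lambda>t. indicator {a..b} t *\<^sub>R f t)"
  proof (rule integrableI_bounded)
    show "(\<lambda>t. indicator {a..b} t *\<^sub>R f t) \<in> borel_measurable lebesgue"
      by (intro borel_measurable_scaleR borel_measurable_indicator fm) simp
    show "(\<integral>\<^sup>+t. ennreal (norm (indicator {a..b} t *\<^sub>R f t)) \<partial>lebesgue) < \<infinity>"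
      unfolding eq infinity_ennreal_def by (rule le_less_trans[OF le ennreal_less_top])
  qed
  then show ai: "f absolutely_integrable_on {a..b}" by (simp add: set_integrable_def)
  then have "(\<lambda>t. norm (f t)) integrable_on {a..b}" by (rule absolutely_integrable_on_def[THEN iffD1, THEN conjunct2])
  then have "((\<lambda>t. norm (f t)) has_integral integral {a..b} (\<lambda>t. norm (f t))) {a..b}" by (rule integrable_integral)
  then have "(\<integral>\<^sup>+t. ennreal (norm (f t)) * indicator {a..b} t \<partial>lborel) = ennreal (integral {a..b} (\<lambda>t. norm (f t)))"
    by (intro nn_integral_has_integral_lebesgue') auto
  then have "ennreal (integral {a..b} (\<lambda>t. norm (f t))) \<le> ennreal ?C"
    using le by (simp add: nn_integral_completion)
  then show "integral {a..b} (\<lambda>t. norm (f t)) \<le> ?C" using C by (simp add: ennreal_le_iff)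
qed

text \<open>Completeness. The local estimate makes an absolutely convergent series converge almost
  everywhere, and Fatou's lemma bounds its remainders.\<close>

lemma Lp_complete:
  fixes f :: "nat \<Rightarrow> real \<Rightarrow> real^'n"
  assumes p: "1 \<le> p" and f: "\<And>k. f k \<in> Lp_set p" and s: "summable (\<lambda>k. Lp_norm p (f k))"
  shows "\<exists>g\<in>Lp_set p. (\<lambda>m. Lp_norm p (g - (\<Sum>k<m. f k))) \<longlonglongrightarrow> 0"
proof -
  interpret Y: seminormed_space "Lp_set p :: (real \<Rightarrow> real^'n) set" "Lp_norm p" by (rule Lp_seminormed[OF p])
  have fm[measurable]: "f k \<in> borel_measurable lebesgue" for k using f by (rule Lp_set_measurable)
  have "AE t in lebesgue. t \<in> {- real m..real m} \<longrightarrow> summable (\<lambda>k. norm (f k t))" for m :: nat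
  proof -
    define C where "C = ((real m - - real m) + 1) * (2 * (1 + (real m - - real m)\<^sup>2)) / point_weight p (- real m)"
    have C: "0 \<le> C" using point_weight_pos[of p "- real m"] by (auto simp: C_def)
    let ?i = "indicator {- real m..real m} :: real \<Rightarrow> ennreal"
    have im: "(\<lambda>t. ennreal (norm (f k t)) * ?i t) \<in> borel_measurable lebesgue" for k
      by (intro borel_measurable_times_ennreal borel_measurable_indicator) simp_all
    have "(\<integral>\<^sup>+t. (\<Sum>k. ennreal (norm (f k t)) * ?i t) \<partial>lebesgue) = (\<Sum>k. \<integral>\<^sup>+t. ennreal (norm (f k t)) * ?i t \<partial>lebesgue)"
      by (intro nn_integral_suminf im)
    also have "\<dots> \<le> (\<Sum>k. ennreal (C * Lp_norm p (f k)))"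
    proof (intro suminf_le summableI)
      fix k show "(\<integral>\<^sup>+t. ennreal (norm (f k t)) * ?i t \<partial>lebesgue) \<le> ennreal (C * Lp_norm p (f k))"
        using Lp_local_nn_integral[OF p f, of "- real m" "real m" k] by (simp add: C_def)
    qed
    also have "\<dots> < \<infinity>"
      using summable_mult[OF s, of C] C by (subst suminf_ennreal2) (auto intro: mult_nonneg_nonneg Lp_norm_nonneg)
    finally have "AE t in lebesgue. (\<Sum>k. ennreal (norm (f k t)) * ?i t) \<noteq> \<infinity>"
      by (intro nn_integral_PInf_AE borel_measurable_suminf_order im) simp
    then show ?thesis
    proof eventually_elim
      case (elim t)
      show ?case
      proof
        assume "t \<in> {- real m..real m}"
        then have "(\<Sum>k. ennreal (norm (f k t))) \<noteq> top" using elim by simp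
        then show "summable (\<lambda>k. norm (f k t))" by (rule summable_suminf_not_top[rotated]) auto
      qed
    qed
  qed
  then have "AE t in lebesgue. \<forall>m::nat. t \<in> {- real m..real m} \<longrightarrow> summable (\<lambda>k. norm (f k t))"
    by (intro AE_all_countable[THEN iffD2] allI) blast
  then have sm: "AE t in lebesgue. summable (\<lambda>k. f k t)"
  proof eventually_elim
    case (elim t)
    obtain m :: nat where "\<bar>t\<bar> \<le> real m" using real_arch_simple by blast
    then have "t \<in> {- real m..real m}" by auto
    then have "summable (\<lambda>k. norm (f k t))" using elim by blast
    then show ?case by (rule summable_norm_cancel)
  qed
  define g where "g t = (\<Sum>k. f k t)" for t
  have gm[measurable]: "g \<in> borel_measurable lebesgue" unfolding g_def[abs_def] by measurable
  define r where "r m = (\<Sum>k. Lp_norm p (f (k + m)))" for m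
  have S: "(\<Sum>k<m. f k) \<in> Lp_set p" for m by (rule Y.sum_closed[OF f])
  have Sap: "(\<Sum>k<m. f k) t = (\<Sum>k<m. f k t)" for m t by (induction m) auto
  have tail: "g - (\<Sum>k<m. f k) \<in> Lp_set p \<and> Lp_norm p (g - (\<Sum>k<m. f k)) \<le> r m" for m
  proof -
    define h where "h n t = (\<Sum>k<n. f (k + m) t)" for n t
    have "h n \<in> Lp_set p \<and> Lp_norm p (h n) \<le> r m" for n
    proof -
      have "h n \<in> Lp_set p \<and> Lp_norm p (h n) \<le> (\<Sum>k<n. Lp_norm p (f (k + m)))"
        unfolding h_def[abs_def] by (rule Lp_sum[OF p]) (auto intro: f)
      moreover have "(\<Sum>k<n. Lp_norm p (f (k + m))) \<le> r m"
        unfolding r_def using summable_ignore_initial_segment[OF s] Lp_norm_nonneg by (intro sum_le_suminf) auto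
      ultimately show ?thesis by linarith
    qed
    moreover have "AE t in lebesgue. (\<lambda>n. h n t) \<longlonglongrightarrow> (g - (\<Sum>k<m. f k)) t"
      using sm
    proof eventually_elim
      case (elim t)
      have "(\<lambda>k. f (k + m) t) sums (g t - (\<Sum>k<m. f k t))"
        using sums_split_initial_segment[OF summable_sums[OF elim], of m] by (simp add: g_def)
      then show ?case by (simp add: sums_def h_def Sap)
    qed
    moreover have "g - (\<Sum>k<m. f k) \<in> borel_measurable lebesgue"
      using Lp_set_measurable[OF S[of m]] by (simp add: fun_diff_def)
    ultimately show ?thesis using Lp_fatou[OF p, of h "r m" "g - (\<Sum>k<m. f k)"] by blast
  qed
  have "r \<longlonglongrightarrow> 0" unfolding r_def[abs_def] using s by (rule suminf_exist_split2)
  then have "(\<lambda>m. Lp_norm p (g - (\<Sum>k<m. f k))) \<longlonglongrightarrow> 0"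
    by (rule tendsto_sandwich[OF _ _ tendsto_const, rotated 2]) (simp_all add: tail Lp_norm_nonneg)
  moreover have "g \<in> Lp_set p" using tail[of 0] by simp
  ultimately show ?thesis by blast
qed

section \<open>Delay equations as integral equations\<close>

lemma bounded_measurable_integrable:
  fixes g :: "real \<Rightarrow> 'a::euclidean_space"
  assumes g: "g \<in> borel_measurable lebesgue" and bnd: "\<And>t. t \<in> {a..b} \<Longrightarrow> norm (g t) \<le> c"
  shows "g absolutely_integrable_on {a..b}"
proof (rule measurable_bounded_by_integrable_imp_absolutely_integrable)
  show "g \<in> borel_measurable (lebesgue_on {a..b})" using g by (rule measurable_restrict_space1)
  show "(\<lambda>_. c) integrable_on {a..b}" by (rule integrable_const_ivl)
qed (use bnd in auto)

lemma continuous_imp_lebesgue_measurable: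
  fixes x :: "real \<Rightarrow> 'a::euclidean_space"
  assumes "continuous_on UNIV x"
  shows "x \<in> borel_measurable lebesgue"
  using borel_measurable_continuous_onI[OF assms] by (simp add: measurable_completion)

lemma continuous_bounded_on_interval:
  fixes x :: "real \<Rightarrow> 'a::real_normed_vector"
  assumes "continuous_on UNIV x"
  obtains c where "0 \<le> c" "\<And>t. t \<in> {a..b} \<Longrightarrow> norm (x t) \<le> c"
proof -
  have "compact (x ` {a..b})" by (intro compact_continuous_image continuous_on_subset[OF assms]) auto
  then obtain c where c: "\<forall>y\<in>x ` {a..b}. norm y \<le> c" using compact_imp_bounded bounded_iff by blast
  have "norm (x t) \<le> max c 0" if "t \<in> {a..b}" for t
  proof -
    have "norm (x t) \<le> c" using c that by blast
    then show ?thesis by simp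
  qed
  then show ?thesis using that[of "max c 0"] by simp
qed

lemma matrix_vector_mult_measurable:
  fixes F :: "real \<Rightarrow> real^'n^'n" and x :: "real \<Rightarrow> real^'n"
  assumes "F \<in> borel_measurable M" "x \<in> borel_measurable M"
  shows "(\<lambda>t. F t *v x t) \<in> borel_measurable M"
proof (rule borel_measurable_continuous_Pair[OF assms])
  show "continuous_on UNIV (\<lambda>z :: (real^'n^'n) \<times> (real^'n). fst z *v snd z)"
    unfolding matrix_vector_mult_def by (intro continuous_intros)
qed

lemma norm_matrix_vector_mult_le:
  fixes F :: "real^'n^'n" and v :: "real^'n"
  shows "norm (F *v v) \<le> (real CARD('n) * norm F) * norm v"
proof -
  have "norm (F *v v) \<le> (\<Sum>i\<in>UNIV. \<bar>(F *v v) $ i\<bar>)" by (rule norm_le_l1_cart)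
  also have "\<dots> \<le> (\<Sum>i\<in>(UNIV::'n set). norm F * norm v)"
  proof (rule sum_mono)
    fix i :: 'n
    have "\<bar>(F *v v) $ i\<bar> \<le> norm (F $ i) * norm v"
      unfolding matrix_vector_mul_component by (rule Cauchy_Schwarz_ineq2)
    also have "\<dots> \<le> norm F * norm v" by (intro mult_right_mono Finite_Cartesian_Product.norm_nth_le norm_ge_zero)
    finally show "\<bar>(F *v v) $ i\<bar> \<le> norm F * norm v" .
  qed
  finally show ?thesis by simp
qed

locale delay_system =
  fixes N :: nat and r :: "nat \<Rightarrow> real" and A :: "nat \<Rightarrow> real \<Rightarrow> real^'n^'n" and B :: real
  assumes delays: "delays N r"
    and A_measurable: "\<And>j. j \<le> N \<Longrightarrow> A j \<in> borel_measurable lebesgue"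
    and A_bound: "\<And>j t v. j \<le> N \<Longrightarrow> norm (A j t *v v) \<le> B * norm v"
    and B_pos: "0 < B"
begin

lemma r_bounds:
  assumes "j \<le> N"
  shows "0 \<le> r j" "r j \<le> r N"
proof -
  have r0: "r 0 = 0" using delays by (simp add: delays_def)
  have mono: "r i \<le> r k" if "i \<le> k" "k \<le> N" for i k
    using that
  proof (induction k rule: dec_induct)
    case (step k)
    then show ?case using delays unfolding delays_def by (meson Suc_le_lessD less_imp_le order.trans)
  qed simp
  show "0 \<le> r j" "r j \<le> r N" using mono[of 0 j] mono[of j N] r0 assms by auto
qed

lemma r_nonneg: "0 \<le> r N"
  using r_bounds[of N] by simp

text \<open>A bound for the operator norms of all \<open>L(t)\<close>.\<close>

definition M :: real where "M = real (Suc N) * B"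

lemma M_pos: "0 < M"
  using B_pos by (simp add: M_def)

definition lin :: "(real \<Rightarrow> real^'n) \<Rightarrow> real \<Rightarrow> real^'n" where
  "lin x t = (\<Sum>j\<le>N. A j t *v x (t - r j))"

lemma lin_bound:
  assumes "\<And>u. t - r N \<le> u \<Longrightarrow> u \<le> t \<Longrightarrow> norm (x u) \<le> c"
  shows "norm (lin x t) \<le> M * c"
proof -
  have "norm (lin x t) \<le> (\<Sum>j\<le>N. norm (A j t *v x (t - r j)))" unfolding lin_def by (rule norm_sum)
  also have "\<dots> \<le> (\<Sum>j\<le>N. B * c)"
  proof (rule sum_mono)
    fix j assume "j \<in> {..N}"
    then have j: "j \<le> N" by simp
    have "norm (A j t *v x (t - r j)) \<le> B * norm (x (t - r j))" by (rule A_bound[OF j])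
    also have "\<dots> \<le> B * c" using B_pos r_bounds[OF j] by (intro mult_left_mono assms) auto
    finally show "norm (A j t *v x (t - r j)) \<le> B * c" .
  qed
  finally show ?thesis by (simp add: M_def)
qed

lemma lin_add: "lin (\<lambda>t. x t + y t) t = lin x t + lin y t"
  by (simp add: lin_def matrix_vector_right_distrib sum.distrib)

lemma lin_diff: "lin (\<lambda>t. x t - y t) t = lin x t - lin y t"
  by (simp add: lin_def matrix_vector_mult_diff_distrib sum_subtractf)

lemma lin_scale: "lin (\<lambda>t. c *\<^sub>R x t) t = c *\<^sub>R lin x t"
  by (simp add: lin_def matrix_vector_mult_scaleR scaleR_sum_right)

lemma lin_cong: "(\<And>u. t - r N \<le> u \<Longrightarrow> u \<le> t \<Longrightarrow> x u = y u) \<Longrightarrow> lin x t = lin y t"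
  using r_bounds by (auto simp: lin_def intro!: sum.cong)

lemma lin_zero: "lin (\<lambda>_. 0) t = 0"
  by (simp add: lin_def)

lemma lin_measurable:
  assumes "x \<in> borel_measurable lebesgue"
  shows "lin x \<in> borel_measurable lebesgue"
proof -
  have "(\<lambda>t. x (t - r j)) \<in> borel_measurable lebesgue" for j
    using measurable_compose[OF translation_measurable[of "- r j"] assms] by simp
  then show ?thesis
    unfolding lin_def[abs_def] by (intro borel_measurable_sum matrix_vector_mult_measurable A_measurable) auto
qed

lemma lin_integrable:
  assumes "continuous_on UNIV x"
  shows "lin x absolutely_integrable_on {a..b}" "lin x integrable_on {a..b}"
proof -
  obtain c where c: "\<And>t. t \<in> {a - r N..b} \<Longrightarrow> norm (x t) \<le> c"
    using continuous_bounded_on_interval[OF assms] by blast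
  have "norm (lin x t) \<le> M * c" if "t \<in> {a..b}" for t
    using that by (intro lin_bound c) auto
  then show "lin x absolutely_integrable_on {a..b}"
    by (intro bounded_measurable_integrable[where c = "M * c"] lin_measurable
        continuous_imp_lebesgue_measurable assms) auto
  then show "lin x integrable_on {a..b}" by (rule set_lebesgue_integral_eq_integral)
qed

text \<open>Solutions of \<open>x' = lin x + f\<close> on \<open>[s, \<infinity>)\<close> and on the whole line, in integral form. They are
  defined and continuous on the whole line; before time \<open>s - r N\<close> they may take any values.\<close>

definition solves_from :: "real \<Rightarrow> (real \<Rightarrow> real^'n) \<Rightarrow> (real \<Rightarrow> real^'n) \<Rightarrow> bool" where
  "solves_from s f x \<longleftrightarrow> continuous_on UNIV x \<and>
     (\<forall>a b. s \<le> a \<and> a \<le> b \<longrightarrow> ((\<lambda>t. lin x t + f t) has_integral x b - x a) {a..b})"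

definition solves :: "(real \<Rightarrow> real^'n) \<Rightarrow> (real \<Rightarrow> real^'n) \<Rightarrow> bool" where
  "solves f x \<longleftrightarrow> (\<forall>s. solves_from s f x)"

lemma solves_fromD:
  assumes "solves_from s f x"
  shows "continuous_on UNIV x"
    and "\<And>a b. s \<le> a \<Longrightarrow> a \<le> b \<Longrightarrow> ((\<lambda>t. lin x t + f t) has_integral x b - x a) {a..b}"
  using assms by (auto simp: solves_from_def)

lemma solvesD:
  assumes "solves f x"
  shows "continuous_on UNIV x"
    and "\<And>a b. a \<le> b \<Longrightarrow> ((\<lambda>t. lin x t + f t) has_integral x b - x a) {a..b}"
    and "solves_from s f x"
  using assms by (auto simp: solves_def solves_from_def)

lemma solvesI:
  assumes "continuous_on UNIV x" "\<And>a b. a \<le> b \<Longrightarrow> ((\<lambda>t. lin x t + f t) has_integral x b - x a) {a..b}"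
  shows "solves f x"
  using assms by (auto simp: solves_def solves_from_def)

lemma solves_from_later: "solves_from s f x \<Longrightarrow> s \<le> t \<Longrightarrow> solves_from t f x"
  by (auto simp: solves_from_def)

lemma solves_from_add:
  assumes "solves_from s f x" "solves_from s g y"
  shows "solves_from s (\<lambda>t. f t + g t) (\<lambda>t. x t + y t)"
  unfolding solves_from_def
proof (intro conjI allI impI continuous_on_add)
  fix a b assume ab: "s \<le> a \<and> a \<le> b"
  have "((\<lambda>t. (lin x t + f t) + (lin y t + g t)) has_integral (x b - x a) + (y b - y a)) {a..b}"
    using ab assms by (intro has_integral_add solves_fromD(2)[OF assms(1)] solves_fromD(2)[OF assms(2)]) auto
  then show "((\<lambda>t. lin (\<lambda>t. x t + y t) t + (f t + g t)) has_integral x b + y b - (x a + y a)) {a..b}"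
    by (simp add: lin_add algebra_simps)
qed (rule solves_fromD(1)[OF assms(1)] solves_fromD(1)[OF assms(2)])+

lemma solves_from_scale:
  assumes "solves_from s f x"
  shows "solves_from s (\<lambda>t. c *\<^sub>R f t) (\<lambda>t. c *\<^sub>R x t)"
  unfolding solves_from_def
proof (intro conjI allI impI continuous_on_scaleR continuous_on_const)
  fix a b assume ab: "s \<le> a \<and> a \<le> b"
  have "((\<lambda>t. c *\<^sub>R (lin x t + f t)) has_integral c *\<^sub>R (x b - x a)) {a..b}"
    using ab by (intro has_integral_cmul solves_fromD(2)[OF assms(1)]) auto
  then show "((\<lambda>t. lin (\<lambda>t. c *\<^sub>R x t) t + c *\<^sub>R f t) has_integral c *\<^sub>R x b - c *\<^sub>R x a) {a..b}"
    by (simp add: lin_scale algebra_simps)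
qed (rule solves_fromD(1)[OF assms(1)])

lemma solves_from_diff:
  assumes "solves_from s f x" "solves_from s g y"
  shows "solves_from s (\<lambda>t. f t - g t) (\<lambda>t. x t - y t)"
  using solves_from_add[OF assms(1) solves_from_scale[OF assms(2), of "-1"]] by simp

lemma solves_add: "solves f x \<Longrightarrow> solves g y \<Longrightarrow> solves (\<lambda>t. f t + g t) (\<lambda>t. x t + y t)"
  by (simp add: solves_def solves_from_add)

lemma solves_scale: "solves f x \<Longrightarrow> solves (\<lambda>t. c *\<^sub>R f t) (\<lambda>t. c *\<^sub>R x t)"
  by (simp add: solves_def solves_from_scale)

lemma solves_diff: "solves f x \<Longrightarrow> solves g y \<Longrightarrow> solves (\<lambda>t. f t - g t) (\<lambda>t. x t - y t)"
  by (simp add: solves_def solves_from_diff)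

text \<open>Gronwall's inequality by maximising \<open>\<bar>x(t)\<bar> e\<^sup>-\<^sup>M\<^sup>(\<^sup>t\<^sup>-\<^sup>s\<^sup>)\<close>: the integral equation at the
  maximum shows that the maximal value is at most the bound on the initial segment.\<close>

lemma solution_growth:
  assumes x: "solves_from s (\<lambda>_. 0) x"
    and init: "\<And>t. t \<in> {s - r N..s} \<Longrightarrow> norm (x t) \<le> c" and t: "s \<le> t"
  shows "norm (x t) \<le> c * exp (M * (t - s))"
proof -
  note cont = solves_fromD(1)[OF x]
  define w where "w u = exp (M * max (u - s) 0)" for u
  have w: "1 \<le> w u" "u \<le> v \<Longrightarrow> w u \<le> w v" for u v
    using M_pos by (auto simp: w_def intro!: mult_left_mono)
  have "continuous_on {s - r N..t} (\<lambda>u. norm (x u) / w u)"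
    unfolding w_def by (intro continuous_intros continuous_on_subset[OF cont]) auto
  moreover have "{s - r N..t} \<noteq> {}" using t r_nonneg by auto
  ultimately obtain t0 where t0: "t0 \<in> {s - r N..t}"
    and max: "\<And>u. u \<in> {s - r N..t} \<Longrightarrow> norm (x u) / w u \<le> norm (x t0) / w t0"
    using continuous_attains_sup[of "{s - r N..t}" "\<lambda>u. norm (x u) / w u"] by auto
  define K where "K = norm (x t0) / w t0"
  have w_pos: "0 < w u" for u by (simp add: w_def)
  have le: "norm (x u) \<le> K * w u" if "u \<in> {s - r N..t}" for u
    using max[OF that] w_pos[of u] by (simp add: K_def field_simps)
  have K0: "0 \<le> K" using w_pos[of t0] by (simp add: K_def)
  have "K \<le> c"
  proof (cases "t0 \<le> s")
    case True
    then have "w t0 = 1" by (simp add: w_def)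
    then show ?thesis using init[of t0] t0 True by (simp add: K_def)
  next
    case False
    have I: "((\<lambda>u. lin x u) has_integral x t0 - x s) {s..t0}"
      using solves_fromD(2)[OF x, of s t0] False by simp
    have E: "((\<lambda>u. M * (K * exp (M * (u - s)))) has_integral K * exp (M * (t0 - s)) - K * exp (M * (s - s))) {s..t0}"
      using False by (intro fundamental_theorem_of_calculus)
        (auto intro!: derivative_eq_intros simp flip: has_real_derivative_iff_has_vector_derivative)
    have "norm (integral {s..t0} (lin x)) \<le> integral {s..t0} (\<lambda>u. M * (K * exp (M * (u - s))))"
    proof (rule integral_norm_bound_integral)
      show "lin x integrable_on {s..t0}" using I by (rule has_integral_integrable)
      show "(\<lambda>u. M * (K * exp (M * (u - s)))) integrable_on {s..t0}" using E by (rule has_integral_integrable)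
      fix u assume u: "u \<in> {s..t0}"
      have "norm (lin x u) \<le> M * (K * w u)"
      proof (rule lin_bound)
        fix v assume v: "u - r N \<le> v" "v \<le> u"
        then have "norm (x v) \<le> K * w v" using u t0 by (intro le) auto
        also have "\<dots> \<le> K * w u" using v K0 by (intro mult_left_mono w) auto
        finally show "norm (x v) \<le> K * w u" .
      qed
      then show "norm (lin x u) \<le> M * (K * exp (M * (u - s)))" using u by (simp add: w_def)
    qed
    then have "norm (x t0 - x s) \<le> K * exp (M * (t0 - s)) - K"
      using integral_unique[OF I] integral_unique[OF E] by simp
    moreover have "norm (x s) \<le> c" using init[of s] r_nonneg by simp
    moreover have "norm (x t0) \<le> norm (x t0 - x s) + norm (x s)" using norm_triangle_sub[of "x t0" "x s"] by simp
    moreover have "norm (x t0) = K * exp (M * (t0 - s))" using False w_pos[of t0] by (simp add: K_def w_def)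
    ultimately show ?thesis by linarith
  qed
  then have "K * w t \<le> c * w t" using w_pos[of t] by (intro mult_right_mono) auto
  moreover have "norm (x t) \<le> K * w t" using t r_nonneg by (intro le) auto
  ultimately have "norm (x t) \<le> c * w t" by linarith
  then show ?thesis using t by (simp add: w_def)
qed

lemma solution_unique:
  assumes "solves_from s (\<lambda>_. 0) x" "solves_from s (\<lambda>_. 0) y"
    and "\<And>t. t \<in> {s - r N..s} \<Longrightarrow> x t = y t" and "s - r N \<le> t"
  shows "x t = y t"
proof (cases "s \<le> t")
  case True
  have "solves_from s (\<lambda>_. 0) (\<lambda>t. x t - y t)" using solves_from_diff[OF assms(1,2)] by simp
  from solution_growth[OF this, of 0 t] show ?thesis using assms(3) True by simp
qed (use assms in auto)

text \<open>Existence: with the norm \<open>sup \<bar>x(t)\<bar> e\<^sup>-\<^sup>2\<^sup>M\<^sup>(\<^sup>t\<^sup>-\<^sup>s\<^sup>)\<close> the integral operator contracts by the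
  factor \<open>1/2\<close> on the whole half-line, so that its fixed point is a global solution.\<close>

lemma solution_exists:
  assumes \<phi>: "continuous_on {- r N..0} \<phi>"
  obtains x where "solves_from s (\<lambda>_. 0) x" "\<And>\<theta>. \<theta> \<in> {- r N..0} \<Longrightarrow> x (s + \<theta>) = \<phi> \<theta>"
proof -
  define c where "c t = max (- r N) (min (t - s) 0)" for t
  define \<phi>' where "\<phi>' t = \<phi> (c t)" for t
  have c: "c t \<in> {- r N..0}" for t using r_nonneg by (auto simp: c_def)
  have cont\<phi>: "continuous_on UNIV \<phi>'"
    unfolding \<phi>'_def by (rule continuous_on_compose2[OF \<phi>]) (use c in \<open>auto simp: c_def intro!: continuous_intros\<close>)
  obtain C where C: "0 \<le> C" "\<And>t. norm (\<phi>' t) \<le> C"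
  proof -
    obtain C where "0 \<le> C" "\<And>t. t \<in> {s - r N..s} \<Longrightarrow> norm (\<phi>' t) \<le> C"
      using continuous_bounded_on_interval[OF cont\<phi>] by blast
    moreover have "\<phi>' t = \<phi>' (s + c t)" for t using r_nonneg by (simp add: \<phi>'_def c_def)
    moreover have "s + c t \<in> {s - r N..s}" for t using c[of t] by auto
    ultimately show ?thesis using that[of C] by metis
  qed
  define w where "w t = exp (2 * M * max (t - s) 0)" for t
  have w: "1 \<le> w t" "0 < w t" "u \<le> v \<Longrightarrow> w u \<le> w v" for t u v
    using M_pos by (auto simp: w_def intro!: mult_left_mono)
  have wc: "continuous_on UNIV w" unfolding w_def by (intro continuous_intros)
  define X where "X v t = w t *\<^sub>R apply_bcontfun v t" for v :: "real \<Rightarrow>\<^sub>C (real^'n)" and t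
  have Xc: "continuous_on UNIV (X v)" for v unfolding X_def by (intro continuous_intros continuous_on_apply_bcontfun wc)
  define G where "G v t = integral {s..max s t} (lin (X v))" for v t
  have Gc: "continuous_on UNIV (G v)" for v
  proof -
    have "continuous_on {..<m} (G v)" for m
    proof -
      have "continuous_on {s..max s m} (\<lambda>t. integral {s..t} (lin (X v)))"
        by (intro indefinite_integral_continuous_1 lin_integrable Xc)
      then show ?thesis
        unfolding G_def by (rule continuous_on_compose2) (auto intro!: continuous_intros)
    qed
    then have "continuous_on (\<Union>m\<in>UNIV. {..<m}) (G v)" by (intro continuous_on_open_UN) auto
    moreover have "(\<Union>m\<in>UNIV. {..<m :: real}) = UNIV"
      using gt_ex by blast
    ultimately show ?thesis by simp
  qed
  have Ew: "((\<lambda>u. M * (K * w u)) has_integral (K / 2) * w t - K / 2) {s..t}" if "s \<le> t" for K t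
  proof -
    have "((\<lambda>u. M * (K * exp (2 * M * (u - s)))) has_integral (K / 2) * exp (2 * M * (t - s)) - (K / 2) * exp (2 * M * (s - s))) {s..t}"
      using that by (intro fundamental_theorem_of_calculus)
        (auto intro!: derivative_eq_intros simp flip: has_real_derivative_iff_has_vector_derivative)
    moreover have "((\<lambda>u. M * (K * exp (2 * M * (u - s)))) has_integral I) {s..t} \<longleftrightarrow> ((\<lambda>u. M * (K * w u)) has_integral I) {s..t}" for I
      by (rule has_integral_cong) (simp add: w_def)
    ultimately show ?thesis using that by (simp add: w_def)
  qed
  have Gbound: "norm (integral {s..max s t} (lin y)) \<le> K / 2 * w t"
    if y: "continuous_on UNIV y" "\<And>t. norm (y t) \<le> K * w t" and K: "0 \<le> K" for y K t
  proof -
    have "norm (integral {s..max s t} (lin y)) \<le> integral {s..max s t} (\<lambda>u. M * (K * w u))"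
    proof (rule integral_norm_bound_integral)
      show "lin y integrable_on {s..max s t}" by (rule lin_integrable(2)[OF y(1)])
      show "(\<lambda>u. M * (K * w u)) integrable_on {s..max s t}" using Ew[of "max s t" K] by (intro has_integral_integrable) auto
      fix u assume "u \<in> {s..max s t}"
      show "norm (lin y u) \<le> M * (K * w u)"
      proof (rule lin_bound)
        fix v assume v: "u - r N \<le> v" "v \<le> u"
        have "K * w v \<le> K * w u" using v K by (intro mult_left_mono w) auto
        then show "norm (y v) \<le> K * w u" using y(2)[of v] by simp
      qed
    qed
    also have "\<dots> = (K / 2) * w (max s t) - K / 2" using Ew[of "max s t" K] by (intro integral_unique) auto
    also have "\<dots> \<le> (K / 2) * w t" using K by (simp add: w_def max_def)
    finally show ?thesis .
  qed
  have Xb: "norm (X v t) \<le> norm v * w t" for v t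
  proof -
    have "norm (apply_bcontfun v t) * w t \<le> norm v * w t" using w(2)[of t] by (intro mult_right_mono norm_bounded) auto
    then show ?thesis using w(2)[of t] by (simp add: X_def mult.commute)
  qed
  define F where "F v t = (1 / w t) *\<^sub>R (\<phi>' t + G v t)" for v t
  have Fb: "F v \<in> bcontfun" for v
  proof (rule bcontfun_normI)
    show "continuous_on UNIV (F v)"
      unfolding F_def by (intro continuous_intros wc cont\<phi> Gc) (use w(2) in \<open>auto simp: less_imp_neq[symmetric]\<close>)
    fix t
    have "norm (\<phi>' t + G v t) \<le> C + norm v / 2 * w t"
      unfolding G_def using C(2)[of t] Gbound[OF Xc[of v] Xb[of v] norm_ge_zero, of t] by (intro order.trans[OF norm_triangle_ineq] add_mono)
    also have "\<dots> \<le> (C + norm v / 2) * w t" using w(1)[of t] C(1) mult_left_mono[of 1 "w t" C] by (simp add: distrib_right)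
    finally have "norm (\<phi>' t + G v t) \<le> (C + norm v / 2) * w t" .
    moreover have "norm (F v t) = norm (\<phi>' t + G v t) / w t"
      unfolding F_def norm_scaleR using w(2)[of t] by simp
    ultimately show "norm (F v t) \<le> C + norm v / 2" using w(2)[of t] by (simp add: pos_divide_le_eq)
  qed
  define \<Psi> where "\<Psi> v = Bcontfun (F v)" for v
  have \<Psi>: "apply_bcontfun (\<Psi> v) = F v" for v unfolding \<Psi>_def using Fb by (rule Bcontfun_inverse)
  have "\<forall>u v. dist (\<Psi> u) (\<Psi> v) \<le> 1/2 * dist u v"
  proof (intro allI dist_bound)
    fix u v t
    have "G u t - G v t = integral {s..max s t} (lin (X (u - v)))"
    proof -
      have "lin (X (u - v)) = (\<lambda>t. lin (X u) t - lin (X v) t)"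
        unfolding X_def by (simp add: fun_eq_iff scaleR_diff_right flip: lin_diff)
      then show ?thesis unfolding G_def by (simp add: integral_diff lin_integrable Xc)
    qed
    then have "norm (G u t - G v t) \<le> norm (u - v) / 2 * w t"
      using Gbound[OF Xc[of "u - v"] Xb[of "u - v"] norm_ge_zero, of t] by simp
    moreover have "F u t - F v t = (1 / w t) *\<^sub>R (G u t - G v t)" by (simp add: F_def algebra_simps)
    then have "norm (F u t - F v t) = norm (G u t - G v t) / w t" using w(2)[of t] by simp
    ultimately show "dist (apply_bcontfun (\<Psi> u) t) (apply_bcontfun (\<Psi> v) t) \<le> 1/2 * dist u v"
      using w(2)[of t] by (simp add: \<Psi> dist_norm pos_divide_le_eq)
  qed
  then have "\<exists>!v. \<Psi> v = v" by (intro banach_fix_type[of "1/2"]) auto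
  then obtain v where v: "\<Psi> v = v" by blast
  define x where "x = X v"
  have xeq: "x t = \<phi>' t + integral {s..max s t} (lin x)" for t
  proof -
    have "apply_bcontfun v t = F v t" using \<Psi>[of v] v by simp
    then have "x t = w t *\<^sub>R F v t" by (simp add: x_def X_def)
    then show ?thesis using w(2)[of t] by (simp add: F_def G_def x_def)
  qed
  have xc: "continuous_on UNIV x" unfolding x_def by (rule Xc)
  have "solves_from s (\<lambda>_. 0) x"
    unfolding solves_from_def
  proof (intro conjI allI impI xc)
    fix a b assume ab: "s \<le> a \<and> a \<le> b"
    have "integral {s..a} (lin x) + integral {a..b} (lin x) = integral {s..b} (lin x)"
      using ab by (intro Henstock_Kurzweil_Integration.integral_combine lin_integrable xc) auto
    moreover have "x b = \<phi> 0 + integral {s..b} (lin x)" "x a = \<phi> 0 + integral {s..a} (lin x)"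
      using ab r_nonneg by (subst xeq; simp add: \<phi>'_def c_def max_def)+
    ultimately have "integral {a..b} (lin x) = x b - x a" by (simp add: algebra_simps)
    then show "((\<lambda>t. lin x t + 0) has_integral x b - x a) {a..b}"
      using integrable_integral[OF lin_integrable(2)[OF xc, of a b]] by simp
  qed
  moreover have "x (s + \<theta>) = \<phi> \<theta>" if "\<theta> \<in> {- r N..0}" for \<theta>
  proof -
    have "max s (s + \<theta>) = s" using that by auto
    then show ?thesis using that by (subst xeq) (auto simp: \<phi>'_def c_def max_def min_def)
  qed
  ultimately show ?thesis using that by blast
qed

text \<open>With locally bounded forcing a solution is locally Lipschitz, hence differentiable almost
  everywhere, and satisfies the equation pointwise.\<close>

lemma solution_regular:
  assumes x: "solves_from s f x" and f: "f \<in> borel_measurable lebesgue"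
    and fb: "\<And>a b. \<exists>c. \<forall>t\<in>{a..b}. norm (f t) \<le> c"
  shows "\<And>a b. s \<le> a \<Longrightarrow> a \<le> b \<Longrightarrow> \<exists>K. \<forall>u v. a \<le> u \<and> u \<le> v \<and> v \<le> b \<longrightarrow> norm (x v - x u) \<le> K * (v - u)"
    and "AE t in lebesgue. s < t \<longrightarrow> (x has_vector_derivative lin x t + f t) (at t)"
proof -
  note cont = solves_fromD(1)[OF x] and int = solves_fromD(2)[OF x]
  have bound: "\<exists>K. 0 \<le> K \<and> (\<forall>t\<in>{a..b}. norm (lin x t + f t) \<le> K)" for a b
  proof -
    obtain c where c: "0 \<le> c" "\<And>t. t \<in> {a - r N..b} \<Longrightarrow> norm (x t) \<le> c"
      using continuous_bounded_on_interval[OF cont] by blast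
    obtain d where d: "\<forall>t\<in>{a..b}. norm (f t) \<le> d" using fb by blast
    have "norm (lin x t + f t) \<le> M * c + \<bar>d\<bar>" if "t \<in> {a..b}" for t
    proof -
      have "norm (lin x t) \<le> M * c" using that by (intro lin_bound c) auto
      moreover have "norm (f t) \<le> \<bar>d\<bar>" using d that by force
      ultimately show ?thesis using norm_triangle_ineq[of "lin x t" "f t"] by linarith
    qed
    moreover have "0 \<le> M * c + \<bar>d\<bar>" using M_pos c(1) by simp
    ultimately show ?thesis by blast
  qed
  show "\<exists>K. \<forall>u v. a \<le> u \<and> u \<le> v \<and> v \<le> b \<longrightarrow> norm (x v - x u) \<le> K * (v - u)" if ab: "s \<le> a" "a \<le> b" for a b
  proof -
    obtain K where K: "0 \<le> K" "\<forall>t\<in>{a..b}. norm (lin x t + f t) \<le> K" using bound by blast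
    have "norm (x v - x u) \<le> K * (v - u)" if "a \<le> u" "u \<le> v" "v \<le> b" for u v
      using has_integral_bound_real[OF K(1) finite.emptyI int[of u v]] that ab K by auto
    then show ?thesis by blast
  qed
  have m: "(\<lambda>t. lin x t + f t) \<in> borel_measurable lebesgue"
    by (intro borel_measurable_add lin_measurable continuous_imp_lebesgue_measurable cont f)
  have "AE t in lebesgue. t \<in> {s<..<s + real n} \<longrightarrow> (x has_vector_derivative lin x t + f t) (at t)" for n
  proof -
    obtain K where K: "\<forall>t\<in>{s..s + real n}. norm (lin x t + f t) \<le> K" using bound by blast
    show ?thesis
      by (rule AE_has_vector_derivative_indefinite_integral[OF m]) (use K int in auto)
  qed
  then have "AE t in lebesgue. \<forall>n. t \<in> {s<..<s + real n} \<longrightarrow> (x has_vector_derivative lin x t + f t) (at t)"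
    by (intro AE_all_countable[THEN iffD2] allI) blast
  then show "AE t in lebesgue. s < t \<longrightarrow> (x has_vector_derivative lin x t + f t) (at t)"
  proof eventually_elim
    case (elim t)
    obtain n where "t - s < real n" using reals_Archimedean2 by blast
    then show ?case using elim by (auto simp: algebra_simps)
  qed
qed

section \<open>The solution operator\<close>

lemma AE_not_point: "AE t in lebesgue. t \<noteq> (c::real)"
  by (rule AE_not_in[of "{c}", simplified]) (simp add: negligible_iff_null_sets[symmetric])

lemma delay_op_history:
  "delay_op N r A t (history (r N) x t) = lin x t"
  using r_bounds by (auto simp: delay_op_def history_def lin_def intro!: sum.cong)

lemma history_in_C_set:
  "continuous_on {t - r N..t} x \<Longrightarrow> history (r N) x t \<in> C_set (r N)"
proof -
  assume c: "continuous_on {t - r N..t} x"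
  have "continuous_on {- r N..0} (\<lambda>\<theta>. x (t + \<theta>))"
    by (rule continuous_on_compose2[OF c]) (auto intro!: continuous_intros)
  then have "continuous_on {- r N..0} (history (r N) x t)"
    by (rule continuous_on_eq) (simp add: history_def)
  then show ?thesis by (simp add: C_set_def history_def)
qed

lemma solves_from_imp_is_solution:
  assumes x: "solves_from s (\<lambda>_. 0) x"
  shows "is_solution N r A {s..} x"
  unfolding is_solution_def
proof (intro conjI)
  note cont = solves_fromD(1)[OF x]
  have b: "\<And>a b. \<exists>c. \<forall>t\<in>{a..b}. norm (0 :: real^'n) \<le> c" by auto
  note reg = solution_regular[OF x _ b, simplified]
  show "continuous_on {t + \<theta> |t \<theta>. t \<in> {s..} \<and> \<theta> \<in> {- r N..0}} x"
    by (rule continuous_on_subset[OF cont]) simp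
  show "loc_abs_continuous_on {s..} x"
    unfolding loc_abs_continuous_on_def
  proof (intro allI impI)
    fix a b assume ab: "a \<le> b \<and> {a..b} \<subseteq> {s..}"
    then have "s \<le> a" by auto
    then obtain K where "\<forall>u v. a \<le> u \<and> u \<le> v \<and> v \<le> b \<longrightarrow> norm (x v - x u) \<le> K * (v - u)"
      using reg(1)[of a b] ab by blast
    then show "abs_continuous_on a b x" by (intro lipschitz_imp_abs_continuous_on[of a b x K]) blast
  qed
  show "AE t in lebesgue. t \<in> {s..} \<longrightarrow>
      (x has_vector_derivative delay_op N r A t (history (r N) x t)) (at t within {s..})"
    using reg(2) AE_not_point[of s]
  proof eventually_elim
    case (elim t)
    then show ?case
      unfolding delay_op_history by (auto intro: has_vector_derivative_at_within)
  qed
qed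

lemma is_solution_imp_solves_from:
  assumes sol: "is_solution N r A {s..} x"
  shows "solves_from s (\<lambda>_. 0) (\<lambda>t. x (max (s - r N) t))"
  unfolding solves_from_def
proof (intro conjI allI impI)
  let ?y = "\<lambda>t. x (max (s - r N) t)"
  have sub: "{s - r N..} \<subseteq> {t + \<theta> |t \<theta>. t \<in> {s..} \<and> \<theta> \<in> {- r N..0}}"
  proof
    fix u assume "u \<in> {s - r N..}"
    then have "u = max s u + (u - max s u) \<and> max s u \<in> {s..} \<and> u - max s u \<in> {- r N..0}"
      using r_nonneg by auto
    then show "u \<in> {t + \<theta> |t \<theta>. t \<in> {s..} \<and> \<theta> \<in> {- r N..0}}" by blast
  qed
  then have "continuous_on {s - r N..} x" using sol continuous_on_subset unfolding is_solution_def by blast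
  then show "continuous_on UNIV ?y" by (rule continuous_on_compose2) (auto intro!: continuous_intros)
  fix a b assume ab: "s \<le> a \<and> a \<le> b"
  have "abs_continuous_on a b x"
    using sol ab unfolding is_solution_def loc_abs_continuous_on_def by auto
  moreover have "AE t in lebesgue. t \<in> {a<..<b} \<longrightarrow> (x has_vector_derivative lin x t) (at t)"
  proof -
    have "AE t in lebesgue. t \<in> {s..} \<longrightarrow> (x has_vector_derivative lin x t) (at t within {s..})"
      using sol unfolding is_solution_def delay_op_history by blast
    then show ?thesis
    proof eventually_elim
      case (elim t)
      show ?case
      proof
        assume t: "t \<in> {a<..<b}"
        then have "at t within {s..} = at t" using ab by (intro at_within_open_subset[of _ "{a<..<b}"]) auto
        then show "(x has_vector_derivative lin x t) (at t)" using elim t ab by auto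
      qed
    qed
  qed
  ultimately have "(lin x has_integral x b - x a) {a..b}"
    using ab by (intro abs_continuous_on_has_integral_deriv) auto
  moreover have "lin x t = lin ?y t + 0" if "t \<in> {a..b}" for t
    using that ab by (simp, intro lin_cong) auto
  ultimately have "((\<lambda>t. lin ?y t + 0) has_integral x b - x a) {a..b}" by (rule has_integral_eq[rotated])
  then show "((\<lambda>t. lin ?y t + 0) has_integral ?y b - ?y a) {a..b}" using ab r_nonneg by (simp add: max_def)
qed

lemma sol_op_eq:
  assumes x: "solves_from s (\<lambda>_. 0) x" and st: "s \<le> t"
  shows "sol_op N r A t s (history (r N) x s) = history (r N) x t"
  unfolding sol_op_def
proof (rule the_equality)
  show "\<exists>y. is_solution N r A {s..} y \<and> history (r N) y s = history (r N) x s \<and> history (r N) y t = history (r N) x t"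
    using solves_from_imp_is_solution[OF x] by blast
  fix \<psi> assume "\<exists>y. is_solution N r A {s..} y \<and> history (r N) y s = history (r N) x s \<and> history (r N) y t = \<psi>"
  then obtain y where y: "is_solution N r A {s..} y" "history (r N) y s = history (r N) x s" "history (r N) y t = \<psi>" by blast
  let ?y = "\<lambda>t. y (max (s - r N) t)"
  have "x u = ?y u" if "s - r N \<le> u" for u
  proof (rule solution_unique[OF x is_solution_imp_solves_from[OF y(1)] _ that])
    fix u assume u: "u \<in> {s - r N..s}"
    have "y (s + (u - s)) = x (s + (u - s))"
      using fun_cong[OF y(2), of "u - s"] u by (simp add: history_def)
    then show "x u = ?y u" using u by simp
  qed
  then have "history (r N) x t = history (r N) y t" using st by (auto simp: history_def fun_eq_iff)
  then show "\<psi> = history (r N) x t" using y(3) by simp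
qed

text \<open>Every initial segment is the history of a solution, so \<open>sol_op_eq\<close> describes the solution
  operator completely.\<close>

lemma initial_value_solution:
  assumes "\<phi> \<in> C_set (r N)"
  obtains x where "solves_from s (\<lambda>_. 0) x" "history (r N) x s = \<phi>"
proof -
  obtain x where x: "solves_from s (\<lambda>_. 0) x" "\<And>\<theta>. \<theta> \<in> {- r N..0} \<Longrightarrow> x (s + \<theta>) = \<phi> \<theta>"
    using solution_exists[of \<phi> s] assms by (auto simp: C_set_def)
  have "history (r N) x s = \<phi>" using x(2) assms by (auto simp: history_def C_set_def fun_eq_iff)
  then show ?thesis using that x(1) by blast
qed

end

section \<open>The Green operator\<close>

context delay_system
begin

text \<open>The operator norm of \<open>lin\<close> on \<open>L\<^sup>p\<^sub>\<mu>\<close> is finite because translations are bounded.\<close>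

definition lin_const :: real where
  "lin_const = (\<Sum>j\<le>N. B * (2 * (1 + (r j)\<^sup>2)))"

lemma lin_const_nonneg: "0 \<le> lin_const"
  unfolding lin_const_def using B_pos by (intro sum_nonneg) auto

text \<open>The form with variable factors \<open>q j\<close> is used for the commutator with an exponential weight.\<close>

lemma weighted_lin_Lp:
  fixes x :: "real \<Rightarrow> real^'n"
  assumes p: "1 \<le> p" and x: "x \<in> Lp_set p" and q: "\<And>j. j \<le> N \<Longrightarrow> q j \<in> borel_measurable lebesgue"
    and qb: "\<And>j t. j \<le> N \<Longrightarrow> \<bar>q j t\<bar> \<le> c" and c: "0 \<le> c"
  shows "(\<lambda>t. \<Sum>j\<le>N. A j t *v (q j t *\<^sub>R x (t - r j))) \<in> Lp_set p"
    "Lp_norm p (\<lambda>t. \<Sum>j\<le>N. A j t *v (q j t *\<^sub>R x (t - r j))) \<le> lin_const * c * Lp_norm p x"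
proof -
  define y where "y j t = A j t *v (q j t *\<^sub>R x (t - r j))" for j t
  have y: "y j \<in> Lp_set p \<and> Lp_norm p (y j) \<le> B * (2 * (1 + (r j)\<^sup>2)) * c * Lp_norm p x" if j: "j \<le> N" for j
  proof -
    note tr = Lp_translation[OF p x, of "r j"]
    have m: "y j \<in> borel_measurable lebesgue"
      unfolding y_def[abs_def]
      by (intro matrix_vector_mult_measurable A_measurable[OF j] borel_measurable_scaleR q[OF j]
          Lp_set_measurable[OF tr(1)])
    have le: "norm (y j t) \<le> (B * c) * norm (x (t - r j))" for t
    proof -
      have "norm (y j t) \<le> B * norm (q j t *\<^sub>R x (t - r j))" unfolding y_def by (rule A_bound[OF j])
      also have "\<dots> \<le> B * (c * norm (x (t - r j)))"
        unfolding norm_scaleR using B_pos qb[OF j] by (intro mult_left_mono mult_right_mono) auto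
      finally show ?thesis by (simp add: mult.assoc)
    qed
    have Bc: "0 \<le> B * c" using B_pos c by simp
    have "y j \<in> Lp_set p" "Lp_norm p (y j) \<le> (B * c) * Lp_norm p (\<lambda>t. x (t - r j))"
      using Lp_scaled_dominated[OF p m tr(1) Bc] le by auto
    moreover have "(B * c) * Lp_norm p (\<lambda>t. x (t - r j)) \<le> (B * c) * (2 * (1 + (r j)\<^sup>2) * Lp_norm p x)"
      by (rule mult_left_mono[OF tr(2) Bc])
    ultimately show ?thesis by (simp add: ac_simps)
  qed
  have "(\<lambda>t. \<Sum>j\<in>{..N}. y j t) \<in> Lp_set p \<and> Lp_norm p (\<lambda>t. \<Sum>j\<in>{..N}. y j t) \<le> (\<Sum>j\<in>{..N}. Lp_norm p (y j))"
    by (rule Lp_sum[OF p]) (use y in auto)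
  moreover have "(\<Sum>j\<in>{..N}. Lp_norm p (y j)) \<le> (\<Sum>j\<in>{..N}. B * (2 * (1 + (r j)\<^sup>2)) * c * Lp_norm p x)"
    by (rule sum_mono) (use y in auto)
  moreover have "(\<Sum>j\<in>{..N}. B * (2 * (1 + (r j)\<^sup>2)) * c * Lp_norm p x) = lin_const * c * Lp_norm p x"
    by (simp only: lin_const_def sum_distrib_right)
  ultimately show "(\<lambda>t. \<Sum>j\<le>N. A j t *v (q j t *\<^sub>R x (t - r j))) \<in> Lp_set p"
    "Lp_norm p (\<lambda>t. \<Sum>j\<le>N. A j t *v (q j t *\<^sub>R x (t - r j))) \<le> lin_const * c * Lp_norm p x"
    by (auto simp: y_def)
qed

lemma lin_Lp:
  fixes x :: "real \<Rightarrow> real^'n"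
  assumes p: "1 \<le> p" and x: "x \<in> Lp_set p"
  shows "lin x \<in> Lp_set p" "Lp_norm p (lin x) \<le> lin_const * Lp_norm p x"
  using weighted_lin_Lp[OF p x, of "\<lambda>_ _. 1" 1] by (simp_all add: lin_def[abs_def])

text \<open>A local Sobolev inequality: the value at \<open>t\<close> differs from the mean over \<open>[t - 1, t]\<close> by at most
  the integral of the derivative.\<close>

lemma solves_pointwise_bound:
  assumes p: "1 \<le> p" and z: "z \<in> Lp_set p" and f: "f \<in> Lp_set p" and sol: "solves f z"
  shows "norm (z t) \<le> 32 * (1 + lin_const) * (Lp_norm p z + Lp_norm p f) / point_weight p t"
proof -
  define g where "g t = lin z t + f t" for t
  have g: "g \<in> Lp_set p" "Lp_norm p g \<le> lin_const * Lp_norm p z + Lp_norm p f"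
    using Lp_add[OF p lin_Lp(1)[OF p z] f] lin_Lp(2)[OF p z] by (auto simp: g_def[abs_def])
  note lz = Lp_local_integral[OF p z, of "t - 1" t] and lg = Lp_local_integral[OF p g(1), of "t - 1" t]
  have iz: "(\<lambda>u. norm (z u)) integrable_on {t - 1..t}" and ig: "(\<lambda>u. norm (g u)) integrable_on {t - 1..t}"
    using lz(1) lg(1) by (auto simp: absolutely_integrable_on_def)
  have pt: "norm (z t) \<le> norm (z u) + integral {t - 1..t} (\<lambda>u. norm (g u))" if u: "u \<in> {t - 1..t}" for u
  proof -
    have I: "(g has_integral z t - z u) {u..t}" using solvesD(2)[OF sol, of u t] u by (simp add: g_def[abs_def])
    have igu: "(\<lambda>u. norm (g u)) integrable_on {u..t}" by (rule integrable_subinterval_real[OF ig]) (use u in auto)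
    have "norm (z t - z u) \<le> integral {u..t} (\<lambda>u. norm (g u))"
      using integral_norm_bound_integral[OF has_integral_integrable[OF I] igu] integral_unique[OF I] by simp
    also have "\<dots> \<le> integral {t - 1..t} (\<lambda>u. norm (g u))"
      by (rule integral_subset_le) (use u ig igu in auto)
    finally show ?thesis using norm_triangle_sub[of "z t" "z u"] by simp
  qed
  have "integral {t - 1..t} (\<lambda>u. norm (z t)) \<le> integral {t - 1..t} (\<lambda>u. norm (z u) + integral {t - 1..t} (\<lambda>u. norm (g u)))"
    by (rule integral_le) (use iz pt in \<open>auto intro!: integrable_add integrable_const_ivl\<close>)
  also have "\<dots> = integral {t - 1..t} (\<lambda>u. norm (z u)) + integral {t - 1..t} (\<lambda>u. norm (g u))"
    using iz by (subst integral_add) (auto intro: integrable_const_ivl)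
  finally have "norm (z t) \<le> integral {t - 1..t} (\<lambda>u. norm (z u)) + integral {t - 1..t} (\<lambda>u. norm (g u))" by simp
  \<comment> \<open>The constants \<open>8\<close> and \<open>4\<close> are those of the local integral estimate and of the shift of the
    weight by \<open>1\<close>.\<close>
  also have "\<dots> \<le> 8 * Lp_norm p z / point_weight p (t - 1) + 8 * Lp_norm p g / point_weight p (t - 1)"
    using lz(2) lg(2) by (intro add_mono) simp_all
  also have "\<dots> = 8 * (Lp_norm p z + Lp_norm p g) / point_weight p (t - 1)"
    by (simp add: add_divide_distrib distrib_left)
  also have "\<dots> \<le> 8 * (Lp_norm p z + Lp_norm p g) * (4 / point_weight p t)"
  proof -
    have "point_weight p t \<le> 4 * point_weight p (t - 1)" using point_weight_shift[OF p, of t "t - 1"] by simp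
    then have "1 / point_weight p (t - 1) \<le> 4 / point_weight p t"
      using point_weight_pos[of p t] point_weight_pos[of p "t - 1"] by (simp add: field_simps)
    then have "8 * (Lp_norm p z + Lp_norm p g) * (1 / point_weight p (t - 1)) \<le> 8 * (Lp_norm p z + Lp_norm p g) * (4 / point_weight p t)"
      using Lp_norm_nonneg[of p z] Lp_norm_nonneg[of p g] by (intro mult_left_mono) auto
    then show ?thesis by simp
  qed
  also have "\<dots> = 32 * (Lp_norm p z + Lp_norm p g) / point_weight p t" by simp
  also have "\<dots> \<le> 32 * ((1 + lin_const) * (Lp_norm p z + Lp_norm p f)) / point_weight p t"
  proof -
    have "0 \<le> lin_const * Lp_norm p f" using lin_const_nonneg Lp_norm_nonneg by (rule mult_nonneg_nonneg)
    then have "Lp_norm p z + Lp_norm p g \<le> (1 + lin_const) * (Lp_norm p z + Lp_norm p f)"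
      using g(2) by (simp add: algebra_simps)
    then show ?thesis using point_weight_pos[of p t] by (intro divide_right_mono mult_left_mono) auto
  qed
  finally show ?thesis by (simp only: mult.assoc)
qed

text \<open>The product rule for a solution and a Lipschitz factor, in integral form.\<close>

lemma product_has_integral:
  assumes x: "solves_from s f x" and f: "f \<in> borel_measurable lebesgue"
    and fb: "\<And>a b. \<exists>c. \<forall>t\<in>{a..b}. norm (f t) \<le> c"
    and lip: "\<And>u v. s \<le> u \<Longrightarrow> u \<le> v \<Longrightarrow> \<bar>\<rho> v - \<rho> u\<bar> \<le> K * (v - u)" and K: "0 \<le> K"
    and der: "AE t in lebesgue. s < t \<longrightarrow> (\<rho> has_vector_derivative \<rho>' t) (at t)"
    and ab: "s \<le> a" "a \<le> b"
  shows "((\<lambda>t. \<rho> t *\<^sub>R (lin x t + f t) + \<rho>' t *\<^sub>R x t) has_integral \<rho> b *\<^sub>R x b - \<rho> a *\<^sub>R x a) {a..b}"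
proof (rule abs_continuous_on_has_integral_deriv[OF _ ab(2)])
  obtain c where c: "0 \<le> c" "\<And>t. t \<in> {a..b} \<Longrightarrow> norm (x t) \<le> c"
    using continuous_bounded_on_interval[OF solves_fromD(1)[OF x]] by blast
  obtain K1 where K1: "\<And>u v. a \<le> u \<Longrightarrow> u \<le> v \<Longrightarrow> v \<le> b \<Longrightarrow> norm (x v - x u) \<le> K1 * (v - u)"
    using solution_regular(1)[OF x f fb ab] by blast
  define R where "R = \<bar>\<rho> a\<bar> + K * (b - a)"
  have R: "\<bar>\<rho> v\<bar> \<le> R" if "a \<le> v" "v \<le> b" for v
  proof -
    have "\<bar>\<rho> v - \<rho> a\<bar> \<le> K * (v - a)" using that ab by (intro lip) auto
    also have "\<dots> \<le> K * (b - a)" using that K by (intro mult_left_mono) auto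
    finally show ?thesis by (simp add: R_def)
  qed
  show "abs_continuous_on a b (\<lambda>t. \<rho> t *\<^sub>R x t)"
  proof (rule lipschitz_imp_abs_continuous_on)
    fix u v assume uv: "a \<le> u" "u \<le> v" "v \<le> b"
    have "\<rho> v *\<^sub>R x v - \<rho> u *\<^sub>R x u = \<rho> v *\<^sub>R (x v - x u) + (\<rho> v - \<rho> u) *\<^sub>R x u" by (simp add: algebra_simps)
    also have "norm \<dots> \<le> \<bar>\<rho> v\<bar> * norm (x v - x u) + \<bar>\<rho> v - \<rho> u\<bar> * norm (x u)"
      using norm_triangle_ineq[of "\<rho> v *\<^sub>R (x v - x u)" "(\<rho> v - \<rho> u) *\<^sub>R x u"] by simp
    also have "\<dots> \<le> R * (\<bar>K1\<bar> * (v - u)) + (K * (v - u)) * c"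
    proof (intro add_mono mult_mono)
      have "K1 * (v - u) \<le> \<bar>K1\<bar> * (v - u)" using uv by (intro mult_right_mono) auto
      then show "norm (x v - x u) \<le> \<bar>K1\<bar> * (v - u)" using K1[OF uv] by linarith
      show "0 \<le> R" using R[of a] ab by (meson abs_ge_zero order.refl order.trans)
      show "\<bar>\<rho> v - \<rho> u\<bar> \<le> K * (v - u)" using uv ab by (intro lip) auto
    qed (use R c uv K in auto)
    finally show "norm (\<rho> v *\<^sub>R x v - \<rho> u *\<^sub>R x u) \<le> (R * \<bar>K1\<bar> + K * c) * (v - u)" by (simp add: algebra_simps)
  qed
  show "AE t in lebesgue. t \<in> {a<..<b} \<longrightarrow>
      ((\<lambda>t. \<rho> t *\<^sub>R x t) has_vector_derivative \<rho> t *\<^sub>R (lin x t + f t) + \<rho>' t *\<^sub>R x t) (at t)"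
    using der solution_regular(2)[OF x f fb]
  proof eventually_elim
    case (elim t)
    show ?case
    proof
      assume "t \<in> {a<..<b}"
      then have "s < t" using ab by auto
      then show "((\<lambda>t. \<rho> t *\<^sub>R x t) has_vector_derivative \<rho> t *\<^sub>R (lin x t + f t) + \<rho>' t *\<^sub>R x t) (at t)"
        using elim by (intro has_vector_derivative_scaleR) (auto simp: has_real_derivative_iff_has_vector_derivative)
    qed
  qed
qed

end

text \<open>A bounded smooth weight that grows like \<open>e\<^sup>\<delta>\<^sup>|\<^sup>t\<^sup>-\<^sup>s\<^sup>|\<close> until it saturates at height \<open>1/\<eta>\<close>. Its
  logarithmic derivative is bounded by \<open>\<delta>\<close>, uniformly in \<open>s\<close> and \<open>\<eta>\<close>.\<close>

lemma exponential_weight_exists: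
  fixes s \<delta> \<eta> :: real
  assumes \<delta>: "0 < \<delta>" and \<eta>: "0 < \<eta>"
  obtains \<rho> \<rho>' :: "real \<Rightarrow> real" where
    "\<And>t. (\<rho> has_real_derivative \<rho>' t) (at t)" "continuous_on UNIV \<rho>'"
    "\<And>t. 0 < \<rho> t" "\<And>t. \<rho> t \<le> 1 / \<eta>" "\<And>t. \<bar>\<rho>' t\<bar> \<le> \<delta> * \<rho> t"
    "\<And>t \<tau>. 0 \<le> \<tau> \<Longrightarrow> \<bar>\<rho> t - \<rho> (t - \<tau>)\<bar> \<le> (exp (\<delta> * \<tau>) - 1) * \<rho> (t - \<tau>)"
    "\<And>t. \<rho> t \<le> exp (\<delta> * \<bar>t - s\<bar>)" "\<And>t. 1 / \<rho> t \<le> \<eta> + 2 * exp (- \<delta> * \<bar>t - s\<bar>)"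
proof -
  \<comment> \<open>\<open>cosh\<close> is a smooth substitute for the exponential of \<open>\<delta>\<bar>t - s\<bar>\<close>.\<close>
  define c where "c t = 1 / cosh (\<delta> * (t - s))" for t
  define \<rho> where "\<rho> t = 1 / (\<eta> + c t)" for t
  define c' where "c' t = - (\<delta> * sinh (\<delta> * (t - s))) / (cosh (\<delta> * (t - s)))\<^sup>2" for t
  define \<rho>' where "\<rho>' t = - c' t / (\<eta> + c t)\<^sup>2" for t
  have ch: "0 < cosh x" for x :: real by (rule cosh_real_pos)
  have c: "0 < c t" for t using ch by (simp add: c_def)
  have dc: "(c has_real_derivative c' t) (at t)" for t
    unfolding c_def c'_def using ch[of "\<delta> * (t - s)"]
    by (auto intro!: derivative_eq_intros simp: power2_eq_square)
  have \<eta>c: "0 < \<eta> + c t" for t using c[of t] \<eta> by simp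
  have d\<rho>: "(\<rho> has_real_derivative \<rho>' t) (at t)" for t
    unfolding \<rho>_def \<rho>'_def using \<eta>c[of t]
    by (auto intro!: derivative_eq_intros dc simp: power2_eq_square)
  have c'c: "\<bar>c' t\<bar> \<le> \<delta> * c t" for t
  proof -
    let ?x = "\<delta> * (t - s)"
    have "\<bar>sinh ?x\<bar> \<le> cosh ?x"
      using sinh_less_cosh_real[of ?x] sinh_less_cosh_real[of "- ?x"] by auto
    then have "\<delta> * \<bar>sinh ?x\<bar> / (cosh ?x)\<^sup>2 \<le> \<delta> * cosh ?x / (cosh ?x)\<^sup>2"
      using \<delta> by (intro divide_right_mono mult_left_mono) auto
    then show ?thesis using ch[of ?x] \<delta> by (simp add: c'_def c_def abs_mult power2_eq_square)
  qed
  have shift: "c u \<le> exp (\<delta> * \<bar>u - v\<bar>) * c v" for u v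
  proof -
    let ?y = "\<delta> * \<bar>u - v\<bar>"
    have y: "0 \<le> ?y" using \<delta> by simp
    have "cosh (\<delta> * (v - s)) \<le> exp ?y * cosh (\<delta> * (u - s))"
    proof -
      have "exp (\<delta> * (v - s)) \<le> exp ?y * exp (\<delta> * (u - s))"
        using \<delta> by (simp flip: exp_add distrib_left)
      moreover have "exp (- (\<delta> * (v - s))) \<le> exp ?y * exp (- (\<delta> * (u - s)))"
      proof -
        have "\<delta> * (u - v) \<le> ?y" using \<delta> by (intro mult_left_mono) auto
        then have "- (\<delta> * (v - s)) \<le> ?y + - (\<delta> * (u - s))" by (simp add: algebra_simps)
        then show ?thesis unfolding exp_add[symmetric] by simp
      qed
      ultimately show ?thesis by (simp add: cosh_def distrib_left)
    qed
    then show ?thesis using ch[of "\<delta> * (u - s)"] ch[of "\<delta> * (v - s)"] by (simp add: c_def field_simps)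
  qed
  have shift': "\<eta> + c u \<le> exp (\<delta> * \<bar>u - v\<bar>) * (\<eta> + c v)" for u v
  proof -
    have "1 * \<eta> \<le> exp (\<delta> * \<bar>u - v\<bar>) * \<eta>" using \<delta> \<eta> by (intro mult_right_mono) auto
    then show ?thesis using shift[of u v] by (simp add: distrib_left)
  qed
  show ?thesis
  proof (rule that[of \<rho> \<rho>'])
    show "(\<rho> has_real_derivative \<rho>' t) (at t)" for t by (rule d\<rho>)
    have "continuous_on UNIV c" using dc by (intro DERIV_continuous_on) auto
    then show "continuous_on UNIV \<rho>'"
      unfolding \<rho>'_def c'_def using \<eta>c ch by (intro continuous_intros) (auto simp: less_imp_neq[symmetric])
    show pos: "0 < \<rho> t" for t using \<eta>c[of t] by (simp add: \<rho>_def)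
    show "\<rho> t \<le> 1 / \<eta>" for t using c[of t] \<eta> by (simp add: \<rho>_def frac_le)
    show "\<bar>\<rho>' t\<bar> \<le> \<delta> * \<rho> t" for t
    proof -
      have "\<bar>\<rho>' t\<bar> = \<bar>c' t\<bar> / (\<eta> + c t)\<^sup>2" by (simp add: \<rho>'_def)
      also have "\<dots> \<le> \<delta> * (\<eta> + c t) / (\<eta> + c t)\<^sup>2"
      proof -
        have "\<delta> * c t \<le> \<delta> * (\<eta> + c t)" using \<delta> \<eta> by (intro mult_left_mono) auto
        then show ?thesis using c'c[of t] by (intro divide_right_mono) auto
      qed
      also have "\<dots> = \<delta> * \<rho> t" using \<eta>c[of t] by (simp add: \<rho>_def power2_eq_square)
      finally show ?thesis .
    qed
    show "\<bar>\<rho> t - \<rho> (t - \<tau>)\<bar> \<le> (exp (\<delta> * \<tau>) - 1) * \<rho> (t - \<tau>)" if "0 \<le> \<tau>" for t \<tau>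
    proof -
      let ?u = "\<eta> + c t" and ?v = "\<eta> + c (t - \<tau>)" and ?E = "exp (\<delta> * \<tau>)"
      have uv: "?u \<le> ?E * ?v" "?v \<le> ?E * ?u" using shift'[of t "t - \<tau>"] shift'[of "t - \<tau>" t] that by auto
      have E: "1 \<le> ?E" using that \<delta> by simp
      have "\<bar>?v - ?u\<bar> \<le> (?E - 1) * ?u"
      proof -
        have "?u - ?v \<le> (?E - 1) * ?u"
        proof -
          have "?u - ?v \<le> (?E - 1) * ?v" using uv(1) by (simp add: algebra_simps)
          show ?thesis
          proof (cases "?v \<le> ?u")
            case True
            have "(?E - 1) * ?v \<le> (?E - 1) * ?u" using True E by (intro mult_left_mono) auto
            then show ?thesis using \<open>?u - ?v \<le> (?E - 1) * ?v\<close> by linarith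
          next
            case False
            have "0 \<le> (?E - 1) * ?u" using E \<eta>c[of t] by (intro mult_nonneg_nonneg) auto
            then show ?thesis using False by linarith
          qed
        qed
        moreover have "?v - ?u \<le> (?E - 1) * ?u" using uv(2) by (simp add: algebra_simps)
        ultimately show ?thesis by (simp add: abs_le_iff)
      qed
      then have "\<bar>?v - ?u\<bar> / (?u * ?v) \<le> (?E - 1) * ?u / (?u * ?v)"
        using \<eta>c[of t] \<eta>c[of "t - \<tau>"] by (intro divide_right_mono) auto
      moreover have "\<rho> t - \<rho> (t - \<tau>) = (?v - ?u) / (?u * ?v)"
        using \<eta>c[of t] \<eta>c[of "t - \<tau>"] by (simp add: \<rho>_def divide_simps) 
      moreover have "(?E - 1) * ?u / (?u * ?v) = (?E - 1) * \<rho> (t - \<tau>)"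
        using \<eta>c[of t] by (simp add: \<rho>_def)
      ultimately show ?thesis using \<eta>c[of t] \<eta>c[of "t - \<tau>"] by (simp add: abs_divide abs_mult)
    qed
    show "\<rho> t \<le> exp (\<delta> * \<bar>t - s\<bar>)" for t
    proof -
      have "1 \<le> exp (\<delta> * \<bar>t - s\<bar>) * c t" using shift[of s t] by (simp add: c_def abs_minus_commute)
      also have "\<dots> \<le> exp (\<delta> * \<bar>t - s\<bar>) * (\<eta> + c t)" using \<eta> by (intro mult_left_mono) auto
      finally show ?thesis using \<eta>c[of t] by (simp add: \<rho>_def field_simps)
    qed
    show "1 / \<rho> t \<le> \<eta> + 2 * exp (- \<delta> * \<bar>t - s\<bar>)" for t
    proof -
      have "exp (\<delta> * \<bar>t - s\<bar>) / 2 \<le> cosh (\<delta> * (t - s))"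
        by (cases "s \<le> t") (simp_all add: cosh_def right_diff_distrib)
      then have "c t \<le> 1 / (exp (\<delta> * \<bar>t - s\<bar>) / 2)" unfolding c_def by (intro divide_left_mono) (auto simp: ch)
      moreover have "1 / (exp (\<delta> * \<bar>t - s\<bar>) / 2) = 2 * exp (- \<delta> * \<bar>t - s\<bar>)"
        by (simp add: exp_minus inverse_eq_divide)
      moreover have "1 / \<rho> t = \<eta> + c t" by (simp add: \<rho>_def)
      ultimately show ?thesis by linarith
    qed
  qed
qed

locale admissible_system = delay_system N r A B
  for N :: nat and r :: "nat \<Rightarrow> real" and A :: "nat \<Rightarrow> real \<Rightarrow> real^'n^'n" and B :: real +
  fixes p :: ennreal
  assumes p: "1 \<le> p"
    and surjective: "\<And>f. f \<in> Lp_set p \<Longrightarrow> \<exists>z\<in>Lp_set p. solves f z"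
    and injective: "\<And>z. z \<in> Lp_set p \<Longrightarrow> solves (\<lambda>_. 0) z \<Longrightarrow> z = (\<lambda>_. 0)"
begin

definition green :: "(real \<Rightarrow> real^'n) \<Rightarrow> real \<Rightarrow> real^'n" where
  "green f = (THE z. z \<in> Lp_set p \<and> solves f z)"

lemma green_unique:
  assumes "z \<in> Lp_set p" "solves f z" "y \<in> Lp_set p" "solves f y"
  shows "z = y"
proof -
  have "(\<lambda>t. z t - y t) = (\<lambda>_. 0)"
    by (rule injective[OF Lp_diff(1)[OF p assms(1,3)]]) (use solves_diff[OF assms(2,4)] in simp)
  then show ?thesis by (simp add: fun_eq_iff)
qed

lemma green:
  assumes "f \<in> Lp_set p"
  shows "green f \<in> Lp_set p" "solves f (green f)"
proof -
  have "\<exists>!z. z \<in> Lp_set p \<and> solves f z" using surjective[OF assms] green_unique by blast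
  from theI'[OF this] show "green f \<in> Lp_set p" "solves f (green f)" by (simp_all add: green_def)
qed

lemma green_eqI: "f \<in> Lp_set p \<Longrightarrow> z \<in> Lp_set p \<Longrightarrow> solves f z \<Longrightarrow> green f = z"
  using green green_unique by blast

lemma green_scale:
  assumes "f \<in> Lp_set p"
  shows "green (\<lambda>t. c *\<^sub>R f t) = (\<lambda>t. c *\<^sub>R green f t)"
  by (intro green_eqI Lp_scale_le(1)[OF p] solves_scale green assms)

text \<open>If \<open>f\<close> and the Green functions converge absolutely as series in \<open>L\<^sup>p\<^sub>\<mu>\<close>, then the latter converge locally
  uniformly, by the pointwise bound, and the integral equation passes to the limit. This gives
  countable subadditivity of \<open>\<lambda>f. Lp_norm p (green f)\<close>.\<close>

lemma green_countably_subadditive: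
  assumes f: "\<And>k::nat. f k \<in> Lp_set p" and g: "g \<in> Lp_set p"
    and sf: "summable (\<lambda>k. Lp_norm p (f k))" and sG: "summable (\<lambda>k. Lp_norm p (green (f k)))"
    and lim: "(\<lambda>m. Lp_norm p (g - (\<Sum>k<m. f k))) \<longlonglongrightarrow> 0"
  shows "Lp_norm p (green g) \<le> (\<Sum>k. Lp_norm p (green (f k)))"
proof -
  define z where "z k = green (f k)" for k
  have z: "z k \<in> Lp_set p" "solves (f k) (z k)" for k using green[OF f] by (simp_all add: z_def)
  define a where "a k = 32 * (1 + lin_const) * (Lp_norm p (z k) + Lp_norm p (f k))" for k
  have sa: "summable a" unfolding a_def z_def by (intro summable_mult summable_add sG sf)
  have a0: "0 \<le> a k" for k
    using lin_const_nonneg Lp_norm_nonneg[of p "z k"] Lp_norm_nonneg[of p "f k"] by (simp add: a_def)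
  have za: "norm (z k t) \<le> a k / point_weight p t" for k t
    unfolding a_def by (rule solves_pointwise_bound[OF p z(1) f z(2)])
  have sz: "summable (\<lambda>k. z k t)" for t
    by (rule summable_comparison_test'[OF summable_divide[OF sa], of 0]) (rule za)
  define Z where "Z t = (\<Sum>k. z k t)" for t
  define S where "S m t = (\<Sum>k<m. z k t)" for m t
  define F where "F m t = (\<Sum>k<m. f k t)" for m t
  define \<rho> where "\<rho> m = (\<Sum>k. a (k + m))" for m
  have \<rho>: "\<rho> \<longlonglongrightarrow> 0" unfolding \<rho>_def[abs_def] using sa by (rule suminf_exist_split2)
  have ZS: "norm (Z t - S m t) \<le> \<rho> m / point_weight p t" for m t
  proof -
    have sa': "summable (\<lambda>k. a (k + m) / point_weight p t)"
      by (intro summable_divide summable_ignore_initial_segment sa)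
    have "Z t - S m t = (\<Sum>k. z (k + m) t)"
      using suminf_minus_initial_segment[OF sz, of m t] by (simp add: Z_def S_def)
    also have "norm \<dots> \<le> (\<Sum>k. a (k + m) / point_weight p t)"
      by (rule norm_suminf_le[OF za sa'])
    also have "\<dots> = \<rho> m / point_weight p t"
      unfolding \<rho>_def by (intro suminf_divide summable_ignore_initial_segment sa)
    finally show ?thesis .
  qed
  have \<rho>0: "0 \<le> \<rho> m" for m
    unfolding \<rho>_def by (intro suminf_nonneg summable_ignore_initial_segment sa a0)
  have pw: "\<exists>D\<ge>0. \<forall>t\<in>{u..v}. 1 / point_weight p t \<le> D" for u v
  proof -
    have "1 / point_weight p t \<le> 2 * (1 + (v - u)\<^sup>2) / point_weight p u" if "t \<in> {u..v}" for t
    proof -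
      have "(u - t)\<^sup>2 \<le> (v - u)\<^sup>2" using that by (subst power2_commute, intro power_mono) auto
      then have "2 * (1 + (u - t)\<^sup>2) * point_weight p t \<le> 2 * (1 + (v - u)\<^sup>2) * point_weight p t"
        using point_weight_pos[of p t] by (intro mult_right_mono) auto
      then have "point_weight p u \<le> 2 * (1 + (v - u)\<^sup>2) * point_weight p t"
        using point_weight_shift[OF p, of u t] by linarith
      then show ?thesis using point_weight_pos[of p t] point_weight_pos[of p u] by (simp add: field_simps)
    qed
    moreover have "0 \<le> 2 * (1 + (v - u)\<^sup>2) / point_weight p u" using point_weight_pos[of p u] by simp
    ultimately show ?thesis by blast
  qed
  have solS: "solves (F m) (S m)" for m
  proof (induction m)
    case 0
    show ?case by (auto intro!: solvesI simp: S_def[abs_def] F_def[abs_def] lin_zero)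
  next
    case (Suc m)
    from solves_add[OF Suc z(2)[of m]] show ?case by (simp add: S_def[abs_def] F_def[abs_def])
  qed
  have unif: "uniform_limit {u..v} S Z sequentially" for u v
  proof (rule uniform_limitI)
    fix e :: real assume e: "e > 0"
    obtain D where D: "0 \<le> D" "\<forall>t\<in>{u..v}. 1 / point_weight p t \<le> D" using pw by blast
    have "(\<lambda>m. \<rho> m * D) \<longlonglongrightarrow> 0 * D" by (intro tendsto_intros \<rho>)
    then have "\<forall>\<^sub>F m in sequentially. \<rho> m * D < e" using e by (intro order_tendstoD(2)) auto
    then show "\<forall>\<^sub>F m in sequentially. \<forall>t\<in>{u..v}. dist (S m t) (Z t) < e"
    proof eventually_elim
      case (elim m)
      show ?case
      proof
        fix t assume t: "t \<in> {u..v}"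
        have "\<rho> m * (1 / point_weight p t) \<le> \<rho> m * D" using D t \<rho>0 by (intro mult_left_mono) auto
        then show "dist (S m t) (Z t) < e" using ZS[of t m] elim by (simp add: dist_norm norm_minus_commute)
      qed
    qed
  qed
  have Zc: "continuous_on UNIV Z"
  proof -
    have "continuous_on {u..v} Z" for u v
    proof -
      have "\<forall>\<^sub>F m in sequentially. continuous_on {u..v} (S m)"
        by (intro always_eventually allI continuous_on_subset[OF solvesD(1)[OF solS]]) simp
      then show ?thesis by (rule uniform_limit_theorem[OF _ unif]) simp
    qed
    note ivl = this
    have "continuous_on {- real n<..<real n} Z" for n :: nat
      by (rule continuous_on_subset[OF ivl[of "- real n" "real n"]]) auto
    then have "continuous_on (\<Union>n\<in>UNIV. {- real n<..<real n}) Z" by (intro continuous_on_open_UN) auto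
    moreover have "(\<Union>n\<in>UNIV. {- real n<..<real n}) = UNIV"
    proof -
      have "\<exists>n. - real n < t \<and> t < real n" for t
      proof -
        obtain n where "\<bar>t\<bar> < real n" using reals_Archimedean2 by blast
        then show ?thesis by (intro exI[of _ n]) auto
      qed
      then show ?thesis by auto
    qed
    ultimately show ?thesis by simp
  qed
  have fmem: "F m \<in> Lp_set p" "(\<lambda>t. g t - F m t) \<in> Lp_set p"
    and Fnorm: "Lp_norm p (\<lambda>t. g t - F m t) = Lp_norm p (g - (\<Sum>k<m. f k))" for m
  proof -
    show "F m \<in> Lp_set p" using Lp_sum[OF p, of "{..<m}" f] f by (simp add: F_def[abs_def])
    then show "(\<lambda>t. g t - F m t) \<in> Lp_set p" by (rule Lp_diff(1)[OF p g])
    have "(\<Sum>k<m. f k) = F m" unfolding F_def by (induction m) (auto simp: fun_eq_iff)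
    then show "Lp_norm p (\<lambda>t. g t - F m t) = Lp_norm p (g - (\<Sum>k<m. f k))" by (simp add: fun_diff_def)
  qed
  have solZ: "solves g Z"
  proof (rule solvesI[OF Zc])
    fix u v :: real assume uv: "u \<le> v"
    obtain D where D: "0 \<le> D" "\<forall>t\<in>{u - r N..v}. 1 / point_weight p t \<le> D" using pw by blast
    have ig: "g integrable_on {u..v}"
      using Lp_local_integral(1)[OF p g uv] by (rule set_lebesgue_integral_eq_integral)
    have iZ: "(\<lambda>t. lin Z t + g t) integrable_on {u..v}" by (intro integrable_add lin_integrable Zc ig)
    define C where "C = ((v - u) + 1) * (2 * (1 + (v - u)\<^sup>2)) / point_weight p u"
    have bnd: "norm (integral {u..v} (\<lambda>t. lin Z t + g t) - (S m v - S m u))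
        \<le> M * (\<rho> m * D) * (v - u) + C * Lp_norm p (g - (\<Sum>k<m. f k))" for m
    proof -
      note I = solvesD(2)[OF solS[of m] uv]
      have "integral {u..v} (\<lambda>t. lin Z t + g t) - (S m v - S m u)
          = integral {u..v} (\<lambda>t. (lin Z t + g t) - (lin (S m) t + F m t))"
        using integral_diff[OF iZ has_integral_integrable[OF I]] integral_unique[OF I] by simp
      also have "\<dots> = integral {u..v} (\<lambda>t. lin (\<lambda>t. Z t - S m t) t + (g t - F m t))"
        by (simp add: lin_diff algebra_simps)
      also have "norm \<dots> \<le> integral {u..v} (\<lambda>t. M * (\<rho> m * D) + norm (g t - F m t))"
      proof (rule integral_norm_bound_integral)
        note ai = Lp_local_integral(1)[OF p fmem(2)[of m] uv]
        have c: "continuous_on UNIV (\<lambda>t. Z t - S m t)" by (intro continuous_intros Zc solvesD(1)[OF solS])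
        show "(\<lambda>t. lin (\<lambda>t. Z t - S m t) t + (g t - F m t)) integrable_on {u..v}"
          by (intro integrable_add lin_integrable c set_lebesgue_integral_eq_integral(1)[OF ai])
        show "(\<lambda>t. M * (\<rho> m * D) + norm (g t - F m t)) integrable_on {u..v}"
          using ai by (intro integrable_add integrable_const_ivl) (simp add: absolutely_integrable_on_def)
        fix t assume t: "t \<in> {u..v}"
        have "norm (lin (\<lambda>t. Z t - S m t) t) \<le> M * (\<rho> m * D)"
        proof (rule lin_bound)
          fix w assume "t - r N \<le> w" "w \<le> t"
          then have "w \<in> {u - r N..v}" using t by auto
          then have "\<rho> m * (1 / point_weight p w) \<le> \<rho> m * D" using D \<rho>0 by (intro mult_left_mono) auto
          then show "norm (Z w - S m w) \<le> \<rho> m * D" using ZS[of w m] by simp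
        qed
        then show "norm (lin (\<lambda>t. Z t - S m t) t + (g t - F m t)) \<le> M * (\<rho> m * D) + norm (g t - F m t)"
          using norm_triangle_ineq[of "lin (\<lambda>t. Z t - S m t) t" "g t - F m t"] by linarith
      qed
      also have "\<dots> = M * (\<rho> m * D) * (v - u) + integral {u..v} (\<lambda>t. norm (g t - F m t))"
      proof -
        have "(\<lambda>t. norm (g t - F m t)) integrable_on {u..v}"
          using Lp_local_integral(1)[OF p fmem(2)[of m] uv] by (simp add: absolutely_integrable_on_def)
        then show ?thesis using uv by (subst integral_add) (auto intro: integrable_const_ivl)
      qed
      also have "\<dots> \<le> M * (\<rho> m * D) * (v - u) + C * Lp_norm p (g - (\<Sum>k<m. f k))"
        using Lp_local_integral(2)[OF p fmem(2)[of m] uv] by (simp add: C_def Fnorm)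
      finally show ?thesis .
    qed
    have "(\<lambda>m. M * (\<rho> m * D) * (v - u) + C * Lp_norm p (g - (\<Sum>k<m. f k))) \<longlonglongrightarrow> M * (0 * D) * (v - u) + C * 0"
      by (intro tendsto_intros \<rho> lim)
    then have lim0: "(\<lambda>m. M * (\<rho> m * D) * (v - u) + C * Lp_norm p (g - (\<Sum>k<m. f k))) \<longlonglongrightarrow> 0" by simp
    have "(\<lambda>m. integral {u..v} (\<lambda>t. lin Z t + g t) - (S m v - S m u)) \<longlonglongrightarrow> 0"
      by (rule Lim_null_comparison[OF _ lim0]) (intro always_eventually allI bnd)
    moreover have S_lim: "(\<lambda>m. S m t) \<longlonglongrightarrow> Z t" for t
      unfolding S_def Z_def by (rule summable_LIMSEQ[OF sz])
    then have "(\<lambda>m. integral {u..v} (\<lambda>t. lin Z t + g t) - (S m v - S m u))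
        \<longlonglongrightarrow> integral {u..v} (\<lambda>t. lin Z t + g t) - (Z v - Z u)"
      by (intro tendsto_intros S_lim)
    ultimately have "0 = integral {u..v} (\<lambda>t. lin Z t + g t) - (Z v - Z u)" by (rule LIMSEQ_unique)
    then have "integral {u..v} (\<lambda>t. lin Z t + g t) = Z v - Z u" by simp
    then show "((\<lambda>t. lin Z t + g t) has_integral Z v - Z u) {u..v}" using integrable_integral[OF iZ] by simp
  qed
  have "S m \<in> Lp_set p \<and> Lp_norm p (S m) \<le> (\<Sum>k. Lp_norm p (green (f k)))" for m
  proof -
    have "S m \<in> Lp_set p \<and> Lp_norm p (S m) \<le> (\<Sum>k<m. Lp_norm p (z k))"
      unfolding S_def[abs_def] by (rule Lp_sum[OF p]) (auto intro: z)
    moreover have "(\<Sum>k<m. Lp_norm p (z k)) \<le> (\<Sum>k. Lp_norm p (green (f k)))"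
      unfolding z_def using sG Lp_norm_nonneg by (intro sum_le_suminf) auto
    ultimately show ?thesis by linarith
  qed
  moreover have "AE t in lebesgue. (\<lambda>m. S m t) \<longlonglongrightarrow> Z t"
    unfolding S_def Z_def by (intro always_eventually allI summable_LIMSEQ sz)
  ultimately have "Z \<in> Lp_set p" "Lp_norm p Z \<le> (\<Sum>k. Lp_norm p (green (f k)))"
    using Lp_fatou[OF p, of S _ Z] continuous_imp_lebesgue_measurable[OF Zc] by auto
  then show ?thesis using green_eqI[OF g _ solZ] by simp
qed

text \<open>Boundedness of the inverse, by Zabreiko's lemma: countable subadditivity is the form in which
  closedness of the graph is used.\<close>

lemma green_bounded: obtains K where "K > 0" "\<And>f. f \<in> Lp_set p \<Longrightarrow> Lp_norm p (green f) \<le> K * Lp_norm p f"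
proof -
  interpret Y: seminormed_space "Lp_set p :: (real \<Rightarrow> real^'n) set" "Lp_norm p" by (rule Lp_seminormed[OF p])
  show ?thesis
  proof (rule Y.countably_subadditive_seminorm_bounded[of "\<lambda>f. Lp_norm p (green f)"])
    show "Lp_norm p (green (c *\<^sub>R f)) = \<bar>c\<bar> * Lp_norm p (green f)" if "f \<in> Lp_set p" for c and f :: "real \<Rightarrow> real^'n"
      using green_scale[OF that, of c] Y.scale[OF green(1)[OF that], of c] by (simp add: scaleR_fun_def)
  qed (use Lp_complete[OF p] Lp_norm_nonneg green_countably_subadditive that in auto)
qed

text \<open>The heart of the matter: forcing supported near \<open>s\<close> produces a response that decays
  exponentially away from \<open>s\<close>, uniformly in \<open>s\<close>. Multiplying the response by an exponential weight of
  small rate \<open>\<delta>\<close> changes the equation by a term of relative size \<open>O(\<delta>)\<close>, which the bound on the Green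
  operator absorbs. The polynomial weight of the space costs only powers of \<open>\<bar>t - s\<bar>\<close>.\<close>

lemma green_decay:
  assumes h: "0 \<le> h"
  obtains K \<delta> where "K > 0" "\<delta> > 0"
    "\<And>s f c t. f \<in> borel_measurable lebesgue \<Longrightarrow> 0 \<le> c \<Longrightarrow> (\<And>t. norm (f t) \<le> c) \<Longrightarrow>
      (\<And>t. t \<notin> {s..s + h} \<Longrightarrow> f t = 0) \<Longrightarrow> norm (green f t) \<le> K * c * exp (- \<delta> * \<bar>t - s\<bar>)"
proof -
  obtain K where K: "K > 0" "\<And>f. f \<in> Lp_set p \<Longrightarrow> Lp_norm p (green f) \<le> K * Lp_norm p f"
    using green_bounded by blast
  have "((\<lambda>\<delta>. K * (\<delta> + lin_const * (exp (\<delta> * r N) - 1))) \<longlongrightarrow> K * (0 + lin_const * (exp (0 * r N) - 1))) (at_right 0)"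
    by (intro tendsto_intros)
  then have "\<forall>\<^sub>F \<delta> in at_right 0. K * (\<delta> + lin_const * (exp (\<delta> * r N) - 1)) < 1/2"
    by (intro order_tendstoD(2)) auto
  then obtain b where b: "b > 0" "\<And>\<delta>. 0 < \<delta> \<Longrightarrow> \<delta> < b \<Longrightarrow> K * (\<delta> + lin_const * (exp (\<delta> * r N) - 1)) < 1/2"
    by (auto simp: eventually_at_right_field)
  define \<delta> where "\<delta> = min (b / 2) 1"
  have \<delta>: "0 < \<delta>" "\<delta> \<le> 1" "K * (\<delta> + lin_const * (exp (\<delta> * r N) - 1)) \<le> 1/2"
  proof -
    show "0 < \<delta>" "\<delta> \<le> 1" using b(1) by (auto simp: \<delta>_def)
    moreover have "\<delta> < b" using b(1) by (auto simp: \<delta>_def)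
    ultimately show "K * (\<delta> + lin_const * (exp (\<delta> * r N) - 1)) \<le> 1/2" using b(2)[of \<delta>] by linarith
  qed
  define \<epsilon> where "\<epsilon> = \<delta> + lin_const * (exp (\<delta> * r N) - 1)"
  have ex: "0 \<le> exp (\<delta> * r N) - 1" using \<delta> r_nonneg by simp
  have \<epsilon>: "0 \<le> \<epsilon>" using \<delta> ex lin_const_nonneg by (simp add: \<epsilon>_def)
  define C1 where "C1 = (1 + h) * (2 * (1 + h\<^sup>2)) * exp h"
  define C2 where "C2 = 32 * (1 + lin_const) * (2 * K + (1 + \<epsilon> * (2 * K)))"
  define C3 where "C3 = C2 * C1"
  have pos: "0 < C1" "0 < C2"
  proof -
    have "0 < 1 + h" "0 < 1 + h\<^sup>2" using h by (simp_all add: add_pos_nonneg)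
    then show "0 < C1" by (simp add: C1_def)
    have "0 \<le> \<epsilon> * (2 * K)" using K(1) \<epsilon> by simp
    then have "0 < 2 * K + (1 + \<epsilon> * (2 * K))" using K(1) by linarith
    then show "0 < C2" using lin_const_nonneg by (simp add: C2_def)
  qed
  then have C3: "0 < C3" by (simp add: C3_def)
  have main: "norm (green f t) \<le> (4 * C3 * (1 + 8 / \<delta>\<^sup>2)) * c * exp (- (\<delta> / 2) * \<bar>t - s\<bar>)"
    if f: "f \<in> borel_measurable lebesgue" and c: "0 \<le> c" and fc: "\<And>t. norm (f t) \<le> c"
      and fs: "\<And>t. t \<notin> {s..s + h} \<Longrightarrow> f t = 0" for s f c t
  proof -
    have fL: "f \<in> Lp_set p" by (rule Lp_bounded_on_interval(1)[OF p f _ c, of s "s + h"]) (use h fc fs in auto)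
    define z where "z = green f"
    have z: "z \<in> Lp_set p" "solves f z" using green[OF fL] by (simp_all add: z_def)
    have zc: "continuous_on UNIV z" by (rule solvesD(1)[OF z(2)])
    have fb: "\<And>a b. \<exists>c. \<forall>t\<in>{a..b}. norm (f t) \<le> c" using fc by blast
    define d where "d = \<bar>t - s\<bar>"
    define X where "X = C3 * c * (2 * (1 + d\<^sup>2))"
    have X0: "0 \<le> X" using C3 c by (simp add: X_def)
    have weighted: "norm (z t) \<le> X * (\<eta> + 2 * exp (- \<delta> * d))" if \<eta>: "\<eta> > 0" for \<eta>
    proof -
      obtain \<rho> \<rho>' where \<rho>: "\<And>t. (\<rho> has_real_derivative \<rho>' t) (at t)" "continuous_on UNIV \<rho>'"
        "\<And>t. 0 < \<rho> t" "\<And>t. \<rho> t \<le> 1 / \<eta>" "\<And>t. \<bar>\<rho>' t\<bar> \<le> \<delta> * \<rho> t"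
        "\<And>t \<tau>. 0 \<le> \<tau> \<Longrightarrow> \<bar>\<rho> t - \<rho> (t - \<tau>)\<bar> \<le> (exp (\<delta> * \<tau>) - 1) * \<rho> (t - \<tau>)"
        "\<And>t. \<rho> t \<le> exp (\<delta> * \<bar>t - s\<bar>)" "\<And>t. 1 / \<rho> t \<le> \<eta> + 2 * exp (- \<delta> * \<bar>t - s\<bar>)"
        using exponential_weight_exists[OF \<delta>(1) \<eta>, of s] by metis
      have \<rho>c: "continuous_on UNIV \<rho>" using \<rho>(1) by (intro DERIV_continuous_on) auto
      define u where "u t = \<rho> t *\<^sub>R z t" for t
      have uc: "continuous_on UNIV u" unfolding u_def by (intro continuous_intros \<rho>c zc)
      have uL: "u \<in> Lp_set p"
      proof (rule Lp_scaled_dominated(1)[OF p continuous_imp_lebesgue_measurable[OF uc] z(1), of "1/\<eta>"])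
        have "norm (u t) \<le> 1 / \<eta> * norm (z t)" for t
          using mult_right_mono[OF \<rho>(4)[of t] norm_ge_zero[of "z t"]] \<rho>(3)[of t] by (simp add: u_def)
        then show "AE t in lebesgue. norm (u t) \<le> 1 / \<eta> * norm (z t)" by simp
      qed (use \<eta> in simp)
      \<comment> \<open>\<open>E1\<close> is the commutator of \<open>\<rho>\<close> with the delay terms, written in terms of \<open>u\<close>.\<close>
      define q where "q j t = (\<rho> t - \<rho> (t - r j)) / \<rho> (t - r j)" for j t
      define E0 where "E0 t = \<rho>' t *\<^sub>R z t" for t
      define E1 where "E1 t = (\<Sum>j\<le>N. A j t *v (q j t *\<^sub>R u (t - r j)))" for t
      define F where "F t = \<rho> t *\<^sub>R f t + (E0 t + E1 t)" for t
      have E0c: "continuous_on UNIV E0" unfolding E0_def by (intro continuous_intros \<rho>(2) zc)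
      have E0: "E0 \<in> Lp_set p" "Lp_norm p E0 \<le> \<delta> * Lp_norm p u"
      proof -
        have "norm (E0 t) \<le> \<delta> * norm (u t)" for t
          using mult_right_mono[OF \<rho>(5)[of t] norm_ge_zero[of "z t"]] \<rho>(3)[of t] by (simp add: E0_def u_def abs_of_pos)
        then show "E0 \<in> Lp_set p" "Lp_norm p E0 \<le> \<delta> * Lp_norm p u"
          using Lp_scaled_dominated[OF p continuous_imp_lebesgue_measurable[OF E0c] uL, of \<delta>] \<delta>(1) by auto
      qed
      have E1: "E1 \<in> Lp_set p" "Lp_norm p E1 \<le> lin_const * (exp (\<delta> * r N) - 1) * Lp_norm p u"
      proof -
        have "q j \<in> borel_measurable lebesgue" for j
        proof (rule continuous_imp_lebesgue_measurable)
          have "continuous_on UNIV (\<lambda>t. \<rho> (t - r j))"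
            by (rule continuous_on_compose2[OF \<rho>c]) (auto intro!: continuous_intros)
          then show "continuous_on UNIV (q j)"
            unfolding q_def using \<rho>(3) by (intro continuous_intros \<rho>c) (auto simp: less_imp_neq[symmetric])
        qed
        moreover have "\<bar>q j t\<bar> \<le> exp (\<delta> * r N) - 1" if j: "j \<le> N" for j t
        proof -
          have "\<bar>q j t\<bar> \<le> (exp (\<delta> * r j) - 1) * \<rho> (t - r j) / \<rho> (t - r j)"
            unfolding q_def abs_divide abs_of_pos[OF \<rho>(3)]
            by (rule divide_right_mono[OF \<rho>(6)[OF r_bounds(1)[OF j]] less_imp_le[OF \<rho>(3)]])
          also have "\<dots> = exp (\<delta> * r j) - 1" using \<rho>(3)[of "t - r j"] by simp
          also have "\<dots> \<le> exp (\<delta> * r N) - 1" using r_bounds(2)[OF j] \<delta>(1) by simp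
          finally show ?thesis .
        qed
        ultimately show "E1 \<in> Lp_set p" "Lp_norm p E1 \<le> lin_const * (exp (\<delta> * r N) - 1) * Lp_norm p u"
          unfolding E1_def[abs_def] using weighted_lin_Lp[OF p uL, of q "exp (\<delta> * r N) - 1"] ex by auto
      qed
      have \<rho>f: "(\<lambda>t. \<rho> t *\<^sub>R f t) \<in> Lp_set p" "Lp_norm p (\<lambda>t. \<rho> t *\<^sub>R f t) \<le> C1 * c * point_weight p s"
      proof -
        have m: "(\<lambda>t. \<rho> t *\<^sub>R f t) \<in> borel_measurable lebesgue"
          by (intro borel_measurable_scaleR continuous_imp_lebesgue_measurable \<rho>c f)
        have bd: "norm (\<rho> t *\<^sub>R f t) \<le> exp h * c" if t: "t \<in> {s..s + h}" for t
        proof -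
          have "\<delta> * \<bar>t - s\<bar> \<le> 1 * h" using t \<delta> by (intro mult_mono) auto
          then have "exp (\<delta> * \<bar>t - s\<bar>) \<le> exp h" by simp
          then have "\<rho> t \<le> exp h" using \<rho>(7)[of t] by linarith
          then show ?thesis using fc[of t] c \<rho>(3)[of t] by (simp add: abs_of_pos mult_mono)
        qed
        have e0: "0 \<le> exp h * c" using c by simp
        have le: "s \<le> s + h" using h by simp
        show "(\<lambda>t. \<rho> t *\<^sub>R f t) \<in> Lp_set p" "Lp_norm p (\<lambda>t. \<rho> t *\<^sub>R f t) \<le> C1 * c * point_weight p s"
          using Lp_bounded_on_interval[OF p m le e0 bd] fs by (auto simp: C1_def mult.assoc)
      qed
      have FL: "F \<in> Lp_set p" and Fn: "Lp_norm p F \<le> C1 * c * point_weight p s + \<epsilon> * Lp_norm p u"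
      proof -
        have E: "(\<lambda>t. E0 t + E1 t) \<in> Lp_set p" "Lp_norm p (\<lambda>t. E0 t + E1 t) \<le> \<epsilon> * Lp_norm p u"
          using Lp_add[OF p E0(1) E1(1)] E0(2) E1(2) by (auto simp: \<epsilon>_def distrib_right)
        show "F \<in> Lp_set p" unfolding F_def[abs_def] by (rule Lp_add(1)[OF p \<rho>f(1) E(1)])
        show "Lp_norm p F \<le> C1 * c * point_weight p s + \<epsilon> * Lp_norm p u"
          unfolding F_def[abs_def] using Lp_add(2)[OF p \<rho>f(1) E(1)] \<rho>f(2) E(2) by linarith
      qed
      have solu: "solves F u"
      proof (rule solvesI[OF uc])
        fix a b :: real assume ab: "a \<le> b"
        have lip: "\<bar>\<rho> v - \<rho> w\<bar> \<le> (\<delta> / \<eta>) * (v - w)" if "w \<le> v" for v w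
        proof -
          have "norm (\<rho> v - \<rho> w) \<le> (\<delta> / \<eta>) * norm (v - w)"
          proof (rule field_differentiable_bound[of UNIV])
            show "(\<rho> has_field_derivative \<rho>' x) (at x within UNIV)" for x using \<rho>(1) by simp
            show "norm (\<rho>' x) \<le> \<delta> / \<eta>" for x
              using \<rho>(5)[of x] mult_left_mono[OF \<rho>(4)[of x], of \<delta>] \<delta>(1) by simp
          qed auto
          then show ?thesis using that by simp
        qed
        have "((\<lambda>t. \<rho> t *\<^sub>R (lin z t + f t) + \<rho>' t *\<^sub>R z t) has_integral \<rho> b *\<^sub>R z b - \<rho> a *\<^sub>R z a) {a..b}"
        proof (rule product_has_integral[OF solvesD(3)[OF z(2), of a] f fb])
          show "\<bar>\<rho> v - \<rho> w\<bar> \<le> (\<delta> / \<eta>) * (v - w)" if "w \<le> v" for v w by (rule lip[OF that])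
          show "0 \<le> \<delta> / \<eta>" using \<delta>(1) \<eta> by simp
          show "AE t in lebesgue. a < t \<longrightarrow> (\<rho> has_vector_derivative \<rho>' t) (at t)"
            using \<rho>(1) by (simp add: has_real_derivative_iff_has_vector_derivative)
          show "a \<le> a" "a \<le> b" using ab by simp_all
        qed
        moreover have "\<rho> t *\<^sub>R (lin z t + f t) + \<rho>' t *\<^sub>R z t = lin u t + F t" for t
        proof -
          have "\<rho> t *\<^sub>R lin z t = lin u t + E1 t"
          proof -
            have "\<rho> t *\<^sub>R z (t - r j) = u (t - r j) + q j t *\<^sub>R u (t - r j)" for j
            proof -
              have "q j t * \<rho> (t - r j) = \<rho> t - \<rho> (t - r j)" using \<rho>(3)[of "t - r j"] by (simp add: q_def)
              then show ?thesis by (simp add: u_def scaleR_diff_left)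
            qed
            then have "\<rho> t *\<^sub>R (A j t *v z (t - r j)) = A j t *v u (t - r j) + A j t *v (q j t *\<^sub>R u (t - r j))" for j
              by (simp flip: matrix_vector_mult_scaleR matrix_vector_right_distrib)
            then show ?thesis by (simp add: lin_def E1_def scaleR_sum_right sum.distrib)
          qed
          then show ?thesis by (simp add: F_def E0_def scaleR_add_right)
        qed
        ultimately show "((\<lambda>t. lin u t + F t) has_integral u b - u a) {a..b}" by (simp add: u_def)
      qed
      have "green F = u" by (rule green_eqI[OF FL uL solu])
      then have "Lp_norm p u \<le> K * Lp_norm p F" using K(2)[OF FL] by simp
      also have "\<dots> \<le> K * (C1 * c * point_weight p s + \<epsilon> * Lp_norm p u)" using Fn K(1) by (intro mult_left_mono) auto
      also have "\<dots> = K * (C1 * c * point_weight p s) + (K * \<epsilon>) * Lp_norm p u" by (simp add: distrib_left)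
      also have "(K * \<epsilon>) * Lp_norm p u \<le> 1/2 * Lp_norm p u"
        using \<delta>(3) by (intro mult_right_mono Lp_norm_nonneg) (simp add: \<epsilon>_def)
      finally have un: "Lp_norm p u \<le> 2 * K * (C1 * c * point_weight p s)" by simp
      have "norm (u t) \<le> 32 * (1 + lin_const) * (Lp_norm p u + Lp_norm p F) / point_weight p t"
        by (rule solves_pointwise_bound[OF p uL FL solu])
      also have "\<dots> \<le> (C2 * (C1 * c * point_weight p s)) / point_weight p t"
      proof (rule divide_right_mono)
        have "\<epsilon> * Lp_norm p u \<le> \<epsilon> * (2 * K * (C1 * c * point_weight p s))" by (rule mult_left_mono[OF un \<epsilon>])
        then have "Lp_norm p u + Lp_norm p F \<le> (2 * K + (1 + \<epsilon> * (2 * K))) * (C1 * c * point_weight p s)"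
          using un Fn by (simp add: algebra_simps)
        then have "32 * (1 + lin_const) * (Lp_norm p u + Lp_norm p F) \<le> 32 * (1 + lin_const) * ((2 * K + (1 + \<epsilon> * (2 * K))) * (C1 * c * point_weight p s))"
          using lin_const_nonneg by (intro mult_left_mono) auto
        then show "32 * (1 + lin_const) * (Lp_norm p u + Lp_norm p F) \<le> C2 * (C1 * c * point_weight p s)"
          by (simp only: C2_def mult.assoc)
      qed (use point_weight_pos[of p t] in simp)
      also have "\<dots> = C3 * c * (point_weight p s / point_weight p t)" by (simp add: C3_def)
      also have "\<dots> \<le> C3 * c * (2 * (1 + d\<^sup>2))"
      proof (rule mult_left_mono)
        have "(s - t)\<^sup>2 = d\<^sup>2" by (simp add: d_def power2_commute)
        then show "point_weight p s / point_weight p t \<le> 2 * (1 + d\<^sup>2)"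
          using point_weight_shift[OF p, of s t] point_weight_pos[of p t] by (simp add: pos_divide_le_eq)
      qed (use C3 c in simp)
      finally have uX: "norm (u t) \<le> X" by (simp add: X_def)
      have "norm (z t) = norm (u t) * (1 / \<rho> t)" using \<rho>(3)[of t] by (simp add: u_def abs_of_pos)
      also have "\<dots> \<le> X * (\<eta> + 2 * exp (- \<delta> * d))"
        using uX \<rho>(8)[of t] \<rho>(3)[of t] X0 by (intro mult_mono) (auto simp: d_def)
      finally show ?thesis .
    qed
    \<comment> \<open>The constants do not depend on the saturation height \<open>1/\<eta>\<close>, which is sent to infinity.\<close>
    have zX: "norm (z t) \<le> X * (2 * exp (- \<delta> * d))"
    proof (rule tendsto_lowerbound)
      show "((\<lambda>\<eta>. X * (\<eta> + 2 * exp (- \<delta> * d))) \<longlongrightarrow> X * (2 * exp (- \<delta> * d))) (at_right 0)"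
        by (auto intro!: tendsto_eq_intros)
      show "\<forall>\<^sub>F \<eta> in at_right 0. norm (z t) \<le> X * (\<eta> + 2 * exp (- \<delta> * d))"
        unfolding eventually_at_right_field using weighted by (intro exI[of _ 1]) auto
    qed simp
    have "1 + d\<^sup>2 \<le> (1 + 8 / \<delta>\<^sup>2) * exp (\<delta> / 2 * d)"
    proof -
      define e where "e = exp (\<delta> / 2 * d)"
      have d0: "0 \<le> \<delta> / 2 * d" using \<delta>(1) by (simp add: d_def)
      have "(\<delta> / 2 * d)\<^sup>2 / 2 \<le> e"
        using exp_lower_Taylor_quadratic[OF d0] d0 unfolding e_def by linarith
      then have "d\<^sup>2 \<le> 8 / \<delta>\<^sup>2 * e" using \<delta>(1) by (simp add: field_simps)
      moreover have "1 \<le> e" using d0 by (simp add: e_def)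
      moreover have "(1 + 8 / \<delta>\<^sup>2) * e = e + 8 / \<delta>\<^sup>2 * e" by (simp add: distrib_right)
      ultimately show ?thesis unfolding e_def[symmetric] by linarith
    qed
    then have "X * (2 * exp (- \<delta> * d)) \<le> (C3 * c * (2 * ((1 + 8 / \<delta>\<^sup>2) * exp (\<delta> / 2 * d)))) * (2 * exp (- \<delta> * d))"
      unfolding X_def using C3 c by (intro mult_right_mono mult_left_mono) auto
    also have "\<dots> = (4 * C3 * (1 + 8 / \<delta>\<^sup>2)) * c * (exp (\<delta> / 2 * d) * exp (- \<delta> * d))" by (simp only: ac_simps)
    also have "exp (\<delta> / 2 * d) * exp (- \<delta> * d) = exp (- (\<delta> / 2) * d)" by (simp flip: exp_add)
    finally show ?thesis using zX unfolding z_def d_def by linarith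
  qed
  show ?thesis
  proof (rule that[OF _ _ main])
    have "0 < 1 + 8 / \<delta>\<^sup>2" using \<delta>(1) by (intro add_pos_nonneg) auto
    then show "0 < 4 * C3 * (1 + 8 / \<delta>\<^sup>2)" using C3 by simp
    show "0 < \<delta> / 2" using \<delta> by simp
  qed
qed

end

section \<open>The dichotomy\<close>

context delay_system
begin

abbreviation segments :: "(real \<Rightarrow> real^'n) set" where
  "segments \<equiv> C_set (r N)"

abbreviation seg_norm :: "(real \<Rightarrow> real^'n) \<Rightarrow> real" where
  "seg_norm \<equiv> sup_norm (r N)"

abbreviation seg :: "(real \<Rightarrow> real^'n) \<Rightarrow> real \<Rightarrow> real \<Rightarrow> real^'n" where
  "seg \<equiv> history (r N)"

abbreviation T :: "real \<Rightarrow> real \<Rightarrow> (real \<Rightarrow> real^'n) \<Rightarrow> real \<Rightarrow> real^'n" where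
  "T \<equiv> sol_op N r A"

lemma seg_norm_le: "(\<And>\<theta>. \<theta> \<in> {- r N..0} \<Longrightarrow> norm (\<phi> \<theta>) \<le> c) \<Longrightarrow> seg_norm \<phi> \<le> c"
  unfolding sup_norm_def using r_nonneg by (intro cSUP_least) auto

lemma le_seg_norm:
  assumes "\<phi> \<in> segments" "\<theta> \<in> {- r N..0}"
  shows "norm (\<phi> \<theta>) \<le> seg_norm \<phi>"
proof -
  have "continuous_on {- r N..0} (\<lambda>\<theta>. norm (\<phi> \<theta>))"
    using assms(1) by (intro continuous_on_norm) (simp add: C_set_def)
  then have "bdd_above ((\<lambda>\<theta>. norm (\<phi> \<theta>)) ` {- r N..0})"
    by (intro bounded_imp_bdd_above compact_imp_bounded compact_continuous_image) auto
  then show ?thesis unfolding sup_norm_def using assms(2) by (intro cSUP_upper)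
qed

lemma seg_norm_nonneg: "\<phi> \<in> segments \<Longrightarrow> 0 \<le> seg_norm \<phi>"
  using order.trans[OF norm_ge_zero le_seg_norm[of \<phi> 0]] r_nonneg by simp

lemma segments_subspace: "subspace segments"
  unfolding subspace_def C_set_def mem_Collect_eq zero_fun_def plus_fun_def scaleR_fun_def
  by (intro conjI allI ballI impI) (auto intro!: continuous_on_add continuous_on_scaleR continuous_on_const)

lemma seg_norm_zero: "seg_norm 0 = 0"
proof (rule antisym)
  show "seg_norm 0 \<le> 0" by (rule seg_norm_le) simp
  show "0 \<le> seg_norm 0" by (rule seg_norm_nonneg[OF subspace_0[OF segments_subspace]])
qed

lemma seg_norm_minus: "seg_norm (\<phi> - \<psi>) = seg_norm (\<psi> - \<phi>)"
  by (simp add: sup_norm_def norm_minus_commute)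

lemma seg_norm_add:
  assumes "\<phi> \<in> segments" "\<psi> \<in> segments"
  shows "seg_norm (\<phi> + \<psi>) \<le> seg_norm \<phi> + seg_norm \<psi>"
proof (rule seg_norm_le)
  fix \<theta> assume "\<theta> \<in> {- r N..0}"
  then show "norm ((\<phi> + \<psi>) \<theta>) \<le> seg_norm \<phi> + seg_norm \<psi>"
    using norm_triangle_mono[OF le_seg_norm[OF assms(1)] le_seg_norm[OF assms(2)]] by simp
qed

lemma seg_add: "seg (\<lambda>t. x t + y t) s = seg x s + seg y s"
  by (auto simp: history_def fun_eq_iff)

lemma seg_diff: "seg (\<lambda>t. x t - y t) s = seg x s - seg y s"
  by (auto simp: history_def fun_eq_iff)

lemma seg_scale: "seg (\<lambda>t. c *\<^sub>R x t) s = c *\<^sub>R seg x s"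
  by (auto simp: history_def fun_eq_iff scaleR_fun_def)

lemma seg_in_segments: "continuous_on UNIV x \<Longrightarrow> seg x s \<in> segments"
  by (rule history_in_C_set, erule continuous_on_subset) simp

lemma seg_eqD: "seg x s = seg y s \<Longrightarrow> s - r N \<le> t \<Longrightarrow> t \<le> s \<Longrightarrow> x t = y t"
  by (drule fun_cong[of _ _ "t - s"]) (simp add: history_def)

lemma norm_seg_le:
  assumes "continuous_on UNIV x" "s - r N \<le> t" "t \<le> s"
  shows "norm (x t) \<le> seg_norm (seg x s)"
  using le_seg_norm[OF seg_in_segments[OF assms(1)], of "t - s" s] assms(2,3) by (simp add: history_def)

lemma seg_norm_seg_le:
  "(\<And>t. s - r N \<le> t \<Longrightarrow> t \<le> s \<Longrightarrow> norm (x t) \<le> c) \<Longrightarrow> seg_norm (seg x s) \<le> c"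
  by (rule seg_norm_le) (auto simp: history_def)

lemma T_linear:
  assumes "\<phi> \<in> segments" "\<psi> \<in> segments" "s \<le> t"
  shows "T t s (\<phi> + \<psi>) = T t s \<phi> + T t s \<psi>" "T t s (c *\<^sub>R \<phi>) = c *\<^sub>R T t s \<phi>"
    "T t s (\<phi> - \<psi>) = T t s \<phi> - T t s \<psi>"
proof -
  obtain x where x: "solves_from s (\<lambda>_. 0) x" "seg x s = \<phi>" using initial_value_solution[OF assms(1)] .
  obtain y where y: "solves_from s (\<lambda>_. 0) y" "seg y s = \<psi>" using initial_value_solution[OF assms(2)] .
  have "solves_from s (\<lambda>_. 0) (\<lambda>t. x t + y t)" "solves_from s (\<lambda>_. 0) (\<lambda>t. x t - y t)"
    "solves_from s (\<lambda>_. 0) (\<lambda>t. c *\<^sub>R x t)"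
    using solves_from_add[OF x(1) y(1)] solves_from_diff[OF x(1) y(1)] solves_from_scale[OF x(1), of c] by simp_all
  from this[THEN sol_op_eq, OF assms(3)]
  show "T t s (\<phi> + \<psi>) = T t s \<phi> + T t s \<psi>" "T t s (c *\<^sub>R \<phi>) = c *\<^sub>R T t s \<phi>"
    "T t s (\<phi> - \<psi>) = T t s \<phi> - T t s \<psi>"
    using sol_op_eq[OF x(1) assms(3)] sol_op_eq[OF y(1) assms(3)]
    by (simp_all add: seg_add seg_diff seg_scale x(2) y(2))
qed

lemma T_bounded:
  assumes "\<phi> \<in> segments" "s \<le> t"
  shows "T t s \<phi> \<in> segments" "seg_norm (T t s \<phi>) \<le> exp (M * (t - s)) * seg_norm \<phi>"
proof -
  obtain x where x: "solves_from s (\<lambda>_. 0) x" "seg x s = \<phi>" using initial_value_solution[OF assms(1)] .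
  note cont = solves_fromD(1)[OF x(1)]
  have T: "T t s \<phi> = seg x t" using sol_op_eq[OF x(1) assms(2)] x(2) by simp
  then show "T t s \<phi> \<in> segments" using seg_in_segments[OF cont] by simp
  have init: "norm (x u) \<le> seg_norm \<phi>" if "u \<in> {s - r N..s}" for u
    using norm_seg_le[OF cont, of s u] that x(2) by simp
  have "norm (x u) \<le> seg_norm \<phi> * exp (M * (t - s))" if u: "t - r N \<le> u" "u \<le> t" for u
  proof (cases "s \<le> u")
    case True
    then have "norm (x u) \<le> seg_norm \<phi> * exp (M * (u - s))" using solution_growth[OF x(1) init] by simp
    also have "\<dots> \<le> seg_norm \<phi> * exp (M * (t - s))"
      using seg_norm_nonneg[OF assms(1)] M_pos u by (intro mult_left_mono) auto
    finally show ?thesis .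
  next
    case False
    then have "norm (x u) \<le> seg_norm \<phi> * 1" using init[of u] u assms(2) by simp
    also have "\<dots> \<le> seg_norm \<phi> * exp (M * (t - s))"
      using seg_norm_nonneg[OF assms(1)] M_pos assms(2) by (intro mult_left_mono) auto
    finally show ?thesis .
  qed
  then show "seg_norm (T t s \<phi>) \<le> exp (M * (t - s)) * seg_norm \<phi>"
    unfolding T by (intro seg_norm_seg_le) (simp add: mult.commute)
qed

text \<open>After a short time \<open>h\<close> the solution operator has moved \<open>\<phi>\<close> by little more than the
  oscillation of \<open>\<phi>\<close> over distances \<open>h\<close>. The bound depends on \<open>\<phi>\<close> only through this oscillation
  and the norm, and not on \<open>s\<close>.\<close>

lemma T_short_time:
  assumes \<phi>: "\<phi> \<in> segments" and h: "0 \<le> h" "h \<le> 1"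
    and osc: "\<And>\<theta> \<theta>'. \<theta> \<in> {- r N..0} \<Longrightarrow> \<theta>' \<in> {- r N..0} \<Longrightarrow> \<bar>\<theta> - \<theta>'\<bar> \<le> h \<Longrightarrow> norm (\<phi> \<theta> - \<phi> \<theta>') \<le> \<epsilon>"
  shows "seg_norm (T (s + h) s \<phi> - \<phi>) \<le> \<epsilon> + M * (seg_norm \<phi> * exp M) * h"
proof -
  obtain x where x: "solves_from s (\<lambda>_. 0) x" "seg x s = \<phi>" using initial_value_solution[OF \<phi>] .
  note cont = solves_fromD(1)[OF x(1)]
  have st: "s \<le> s + h" using h by simp
  have T: "T (s + h) s \<phi> = seg x (s + h)" using sol_op_eq[OF x(1) st] x(2) by simp
  have xs: "x (s + \<theta>) = \<phi> \<theta>" if "\<theta> \<in> {- r N..0}" for \<theta>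
    using that by (simp add: x(2)[symmetric] history_def)
  have init: "norm (x u) \<le> seg_norm \<phi>" if "u \<in> {s - r N..s}" for u
    using norm_seg_le[OF cont, of s u] that x(2) by simp
  define c where "c = seg_norm \<phi> * exp M"
  have e1: "1 \<le> exp M" using M_pos by simp
  have c: "0 \<le> c" "seg_norm \<phi> \<le> c"
    using seg_norm_nonneg[OF \<phi>] mult_left_mono[OF e1, of "seg_norm \<phi>"] by (auto simp: c_def)
  have xb: "norm (x u) \<le> c" if "s - r N \<le> u" "u \<le> s + h" for u
  proof (cases "s \<le> u")
    case True
    then have "norm (x u) \<le> seg_norm \<phi> * exp (M * (u - s))" using solution_growth[OF x(1) init] by simp
    also have "M * (u - s) \<le> M * 1" using that h M_pos by (intro mult_left_mono) auto
    then have "seg_norm \<phi> * exp (M * (u - s)) \<le> c"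
      unfolding c_def using seg_norm_nonneg[OF \<phi>] by (intro mult_left_mono) auto
    finally show ?thesis .
  next
    case False
    then show ?thesis using init[of u] that c by simp
  qed
  have move: "norm (x u - x s) \<le> M * c * (u - s)" if u: "s \<le> u" "u \<le> s + h" for u
  proof -
    have I: "((\<lambda>t. lin x t + 0) has_integral x u - x s) {s..u}" using solves_fromD(2)[OF x(1), of s u] u by simp
    have "norm (lin x v + 0) \<le> M * c" if "v \<in> {s..u}" for v
      using that u by (simp, intro lin_bound xb) auto
    then show ?thesis using has_integral_bound_real[OF _ finite.emptyI I, of "M * c"] M_pos c u by simp
  qed
  show ?thesis
  proof (rule seg_norm_le)
    fix \<theta> assume \<theta>: "\<theta> \<in> {- r N..0}"
    have eq: "(T (s + h) s \<phi> - \<phi>) \<theta> = x (s + h + \<theta>) - \<phi> \<theta>" using \<theta> by (simp add: T history_def)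
    have Mc: "0 \<le> M * c * h" using M_pos c h by simp
    have "norm (x (s + h + \<theta>) - \<phi> \<theta>) \<le> \<epsilon> + M * c * h"
    proof (cases "h + \<theta> \<le> 0")
      case True
      then have "h + \<theta> \<in> {- r N..0}" using \<theta> h by auto
      then show ?thesis using osc[of "h + \<theta>" \<theta>] xs[of "h + \<theta>"] \<theta> h Mc by (simp add: add.assoc)
    next
      case False
      have z: "0 \<in> {- r N..0}" using r_nonneg by simp
      have "norm (x (s + h + \<theta>) - x s) \<le> M * c * (s + h + \<theta> - s)" using False \<theta> by (intro move) auto
      also have "\<dots> \<le> M * c * h" using \<theta> M_pos c by (intro mult_left_mono) auto
      finally have "norm (x (s + h + \<theta>) - x s) \<le> M * c * h" .
      moreover have "norm (x s - \<phi> \<theta>) \<le> \<epsilon>" using osc[OF z \<theta>] xs[OF z] False \<theta> by simp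
      moreover have "norm (x (s + h + \<theta>) - \<phi> \<theta>) \<le> norm (x (s + h + \<theta>) - x s) + norm (x s - \<phi> \<theta>)"
        using norm_triangle_ineq[of "x (s + h + \<theta>) - x s" "x s - \<phi> \<theta>"] by simp
      ultimately show ?thesis by linarith
    qed
    then show "norm ((T (s + h) s \<phi> - \<phi>) \<theta>) \<le> \<epsilon> + M * (seg_norm \<phi> * exp M) * h"
      unfolding eq c_def .
  qed
qed

text \<open>A solution started at time \<open>s\<close> is switched on gradually by the ramp \<open>\<xi>\<close> and continued by \<open>0\<close>
  to the left. The result solves the equation on the whole line up to a forcing term that lives on
  \<open>[s, s + 1 + r N]\<close>, where the delays still see the ramp.\<close>

lemma switched_on_solution:
  assumes x: "solves_from s (\<lambda>_. 0) x" and c: "\<And>t. t \<in> {s - r N..s} \<Longrightarrow> norm (x t) \<le> c" "0 \<le> c"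
  obtains y f where "solves f y" "f \<in> borel_measurable lebesgue"
    "\<And>t. norm (f t) \<le> (1 + 2 * M) * (c * exp (M * (1 + r N)))"
    "\<And>t. t \<notin> {s..s + (1 + r N)} \<Longrightarrow> f t = 0"
    "\<And>t. t \<le> s \<Longrightarrow> y t = 0" "\<And>t. s + 1 \<le> t \<Longrightarrow> y t = x t"
    "\<And>t. norm (x t - y t) \<le> norm (x t)"
proof -
  define \<xi> where "\<xi> t = max 0 (min 1 (t - s))" for t
  define \<xi>' where "\<xi>' t = (if s < t \<and> t < s + 1 then 1 else 0 :: real)" for t
  define y where "y t = \<xi> t *\<^sub>R x t" for t
  define f where "f t = \<xi>' t *\<^sub>R x t + \<xi> t *\<^sub>R lin x t - lin y t" for t
  note cont = solves_fromD(1)[OF x]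
  have \<xi>c: "continuous_on UNIV \<xi>" unfolding \<xi>_def by (intro continuous_intros)
  have \<xi>: "0 \<le> \<xi> t" "\<xi> t \<le> 1" "t \<le> s \<Longrightarrow> \<xi> t = 0" "s + 1 \<le> t \<Longrightarrow> \<xi> t = 1" for t
    by (auto simp: \<xi>_def)
  have yc: "continuous_on UNIV y" unfolding y_def by (intro continuous_intros \<xi>c cont)
  have y0: "y t = 0" if "t \<le> s" for t using that \<xi> by (simp add: y_def)
  have y1: "y t = x t" if "s + 1 \<le> t" for t using that \<xi> by (simp add: y_def)
  have left: "lin y t = 0" "f t = 0" if "t \<le> s" for t
  proof -
    have "lin y t = lin (\<lambda>_. 0) t" using that y0 by (intro lin_cong) auto
    then show "lin y t = 0" by (simp add: lin_zero)
    then show "f t = 0" using that \<xi>(3)[of t] by (simp add: f_def \<xi>'_def)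
  qed
  have right: "f t = 0" if "s + (1 + r N) < t" for t
  proof -
    have "lin y t = lin x t" using that y1 by (intro lin_cong) auto
    then show ?thesis using that \<xi>(4)[of t] r_nonneg by (simp add: f_def \<xi>'_def)
  qed
  have after: "((\<lambda>t. lin y t + f t) has_integral y b - y a) {a..b}" if ab: "s \<le> a" "a \<le> b" for a b
  proof -
    have "((\<lambda>t. \<xi> t *\<^sub>R (lin x t + 0) + \<xi>' t *\<^sub>R x t) has_integral \<xi> b *\<^sub>R x b - \<xi> a *\<^sub>R x a) {a..b}"
    proof (rule product_has_integral[OF x, where K = 1])
      show "(\<lambda>_. 0 :: real^'n) \<in> borel_measurable lebesgue" "\<And>a b. \<exists>c. \<forall>t\<in>{a..b}. norm (0 :: real^'n) \<le> c"
        by auto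
      show "\<bar>\<xi> v - \<xi> u\<bar> \<le> 1 * (v - u)" if "s \<le> u" "u \<le> v" for u v
        using that by (auto simp: \<xi>_def max_def min_def)
      show "AE t in lebesgue. s < t \<longrightarrow> (\<xi> has_vector_derivative \<xi>' t) (at t)"
        using AE_not_point[of "s + 1"]
      proof eventually_elim
        case (elim t)
        show ?case
        proof
          assume "s < t"
          show "(\<xi> has_vector_derivative \<xi>' t) (at t)"
          proof (cases "t < s + 1")
            case True
            have "((\<lambda>t. t - s) has_vector_derivative 1) (at t)"
              by (auto intro!: derivative_eq_intros simp flip: has_real_derivative_iff_has_vector_derivative)
            then have "(\<xi> has_vector_derivative 1) (at t)"
              by (rule has_vector_derivative_transform_within_open[of _ _ _ "{s<..<s + 1}"])
                (use True \<open>s < t\<close> in \<open>auto simp: \<xi>_def\<close>)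
            then show ?thesis using True \<open>s < t\<close> by (simp add: \<xi>'_def)
          next
            case False
            have "((\<lambda>_. 1 :: real) has_vector_derivative 0) (at t)" by simp
            then have "(\<xi> has_vector_derivative 0) (at t)"
              by (rule has_vector_derivative_transform_within_open[of _ _ _ "{s + 1<..}"])
                (use False elim in \<open>auto simp: \<xi>_def\<close>)
            then show ?thesis using False by (simp add: \<xi>'_def)
          qed
        qed
      qed
    qed (use ab in auto)
    moreover have "\<xi> t *\<^sub>R (lin x t + 0) + \<xi>' t *\<^sub>R x t = lin y t + f t" for t by (simp add: f_def)
    ultimately show ?thesis by (simp add: y_def)
  qed
  have before: "((\<lambda>t. lin y t + f t) has_integral 0) {a..b}" if "b \<le> s" for a b
    by (rule has_integral_is_0) (use that left in auto)
  have sol: "solves f y"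
  proof (rule solvesI[OF yc])
    fix a b :: real assume ab: "a \<le> b"
    consider "s \<le> a" | "b \<le> s" | "a \<le> s" "s \<le> b" by linarith
    then show "((\<lambda>t. lin y t + f t) has_integral y b - y a) {a..b}"
    proof cases
      case 1 then show ?thesis using after ab by simp
    next
      case 2 then show ?thesis using before[of b a] y0 ab by simp
    next
      case 3
      have "((\<lambda>t. lin y t + f t) has_integral 0 + (y b - y s)) {a..b}"
        using 3 before[of s a] after[of s b] by (intro has_integral_combine[of a s b]) auto
      then show ?thesis using y0 3 by simp
    qed
  qed
  have fm: "f \<in> borel_measurable lebesgue"
  proof -
    have "\<xi>' = indicator {s<..<s + 1}" by (auto simp: \<xi>'_def indicator_def fun_eq_iff)
    moreover have "(indicator {s<..<s + 1} :: real \<Rightarrow> real) \<in> borel_measurable lebesgue"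
      by (intro borel_measurable_indicator) simp
    ultimately have \<xi>'m: "\<xi>' \<in> borel_measurable lebesgue" by simp
    show ?thesis
      unfolding f_def[abs_def]
      by (intro borel_measurable_diff borel_measurable_add borel_measurable_scaleR lin_measurable \<xi>'m
          continuous_imp_lebesgue_measurable[OF cont] continuous_imp_lebesgue_measurable[OF yc]
          continuous_imp_lebesgue_measurable[OF \<xi>c])
  qed
  define c' where "c' = c * exp (M * (1 + r N))"
  have e1: "1 \<le> exp (M * (1 + r N))" using M_pos r_nonneg by simp
  have cc': "0 \<le> c'" "c \<le> c'" using c(2) mult_left_mono[OF e1 c(2)] by (auto simp: c'_def)
  have xb: "norm (x t) \<le> c'" if "s - r N \<le> t" "t \<le> s + (1 + r N)" for t
  proof (cases "s \<le> t")
    case True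
    then have "norm (x t) \<le> c * exp (M * (t - s))" using solution_growth[OF x c(1)] by simp
    also have "M * (t - s) \<le> M * (1 + r N)" using that M_pos by (intro mult_left_mono) auto
    then have "c * exp (M * (t - s)) \<le> c'" unfolding c'_def using c(2) by (intro mult_left_mono) auto
    finally show ?thesis .
  next
    case False
    then show ?thesis using c(1)[of t] that cc' by simp
  qed
  have yb: "norm (y t) \<le> norm (x t)" for t using \<xi>[of t] by (simp add: y_def mult_left_le_one_le)
  have fb: "norm (f t) \<le> (1 + 2 * M) * c'" for t
  proof (cases "t \<in> {s..s + (1 + r N)}")
    case True
    have 1: "norm (\<xi>' t *\<^sub>R x t) \<le> c'"
      using xb[of t] True r_nonneg cc' by (auto simp: \<xi>'_def)
    have "norm (lin x t) \<le> M * c'" using True by (intro lin_bound xb) auto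
    then have 2: "norm (\<xi> t *\<^sub>R lin x t) \<le> M * c'"
      using \<xi>[of t] mult_left_le_one_le[of "norm (lin x t)" "\<xi> t"] by simp
    have 3: "norm (lin y t) \<le> M * c'" using True by (intro lin_bound order.trans[OF yb xb]) auto
    have "norm (f t) \<le> norm (\<xi>' t *\<^sub>R x t) + norm (\<xi> t *\<^sub>R lin x t) + norm (lin y t)"
      unfolding f_def by (intro order.trans[OF norm_triangle_ineq4] add_mono norm_triangle_ineq order_refl)
    then show ?thesis using 1 2 3 by (simp add: algebra_simps)
  next
    case False
    then have "f t = 0" using left right by force
    then show ?thesis using cc' M_pos by simp
  qed
  have xy: "norm (x t - y t) \<le> norm (x t)" for t
  proof -
    have "x t - y t = (1 - \<xi> t) *\<^sub>R x t" by (simp add: y_def algebra_simps)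
    then show ?thesis using \<xi>[of t] by (simp add: mult_left_le_one_le)
  qed
  show ?thesis
    by (rule that[OF sol fm _ _ y0 y1 xy]) (use fb left right in \<open>auto simp: c'_def not_le\<close>)
qed

end

context admissible_system
begin

text \<open>Both subspaces are defined by membership in \<open>L\<^sup>p\<^sub>\<mu>\<close> near one end of the line, the condition to
  which injectivity applies; that such solutions decay exponentially is a result.\<close>

definition stable :: "real \<Rightarrow> (real \<Rightarrow> real^'n) set" where
  "stable s = {seg x s | x. solves_from s (\<lambda>_. 0) x \<and> (\<lambda>t. if s \<le> t then x t else 0) \<in> Lp_set p}"

definition unstable :: "real \<Rightarrow> (real \<Rightarrow> real^'n) set" where
  "unstable s = {seg w s | w. solves (\<lambda>_. 0) w \<and> (\<lambda>t. if t \<le> s then w t else 0) \<in> Lp_set p}"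

lemma stable_subspace: "subspace (stable s)"
  unfolding subspace_def
proof (intro conjI ballI allI)
  show "0 \<in> stable s"
    unfolding stable_def mem_Collect_eq
  proof (intro exI[of _ "\<lambda>_. 0"] conjI)
    show "0 = seg (\<lambda>_. 0) s" by (simp add: history_def zero_fun_def)
    show "solves_from s (\<lambda>_. 0) (\<lambda>_. 0)" by (auto simp: solves_from_def lin_zero)
    show "(\<lambda>t. if s \<le> t then 0 else 0 :: real^'n) \<in> Lp_set p" using Lp_zero(1)[OF p] by simp
  qed
  fix \<phi> assume "\<phi> \<in> stable s"
  then obtain x where x: "\<phi> = seg x s" "solves_from s (\<lambda>_. 0) x" "(\<lambda>t. if s \<le> t then x t else 0) \<in> Lp_set p"
    by (auto simp: stable_def)
  show "c *\<^sub>R \<phi> \<in> stable s" for c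
    unfolding stable_def mem_Collect_eq
  proof (intro exI[of _ "\<lambda>t. c *\<^sub>R x t"] conjI)
    have "(\<lambda>t. c *\<^sub>R (if s \<le> t then x t else 0)) = (\<lambda>t. if s \<le> t then c *\<^sub>R x t else 0)" by auto
    then show "(\<lambda>t. if s \<le> t then c *\<^sub>R x t else 0) \<in> Lp_set p" using Lp_scale_le(1)[OF p x(3), of c] by simp
  qed (use x solves_from_scale[OF x(2), of c] in \<open>simp_all add: seg_scale\<close>)
  fix \<psi> assume "\<psi> \<in> stable s"
  then obtain y where y: "\<psi> = seg y s" "solves_from s (\<lambda>_. 0) y" "(\<lambda>t. if s \<le> t then y t else 0) \<in> Lp_set p"
    by (auto simp: stable_def)
  show "\<phi> + \<psi> \<in> stable s"
    unfolding stable_def mem_Collect_eq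
  proof (intro exI[of _ "\<lambda>t. x t + y t"] conjI)
    have "(\<lambda>t. (if s \<le> t then x t else 0) + (if s \<le> t then y t else 0)) = (\<lambda>t. if s \<le> t then x t + y t else 0)" by auto
    then show "(\<lambda>t. if s \<le> t then x t + y t else 0) \<in> Lp_set p" using Lp_add(1)[OF p x(3) y(3)] by simp
  qed (use x y solves_from_add[OF x(2) y(2)] in \<open>simp_all add: seg_add\<close>)
qed

lemma unstable_subspace: "subspace (unstable s)"
  unfolding subspace_def
proof (intro conjI ballI allI)
  show "0 \<in> unstable s"
    unfolding unstable_def mem_Collect_eq
  proof (intro exI[of _ "\<lambda>_. 0"] conjI)
    show "0 = seg (\<lambda>_. 0) s" by (simp add: history_def zero_fun_def)
    show "solves (\<lambda>_. 0) (\<lambda>_. 0)" by (auto simp: solves_def solves_from_def lin_zero)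
    show "(\<lambda>t. if t \<le> s then 0 else 0 :: real^'n) \<in> Lp_set p" using Lp_zero(1)[OF p] by simp
  qed
  fix \<phi> assume "\<phi> \<in> unstable s"
  then obtain x where x: "\<phi> = seg x s" "solves (\<lambda>_. 0) x" "(\<lambda>t. if t \<le> s then x t else 0) \<in> Lp_set p"
    by (auto simp: unstable_def)
  show "c *\<^sub>R \<phi> \<in> unstable s" for c
    unfolding unstable_def mem_Collect_eq
  proof (intro exI[of _ "\<lambda>t. c *\<^sub>R x t"] conjI)
    have "(\<lambda>t. c *\<^sub>R (if t \<le> s then x t else 0)) = (\<lambda>t. if t \<le> s then c *\<^sub>R x t else 0)" by auto
    then show "(\<lambda>t. if t \<le> s then c *\<^sub>R x t else 0) \<in> Lp_set p" using Lp_scale_le(1)[OF p x(3), of c] by simp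
  qed (use x solves_scale[OF x(2), of c] in \<open>simp_all add: seg_scale\<close>)
  fix \<psi> assume "\<psi> \<in> unstable s"
  then obtain y where y: "\<psi> = seg y s" "solves (\<lambda>_. 0) y" "(\<lambda>t. if t \<le> s then y t else 0) \<in> Lp_set p"
    by (auto simp: unstable_def)
  show "\<phi> + \<psi> \<in> unstable s"
    unfolding unstable_def mem_Collect_eq
  proof (intro exI[of _ "\<lambda>t. x t + y t"] conjI)
    have "(\<lambda>t. (if t \<le> s then x t else 0) + (if t \<le> s then y t else 0)) = (\<lambda>t. if t \<le> s then x t + y t else 0)" by auto
    then show "(\<lambda>t. if t \<le> s then x t + y t else 0) \<in> Lp_set p" using Lp_add(1)[OF p x(3) y(3)] by simp
  qed (use x y solves_add[OF x(2) y(2)] in \<open>simp_all add: seg_add\<close>)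
qed

lemma stable_segments: "stable s \<subseteq> segments" and unstable_segments: "unstable s \<subseteq> segments"
  by (auto simp: stable_def unstable_def intro: seg_in_segments solves_fromD(1) solvesD(1))

text \<open>On a compact interval a continuous function causes no integrability problem, so membership in
  the space is decided by the behaviour near the ends.\<close>

lemma Lp_extend:
  fixes x y g :: "real \<Rightarrow> real^'n"
  assumes x: "x \<in> borel_measurable lebesgue" and y: "continuous_on UNIV y"
    and g: "g \<in> Lp_set p" and le: "\<And>t. norm (x t) \<le> norm (g t) + (if t \<in> {a..b} then norm (y t) else 0)"
  shows "x \<in> Lp_set p"
proof (cases "a \<le> b")
  case True
  define k where "k t = (if t \<in> {a..b} then y t else 0)" for t
  obtain c where c: "0 \<le> c" "\<And>t. t \<in> {a..b} \<Longrightarrow> norm (y t) \<le> c" using continuous_bounded_on_interval[OF y] by blast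
  have km: "k \<in> borel_measurable lebesgue"
    unfolding k_def[abs_def] by (intro measurable_If_set continuous_imp_lebesgue_measurable y) auto
  have kL: "k \<in> Lp_set p"
    by (rule Lp_bounded_on_interval(1)[OF p km True c(1)]) (use c in \<open>auto simp: k_def\<close>)
  \<comment> \<open>A fixed unit vector turns the two norms into functions of the space.\<close>
  define e where "e = (axis undefined 1 :: real^'n)"
  have e: "norm e = 1" by (simp add: e_def norm_axis_1)
  have "(\<lambda>t. norm (g t) *\<^sub>R e) \<in> Lp_set p" "(\<lambda>t. norm (k t) *\<^sub>R e) \<in> Lp_set p"
    using Lp_dominated(1)[OF p _ g, of "\<lambda>t. norm (g t) *\<^sub>R e"] Lp_dominated(1)[OF p _ kL, of "\<lambda>t. norm (k t) *\<^sub>R e"]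
      Lp_set_measurable[OF g] km e by auto
  from Lp_add(1)[OF p this] have "(\<lambda>t. norm (g t) *\<^sub>R e + norm (k t) *\<^sub>R e) \<in> Lp_set p" .
  then show ?thesis
  proof (rule Lp_dominated(1)[OF p x])
    have "norm (x t) \<le> norm (norm (g t) *\<^sub>R e + norm (k t) *\<^sub>R e)" for t
    proof -
      have "norm (norm (g t) *\<^sub>R e + norm (k t) *\<^sub>R e) = norm (g t) + norm (k t)"
        using e by (simp flip: scaleR_add_left)
      moreover have "norm (k t) = (if t \<in> {a..b} then norm (y t) else 0)" by (simp add: k_def)
      ultimately show ?thesis using le[of t] by linarith
    qed
    then show "AE t in lebesgue. norm (x t) \<le> norm (norm (g t) *\<^sub>R e + norm (k t) *\<^sub>R e)" by simp
  qed
next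
  case False
  then have "AE t in lebesgue. norm (x t) \<le> norm (g t)" using le by auto
  then show ?thesis by (rule Lp_dominated(1)[OF p x g])
qed

lemma half_line_measurable:
  assumes "continuous_on UNIV (x :: real \<Rightarrow> real^'n)"
  shows "(\<lambda>t. if s \<le> t then x t else 0) \<in> borel_measurable lebesgue"
    "(\<lambda>t. if t \<le> s then x t else 0) \<in> borel_measurable lebesgue"
proof -
  note m = continuous_imp_lebesgue_measurable[OF assms]
  have "(\<lambda>t. if t \<in> {s..} then x t else 0) \<in> borel_measurable lebesgue"
    "(\<lambda>t. if t \<in> {..s} then x t else 0) \<in> borel_measurable lebesgue"
    by (intro measurable_If_set m; simp)+
  then show "(\<lambda>t. if s \<le> t then x t else 0) \<in> borel_measurable lebesgue"
    "(\<lambda>t. if t \<le> s then x t else 0) \<in> borel_measurable lebesgue" by simp_all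
qed

text \<open>A segment in both subspaces extends to one solution that lies in the space near both ends, and
  so on the whole line, where the homogeneous equation has no nonzero solution.\<close>

lemma stable_inter_unstable:
  assumes "\<phi> \<in> stable s" "\<phi> \<in> unstable s"
  shows "\<phi> = 0"
proof -
  obtain x where x: "\<phi> = seg x s" "solves_from s (\<lambda>_. 0) x" "(\<lambda>t. if s \<le> t then x t else 0) \<in> Lp_set p"
    using assms(1) by (auto simp: stable_def)
  obtain w where w: "\<phi> = seg w s" "solves (\<lambda>_. 0) w" "(\<lambda>t. if t \<le> s then w t else 0) \<in> Lp_set p"
    using assms(2) by (auto simp: unstable_def)
  have eq: "x t = w t" if "s - r N \<le> t" for t
  proof (rule solution_unique[OF x(2) solvesD(3)[OF w(2)] _ that])
    show "x t = w t" if "t \<in> {s - r N..s}" for t by (rule seg_eqD[of x s w]) (use x w that in auto)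
  qed
  have "w \<in> Lp_set p"
  proof (rule Lp_dominated(1)[OF p continuous_imp_lebesgue_measurable[OF solvesD(1)[OF w(2)]] Lp_add(1)[OF p x(3) w(3)]])
    show "AE t in lebesgue. norm (w t) \<le> norm ((if s \<le> t then x t else 0) + (if t \<le> s then w t else 0))"
      using AE_not_point[of s]
    proof eventually_elim
      case (elim t)
      then show ?case using eq[of t] r_nonneg by (cases "t < s") auto
    qed
  qed
  then have "w = (\<lambda>_. 0)" using injective w(2) by blast
  then show ?thesis using w(1) by (auto simp: history_def)
qed

definition decaying_splitting ::
    "real \<Rightarrow> real \<Rightarrow> real \<Rightarrow> (real \<Rightarrow> real^'n) \<Rightarrow> (real \<Rightarrow> real^'n) \<Rightarrow> (real \<Rightarrow> real^'n) \<Rightarrow> bool" where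
  "decaying_splitting K \<delta> s \<phi> v w \<longleftrightarrow> \<phi> = seg v s + seg w s \<and>
      solves_from s (\<lambda>_. 0) v \<and> (\<lambda>t. if s \<le> t then v t else 0) \<in> Lp_set p \<and>
      solves (\<lambda>_. 0) w \<and> (\<lambda>t. if t \<le> s then w t else 0) \<in> Lp_set p \<and>
      (\<forall>t\<ge>s - r N. norm (v t) \<le> K * seg_norm \<phi> * exp (- \<delta> * (t - s))) \<and>
      (\<forall>t\<le>s. norm (w t) \<le> K * seg_norm \<phi> * exp (- \<delta> * (s - t)))"

text \<open>The decomposition. Let \<open>x\<close> start from \<open>\<phi>\<close> at time \<open>s\<close>, let \<open>y\<close> be its switched-on version, \<open>f\<close>
  the forcing and \<open>z\<close> the response to \<open>f\<close>. Then \<open>w = y - z\<close> solves the homogeneous equation on the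
  whole line and equals \<open>-z\<close> on \<open>(-\<infinity>, s]\<close>, while \<open>v = x - w\<close> equals \<open>z\<close> on \<open>[s + 1, \<infinity>)\<close>. So the decay of
  \<open>z\<close> makes \<open>w\<close> decay to the left and \<open>v\<close> to the right.\<close>

lemma decomposition:
  "\<exists>K>0. \<exists>\<delta>>0. \<forall>s. \<forall>\<phi>\<in>segments. \<exists>v w. decaying_splitting K \<delta> s \<phi> v w"
proof -
  have h: "0 \<le> 1 + r N" using r_nonneg by simp
  obtain K0 \<delta> where K0: "K0 > 0" and \<delta>: "\<delta> > 0" and decay:
    "\<And>s f c t. f \<in> borel_measurable lebesgue \<Longrightarrow> 0 \<le> c \<Longrightarrow> (\<And>t. norm (f t) \<le> c) \<Longrightarrow>
      (\<And>t. t \<notin> {s..s + (1 + r N)} \<Longrightarrow> f t = 0) \<Longrightarrow> norm (green f t) \<le> K0 * c * exp (- \<delta> * \<bar>t - s\<bar>)"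
    using green_decay[OF h] by metis
  define E where "E = exp (M * (1 + r N))"
  define K1 where "K1 = K0 * ((1 + 2 * M) * E) * exp (2 * \<delta> * r N)"
  define K where "K = K1 + E * exp \<delta>"
  have E: "1 \<le> E" using M_pos r_nonneg by (simp add: E_def)
  have K1: "0 < K1" using K0 E M_pos by (simp add: K1_def)
  have K: "0 < K" "K1 \<le> K" using K1 E by (auto simp: K_def intro: add_pos_nonneg)
  have main: "\<exists>v w. decaying_splitting K \<delta> s \<phi> v w"
    if \<phi>: "\<phi> \<in> segments" for s \<phi>
  proof -
    obtain x where x: "solves_from s (\<lambda>_. 0) x" "seg x s = \<phi>" using initial_value_solution[OF \<phi>] .
    define c where "c = seg_norm \<phi>"
    have c: "0 \<le> c" using seg_norm_nonneg[OF \<phi>] by (simp add: c_def)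
    have init: "norm (x t) \<le> c" if "t \<in> {s - r N..s}" for t
      using norm_seg_le[OF solves_fromD(1)[OF x(1)], of s t] that x(2) by (simp add: c_def)
    obtain y f where y: "solves f y" and f: "f \<in> borel_measurable lebesgue"
      "\<And>t. norm (f t) \<le> (1 + 2 * M) * (c * E)" "\<And>t. t \<notin> {s..s + (1 + r N)} \<Longrightarrow> f t = 0"
      and y0: "\<And>t. t \<le> s \<Longrightarrow> y t = 0" and y1: "\<And>t. s + 1 \<le> t \<Longrightarrow> y t = x t"
      and xy: "\<And>t. norm (x t - y t) \<le> norm (x t)"
      using switched_on_solution[OF x(1) init c] unfolding E_def by metis
    have fc: "0 \<le> (1 + 2 * M) * (c * E)" using c E M_pos by simp
    define z where "z = green f"
    have fL: "f \<in> Lp_set p"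
      by (rule Lp_bounded_on_interval(1)[OF p f(1) _ fc, of s "s + (1 + r N)"]) (use f h in auto)
    have z: "z \<in> Lp_set p" "solves f z" using green[OF fL] by (simp_all add: z_def)
    have zb: "norm (z t) \<le> K0 * ((1 + 2 * M) * E) * c * exp (- \<delta> * \<bar>t - s\<bar>)" for t
    proof -
      have "norm (green f t) \<le> K0 * ((1 + 2 * M) * (c * E)) * exp (- \<delta> * \<bar>t - s\<bar>)"
        by (rule decay[OF f(1) fc f(2)]) (rule f(3))
      then show ?thesis by (simp add: z_def ac_simps)
    qed
    define w where "w t = y t - z t" for t
    define v where "v t = x t - w t" for t
    have w: "solves (\<lambda>_. 0) w" using solves_diff[OF y z(2)] by (simp add: w_def[abs_def])
    have v: "solves_from s (\<lambda>_. 0) v"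
      using solves_from_diff[OF x(1) solvesD(3)[OF w]] by (simp add: v_def[abs_def])
    have K0c: "0 \<le> K0 * ((1 + 2 * M) * E) * c" using K0 E M_pos c by simp
    have le1: "K0 * ((1 + 2 * M) * E) * c * a \<le> K1 * c * a" if "0 \<le> a" for a
    proof -
      have "1 \<le> exp (2 * \<delta> * r N)" using \<delta> r_nonneg by simp
      then have "K0 * ((1 + 2 * M) * E) * 1 \<le> K1" unfolding K1_def using K0 E M_pos by (intro mult_left_mono) auto
      then show ?thesis using c that by (intro mult_right_mono) auto
    qed
    have wb: "norm (w t) \<le> K * c * exp (- \<delta> * (s - t))" if "t \<le> s" for t
    proof -
      have "norm (w t) = norm (z t)" using y0[OF that] by (simp add: w_def)
      also have "\<dots> \<le> K0 * ((1 + 2 * M) * E) * c * exp (- \<delta> * (s - t))" using zb[of t] that by simp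
      also have "\<dots> \<le> K1 * c * exp (- \<delta> * (s - t))" by (rule le1) simp
      also have "\<dots> \<le> K * c * exp (- \<delta> * (s - t))" using K c by (intro mult_right_mono) auto
      finally show ?thesis .
    qed
    have zb': "norm (z t) \<le> K1 * c * exp (- \<delta> * (t - s))" if t: "s - r N \<le> t" for t
    proof -
      \<comment> \<open>To the left of \<open>s\<close> the signs of \<open>\<bar>t - s\<bar>\<close> and \<open>t - s\<close> differ, at the cost of a bounded factor.\<close>
      have "\<delta> * (t - s) \<le> \<delta> * (2 * r N + \<bar>t - s\<bar>)"
        using \<delta> r_nonneg by (intro mult_left_mono) auto
      then have "- \<delta> * \<bar>t - s\<bar> \<le> 2 * \<delta> * r N + - \<delta> * (t - s)" by (simp add: algebra_simps)
      then have "exp (- \<delta> * \<bar>t - s\<bar>) \<le> exp (2 * \<delta> * r N) * exp (- \<delta> * (t - s))" unfolding exp_add[symmetric] by simp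
      then have "K0 * ((1 + 2 * M) * E) * c * exp (- \<delta> * \<bar>t - s\<bar>)
          \<le> K0 * ((1 + 2 * M) * E) * c * (exp (2 * \<delta> * r N) * exp (- \<delta> * (t - s)))"
        using K0c by (rule mult_left_mono)
      also have "\<dots> = K1 * c * exp (- \<delta> * (t - s))" by (simp add: K1_def ac_simps)
      finally show ?thesis using zb[of t] by linarith
    qed
    have vb: "norm (v t) \<le> K * c * exp (- \<delta> * (t - s))" if t: "s - r N \<le> t" for t
    proof (cases "s + 1 \<le> t")
      case True
      then have "v t = z t" using y1 by (simp add: v_def w_def)
      then have "norm (v t) \<le> K1 * c * exp (- \<delta> * (t - s))" using zb'[OF t] by simp
      also have "\<dots> \<le> K * c * exp (- \<delta> * (t - s))" using K c by (intro mult_right_mono) auto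
      finally show ?thesis .
    next
      case False
      have "norm (x t) \<le> c * E"
      proof (cases "s \<le> t")
        case True
        then have "norm (x t) \<le> c * exp (M * (t - s))" using solution_growth[OF x(1) init] by simp
        also have "M * (t - s) \<le> M * (1 + r N)" using False M_pos r_nonneg by (intro mult_left_mono) auto
        then have "c * exp (M * (t - s)) \<le> c * E" unfolding E_def using c by (intro mult_left_mono) auto
        finally show ?thesis .
      next
        case False
        then have "norm (x t) \<le> c * 1" using init[of t] t by simp
        also have "\<dots> \<le> c * E" using c E by (intro mult_left_mono) auto
        finally show ?thesis .
      qed
      moreover have "c * E * 1 \<le> c * E * (exp \<delta> * exp (- \<delta> * (t - s)))"
      proof (intro mult_left_mono)
        have "\<delta> * (t - s) \<le> \<delta> * 1" using False \<delta> by (intro mult_left_mono) auto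
        then show "1 \<le> exp \<delta> * exp (- \<delta> * (t - s))" unfolding exp_add[symmetric] by simp
      qed (use c E in simp)
      ultimately have "norm (x t - y t) \<le> (E * exp \<delta>) * c * exp (- \<delta> * (t - s))"
        using xy[of t] by (simp add: ac_simps)
      moreover have "norm (v t) \<le> norm (x t - y t) + norm (z t)"
        using norm_triangle_ineq[of "x t - y t" "z t"] by (simp add: v_def w_def algebra_simps)
      ultimately show ?thesis using zb'[OF t] by (simp add: K_def algebra_simps)
    qed
    have "(\<lambda>t. if s \<le> t then v t else 0) \<in> Lp_set p"
    proof (rule Lp_extend[OF half_line_measurable(1)[OF solves_fromD(1)[OF v]] _ z(1), of "\<lambda>t. x t - y t" s s "s + 1"])
      show "continuous_on UNIV (\<lambda>t. x t - y t)" by (intro continuous_intros solves_fromD(1)[OF x(1)] solvesD(1)[OF y])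
      show "norm (if s \<le> t then v t else 0) \<le> norm (z t) + (if t \<in> {s..s + 1} then norm (x t - y t) else 0)" for t
        using y1[of t] norm_triangle_ineq[of "z t" "x t - y t"] by (auto simp: v_def w_def algebra_simps)
    qed
    moreover have "(\<lambda>t. if t \<le> s then w t else 0) \<in> Lp_set p"
    proof (rule Lp_dominated(1)[OF p half_line_measurable(2)[OF solvesD(1)[OF w]] z(1)])
      have "norm (if t \<le> s then w t else 0) \<le> norm (z t)" for t using y0[of t] by (simp add: w_def)
      then show "AE t in lebesgue. norm (if t \<le> s then w t else 0) \<le> norm (z t)" by simp
    qed
    moreover have "\<phi> = seg v s + seg w s" using x(2) by (simp add: v_def[abs_def] seg_diff)
    ultimately have "decaying_splitting K \<delta> s \<phi> v w"
      unfolding decaying_splitting_def using v w vb wb unfolding c_def by blast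
    then show ?thesis by blast
  qed
  then show ?thesis using K(1) \<delta> by blast
qed

definition unstable_proj :: "real \<Rightarrow> (real \<Rightarrow> real^'n) \<Rightarrow> (real \<Rightarrow> real^'n)" where
  "unstable_proj s \<phi> = (THE \<psi>. \<psi> \<in> unstable s \<and> \<phi> - \<psi> \<in> stable s)"

definition stable_proj :: "real \<Rightarrow> (real \<Rightarrow> real^'n) \<Rightarrow> (real \<Rightarrow> real^'n)" where
  "stable_proj s \<phi> = \<phi> - unstable_proj s \<phi>"

lemma proj_eq:
  assumes "\<alpha> \<in> stable s" "\<beta> \<in> unstable s"
  shows "unstable_proj s (\<alpha> + \<beta>) = \<beta>" "stable_proj s (\<alpha> + \<beta>) = \<alpha>"
proof -
  show "unstable_proj s (\<alpha> + \<beta>) = \<beta>"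
    unfolding unstable_proj_def
  proof (rule the_equality)
    fix \<psi> assume \<psi>: "\<psi> \<in> unstable s \<and> \<alpha> + \<beta> - \<psi> \<in> stable s"
    have "(\<alpha> + \<beta> - \<psi>) - \<alpha> \<in> stable s" by (rule subspace_diff[OF stable_subspace conjunct2[OF \<psi>] assms(1)])
    then have "\<beta> - \<psi> \<in> stable s" by (simp add: algebra_simps)
    moreover have "\<beta> - \<psi> \<in> unstable s" using \<psi> assms by (intro subspace_diff[OF unstable_subspace]) auto
    ultimately have "\<beta> - \<psi> = 0" by (rule stable_inter_unstable)
    then show "\<psi> = \<beta>" by simp
  qed (use assms in simp)
  then show "stable_proj s (\<alpha> + \<beta>) = \<alpha>" by (simp add: stable_proj_def)
qed

lemma stable_plus_unstable:
  assumes "\<phi> \<in> segments"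
  shows "stable_proj s \<phi> \<in> stable s" "unstable_proj s \<phi> \<in> unstable s"
    "stable_proj s \<phi> + unstable_proj s \<phi> = \<phi>"
proof -
  obtain K \<delta> where dec: "\<forall>s. \<forall>\<phi>\<in>segments. \<exists>v w. decaying_splitting K \<delta> s \<phi> v w"
    using decomposition by blast
  from dec assms obtain v w where "decaying_splitting K \<delta> s \<phi> v w" by blast
  then have vw: "\<phi> = seg v s + seg w s"
      "solves_from s (\<lambda>_. 0) v" "(\<lambda>t. if s \<le> t then v t else 0) \<in> Lp_set p"
      "solves (\<lambda>_. 0) w" "(\<lambda>t. if t \<le> s then w t else 0) \<in> Lp_set p"
    unfolding decaying_splitting_def by blast+
  have "seg v s \<in> stable s" "seg w s \<in> unstable s" using vw by (auto simp: stable_def unstable_def)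
  then show "stable_proj s \<phi> \<in> stable s" "unstable_proj s \<phi> \<in> unstable s" using proj_eq vw(1) by simp_all
  show "stable_proj s \<phi> + unstable_proj s \<phi> = \<phi>" by (simp add: stable_proj_def)
qed

lemma stable_proj_segments: "\<phi> \<in> segments \<Longrightarrow> stable_proj s \<phi> \<in> segments"
  using stable_plus_unstable(1) stable_segments by blast

lemma stable_proj_add:
  assumes "\<phi> \<in> segments" "\<psi> \<in> segments"
  shows "stable_proj s (\<phi> + \<psi>) = stable_proj s \<phi> + stable_proj s \<psi>"
proof -
  let ?a = "stable_proj s \<phi> + stable_proj s \<psi>" and ?b = "unstable_proj s \<phi> + unstable_proj s \<psi>"
  have "?a \<in> stable s" "?b \<in> unstable s"
    using stable_plus_unstable assms stable_subspace unstable_subspace by (auto intro: subspace_add)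
  moreover have "?a + ?b = \<phi> + \<psi>" by (simp add: stable_proj_def)
  ultimately show ?thesis using proj_eq(2) by metis
qed

lemma stable_proj_scale:
  assumes "\<phi> \<in> segments"
  shows "stable_proj s (c *\<^sub>R \<phi>) = c *\<^sub>R stable_proj s \<phi>"
proof -
  let ?a = "c *\<^sub>R stable_proj s \<phi>" and ?b = "c *\<^sub>R unstable_proj s \<phi>"
  have "?a \<in> stable s" "?b \<in> unstable s"
    using stable_plus_unstable assms stable_subspace unstable_subspace by (auto intro: subspace_scale)
  moreover have "?a + ?b = c *\<^sub>R \<phi>" by (simp add: stable_proj_def flip: scaleR_add_right)
  ultimately show ?thesis using proj_eq(2) by metis
qed

lemma proj_of_stable: "\<phi> \<in> stable s \<Longrightarrow> stable_proj s \<phi> = \<phi>"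
  using proj_eq(2)[of \<phi> s 0] subspace_0[OF unstable_subspace] by simp

lemma proj_of_unstable: "\<phi> \<in> unstable s \<Longrightarrow> unstable_proj s \<phi> = \<phi>"
  using proj_eq(1)[of 0 s \<phi>] subspace_0[OF stable_subspace] by simp

lemma range_unstable_proj: "unstable_proj s ` segments = unstable s"
proof (intro equalityI subsetI)
  fix \<phi> assume "\<phi> \<in> unstable s"
  then show "\<phi> \<in> unstable_proj s ` segments"
    using proj_of_unstable unstable_segments by (metis image_eqI subsetD)
qed (use stable_plus_unstable(2) in auto)

lemma T_stable:
  assumes "\<phi> \<in> stable s" and st: "s \<le> t"
  shows "T t s \<phi> \<in> stable t"
proof -
  obtain x where x: "\<phi> = seg x s" "solves_from s (\<lambda>_. 0) x" "(\<lambda>t. if s \<le> t then x t else 0) \<in> Lp_set p"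
    using assms(1) by (auto simp: stable_def)
  have "(\<lambda>u. if t \<le> u then x u else 0) \<in> Lp_set p"
    by (rule Lp_dominated(1)[OF p half_line_measurable(1)[OF solves_fromD(1)[OF x(2)]] x(3)]) (use st in simp)
  then show ?thesis
    using sol_op_eq[OF x(2) st] x(1) solves_from_later[OF x(2) st] by (auto simp: stable_def)
qed

lemma unstable_move:
  assumes w: "solves (\<lambda>_. 0) w" "(\<lambda>u. if u \<le> s then w u else 0) \<in> Lp_set p"
  shows "seg w t \<in> unstable t"
proof -
  have "(\<lambda>u. if u \<le> t then w u else 0) \<in> Lp_set p"
    by (rule Lp_extend[OF half_line_measurable(2)[OF solvesD(1)[OF w(1)]] solvesD(1)[OF w(1)] w(2), of t s t]) auto
  then show ?thesis using w(1) by (auto simp: unstable_def)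
qed

lemma T_seg: "solves (\<lambda>_. 0) w \<Longrightarrow> s \<le> t \<Longrightarrow> T t s (seg w s) = seg w t"
  by (rule sol_op_eq[OF solvesD(3)])

lemma T_unstable:
  assumes "\<phi> \<in> unstable s" and st: "s \<le> t"
  shows "T t s \<phi> \<in> unstable t"
proof -
  obtain w where "\<phi> = seg w s" "solves (\<lambda>_. 0) w" "(\<lambda>t. if t \<le> s then w t else 0) \<in> Lp_set p"
    using assms(1) by (auto simp: unstable_def)
  then show ?thesis using unstable_move T_seg st by simp
qed

text \<open>Delay equations are not solvable backwards, and the solution operator need not be injective. On
  the unstable subspace it is: a segment that it annihilates is stable as well.\<close>

lemma T_unstable_bij:
  assumes st: "s \<le> t"
  shows "bij_betw (T t s) (unstable s) (unstable t)"
  unfolding bij_betw_def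
proof
  show "inj_on (T t s) (unstable s)"
  proof (rule inj_onI)
    fix \<phi> \<psi> assume \<phi>: "\<phi> \<in> unstable s" and \<psi>: "\<psi> \<in> unstable s" and eq: "T t s \<phi> = T t s \<psi>"
    have "\<phi> - \<psi> \<in> unstable s" by (rule subspace_diff[OF unstable_subspace \<phi> \<psi>])
    then obtain w where w: "\<phi> - \<psi> = seg w s" "solves (\<lambda>_. 0) w" "(\<lambda>t. if t \<le> s then w t else 0) \<in> Lp_set p"
      by (auto simp: unstable_def)
    have "seg w t = T t s (\<phi> - \<psi>)" using T_seg[OF w(2) st] w(1) by simp
    also have "\<dots> = 0"
      using T_linear(3)[OF subsetD[OF unstable_segments \<phi>] subsetD[OF unstable_segments \<psi>] st] eq
      by (simp only: diff_self)
    finally have w0: "seg w t = seg (\<lambda>_. 0) t" by (auto simp: history_def)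
    have "w u = 0" if "t - r N \<le> u" for u
    proof (rule solution_unique[OF solvesD(3)[OF w(2)] _ _ that])
      show "solves_from t (\<lambda>_. 0) (\<lambda>_. 0)" by (auto simp: solves_from_def lin_zero)
      show "w u = 0" if "u \<in> {t - r N..t}" for u by (rule seg_eqD[OF w0]) (use that in auto)
    qed
    then have "norm (if s \<le> u then w u else 0) \<le> norm (0 :: real^'n) + (if u \<in> {s..t} then norm (w u) else 0)" for u
      using r_nonneg by auto
    then have "(\<lambda>u. if s \<le> u then w u else 0) \<in> Lp_set p"
      by (rule Lp_extend[OF half_line_measurable(1)[OF solvesD(1)[OF w(2)]] solvesD(1)[OF w(2)] Lp_zero(1)[OF p]])
    then have "\<phi> - \<psi> \<in> stable s" using w(1) solvesD(3)[OF w(2)] by (auto simp: stable_def)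
    then have "\<phi> - \<psi> = 0" using \<open>\<phi> - \<psi> \<in> unstable s\<close> by (rule stable_inter_unstable)
    then show "\<phi> = \<psi>" by simp
  qed
  show "T t s ` unstable s = unstable t"
  proof (intro equalityI subsetI)
    fix \<psi> assume "\<psi> \<in> unstable t"
    then obtain w where w: "\<psi> = seg w t" "solves (\<lambda>_. 0) w" "(\<lambda>u. if u \<le> t then w u else 0) \<in> Lp_set p"
      by (auto simp: unstable_def)
    then show "\<psi> \<in> T t s ` unstable s"
      using unstable_move[OF w(2,3), of s] T_seg[OF w(2) st] by (metis image_eqI)
  qed (use T_unstable st in auto)
qed

lemma T_inverse_seg:
  assumes w: "solves (\<lambda>_. 0) w" "(\<lambda>u. if u \<le> t then w u else 0) \<in> Lp_set p" and st: "s \<le> t"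
  shows "inv_into (unstable s) (T t s) (seg w t) = seg w s"
  using bij_betw_inv_into_left[OF T_unstable_bij[OF st] unstable_move[OF w, of s]] T_seg[OF w(1) st] by simp

lemma stable_proj_commute:
  assumes "\<phi> \<in> segments" "s \<le> t"
  shows "T t s (stable_proj s \<phi>) = stable_proj t (T t s \<phi>)"
proof -
  note d = stable_plus_unstable[OF assms(1), of s]
  have "T t s \<phi> = T t s (stable_proj s \<phi>) + T t s (unstable_proj s \<phi>)"
    using T_linear(1)[of "stable_proj s \<phi>" "unstable_proj s \<phi>" s t] d stable_segments unstable_segments assms(2)
    by (metis subsetD)
  then show ?thesis using proj_eq(2)[OF T_stable[OF d(1) assms(2)] T_unstable[OF d(2) assms(2)]] by simp
qed

text \<open>The dichotomy estimates, together with a uniform Lipschitz bound on the unstable parts, which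
  serves their strong continuity.\<close>

definition proj_bounds :: "real \<Rightarrow> real \<Rightarrow> bool" where
  "proj_bounds D \<delta> \<longleftrightarrow>
    (\<forall>\<phi>\<in>segments. \<forall>s t. s \<le> t \<longrightarrow> seg_norm (T t s (stable_proj s \<phi>)) \<le> D * exp (- \<delta> * (t - s)) * seg_norm \<phi>) \<and>
    (\<forall>\<phi>\<in>segments. \<forall>s t. s \<le> t \<longrightarrow>
      seg_norm (inv_into (unstable s) (T t s) (unstable_proj t \<phi>)) \<le> D * exp (- \<delta> * (t - s)) * seg_norm \<phi>) \<and>
    (\<forall>\<phi>\<in>segments. \<forall>s. \<forall>\<theta>\<in>{- r N..0}. \<forall>\<theta>'\<in>{- r N..0}.
      norm (unstable_proj s \<phi> \<theta> - unstable_proj s \<phi> \<theta>') \<le> M * D * seg_norm \<phi> * \<bar>\<theta> - \<theta>'\<bar>)"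

lemma proj_boundsD:
  assumes "proj_bounds D \<delta>" "\<phi> \<in> segments"
  shows "s \<le> t \<Longrightarrow> seg_norm (T t s (stable_proj s \<phi>)) \<le> D * exp (- \<delta> * (t - s)) * seg_norm \<phi>"
    and "s \<le> t \<Longrightarrow>
      seg_norm (inv_into (unstable s) (T t s) (unstable_proj t \<phi>)) \<le> D * exp (- \<delta> * (t - s)) * seg_norm \<phi>"
    and "\<theta> \<in> {- r N..0} \<Longrightarrow> \<theta>' \<in> {- r N..0} \<Longrightarrow>
      norm (unstable_proj s \<phi> \<theta> - unstable_proj s \<phi> \<theta>') \<le> M * D * seg_norm \<phi> * \<bar>\<theta> - \<theta>'\<bar>"
  using assms unfolding proj_bounds_def by simp_all

lemma proj_estimates: "\<exists>D>0. \<exists>\<delta>>0. proj_bounds D \<delta>"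
proof -
  obtain K \<delta> where K: "K > 0" and \<delta>: "\<delta> > 0" and dec: "\<forall>s. \<forall>\<phi>\<in>segments. \<exists>v w. decaying_splitting K \<delta> s \<phi> v w"
    using decomposition by blast
  define D where "D = K * exp (\<delta> * r N)"
  have e1: "1 \<le> exp (\<delta> * r N)" using \<delta> r_nonneg by simp
  have D: "0 < D" "K \<le> D" using K mult_left_mono[OF e1, of K] by (auto simp: D_def)
  have S: "seg_norm (T t s (stable_proj s \<phi>)) \<le> D * exp (- \<delta> * (t - s)) * seg_norm \<phi>"
    if \<phi>: "\<phi> \<in> segments" and st: "s \<le> t" for s t \<phi>
  proof -
    obtain v w where vw: "\<phi> = seg v s + seg w s" "solves_from s (\<lambda>_. 0) v" "(\<lambda>t. if s \<le> t then v t else 0) \<in> Lp_set p"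
      "solves (\<lambda>_. 0) w" "(\<lambda>t. if t \<le> s then w t else 0) \<in> Lp_set p"
      "\<forall>t\<ge>s - r N. norm (v t) \<le> K * seg_norm \<phi> * exp (- \<delta> * (t - s))"
      using dec \<phi> unfolding decaying_splitting_def by meson
    have "seg v s \<in> stable s" "seg w s \<in> unstable s" using vw by (auto simp: stable_def unstable_def)
    then have "stable_proj s \<phi> = seg v s" using proj_eq(2) vw(1) by simp
    then have "T t s (stable_proj s \<phi>) = seg v t" using sol_op_eq[OF vw(2) st] by simp
    moreover have "seg_norm (seg v t) \<le> D * exp (- \<delta> * (t - s)) * seg_norm \<phi>"
    proof (rule seg_norm_seg_le)
      fix u assume u: "t - r N \<le> u" "u \<le> t"
      have "norm (v u) \<le> K * seg_norm \<phi> * exp (- \<delta> * (u - s))" using vw(6) u st by auto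
      also have "\<dots> \<le> K * seg_norm \<phi> * (exp (\<delta> * r N) * exp (- \<delta> * (t - s)))"
      proof (rule mult_left_mono)
        have "\<delta> * (t - r N) \<le> \<delta> * u" using u \<delta> by (intro mult_left_mono) auto
        then have "- \<delta> * (u - s) \<le> \<delta> * r N + - \<delta> * (t - s)" by (simp add: algebra_simps)
        then show "exp (- \<delta> * (u - s)) \<le> exp (\<delta> * r N) * exp (- \<delta> * (t - s))" unfolding exp_add[symmetric] by simp
      qed (use K seg_norm_nonneg[OF \<phi>] in simp)
      finally show "norm (v u) \<le> D * exp (- \<delta> * (t - s)) * seg_norm \<phi>" by (simp add: D_def ac_simps)
    qed
    ultimately show ?thesis by simp
  qed
  have W: "\<exists>w. unstable_proj s \<phi> = seg w s \<and> solves (\<lambda>_. 0) w \<and> (\<lambda>t. if t \<le> s then w t else 0) \<in> Lp_set p \<and>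
      (\<forall>t\<le>s. norm (w t) \<le> K * seg_norm \<phi> * exp (- \<delta> * (s - t)))" if \<phi>: "\<phi> \<in> segments" for s \<phi>
  proof -
    obtain v w where vw: "\<phi> = seg v s + seg w s" "solves_from s (\<lambda>_. 0) v" "(\<lambda>t. if s \<le> t then v t else 0) \<in> Lp_set p"
      "solves (\<lambda>_. 0) w" "(\<lambda>t. if t \<le> s then w t else 0) \<in> Lp_set p"
      "\<forall>t\<le>s. norm (w t) \<le> K * seg_norm \<phi> * exp (- \<delta> * (s - t))"
      using dec \<phi> unfolding decaying_splitting_def by meson
    have "seg v s \<in> stable s" "seg w s \<in> unstable s" using vw by (auto simp: stable_def unstable_def)
    then have "unstable_proj s \<phi> = seg w s" using proj_eq(1) vw(1) by simp
    then show ?thesis using vw by blast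
  qed
  have U: "seg_norm (inv_into (unstable s) (T t s) (unstable_proj t \<phi>)) \<le> D * exp (- \<delta> * (t - s)) * seg_norm \<phi>"
    if \<phi>: "\<phi> \<in> segments" and st: "s \<le> t" for s t \<phi>
  proof -
    obtain w where w: "unstable_proj t \<phi> = seg w t" "solves (\<lambda>_. 0) w" "(\<lambda>u. if u \<le> t then w u else 0) \<in> Lp_set p"
      "\<forall>u\<le>t. norm (w u) \<le> K * seg_norm \<phi> * exp (- \<delta> * (t - u))" using W[OF \<phi>, of t] by blast
    have "seg_norm (seg w s) \<le> D * exp (- \<delta> * (t - s)) * seg_norm \<phi>"
    proof (rule seg_norm_seg_le)
      fix u assume u: "s - r N \<le> u" "u \<le> s"
      have "norm (w u) \<le> K * seg_norm \<phi> * exp (- \<delta> * (t - u))" using w(4) u st by auto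
      also have "\<dots> \<le> D * seg_norm \<phi> * exp (- \<delta> * (t - s))"
      proof (intro mult_mono)
        have "\<delta> * (t - s) \<le> \<delta> * (t - u)" using u \<delta> by (intro mult_left_mono) auto
        then show "exp (- \<delta> * (t - u)) \<le> exp (- \<delta> * (t - s))" by simp
      qed (use D seg_norm_nonneg[OF \<phi>] in auto)
      finally show "norm (w u) \<le> D * exp (- \<delta> * (t - s)) * seg_norm \<phi>" by (simp add: ac_simps)
    qed
    then show ?thesis using T_inverse_seg[OF w(2,3) st] w(1) by simp
  qed
  have L: "norm (unstable_proj s \<phi> \<theta> - unstable_proj s \<phi> \<theta>') \<le> M * D * seg_norm \<phi> * \<bar>\<theta> - \<theta>'\<bar>"
    if \<phi>: "\<phi> \<in> segments" and \<theta>: "\<theta> \<in> {- r N..0}" "\<theta>' \<in> {- r N..0}" for s \<phi> \<theta> \<theta>'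
  proof -
    obtain w where w: "unstable_proj s \<phi> = seg w s" "solves (\<lambda>_. 0) w"
      "\<forall>t\<le>s. norm (w t) \<le> K * seg_norm \<phi> * exp (- \<delta> * (s - t))" using W[OF \<phi>, of s] by blast
    have wb: "norm (w t) \<le> D * seg_norm \<phi>" if "t \<le> s" for t
    proof -
      have "norm (w t) \<le> K * seg_norm \<phi> * exp (- \<delta> * (s - t))" using w(3) that by blast
      also have "\<dots> \<le> K * seg_norm \<phi> * 1" using that \<delta> K seg_norm_nonneg[OF \<phi>] by (intro mult_left_mono) auto
      also have "\<dots> \<le> D * seg_norm \<phi>" using D seg_norm_nonneg[OF \<phi>] by (simp add: mult_right_mono)
      finally show ?thesis .
    qed
    have move: "norm (w (s + b) - w (s + a)) \<le> M * D * seg_norm \<phi> * \<bar>b - a\<bar>" if ab: "a \<le> b" "b \<le> 0" for a b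
    proof -
      have I: "((\<lambda>t. lin w t + 0) has_integral w (s + b) - w (s + a)) {s + a..s + b}"
        using solvesD(2)[OF w(2), of "s + a" "s + b"] ab by simp
      have "norm (lin w u + 0) \<le> M * (D * seg_norm \<phi>)" if "u \<in> {s + a..s + b}" for u
        using that ab by (simp, intro lin_bound wb) auto
      moreover have "0 \<le> M * (D * seg_norm \<phi>)" using M_pos D seg_norm_nonneg[OF \<phi>] by simp
      ultimately show ?thesis
        using has_integral_bound_real[OF _ finite.emptyI I, of "M * (D * seg_norm \<phi>)"] ab by (simp add: mult.assoc)
    qed
    have val: "unstable_proj s \<phi> \<theta> = w (s + \<theta>)" "unstable_proj s \<phi> \<theta>' = w (s + \<theta>')"
      using \<theta> by (simp_all add: w(1) history_def)
    show ?thesis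
    proof (cases "\<theta>' \<le> \<theta>")
      case True then show ?thesis using move[of \<theta>' \<theta>] \<theta> unfolding val by simp
    next
      case False then show ?thesis using move[of \<theta> \<theta>'] \<theta> unfolding val by (simp add: norm_minus_commute abs_minus_commute)
    qed
  qed
  have "proj_bounds D \<delta>"
    unfolding proj_bounds_def using S U L by simp
  then show ?thesis using D(1) \<delta> by blast
qed

text \<open>Strong continuity. Commutation with \<open>T s u\<close> gives
  \<open>P s \<phi> - P u \<phi> = P s (\<phi> - T s u \<phi>) + (T s u (P u \<phi>) - P u \<phi>)\<close> for \<open>u \<le> s\<close>. The short-time
  estimate makes both terms small, because the segments \<open>P u \<phi>\<close> have a common modulus of continuity:
  the unstable parts are uniformly Lipschitz, being segments of bounded solutions.\<close>

lemma stable_proj_continuous: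
  assumes \<phi>: "\<phi> \<in> segments"
  shows "((\<lambda>u. seg_norm (stable_proj u \<phi> - stable_proj s \<phi>)) \<longlongrightarrow> 0) (at s)"
proof (rule tendstoI)
  fix e :: real assume e: "e > 0"
  obtain D \<delta> where D: "D > 0" and bounds: "proj_bounds D \<delta>" using proj_estimates by blast
  note S = proj_boundsD(1)[OF bounds] and L = proj_boundsD(3)[OF bounds]
  have Pb: "seg_norm (stable_proj u \<psi>) \<le> D * seg_norm \<psi>" if \<psi>: "\<psi> \<in> segments" for u \<psi>
  proof -
    obtain x where x: "solves_from u (\<lambda>_. 0) x" "seg x u = stable_proj u \<psi>"
      using initial_value_solution[OF stable_proj_segments[OF \<psi>]] .
    then have "T u u (stable_proj u \<psi>) = stable_proj u \<psi>" using sol_op_eq[OF x(1) order_refl] by simp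
    then show ?thesis using S[OF \<psi>, of u u] by simp
  qed
  define c where "c = seg_norm \<phi>"
  have c: "0 \<le> c" using seg_norm_nonneg[OF \<phi>] by (simp add: c_def)
  define \<epsilon> where "\<epsilon> = e / (2 * (D + 1))"
  have \<epsilon>: "\<epsilon> > 0" using e D by (simp add: \<epsilon>_def)
  have "uniformly_continuous_on {- r N..0} \<phi>"
    using \<phi> by (intro compact_uniformly_continuous) (auto simp: C_set_def)
  then obtain d0 where d0: "d0 > 0" "\<And>\<theta> \<theta>'. \<theta> \<in> {- r N..0} \<Longrightarrow> \<theta>' \<in> {- r N..0} \<Longrightarrow> dist \<theta>' \<theta> < d0 \<Longrightarrow> dist (\<phi> \<theta>') (\<phi> \<theta>) < \<epsilon>"
    using \<epsilon> unfolding uniformly_continuous_on_def by metis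
  define G where "G = D * (M * (c * exp M)) + M * D * c + M * (D * c * exp M)"
  have G: "0 \<le> G" using D M_pos c by (simp add: G_def)
  define d where "d = min 1 (min (d0 / 2) (e / (4 * (G + 1))))"
  have d: "d > 0" "d \<le> 1" "d < d0" "G * d < e / 2"
  proof -
    show "d > 0" "d \<le> 1" "d < d0" using d0(1) e G by (auto simp: d_def)
    have "G * d \<le> (G + 1) * (e / (4 * (G + 1)))" using G e d0(1) by (intro mult_mono) (auto simp: d_def)
    also have "\<dots> = e / 4"
    proof -
      have "4 * G + 4 \<noteq> 0" using G by simp
      then show ?thesis by (simp add: field_simps)
    qed
    finally show "G * d < e / 2" using e by simp
  qed
  have step: "seg_norm (stable_proj (u + h) \<phi> - stable_proj u \<phi>) < e" if h: "0 \<le> h" "h \<le> d" for u h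
  proof -
    let ?T = "T (u + h) u"
    have uh: "u \<le> u + h" using h by simp
    have h1: "h \<le> 1" using h d by simp
    have osc: "norm (\<phi> \<theta> - \<phi> \<theta>') \<le> \<epsilon>" if "\<theta> \<in> {- r N..0}" "\<theta>' \<in> {- r N..0}" "\<bar>\<theta> - \<theta>'\<bar> \<le> h" for \<theta> \<theta>'
      using d0(2)[of \<theta>' \<theta>] that h d by (simp add: dist_norm)
    have A: "seg_norm (?T \<phi> - \<phi>) \<le> \<epsilon> + M * (c * exp M) * h"
      unfolding c_def by (rule T_short_time[OF \<phi> h(1) h1 osc])
    let ?a = "stable_proj u \<phi>"
    have a: "?a \<in> segments" by (rule stable_proj_segments[OF \<phi>])
    have osca: "norm (?a \<theta> - ?a \<theta>') \<le> \<epsilon> + M * D * c * h"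
      if \<theta>: "\<theta> \<in> {- r N..0}" "\<theta>' \<in> {- r N..0}" "\<bar>\<theta> - \<theta>'\<bar> \<le> h" for \<theta> \<theta>'
    proof -
      have "norm (unstable_proj u \<phi> \<theta> - unstable_proj u \<phi> \<theta>') \<le> M * D * c * \<bar>\<theta> - \<theta>'\<bar>"
        unfolding c_def by (rule L[OF \<phi> \<theta>(1,2)])
      also have "\<dots> \<le> M * D * c * h" using \<theta>(3) M_pos D c by (intro mult_left_mono) auto
      finally have "norm (unstable_proj u \<phi> \<theta> - unstable_proj u \<phi> \<theta>') \<le> M * D * c * h" .
      moreover have "?a \<theta> - ?a \<theta>' = (\<phi> \<theta> - \<phi> \<theta>') - (unstable_proj u \<phi> \<theta> - unstable_proj u \<phi> \<theta>')"
        by (simp add: stable_proj_def)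
      ultimately show ?thesis
        using osc[OF \<theta>] norm_triangle_ineq4[of "\<phi> \<theta> - \<phi> \<theta>'" "unstable_proj u \<phi> \<theta> - unstable_proj u \<phi> \<theta>'"] by simp
    qed
    have "seg_norm (?T ?a - ?a) \<le> (\<epsilon> + M * D * c * h) + M * (seg_norm ?a * exp M) * h"
      by (rule T_short_time[OF a h(1) h1 osca])
    also have "M * (seg_norm ?a * exp M) * h \<le> M * (D * c * exp M) * h"
      using Pb[OF \<phi>, of u] M_pos h unfolding c_def[symmetric] by (intro mult_right_mono mult_left_mono) auto
    finally have Bnd: "seg_norm (?T ?a - ?a) \<le> \<epsilon> + M * D * c * h + M * (D * c * exp M) * h" by simp
    have Ts: "?T \<phi> \<in> segments" "?T ?a \<in> segments" using T_bounded(1)[OF _ uh] \<phi> a by auto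
    have in1: "\<phi> - ?T \<phi> \<in> segments" "?T ?a - ?a \<in> segments"
      using Ts \<phi> a segments_subspace by (auto intro: subspace_diff)
    have "stable_proj (u + h) \<phi> = stable_proj (u + h) (\<phi> - ?T \<phi>) + stable_proj (u + h) (?T \<phi>)"
      using stable_proj_add[OF in1(1) Ts(1), of "u + h"] by simp
    also have "stable_proj (u + h) (?T \<phi>) = ?T ?a" by (rule stable_proj_commute[OF \<phi> uh, symmetric])
    finally have "stable_proj (u + h) \<phi> = stable_proj (u + h) (\<phi> - ?T \<phi>) + ?T ?a" .
    then have "stable_proj (u + h) \<phi> - ?a = stable_proj (u + h) (\<phi> - ?T \<phi>) + (?T ?a - ?a)"
      by (simp only: add_diff_eq)
    then have "seg_norm (stable_proj (u + h) \<phi> - ?a) \<le> seg_norm (stable_proj (u + h) (\<phi> - ?T \<phi>)) + seg_norm (?T ?a - ?a)"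
      using seg_norm_add[OF stable_proj_segments[OF in1(1)] in1(2)] by (simp only:)
    also have "seg_norm (stable_proj (u + h) (\<phi> - ?T \<phi>)) \<le> D * (\<epsilon> + M * (c * exp M) * h)"
    proof (rule order.trans[OF Pb[OF in1(1)]])
      show "D * seg_norm (\<phi> - ?T \<phi>) \<le> D * (\<epsilon> + M * (c * exp M) * h)"
        unfolding seg_norm_minus[of \<phi> "?T \<phi>"] using D by (intro mult_left_mono[OF A]) simp
    qed
    also have "D * (\<epsilon> + M * (c * exp M) * h) + seg_norm (?T ?a - ?a) \<le> (D + 1) * \<epsilon> + G * h"
      using Bnd by (simp add: G_def algebra_simps)
    also have "\<dots> \<le> e / 2 + G * d"
    proof (rule add_mono)
      have "\<epsilon> * (2 * (D + 1)) = e" using D by (simp add: \<epsilon>_def)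
      then show "(D + 1) * \<epsilon> \<le> e / 2" by (simp add: algebra_simps)
      show "G * h \<le> G * d" using h G by (intro mult_left_mono)
    qed
    finally show ?thesis using d(4) by simp
  qed
  have "\<forall>u. u \<noteq> s \<and> dist u s < d \<longrightarrow> dist (seg_norm (stable_proj u \<phi> - stable_proj s \<phi>)) 0 < e"
  proof (intro allI impI)
    fix u assume u: "u \<noteq> s \<and> dist u s < d"
    have "seg_norm (stable_proj u \<phi> - stable_proj s \<phi>) < e"
    proof (cases "s \<le> u")
      case True then show ?thesis using step[of "u - s" s] u by (simp add: dist_real_def)
    next
      case False then show ?thesis using step[of "s - u" u] u by (simp add: dist_real_def seg_norm_minus)
    qed
    moreover have "0 \<le> seg_norm (stable_proj u \<phi> - stable_proj s \<phi>)"
      by (intro seg_norm_nonneg subspace_diff[OF segments_subspace] stable_proj_segments \<phi>)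
    ultimately show "dist (seg_norm (stable_proj u \<phi> - stable_proj s \<phi>)) 0 < e" by simp
  qed
  then show "\<forall>\<^sub>F u in at s. dist (seg_norm (stable_proj u \<phi> - stable_proj s \<phi>)) 0 < e"
    unfolding eventually_at using d(1) by blast
qed

theorem exponential_dichotomy: "exponential_dichotomy N r A UNIV"
proof -
  obtain D \<delta> where D: "D > 0" "\<delta> > 0" and bounds: "proj_bounds D \<delta>" using proj_estimates by blast
  note S = proj_boundsD(1)[OF bounds] and U = proj_boundsD(2)[OF bounds]
  have Pb: "seg_norm (stable_proj u \<psi>) \<le> D * seg_norm \<psi>" if \<psi>: "\<psi> \<in> segments" for u \<psi>
  proof -
    obtain x where x: "solves_from u (\<lambda>_. 0) x" "seg x u = stable_proj u \<psi>"
      using initial_value_solution[OF stable_proj_segments[OF \<psi>]] .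
    then have "T u u (stable_proj u \<psi>) = stable_proj u \<psi>" using sol_op_eq[OF x(1) order_refl] by simp
    then show ?thesis using S[OF \<psi>, of u u] by simp
  qed
  have P: "bounded_operator (segments, seg_norm) (segments, seg_norm) (stable_proj s)" for s
    unfolding bounded_operator_def fst_conv snd_conv
    using stable_proj_segments stable_proj_add stable_proj_scale Pb by (auto simp: seg_norm_zero intro!: exI[of _ D])
  have Tb: "bounded_operator (unstable s, seg_norm) (unstable t, seg_norm) (T t s)" if st: "s \<le> t" for s t
    unfolding bounded_operator_def fst_conv snd_conv
  proof (intro conjI ballI allI exI)
    fix \<phi> assume \<phi>: "\<phi> \<in> unstable s"
    then have \<phi>': "\<phi> \<in> segments" using unstable_segments by blast
    show "T t s \<phi> \<in> unstable t" by (rule T_unstable[OF \<phi> st])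
    show "seg_norm (T t s \<phi>) \<le> exp (M * (t - s)) * seg_norm \<phi>" by (rule T_bounded(2)[OF \<phi>' st])
    show "seg_norm (T t s (c *\<^sub>R \<phi>) - c *\<^sub>R T t s \<phi>) = 0" for c
      using T_linear(2)[OF \<phi>' \<phi>' st] by (simp add: seg_norm_zero)
    fix \<psi> assume "\<psi> \<in> unstable s"
    then have "\<psi> \<in> segments" using unstable_segments by blast
    then show "seg_norm (T t s (\<phi> + \<psi>) - (T t s \<phi> + T t s \<psi>)) = 0"
      using T_linear(1)[OF \<phi>' _ st] by (simp add: seg_norm_zero)
  qed
  have Ti: "bounded_operator (unstable t, seg_norm) (unstable s, seg_norm) (inv_into (unstable s) (T t s))"
    if st: "s \<le> t" for s t
    unfolding bounded_operator_def fst_conv snd_conv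
  proof (intro conjI ballI allI exI)
    note bij = T_unstable_bij[OF st]
    let ?I = "inv_into (unstable s) (T t s)"
    have inv: "?I \<psi> \<in> unstable s" "T t s (?I \<psi>) = \<psi>" if "\<psi> \<in> unstable t" for \<psi>
      using that bij by (auto simp: bij_betw_def inv_into_into f_inv_into_f)
    have inv_eq: "?I (T t s \<phi>) = \<phi>" if "\<phi> \<in> unstable s" for \<phi>
      using that bij by (simp add: bij_betw_def)
    fix \<phi> assume \<phi>: "\<phi> \<in> unstable t"
    then have \<phi>s: "?I \<phi> \<in> segments" "\<phi> \<in> segments" using inv unstable_segments by blast+
    show "?I \<phi> \<in> unstable s" by (rule inv(1)[OF \<phi>])
    show "seg_norm (?I \<phi>) \<le> (D * exp (- \<delta> * (t - s))) * seg_norm \<phi>"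
      using U[OF \<phi>s(2) st] proj_of_unstable[OF \<phi>] by simp
    show "seg_norm (?I (c *\<^sub>R \<phi>) - c *\<^sub>R ?I \<phi>) = 0" for c
    proof -
      have "T t s (c *\<^sub>R ?I \<phi>) = c *\<^sub>R \<phi>" using T_linear(2)[OF \<phi>s(1) \<phi>s(1) st] inv(2)[OF \<phi>] by simp
      then have "?I (c *\<^sub>R \<phi>) = c *\<^sub>R ?I \<phi>"
        using inv_eq[of "c *\<^sub>R ?I \<phi>"] inv(1)[OF \<phi>] unstable_subspace by (simp add: subspace_scale)
      then show ?thesis by (simp add: seg_norm_zero)
    qed
    fix \<psi> assume \<psi>: "\<psi> \<in> unstable t"
    then have \<psi>s: "?I \<psi> \<in> segments" using inv unstable_segments by blast
    have "T t s (?I \<phi> + ?I \<psi>) = \<phi> + \<psi>" using T_linear(1)[OF \<phi>s(1) \<psi>s st] inv(2)[OF \<phi>] inv(2)[OF \<psi>] by simp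
    then have "?I (\<phi> + \<psi>) = ?I \<phi> + ?I \<psi>"
      using inv_eq[of "?I \<phi> + ?I \<psi>"] inv(1)[OF \<phi>] inv(1)[OF \<psi>] unstable_subspace by (simp add: subspace_add)
    then show "seg_norm (?I (\<phi> + \<psi>) - (?I \<phi> + ?I \<psi>)) = 0" by (simp add: seg_norm_zero)
  qed
  show ?thesis
    unfolding exponential_dichotomy_def Let_def
  proof (rule exI[of _ D], rule exI[of _ \<delta>], rule exI[of _ stable_proj], rule exI[of _ unstable_proj],
      intro conjI ballI impI)
    show "stable_proj s (stable_proj s \<phi>) = stable_proj s \<phi>" if "\<phi> \<in> segments" for s \<phi>
      by (rule proj_of_stable[OF stable_plus_unstable(1)[OF that]])
    show "unstable_proj s \<phi> = \<phi> - stable_proj s \<phi>" for s \<phi> by (simp add: stable_proj_def)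
    show "((\<lambda>u. seg_norm (stable_proj u \<phi> - stable_proj s \<phi>)) \<longlongrightarrow> 0) (at s within UNIV)" if "\<phi> \<in> segments" for s \<phi>
      using stable_proj_continuous[OF that] by simp
    show "T t s (stable_proj s \<phi>) = stable_proj t (T t s \<phi>)" if "s \<le> t" "\<phi> \<in> segments" for s t \<phi>
      by (rule stable_proj_commute[OF that(2,1)])
    show "bij_betw (T t s) (unstable_proj s ` segments) (unstable_proj t ` segments)" if "s \<le> t" for s t
      unfolding range_unstable_proj by (rule T_unstable_bij[OF that])
    show "bounded_operator (unstable_proj s ` segments, seg_norm) (unstable_proj t ` segments, seg_norm) (T t s)" if "s \<le> t" for s t
      unfolding range_unstable_proj by (rule Tb[OF that])
    show "bounded_operator (unstable_proj t ` segments, seg_norm) (unstable_proj s ` segments, seg_norm)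
        (inv_into (unstable_proj s ` segments) (T t s))" if "s \<le> t" for s t
      unfolding range_unstable_proj by (rule Ti[OF that])
    show "seg_norm (T t s (stable_proj s \<phi>)) \<le> D * exp (- \<delta> * (t - s)) * seg_norm \<phi>" if "s \<le> t" "\<phi> \<in> segments" for s t \<phi>
      by (rule S[OF that(2,1)])
    show "seg_norm (inv_into (unstable_proj s ` segments) (T t s) (unstable_proj t \<phi>)) \<le> D * exp (- \<delta> * (t - s)) * seg_norm \<phi>"
      if "s \<le> t" "\<phi> \<in> segments" for s t \<phi>
      unfolding range_unstable_proj by (rule U[OF that(2,1)])
  qed (use D P in auto)
qed

end

section \<open>From the Sobolev space to solutions\<close>

lemma weight_integrable: "integrable lebesgue weight"
proof -
  have 1: "(arctan has_real_derivative weight t) (at t)" for t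
    using DERIV_arctan[of t] by (simp add: weight_def inverse_eq_divide)
  have 2: "isCont weight t" for t
    unfolding weight_def by (intro continuous_intros) (auto simp: add_nonneg_eq_0_iff)
  have 3: "((arctan \<circ> real_of_ereal) \<longlongrightarrow> - (pi / 2)) (at_right (- \<infinity>))"
    "((arctan \<circ> real_of_ereal) \<longlongrightarrow> pi / 2) (at_left \<infinity>)"
    unfolding ereal_tendsto_simps by (rule tendsto_arctan_at_bot tendsto_arctan_at_top)+
  have "set_integrable lborel (einterval (- \<infinity>) \<infinity>) weight"
    by (rule interval_integral_FTC_nonneg(1)[where F = arctan, OF _ 1 2 _ 3]) (use weight_pos in \<open>auto simp: less_imp_le\<close>)
  moreover have "einterval (- \<infinity>) \<infinity> = UNIV" by (auto simp: einterval_def)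
  ultimately have "integrable lborel weight" by (simp add: set_integrable_def)
  then show ?thesis by (simp add: integrable_completion)
qed

lemma bounded_imp_Lp:
  fixes f :: "real \<Rightarrow> real^'n"
  assumes p: "1 \<le> p" and f[measurable]: "f \<in> borel_measurable lebesgue" and b: "\<And>t. norm (f t) \<le> c"
  shows "f \<in> Lp_set p"
proof -
  have wb: "norm (f t) * weight t \<le> c" for t
    using mult_mono[OF b[of t] weight_le_1[of t]] weight_pos[of t] norm_ge_zero[of "f t"] b[of t] by simp
  have "integrable weighted_lebesgue (\<lambda>t. norm (f t) powr enn2real p)" if "p \<noteq> \<infinity>"
  proof -
    have "integrable lebesgue (\<lambda>t. weight t *\<^sub>R (norm (f t) powr enn2real p))"
    proof (rule Bochner_Integration.integrable_bound)
      show "integrable lebesgue (\<lambda>t. c powr enn2real p * weight t)" using weight_integrable by simp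
      show "AE t in lebesgue. norm (weight t *\<^sub>R (norm (f t) powr enn2real p)) \<le> norm (c powr enn2real p * weight t)"
      proof (rule AE_I2)
        fix t
        have "norm (f t) powr enn2real p \<le> c powr enn2real p" by (rule powr_mono2) (use b in auto)
        then show "norm (weight t *\<^sub>R (norm (f t) powr enn2real p)) \<le> norm (c powr enn2real p * weight t)"
          using weight_pos[of t] by (simp add: abs_mult mult_left_mono mult.commute)
      qed
    qed measurable
    then show ?thesis unfolding weighted_lebesgue_def
      by (subst integrable_density) (auto simp: less_imp_le weight_pos)
  qed
  then show ?thesis using f wb by (auto simp: Lp_set_def)
qed

lemma Lp_cong_AE:
  fixes f g :: "real \<Rightarrow> real^'n"
  assumes p: "1 \<le> p" and f: "f \<in> Lp_set p" and ae: "AE t in lebesgue. f t = g t"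
  shows "g \<in> Lp_set p"
proof (rule Lp_dominated(1)[OF p borel_measurable_AE[OF Lp_set_measurable[OF f] ae] f])
  show "AE t in lebesgue. norm (g t) \<le> norm (f t)" using ae by eventually_elim simp
qed

text \<open>The condition on the families of intervals in the definition of absolute continuity.\<close>

definition small_disjoint_intervals ::
    "real \<Rightarrow> real \<Rightarrow> real \<Rightarrow> nat \<Rightarrow> (nat \<Rightarrow> real) \<Rightarrow> (nat \<Rightarrow> real) \<Rightarrow> bool" where
  "small_disjoint_intervals a b d k u v \<longleftrightarrow> (\<forall>i<k. a \<le> u i \<and> u i \<le> v i \<and> v i \<le> b) \<and>
     (\<forall>i<k. \<forall>j<k. i \<noteq> j \<longrightarrow> {u i<..<v i} \<inter> {u j<..<v j} = {}) \<and> (\<Sum>i<k. v i - u i) < d"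

lemma abs_continuous_on_iff:
  "abs_continuous_on a b f \<longleftrightarrow> (\<forall>e>0. \<exists>d>0. \<forall>k u v. small_disjoint_intervals a b d k u v
      \<longrightarrow> (\<Sum>i<k. norm (f (v i) - f (u i))) < e)"
  by (simp only: abs_continuous_on_def small_disjoint_intervals_def)

lemma small_disjoint_intervals_mono:
  "small_disjoint_intervals a b d k u v \<Longrightarrow> d \<le> d' \<Longrightarrow> small_disjoint_intervals a b d' k u v"
  unfolding small_disjoint_intervals_def by (elim conjE, intro conjI, assumption, assumption, linarith)

lemma abs_continuous_on_add:
  assumes "abs_continuous_on a b f" "abs_continuous_on a b g"
  shows "abs_continuous_on a b (f + g)"
  unfolding abs_continuous_on_iff
proof (intro allI impI)
  fix e :: real assume "e > 0"
  then have e: "e / 2 > 0" by simp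
  obtain d1 where d1: "d1 > 0"
    and f: "\<forall>k u v. small_disjoint_intervals a b d1 k u v \<longrightarrow> (\<Sum>i<k. norm (f (v i) - f (u i))) < e / 2"
    using assms(1) e unfolding abs_continuous_on_iff by blast
  obtain d2 where d2: "d2 > 0"
    and g: "\<forall>k u v. small_disjoint_intervals a b d2 k u v \<longrightarrow> (\<Sum>i<k. norm (g (v i) - g (u i))) < e / 2"
    using assms(2) e unfolding abs_continuous_on_iff by blast
  have "(\<Sum>i<k. norm ((f + g) (v i) - (f + g) (u i))) < e"
    if uv: "small_disjoint_intervals a b (min d1 d2) k u v" for k u v
  proof -
    have "(\<Sum>i<k. norm ((f + g) (v i) - (f + g) (u i)))
        \<le> (\<Sum>i<k. norm (f (v i) - f (u i)) + norm (g (v i) - g (u i)))"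
      by (rule sum_mono) (simp add: plus_fun_def norm_diff_triangle_ineq)
    also have "\<dots> < e / 2 + e / 2"
      unfolding sum.distrib
    proof (rule add_strict_mono)
      show "(\<Sum>i<k. norm (f (v i) - f (u i))) < e / 2" using f small_disjoint_intervals_mono[OF uv min.cobounded1] by blast
      show "(\<Sum>i<k. norm (g (v i) - g (u i))) < e / 2" using g small_disjoint_intervals_mono[OF uv min.cobounded2] by blast
    qed
    finally show ?thesis by simp
  qed
  moreover have "min d1 d2 > 0" using d1 d2 by simp
  ultimately show "\<exists>d>0. \<forall>k u v. small_disjoint_intervals a b d k u v
      \<longrightarrow> (\<Sum>i<k. norm ((f + g) (v i) - (f + g) (u i))) < e" by blast
qed

lemma abs_continuous_on_scale:
  assumes "abs_continuous_on a b f"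
  shows "abs_continuous_on a b (c *\<^sub>R f)"
  unfolding abs_continuous_on_iff
proof (intro allI impI)
  fix e :: real assume "e > 0"
  then have e: "e / (\<bar>c\<bar> + 1) > 0" by (simp add: add_nonneg_pos)
  obtain d where d: "d > 0"
    and f: "\<forall>k u v. small_disjoint_intervals a b d k u v
      \<longrightarrow> (\<Sum>i<k. norm (f (v i) - f (u i))) < e / (\<bar>c\<bar> + 1)"
    using assms e unfolding abs_continuous_on_iff by blast
  have "(\<Sum>i<k. norm ((c *\<^sub>R f) (v i) - (c *\<^sub>R f) (u i))) < e"
    if uv: "small_disjoint_intervals a b d k u v" for k u v
  proof -
    let ?S = "\<Sum>i<k. norm (f (v i) - f (u i))"
    have "norm ((c *\<^sub>R f) (v i) - (c *\<^sub>R f) (u i)) = \<bar>c\<bar> * norm (f (v i) - f (u i))" for i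
      by (simp add: scaleR_fun_def scaleR_diff_right[symmetric])
    then have "(\<Sum>i<k. norm ((c *\<^sub>R f) (v i) - (c *\<^sub>R f) (u i))) = \<bar>c\<bar> * ?S"
      by (simp add: sum_distrib_left)
    also have "\<dots> \<le> (\<bar>c\<bar> + 1) * ?S" by (intro mult_right_mono sum_nonneg) auto
    also have "\<dots> < e"
    proof -
      have "?S < e / (\<bar>c\<bar> + 1)" using f uv by blast
      then show ?thesis by (simp add: pos_less_divide_eq add_nonneg_pos mult.commute)
    qed
    finally show ?thesis .
  qed
  then show "\<exists>d>0. \<forall>k u v. small_disjoint_intervals a b d k u v
      \<longrightarrow> (\<Sum>i<k. norm ((c *\<^sub>R f) (v i) - (c *\<^sub>R f) (u i))) < e" using d by blast
qed

lemma abs_continuous_on_imp_continuous: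
  assumes "abs_continuous_on a b f"
  shows "continuous_on {a..b} f"
  unfolding continuous_on_iff
proof (intro ballI allI impI)
  fix s and e :: real assume s: "s \<in> {a..b}" and "e > 0"
  then obtain d where d: "d > 0"
    and f: "\<forall>k u v. small_disjoint_intervals a b d k u v \<longrightarrow> (\<Sum>i<k. norm (f (v i) - f (u i))) < e"
    using assms unfolding abs_continuous_on_iff by blast
  have 1: "norm (f v - f u) < e" if "a \<le> u" "u \<le> v" "v \<le> b" "v - u < d" for u v
  proof -
    have "small_disjoint_intervals a b d 1 (\<lambda>_. u) (\<lambda>_. v)"
      using that by (simp add: small_disjoint_intervals_def)
    with f have "(\<Sum>i<(1::nat). norm (f v - f u)) < e" by blast
    then show ?thesis by simp
  qed
  show "\<exists>d>0. \<forall>t\<in>{a..b}. dist t s < d \<longrightarrow> dist (f t) (f s) < e"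
  proof (intro exI[of _ d] conjI ballI impI d)
    fix t assume t: "t \<in> {a..b}" "dist t s < d"
    show "dist (f t) (f s) < e"
    proof (cases "s \<le> t")
      case True then show ?thesis using 1[of s t] s t by (simp add: dist_norm)
    next
      case False then show ?thesis using 1[of t s] s t by (simp add: dist_norm norm_minus_commute)
    qed
  qed
qed

lemma loc_abs_continuous_imp_continuous:
  assumes "loc_abs_continuous_on UNIV x"
  shows "continuous_on UNIV x"
proof -
  have "isCont x t" for t
  proof -
    have "continuous_on {t - 1..t + 1} x"
      using assms by (intro abs_continuous_on_imp_continuous) (auto simp: loc_abs_continuous_on_def)
    then show ?thesis by (rule continuous_on_interior) simp
  qed
  then show ?thesis by (simp add: continuous_on_eq_continuous_at)
qed

context delay_system
begin

lemma Lambda_eq: "Lambda N r A x = (\<lambda>t. ae_deriv x t - lin x t)"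
  by (simp add: Lambda_def lin_def)

lemma lin_add_fun: "lin (x + y) t = lin x t + lin y t"
  by (simp add: lin_def plus_fun_def matrix_vector_right_distrib sum.distrib)

text \<open>Additivity of the operator rules out a large set of points at which \<open>x\<close> has no derivative:
  there \<open>ae_deriv\<close> returns one fixed vector for \<open>x\<close> and for \<open>x + y\<close>, where \<open>y\<close> is any differentiable
  function, whereas additivity makes the two values differ by \<open>y'\<close>. Choosing \<open>y'\<close> without zeros gives
  the almost everywhere differentiability of \<open>x\<close>.\<close>

lemma Sobolev_differentiable:
  fixes x :: "real \<Rightarrow> real^'n"
  assumes p: "1 \<le> p"
    and op: "bounded_operator (W1p_mu p) (Lp_mu p) (Lambda N r A)" and x: "x \<in> fst (W1p_mu p)"
  shows "AE t in lebesgue. (x has_vector_derivative ae_deriv x t) (at t)"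
proof -
  \<comment> \<open>A bounded function in the space whose derivative has no zero.\<close>
  define v :: "real^'n" where "v = 1"
  define y where "y t = arctan t *\<^sub>R v" for t
  define y' where "y' t = weight t *\<^sub>R v" for t
  define E where "E = {t. \<exists>D. (x has_vector_derivative D) (at t)}"
  have v: "v \<noteq> 0" by (simp add: v_def)
  have xW: "loc_abs_continuous_on UNIV x" "x \<in> Lp_set p" "ae_deriv x \<in> Lp_set p"
    using x by (auto simp: W1p_mu_def)
  have E: "E \<in> sets lebesgue"
    unfolding E_def by (rule differentiability_set_measurable[OF loc_abs_continuous_imp_continuous[OF xW(1)]])
  have y: "(y has_vector_derivative y' t) (at t)" for t
  proof -
    have "(arctan has_vector_derivative weight t) (at t)"
      using DERIV_arctan[of t] by (simp add: weight_def inverse_eq_divide has_real_derivative_iff_has_vector_derivative)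
    from bounded_linear.has_vector_derivative[OF bounded_linear_scaleR_left this, of v] show ?thesis
      by (simp add: y_def[abs_def] y'_def)
  qed
  have dy: "ae_deriv y = y'" using y by (auto simp: ae_deriv_def vector_derivative_at)
  have ac: "abs_continuous_on a b y" for a b
  proof (rule lipschitz_imp_abs_continuous_on)
    fix s t :: real assume st: "s \<le> t"
    have "norm (y t - y s) \<le> norm v * norm (t - s)"
    proof (rule differentiable_bound[of UNIV y "\<lambda>u h. h *\<^sub>R y' u"])
      show "(y has_derivative (\<lambda>h. h *\<^sub>R y' u)) (at u within UNIV)" for u
        using y[of u] by (simp add: has_vector_derivative_def)
      show "onorm (\<lambda>h. h *\<^sub>R y' u) \<le> norm v" for u
      proof (rule onorm_le)
        show "norm (h *\<^sub>R y' u) \<le> norm v * norm h" for h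
          using mult_right_mono[OF weight_le_1[of u], of "\<bar>h\<bar> * norm v"] weight_pos[of u]
          by (simp add: y'_def abs_mult mult_ac)
      qed
    qed auto
    then show "norm (y t - y s) \<le> norm v * (t - s)" using st by simp
  qed
  have ym: "y \<in> borel_measurable lebesgue"
  proof (rule continuous_imp_lebesgue_measurable)
    show "continuous_on UNIV y" using y has_vector_derivative_continuous continuous_at_imp_continuous_on by blast
  qed
  have y'm: "y' \<in> borel_measurable lebesgue" unfolding y'_def[abs_def] by measurable
  have yL: "y \<in> Lp_set p"
  proof (rule bounded_imp_Lp[OF p ym])
    show "norm (y t) \<le> (pi / 2) * norm v" for t
      unfolding y_def norm_scaleR using arctan_bounded[of t] by (intro mult_right_mono) auto
  qed
  have y'L: "y' \<in> Lp_set p"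
  proof (rule bounded_imp_Lp[OF p y'm])
    show "norm (y' t) \<le> 1 * norm v" for t
      using weight_pos[of t] weight_le_1[of t] unfolding y'_def norm_scaleR by (intro mult_right_mono) auto
  qed
  have yW: "y \<in> fst (W1p_mu p)" using ac yL y'L dy by (simp add: W1p_mu_def loc_abs_continuous_on_def)
  have no_deriv: "(\<exists>D. ((x + y) has_vector_derivative D) (at t)) \<longleftrightarrow> t \<in> E" for t
  proof
    assume "\<exists>D. ((x + y) has_vector_derivative D) (at t)"
    then obtain D where "((x + y) has_vector_derivative D) (at t)" ..
    from has_vector_derivative_diff[OF this y] show "t \<in> E" by (auto simp: E_def plus_fun_def)
  next
    assume "t \<in> E"
    then obtain D where "(x has_vector_derivative D) (at t)" by (auto simp: E_def)
    from has_vector_derivative_add[OF this y] show "\<exists>D. ((x + y) has_vector_derivative D) (at t)"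
      by (auto simp: plus_fun_def)
  qed
  have d: "ae_deriv (x + y) t = (if t \<in> E then ae_deriv x t + y' t else ae_deriv x t)" for t
  proof (cases "t \<in> E")
    case True
    then obtain D where D: "(x has_vector_derivative D) (at t)" by (auto simp: E_def)
    have "((x + y) has_vector_derivative D + y' t) (at t)"
      using has_vector_derivative_add[OF D y] by (simp add: plus_fun_def)
    then show ?thesis using True D by (simp add: ae_deriv_def vector_derivative_at)
  next
    case False
    then have "(x has_vector_derivative D) (at t) \<longleftrightarrow> False" "((x + y) has_vector_derivative D) (at t) \<longleftrightarrow> False" for D
      using no_deriv[of t] by (auto simp: E_def)
    then show ?thesis using False by (simp add: ae_deriv_def vector_derivative_def)
  qed
  have "x + y \<in> fst (W1p_mu p)"
  proof -
    have Ey: "(\<lambda>t. indicat_real E t *\<^sub>R y' t) \<in> Lp_set p"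
    proof (rule Lp_dominated(1)[OF p _ y'L])
      show "(\<lambda>t. indicat_real E t *\<^sub>R y' t) \<in> borel_measurable lebesgue" using E y'm by measurable
    qed (auto simp: indicator_def)
    have "ae_deriv (x + y) = (\<lambda>t. ae_deriv x t + indicat_real E t *\<^sub>R y' t)" by (auto simp: d fun_eq_iff)
    then have "ae_deriv (x + y) \<in> Lp_set p" using Lp_add(1)[OF p xW(3) Ey] by simp
    moreover have "x + y \<in> Lp_set p" using Lp_add(1)[OF p xW(2) yL] by (simp add: plus_fun_def)
    moreover have "loc_abs_continuous_on UNIV (x + y)"
      using xW(1) ac by (auto simp: loc_abs_continuous_on_def intro: abs_continuous_on_add)
    ultimately show ?thesis by (simp add: W1p_mu_def)
  qed
  then have L: "Lambda N r A (x + y) \<in> Lp_set p" "Lambda N r A x \<in> Lp_set p" "Lambda N r A y \<in> Lp_set p"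
    and add: "Lp_norm p (Lambda N r A (x + y) - (Lambda N r A x + Lambda N r A y)) = 0"
    using op x yW by (auto simp: bounded_operator_def Lp_mu_def)
  have "Lambda N r A (x + y) - (Lambda N r A x + Lambda N r A y) \<in> Lp_set p"
    using Lp_diff(1)[OF p L(1) Lp_add(1)[OF p L(2,3)]] by (simp add: fun_diff_def plus_fun_def)
  from Lp_norm_eq_0_iff[OF p this] add
  have "AE t in lebesgue. (Lambda N r A (x + y) - (Lambda N r A x + Lambda N r A y)) t = 0" by simp
  then show ?thesis
  proof eventually_elim
    case (elim t)
    then have "ae_deriv (x + y) t = ae_deriv x t + y' t"
      by (simp add: Lambda_eq plus_fun_def dy lin_add_fun[unfolded plus_fun_def] add_eq_0_iff2)
    moreover have "y' t \<noteq> 0" using v weight_pos[of t] by (simp add: y'_def)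
    ultimately have "t \<in> E" using d[of t] by (auto split: if_splits)
    then show ?case by (auto simp: E_def ae_deriv_def vector_derivative_works[symmetric] differentiableI_vector)
  qed
qed

text \<open>The derivative of a sum is known to be the sum of the derivatives only where both exist. So the space is
  closed under addition because its elements are differentiable almost everywhere.\<close>

lemma Sobolev_subspace:
  assumes p: "1 \<le> p" and op: "bounded_operator (W1p_mu p) (Lp_mu p) (Lambda N r A)"
  shows "subspace (fst (W1p_mu p :: (real \<Rightarrow> real^'n) seminormed))"
proof (rule subspaceI)
  have "ae_deriv (\<lambda>_. 0 :: real^'n) = (\<lambda>_. 0)" by (simp add: ae_deriv_def fun_eq_iff)
  then show "0 \<in> fst (W1p_mu p :: (real \<Rightarrow> real^'n) seminormed)"
    using Lp_zero(1)[OF p, where 'n='n]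
    by (auto simp: W1p_mu_def zero_fun_def loc_abs_continuous_on_def abs_continuous_on_def intro: exI[of _ 1])
next
  fix x y :: "real \<Rightarrow> real^'n" assume xy: "x \<in> fst (W1p_mu p)" "y \<in> fst (W1p_mu p)"
  then have W: "loc_abs_continuous_on UNIV x" "x \<in> Lp_set p" "ae_deriv x \<in> Lp_set p"
    "loc_abs_continuous_on UNIV y" "y \<in> Lp_set p" "ae_deriv y \<in> Lp_set p" by (auto simp: W1p_mu_def)
  note s = Lp_add(1)[OF p W(3,6)]
  have ae: "AE t in lebesgue. ae_deriv x t + ae_deriv y t = ae_deriv (x + y) t"
    using Sobolev_differentiable[OF p op xy(1)] Sobolev_differentiable[OF p op xy(2)]
  proof eventually_elim
    case (elim t)
    from has_vector_derivative_add[OF this] show ?case by (simp add: ae_deriv_def plus_fun_def vector_derivative_at)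
  qed
  have "ae_deriv (x + y) \<in> Lp_set p" by (rule Lp_cong_AE[OF p s ae])
  moreover have "x + y \<in> Lp_set p" using Lp_add(1)[OF p W(2,5)] by (simp add: plus_fun_def)
  moreover have "loc_abs_continuous_on UNIV (x + y)"
    using W(1,4) by (auto simp: loc_abs_continuous_on_def intro: abs_continuous_on_add)
  ultimately show "x + y \<in> fst (W1p_mu p)" by (simp add: W1p_mu_def)
next
  fix c :: real and x :: "real \<Rightarrow> real^'n" assume x: "x \<in> fst (W1p_mu p)"
  then have W: "loc_abs_continuous_on UNIV x" "x \<in> Lp_set p" "ae_deriv x \<in> Lp_set p" by (auto simp: W1p_mu_def)
  note s = Lp_scale_le(1)[OF p W(3), of c]
  have ae: "AE t in lebesgue. c *\<^sub>R ae_deriv x t = ae_deriv (c *\<^sub>R x) t"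
    using Sobolev_differentiable[OF p op x]
  proof eventually_elim
    case (elim t)
    from bounded_linear.has_vector_derivative[OF bounded_linear_scaleR_right this, of c] show ?case
      by (simp add: ae_deriv_def scaleR_fun_def vector_derivative_at)
  qed
  have "ae_deriv (c *\<^sub>R x) \<in> Lp_set p" by (rule Lp_cong_AE[OF p s ae])
  moreover have "c *\<^sub>R x \<in> Lp_set p" using Lp_scale_le(1)[OF p W(2), of c] by (simp add: scaleR_fun_def)
  moreover have "loc_abs_continuous_on UNIV (c *\<^sub>R x)"
    using W(1) by (auto simp: loc_abs_continuous_on_def intro: abs_continuous_on_scale)
  ultimately show "c *\<^sub>R x \<in> fst (W1p_mu p)" by (simp add: W1p_mu_def)
qed

lemma Sobolev_solution:
  assumes p: "1 \<le> p" and op: "bounded_operator (W1p_mu p) (Lp_mu p) (Lambda N r A)"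
    and x: "x \<in> fst (W1p_mu p)" and f: "f \<in> Lp_set p" and eq: "Lp_norm p (f - Lambda N r A x) = 0"
  shows "solves f x"
proof (rule solvesI)
  have W: "loc_abs_continuous_on UNIV x" using x by (simp add: W1p_mu_def)
  show "continuous_on UNIV x" by (rule loc_abs_continuous_imp_continuous[OF W])
  fix a b :: real assume ab: "a \<le> b"
  have L: "Lambda N r A x \<in> Lp_set p" using op x by (auto simp: bounded_operator_def Lp_mu_def)
  have "f - Lambda N r A x \<in> Lp_set p" using Lp_diff(1)[OF p f L] by (simp add: fun_diff_def)
  from Lp_norm_eq_0_iff[OF p this] eq have "AE t in lebesgue. (f - Lambda N r A x) t = 0" by simp
  with Sobolev_differentiable[OF p op x]
  have "AE t in lebesgue. t \<in> {a<..<b} \<longrightarrow> (x has_vector_derivative lin x t + f t) (at t)"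
    by eventually_elim (auto simp: Lambda_eq fun_diff_def algebra_simps)
  from abs_continuous_on_has_integral_deriv[OF _ ab this]
  show "((\<lambda>t. lin x t + f t) has_integral x b - x a) {a..b}" using W ab by (simp add: loc_abs_continuous_on_def)
qed

lemma homogeneous_solution_in_kernel:
  assumes p: "1 \<le> p" and z: "z \<in> Lp_set p" and sol: "solves (\<lambda>_. 0) z"
  shows "z \<in> op_kernel (W1p_mu p) (Lp_mu p) (Lambda N r A)"
proof -
  have b: "\<And>a b. \<exists>c. \<forall>t\<in>{a..b}. norm (0 :: real^'n) \<le> c" by auto
  note reg = solution_regular[OF solvesD(3)[OF sol] _ b, simplified]
  have ac: "loc_abs_continuous_on UNIV z"
    unfolding loc_abs_continuous_on_def
  proof (intro allI impI)
    fix a b :: real assume "a \<le> b \<and> {a..b} \<subseteq> UNIV"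
    then obtain K where "\<forall>u v. a \<le> u \<and> u \<le> v \<and> v \<le> b \<longrightarrow> norm (z v - z u) \<le> K * (v - u)"
      using reg(1)[of a a b] by blast
    then show "abs_continuous_on a b z" by (intro lipschitz_imp_abs_continuous_on[of a b z K]) blast
  qed
  have "AE t in lebesgue. \<forall>n::nat. - real n < t \<longrightarrow> (z has_vector_derivative lin z t) (at t)"
    unfolding AE_all_countable using reg(2) by blast
  then have ae: "AE t in lebesgue. lin z t = ae_deriv z t"
  proof eventually_elim
    case (elim t)
    obtain n :: nat where "- t < real n" using reals_Archimedean2 by blast
    then have "- real n < t" by linarith
    with elim show ?case by (auto simp: ae_deriv_def vector_derivative_at)
  qed
  note L = lin_Lp(1)[OF p z]
  note D = Lp_cong_AE[OF p L ae]
  have "Lp_norm p (Lambda N r A z) = 0"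
    using Lp_norm_eq_0_iff[OF p Lp_diff(1)[OF p D L]] ae unfolding Lambda_eq by (auto elim: eventually_mono)
  then show ?thesis using ac z D by (simp add: op_kernel_def W1p_mu_def Lp_mu_def)
qed

end

lemma coefficients_delay_system:
  assumes "delays N r" and m: "\<And>j. j \<le> N \<Longrightarrow> A j \<in> borel_measurable lebesgue"
    and b: "\<And>j. j \<le> N \<Longrightarrow> bounded (range (A j :: real \<Rightarrow> real^'n^'n))"
  shows "\<exists>B. delay_system N r A B"
proof -
  have "\<exists>c. \<forall>t. norm (A j t) \<le> c" if "j \<le> N" for j using b[OF that] by (auto simp: bounded_iff)
  then obtain c where c: "\<And>j t. j \<le> N \<Longrightarrow> norm (A j t) \<le> c j" by metis
  define B where "B = 1 + (\<Sum>j\<le>N. real CARD('n) * \<bar>c j\<bar>)"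
  have pos: "0 < B" unfolding B_def by (intro add_pos_nonneg sum_nonneg) auto
  have "norm (A j t *v v) \<le> B * norm v" if j: "j \<le> N" for j t v
  proof -
    have "real CARD('n) * norm (A j t) \<le> real CARD('n) * \<bar>c j\<bar>"
      using c[OF j, of t] by (intro mult_left_mono) auto
    also have "\<dots> \<le> (\<Sum>j\<le>N. real CARD('n) * \<bar>c j\<bar>)"
      using j by (intro member_le_sum[of j "{..N}" "\<lambda>j. real CARD('n) * \<bar>c j\<bar>"]) auto
    finally have "real CARD('n) * norm (A j t) \<le> B" by (simp add: B_def)
    then show ?thesis
      using order.trans[OF norm_matrix_vector_mult_le mult_right_mono[OF _ norm_ge_zero]] by blast
  qed
  with assms pos show ?thesis by (intro exI[of _ B]) (simp add: delay_system_def)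
qed

theorem theorem1p2:
  fixes N :: nat and r :: "nat \<Rightarrow> real" and p :: ennreal
    and A :: "nat \<Rightarrow> real \<Rightarrow> real^'n^'n"
    and A_plus A_minus :: "nat \<Rightarrow> real^'n^'n"
  assumes "delays N r"
    and "\<And>j. j \<le> N \<Longrightarrow> A j \<in> borel_measurable lebesgue"
    and "\<And>j. j \<le> N \<Longrightarrow> bounded (range (A j))"
    and "\<And>j. j \<le> N \<Longrightarrow> (A j \<longlongrightarrow> A_plus j) at_top"
    and "\<And>j. j \<le> N \<Longrightarrow> (A j \<longlongrightarrow> A_minus j) at_bot"
    and "1 \<le> p"
    and "asymp_hyperbolic N r A"
    and "fredholm (W1p_mu p) (Lp_mu p) (Lambda N r A)"
    and "fredholm_index (W1p_mu p) (Lp_mu p) (Lambda N r A) = 0"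
    and "op_kernel (W1p_mu p) (Lp_mu p) (Lambda N r A) = {\<lambda>_. 0}"
  shows "exponential_dichotomy N r A UNIV"
proof -
  note p = \<open>1 \<le> p\<close>
  note F = \<open>fredholm (W1p_mu p) (Lp_mu p) (Lambda N r A)\<close>
  note ker = \<open>op_kernel (W1p_mu p) (Lp_mu p) (Lambda N r A) = {\<lambda>_. 0}\<close>
  obtain B where "delay_system N r A B"
    using coefficients_delay_system[of N r A] assms(1-3) by blast
  then interpret delay_system N r A B .
  have op: "bounded_operator (W1p_mu p) (Lp_mu p) (Lambda N r A)" using F by (simp add: fredholm_def)
  have Y: "seminormed_space (fst (Lp_mu p :: (real \<Rightarrow> real^'n) seminormed)) (snd (Lp_mu p))"
    using Lp_seminormed[OF p] by (simp add: Lp_mu_def)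
  have "admissible_system N r A B p"
  proof
    fix f :: "real \<Rightarrow> real^'n" assume f: "f \<in> Lp_set p"
    have "\<exists>x\<in>fst (W1p_mu p). snd (Lp_mu p) (f - Lambda N r A x) = 0"
    proof (rule fredholm_index_zero_imp_surjective[OF Y Sobolev_subspace[OF p op] F assms(9)])
      show "op_kernel (W1p_mu p) (Lp_mu p) (Lambda N r A) = {0}" using ker by (simp add: zero_fun_def)
      show "f \<in> fst (Lp_mu p)" using f by (simp add: Lp_mu_def)
    qed
    then obtain x where x: "x \<in> fst (W1p_mu p)" "Lp_norm p (f - Lambda N r A x) = 0" by (auto simp: Lp_mu_def)
    from Sobolev_solution[OF p op x(1) f x(2)] x(1) show "\<exists>z\<in>Lp_set p. solves f z" by (auto simp: W1p_mu_def)
  next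
    fix z :: "real \<Rightarrow> real^'n" assume "z \<in> Lp_set p" "solves (\<lambda>_. 0) z"
    from homogeneous_solution_in_kernel[OF p this] ker show "z = (\<lambda>_. 0)" by simp
  qed (rule p)
  then show ?thesis by (rule admissible_system.exponential_dichotomy)
qed

end
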